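(* Let $G$ be an affine algebraic group over an algebraically closed field $K$ such that $G^{0}$ is an algebraic torus and $G\neq Z_G(G^{0})$. Then there exist a closed subgroup $H$ of $G$ with $H\supsetneqq Z_G(G^{0})$ and an effective regular action $(X,H)$ of $H$ on an affine normal variety $X=\mathrm{Spec}(R)$ such that $\mathcal{Q}(R^{G^{0}})=\mathcal{Q}(R)^{G^{0}}$ and $$\mathrm{e}\big(\mathfrak{P}\cap R^{\mathcal{I}_H(\mathfrak{P})\cdot G^{0}},\ \mathfrak{P}\cap R^{\mathcal{I}_H(\mathfrak{P}\cap R^{G^{0}})}\big)>1$$ for some $\mathfrak{P}\in\mathrm{Ht}^1(R,R^{H})$. Moreover, for this action, $$\mathfrak{R}(R,H)\vert_{R^{G^{0}}}\neq\mathfrak{R}(R^{G^{0}},H)\vert_{R^{G^{0}}}.$$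
   Context: $K$ is an algebraically closed field of arbitrary characteristic; $G^0$ is the identity component of $G$; $Z_G(G^0)$ is the centralizer of $G^0$ in $G$. For a commutative ring $A$, $\mathcal{Q}(A)$ is its total quotient ring. The action of $H$ on $X=\mathrm{Spec}(R)$ is regular if $H$ acts rationally on $R$ by $K$-algebra automorphisms; it is effective if $\mathrm{Ker}(H\to\mathrm{Aut}(R))$ is finite. If $H$ acts on a ring $A$ and $\mathfrak{P}$ is a prime of $A$, the inertia group is $\mathcal{I}_H(\mathfrak{P})=\{\sigma\in H\mid\sigma(x)-x\in\mathfrak{P}\ (x\in A)\}$; $\mathcal{I}_H(\mathfrak{P}\cap R^{G^0})$ is taken for the action of $H$ on $R^{G^0}$. For rings $A\subseteq B$, $\mathrm{Ht}^1(B,A)=\{\mathfrak{p}\in\mathrm{Spec}(B)\mid\mathrm{ht}(\mathfrak{p})=\mathrm{ht}(\mathfrak{p}\cap A)=1\}$. For Krull domains $A\subseteq B$ and $\mathfrak{q}\in\mathrm{Ht}^1(B,A)$, the ramification index $\mathrm{e}(\mathfrak{q},\mathfrak{q}\cap A)$ is $\mathrm{v}_{B,\mathfrak{q}}(\mathfrak{q}\cap A)$, where $\mathrm{v}_{B,\mathfrak{q}}$ is the discrete valuation defined by $B_{\mathfrak{q}}$ (so $(\mathfrak{q}\cap A)B_{\mathfrak{q}}=(\mathfrak{q}B_{\mathfrak{q}})^{\mathrm{e}}$). Define the subgroups of $H$: $\mathfrak{R}(R,H)=\langle\bigcup_{\mathfrak{P}\in\mathrm{Ht}^1(R,R^{H})}\mathcal{I}_H(\mathfrak{P})\rangle$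 and $\mathfrak{R}(R^{G^{0}},H)=\langle\bigcup_{\mathfrak{p}\in\mathrm{Ht}^1(R^{G^{0}},R^{H})}\mathcal{I}_H(\mathfrak{p})\rangle$. For a subgroup $\Gamma$ of $H$ and a $\Gamma$-invariant subset $S$, $\Gamma\vert_S$ denotes the group of restrictions $\sigma\vert_S$, $\sigma\in\Gamma$. *)

theory Defs
  imports "HOL-Computational_Algebra.Polynomial" "HOL-Algebra.Algebra" "HOL-Analysis.Abstract_Topology_2" "HOL-Library.Extended_Nat"
begin

section \<open>Affine varieties\<close>

text \<open>
  The base field is a type \<open>'k\<close> of class \<^class>\<open>alg_closed_field\<close>.  Points of affine $n$-space
  are functions \<^typ>\<open>nat \<Rightarrow> 'k\<close> vanishing at all indices \<open>\<ge> n\<close>, so that \<open>n\<close> can be quantified.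
\<close>

type_synonym 'k point = "nat \<Rightarrow> 'k"

definition affine_space :: "nat \<Rightarrow> 'k::field point set" where
  "affine_space n = {x. \<forall>i\<ge>n. x i = 0}"

inductive_set polyfun :: "nat \<Rightarrow> ('k::field point \<Rightarrow> 'k) set" for n where
  const: "(\<lambda>x. c) \<in> polyfun n"
| coord: "i < n \<Longrightarrow> (\<lambda>x. x i) \<in> polyfun n"
| add: "f \<in> polyfun n \<Longrightarrow> g \<in> polyfun n \<Longrightarrow> (\<lambda>x. f x + g x) \<in> polyfun n"
| mult: "f \<in> polyfun n \<Longrightarrow> g \<in> polyfun n \<Longrightarrow> (\<lambda>x. f x * g x) \<in> polyfun n"

definition zero_locus :: "nat \<Rightarrow> ('k::field point \<Rightarrow> 'k) set \<Rightarrow> 'k point set" where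
  "zero_locus n F = {x \<in> affine_space n. \<forall>f\<in>F. f x = 0}"

definition zariski :: "nat \<Rightarrow> 'k::field point topology" where
  "zariski n = topology (\<lambda>U. \<exists>F\<subseteq>polyfun n. U = affine_space n - zero_locus n F)"

lemma istopology_zariski:
  "istopology (\<lambda>U :: 'k::field point set. \<exists>F\<subseteq>polyfun n. U = affine_space n - zero_locus n F)"
  unfolding istopology_def
proof (intro conjI allI impI)
  fix S T :: "'k point set"
  assume "\<exists>F\<subseteq>polyfun n. S = affine_space n - zero_locus n F"
    and "\<exists>F\<subseteq>polyfun n. T = affine_space n - zero_locus n F"
  then obtain F E where F: "F \<subseteq> polyfun n" "S = affine_space n - zero_locus n F"
    and E: "E \<subseteq> polyfun n" "T = affine_space n - zero_locus n E"
    by auto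
  let ?P = "{\<lambda>x. f x * g x | f g. f \<in> F \<and> g \<in> E}"
  have "?P \<subseteq> polyfun n"
    using F(1) E(1) by (auto intro: polyfun.mult)
  moreover have "S \<inter> T = affine_space n - zero_locus n ?P"
  proof (intro Set.set_eqI iffI)
    fix x
    assume "x \<in> S \<inter> T"
    then obtain f g where "x \<in> affine_space n" "f \<in> F" "f x \<noteq> 0" "g \<in> E" "g x \<noteq> 0"
      using F(2) E(2) by (auto simp: zero_locus_def)
    moreover from this have "(\<lambda>x. f x * g x) \<in> ?P" "f x * g x \<noteq> 0"
      by auto
    ultimately show "x \<in> affine_space n - zero_locus n ?P"
      unfolding zero_locus_def by fast
  next
    fix x
    assume "x \<in> affine_space n - zero_locus n ?P"
    then show "x \<in> S \<inter> T"
      using F(2) E(2) by (auto simp: zero_locus_def)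
  qed
  ultimately show "\<exists>F\<subseteq>polyfun n. S \<inter> T = affine_space n - zero_locus n F"
    by blast
next
  fix K :: "'k point set set"
  assume "\<forall>U\<in>K. \<exists>F\<subseteq>polyfun n. U = affine_space n - zero_locus n F"
  then have "\<exists>F. \<forall>U\<in>K. F U \<subseteq> polyfun n \<and> U = affine_space n - zero_locus n (F U)"
    by (rule bchoice)
  then obtain F where F: "\<forall>U\<in>K. F U \<subseteq> polyfun n"
    "\<forall>U\<in>K. U = affine_space n - zero_locus n (F U)"
    by blast
  have "(\<Union>U\<in>K. F U) \<subseteq> polyfun n"
    using F(1) by blast
  moreover have "\<Union>K = affine_space n - zero_locus n (\<Union>U\<in>K. F U)"
  proof (rule Set.set_eqI)
    fix x
    have "x \<in> \<Union>K \<longleftrightarrow> (\<exists>U\<in>K. x \<in> affine_space n - zero_locus n (F U))"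
      using F(2) by blast
    then show "x \<in> \<Union>K \<longleftrightarrow> x \<in> affine_space n - zero_locus n (\<Union>U\<in>K. F U)"
      by (auto simp: zero_locus_def)
  qed
  ultimately show "\<exists>F\<subseteq>polyfun n. \<Union>K = affine_space n - zero_locus n F"
    by blast
qed

lemma openin_zariski:
  "openin (zariski n) U \<longleftrightarrow> (\<exists>F\<subseteq>polyfun n. U = affine_space n - zero_locus n F)"
  unfolding zariski_def by (subst topology_inverse'[OF istopology_zariski]) (rule refl)

lemma topspace_zariski: "topspace (zariski n) = (affine_space n :: 'k::field point set)"
proof
  show "topspace (zariski n) \<subseteq> (affine_space n :: 'k point set)"
    unfolding topspace_def openin_zariski by blast
  have "affine_space n - zero_locus n {\<lambda>x. 1 :: 'k} = affine_space n"
    by (auto simp: zero_locus_def)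
  moreover have "{\<lambda>x :: 'k point. 1} \<subseteq> polyfun n"
    using polyfun.const by blast
  ultimately have "openin (zariski n) (affine_space n :: 'k point set)"
    unfolding openin_zariski by metis
  then show "(affine_space n :: 'k point set) \<subseteq> topspace (zariski n)"
    by (rule openin_subset)
qed

lemma closedin_zariski:
  "closedin (zariski n) V \<longleftrightarrow> (\<exists>F\<subseteq>polyfun n. V = zero_locus n F)"
proof -
  have *: "zero_locus n F \<subseteq> affine_space n" for F :: "('a point \<Rightarrow> 'a) set"
    by (auto simp: zero_locus_def)
  show ?thesis
    unfolding closedin_def topspace_zariski openin_zariski
    using * by (metis Diff_Diff_Int double_diff dual_order.refl)
qed

definition coord_ring :: "nat \<Rightarrow> 'k::field point set \<Rightarrow> ('k point \<Rightarrow> 'k) ring" where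
  "coord_ring n V =
    \<lparr>carrier = (\<lambda>f. restrict f V) ` polyfun n,
     monoid.mult = (\<lambda>f g. \<lambda>x\<in>V. f x * g x),
     monoid.one = (\<lambda>x\<in>V. 1),
     ring.zero = (\<lambda>x\<in>V. 0),
     ring.add = (\<lambda>f g. \<lambda>x\<in>V. f x + g x)\<rparr>"

lemma cring_coord_ring: "cring (coord_ring n V)" (is "cring ?R")
proof -
  have add: "f \<oplus>\<^bsub>?R\<^esub> g \<in> carrier ?R" and mult: "f \<otimes>\<^bsub>?R\<^esub> g \<in> carrier ?R"
    if "f \<in> carrier ?R" "g \<in> carrier ?R" for f g
  proof -
    from that obtain p q where pq: "p \<in> polyfun n" "f = restrict p V" "q \<in> polyfun n" "g = restrict q V"
      by (auto simp: coord_ring_def)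
    have "f \<oplus>\<^bsub>?R\<^esub> g = restrict (\<lambda>x. p x + q x) V" "f \<otimes>\<^bsub>?R\<^esub> g = restrict (\<lambda>x. p x * q x) V"
      by (auto simp: coord_ring_def pq)
    then show "f \<oplus>\<^bsub>?R\<^esub> g \<in> carrier ?R" "f \<otimes>\<^bsub>?R\<^esub> g \<in> carrier ?R"
      using polyfun.add[OF pq(1,3)] polyfun.mult[OF pq(1,3)] by (auto simp: coord_ring_def)
  qed
  have const: "(\<lambda>x\<in>V. c) \<in> carrier ?R" for c
    using polyfun.const by (auto simp: coord_ring_def)
  show ?thesis
  proof (intro cringI abelian_groupI comm_monoidI)
    fix f assume f: "f \<in> carrier ?R"
    have "(\<lambda>x\<in>V. -1) \<otimes>\<^bsub>?R\<^esub> f \<in> carrier ?R"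
      by (intro mult const f)
    moreover have "((\<lambda>x\<in>V. -1) \<otimes>\<^bsub>?R\<^esub> f) \<oplus>\<^bsub>?R\<^esub> f = \<zero>\<^bsub>?R\<^esub>"
      by (auto simp: coord_ring_def fun_eq_iff)
    ultimately show "\<exists>g\<in>carrier ?R. g \<oplus>\<^bsub>?R\<^esub> f = \<zero>\<^bsub>?R\<^esub>"
      by blast
  next
    fix f assume f: "f \<in> carrier ?R"
    show "\<zero>\<^bsub>?R\<^esub> \<oplus>\<^bsub>?R\<^esub> f = f" "\<one>\<^bsub>?R\<^esub> \<otimes>\<^bsub>?R\<^esub> f = f"
      using f by (auto simp: coord_ring_def)
  next
    show "\<zero>\<^bsub>?R\<^esub> \<in> carrier ?R" "\<one>\<^bsub>?R\<^esub> \<in> carrier ?R"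
      using const by (simp_all add: coord_ring_def)
  next
    fix f g assume "f \<in> carrier ?R" "g \<in> carrier ?R"
    then show "f \<oplus>\<^bsub>?R\<^esub> g \<in> carrier ?R" "f \<otimes>\<^bsub>?R\<^esub> g \<in> carrier ?R"
      by (rule add, rule mult)
    show "f \<oplus>\<^bsub>?R\<^esub> g = g \<oplus>\<^bsub>?R\<^esub> f" "f \<otimes>\<^bsub>?R\<^esub> g = g \<otimes>\<^bsub>?R\<^esub> f"
      by (simp_all add: coord_ring_def algebra_simps)
  next
    fix f g h assume "f \<in> carrier ?R" "g \<in> carrier ?R" "h \<in> carrier ?R"
    show "(f \<oplus>\<^bsub>?R\<^esub> g) \<oplus>\<^bsub>?R\<^esub> h = f \<oplus>\<^bsub>?R\<^esub> (g \<oplus>\<^bsub>?R\<^esub> h)"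
      "(f \<otimes>\<^bsub>?R\<^esub> g) \<otimes>\<^bsub>?R\<^esub> h = f \<otimes>\<^bsub>?R\<^esub> (g \<otimes>\<^bsub>?R\<^esub> h)"
      "(f \<oplus>\<^bsub>?R\<^esub> g) \<otimes>\<^bsub>?R\<^esub> h = f \<otimes>\<^bsub>?R\<^esub> h \<oplus>\<^bsub>?R\<^esub> g \<otimes>\<^bsub>?R\<^esub> h"
      by (simp_all add: coord_ring_def fun_eq_iff algebra_simps)
  qed
qed

definition regular_map :: "nat \<Rightarrow> 'k::field point set \<Rightarrow> nat \<Rightarrow> 'k point set \<Rightarrow> ('k point \<Rightarrow> 'k point) \<Rightarrow> bool"
  where "regular_map n V m W \<phi> \<longleftrightarrow>
    \<phi> \<in> V \<rightarrow> W \<and> (\<forall>i<m. \<exists>f\<in>polyfun n. \<forall>x\<in>V. \<phi> x i = f x)"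

text \<open>The identification of pairs of points of $n$-space with points of $2n$-space.\<close>

definition pair_point :: "nat \<Rightarrow> 'k::field point \<Rightarrow> 'k point \<Rightarrow> 'k point" where
  "pair_point n x y = (\<lambda>i. if i < n then x i else y (i - n))"


section \<open>Affine algebraic groups\<close>

locale affine_algebraic_group = group G for n :: nat and G :: "'k::field point monoid" (structure) +
  assumes closed: "closedin (zariski n) (carrier G)"
    and regular_mult: "\<forall>i<n. \<exists>f\<in>polyfun (2 * n). \<forall>x\<in>carrier G. \<forall>y\<in>carrier G.
          (x \<otimes> y) i = f (pair_point n x y)"
    and regular_inv: "regular_map n (carrier G) n (carrier G) (m_inv G)"

definition closed_subgroup :: "nat \<Rightarrow> 'k::field point monoid \<Rightarrow> 'k point set \<Rightarrow> bool" where
  "closed_subgroup n G H \<longleftrightarrow> subgroup H G \<and> closedin (zariski n) H"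

definition identity_component :: "nat \<Rightarrow> 'k::field point monoid \<Rightarrow> 'k point set" where
  "identity_component n G =
    connected_component_of_set (subtopology (zariski n) (carrier G)) \<one>\<^bsub>G\<^esub>"

definition centralizer :: "('a, 'b) monoid_scheme \<Rightarrow> 'a set \<Rightarrow> 'a set" where
  "centralizer G S = {g \<in> carrier G. \<forall>s\<in>S. g \<otimes>\<^bsub>G\<^esub> s = s \<otimes>\<^bsub>G\<^esub> g}"

text \<open>
  The group $(K^\ast)^r$, realised as a closed subset of $2r$-space by listing each coordinate
  \<open>x i\<close> together with its inverse \<open>x (r + i)\<close>.
\<close>

definition split_torus :: "nat \<Rightarrow> 'k::field point monoid" where
  "split_torus r =
    \<lparr>carrier = {x \<in> affine_space (2 * r). \<forall>i<r. x i * x (r + i) = 1},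
     monoid.mult = (\<lambda>x y i. x i * y i),
     monoid.one = (\<lambda>i. if i < 2 * r then 1 else 0)\<rparr>"

definition algebraic_torus :: "nat \<Rightarrow> 'k::field point monoid \<Rightarrow> bool" where
  "algebraic_torus n T \<longleftrightarrow> affine_algebraic_group n T \<and>
    (\<exists>r. \<exists>\<phi> \<in> iso (split_torus r) T.
      regular_map (2 * r) (carrier (split_torus r)) n (carrier T) \<phi> \<and>
      regular_map n (carrier T) (2 * r) (carrier (split_torus r))
        (inv_into (carrier (split_torus r)) \<phi>))"


section \<open>Localization and total quotient rings\<close>

definition fraction :: "('a, 'b) ring_scheme \<Rightarrow> 'a set \<Rightarrow> 'a \<Rightarrow> 'a \<Rightarrow> ('a \<times> 'a) set" where
  "fraction R S a s = {(b, t). b \<in> carrier R \<and> t \<in> S \<and>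
    (\<exists>u\<in>S. u \<otimes>\<^bsub>R\<^esub> (t \<otimes>\<^bsub>R\<^esub> a) = u \<otimes>\<^bsub>R\<^esub> (s \<otimes>\<^bsub>R\<^esub> b))}"

definition localization :: "('a, 'b) ring_scheme \<Rightarrow> 'a set \<Rightarrow> ('a \<times> 'a) set ring" where
  "localization R S =
    \<lparr>carrier = {fraction R S a s | a s. a \<in> carrier R \<and> s \<in> S},
     monoid.mult = (\<lambda>x y. \<Union>(a, s)\<in>x. \<Union>(b, t)\<in>y. fraction R S (a \<otimes>\<^bsub>R\<^esub> b) (s \<otimes>\<^bsub>R\<^esub> t)),
     monoid.one = fraction R S \<one>\<^bsub>R\<^esub> \<one>\<^bsub>R\<^esub>,
     ring.zero = fraction R S \<zero>\<^bsub>R\<^esub> \<one>\<^bsub>R\<^esub>,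
     ring.add = (\<lambda>x y. \<Union>(a, s)\<in>x. \<Union>(b, t)\<in>y.
        fraction R S (t \<otimes>\<^bsub>R\<^esub> a \<oplus>\<^bsub>R\<^esub> s \<otimes>\<^bsub>R\<^esub> b) (s \<otimes>\<^bsub>R\<^esub> t))\<rparr>"

lemma UN_UN_eqI:
  assumes "\<And>a s b t. (a, s) \<in> X' \<Longrightarrow> (b, t) \<in> Y' \<Longrightarrow> F a s b t = Z"
    and "p \<in> X'" "q \<in> Y'"
  shows "(\<Union>(a, s)\<in>X'. \<Union>(b, t)\<in>Y'. F a s b t) = Z"
proof -
  have "(\<Union>(a, s)\<in>X'. \<Union>(b, t)\<in>Y'. F a s b t) = (\<Union>_\<in>X'. \<Union>_\<in>Y'. Z)"
    by (intro SUP_cong refl) (auto simp: assms(1))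
  with assms(2,3) show ?thesis
    by auto
qed

context
  fixes R (structure) and S
  assumes R: "cring R" and S: "submonoid S R"
begin

interpretation cring R by (rule R)
interpretation S: submonoid S R by (rule S)

lemma mem_fraction: "a \<in> carrier R \<Longrightarrow> s \<in> S \<Longrightarrow> (a, s) \<in> fraction R S a s"
  unfolding fraction_def using S.one_closed by blast

lemma fraction_eq_iff:
  assumes "a \<in> carrier R" "b \<in> carrier R" "s \<in> S" "t \<in> S"
  shows "fraction R S a s = fraction R S b t \<longleftrightarrow> (\<exists>u\<in>S. u \<otimes> (t \<otimes> a) = u \<otimes> (s \<otimes> b))"
proof
  have "(b, t) \<in> fraction R S b t"
    using assms by (auto simp: fraction_def intro: S.one_closed)
  moreover assume "fraction R S a s = fraction R S b t"
  ultimately have "(b, t) \<in> fraction R S a s"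
    by simp
  then show "\<exists>u\<in>S. u \<otimes> (t \<otimes> a) = u \<otimes> (s \<otimes> b)"
    by (simp add: fraction_def)
next
  have trans: "\<exists>w\<in>S. w \<otimes> (r \<otimes> a) = w \<otimes> (s \<otimes> c)"
    if "a \<in> carrier R" "b \<in> carrier R" "c \<in> carrier R" "s \<in> S" "t \<in> S" "r \<in> S" "u \<in> S" "v \<in> S"
      and 1: "u \<otimes> (t \<otimes> a) = u \<otimes> (s \<otimes> b)" and 2: "v \<otimes> (r \<otimes> b) = v \<otimes> (t \<otimes> c)"
    for a b c s t r u v
  proof -
    have [simp]: "s \<in> carrier R" "t \<in> carrier R" "r \<in> carrier R" "u \<in> carrier R" "v \<in> carrier R"
      using that S.subset by auto
    note [simp] = that(1-3)
    have "(u \<otimes> v \<otimes> t) \<otimes> (r \<otimes> a) = (v \<otimes> r) \<otimes> (u \<otimes> (t \<otimes> a))"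
      by (simp add: m_ac)
    also have "\<dots> = (u \<otimes> s) \<otimes> (v \<otimes> (r \<otimes> b))"
      unfolding 1 by (simp add: m_ac)
    also have "\<dots> = (u \<otimes> v \<otimes> t) \<otimes> (s \<otimes> c)"
      unfolding 2 by (simp add: m_ac)
    finally show ?thesis
      using that by (intro bexI[of _ "u \<otimes> v \<otimes> t"]) auto
  qed
  assume "\<exists>u\<in>S. u \<otimes> (t \<otimes> a) = u \<otimes> (s \<otimes> b)"
  then obtain u where u: "u \<in> S" "u \<otimes> (t \<otimes> a) = u \<otimes> (s \<otimes> b)"
    by blast
  have "(\<exists>v\<in>S. v \<otimes> (r \<otimes> a) = v \<otimes> (s \<otimes> c)) \<longleftrightarrow> (\<exists>v\<in>S. v \<otimes> (r \<otimes> b) = v \<otimes> (t \<otimes> c))"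
    if "c \<in> carrier R" "r \<in> S" for c r
  proof
    assume "\<exists>v\<in>S. v \<otimes> (r \<otimes> a) = v \<otimes> (s \<otimes> c)"
    then obtain v where "v \<in> S" "v \<otimes> (r \<otimes> a) = v \<otimes> (s \<otimes> c)"
      by blast
    then show "\<exists>v\<in>S. v \<otimes> (r \<otimes> b) = v \<otimes> (t \<otimes> c)"
      by (intro trans[of b a c t s r u v]) (simp_all add: u assms that)
  next
    assume "\<exists>v\<in>S. v \<otimes> (r \<otimes> b) = v \<otimes> (t \<otimes> c)"
    then obtain v where "v \<in> S" "v \<otimes> (r \<otimes> b) = v \<otimes> (t \<otimes> c)"
      by blast
    then show "\<exists>v\<in>S. v \<otimes> (r \<otimes> a) = v \<otimes> (s \<otimes> c)"
      by (intro trans[of a b c s t r u v]) (simp_all add: u assms that)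
  qed
  then show "fraction R S a s = fraction R S b t"
    unfolding fraction_def by auto
qed

lemma localization_mult:
  assumes "a \<in> carrier R" "b \<in> carrier R" "s \<in> S" "t \<in> S"
  shows "fraction R S a s \<otimes>\<^bsub>localization R S\<^esub> fraction R S b t = fraction R S (a \<otimes> b) (s \<otimes> t)"
proof -
  have "fraction R S (a' \<otimes> b') (s' \<otimes> t') = fraction R S (a \<otimes> b) (s \<otimes> t)"
    if in_frac: "(a', s') \<in> fraction R S a s" "(b', t') \<in> fraction R S b t" for a' b' s' t'
  proof -
    obtain u where u: "u \<in> S" "u \<otimes> (s' \<otimes> a) = u \<otimes> (s \<otimes> a')"
      using in_frac(1) unfolding fraction_def by blast
    obtain v where v: "v \<in> S" "v \<otimes> (t' \<otimes> b) = v \<otimes> (t \<otimes> b')"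
      using in_frac(2) unfolding fraction_def by blast
    have S': "s' \<in> S" "t' \<in> S" and R': "a' \<in> carrier R" "b' \<in> carrier R"
      using in_frac by (simp_all add: fraction_def)
    have [simp]: "s \<in> carrier R" "t \<in> carrier R" "s' \<in> carrier R" "t' \<in> carrier R"
      "u \<in> carrier R" "v \<in> carrier R"
      using assms(3,4) u(1) v(1) S' S.subset by blast+
    have "(u \<otimes> v) \<otimes> (s \<otimes> t \<otimes> (a' \<otimes> b')) = (u \<otimes> (s \<otimes> a')) \<otimes> (v \<otimes> (t \<otimes> b'))"
      using R' by (simp add: m_ac)
    also have "\<dots> = (u \<otimes> v) \<otimes> (s' \<otimes> t' \<otimes> (a \<otimes> b))"
      unfolding u(2)[symmetric] v(2)[symmetric] using assms by (simp add: m_ac)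
    finally have "\<exists>w\<in>S. w \<otimes> (s \<otimes> t \<otimes> (a' \<otimes> b')) = w \<otimes> (s' \<otimes> t' \<otimes> (a \<otimes> b))"
      using S.m_closed[OF u(1) v(1)] by (rule bexI)
    then show ?thesis
      using assms R' S' by (subst fraction_eq_iff) simp_all
  qed
  moreover have "(a, s) \<in> fraction R S a s" "(b, t) \<in> fraction R S b t"
    using assms by (auto simp: fraction_def intro: S.one_closed)
  ultimately show ?thesis
    unfolding localization_def monoid.simps ring.simps by (rule UN_UN_eqI)
qed

lemma localization_add:
  assumes "a \<in> carrier R" "b \<in> carrier R" "s \<in> S" "t \<in> S"
  shows "fraction R S a s \<oplus>\<^bsub>localization R S\<^esub> fraction R S b t = fraction R S (t \<otimes> a \<oplus> s \<otimes> b) (s \<otimes> t)"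
proof -
  have "fraction R S (t' \<otimes> a' \<oplus> s' \<otimes> b') (s' \<otimes> t') = fraction R S (t \<otimes> a \<oplus> s \<otimes> b) (s \<otimes> t)"
    if in_frac: "(a', s') \<in> fraction R S a s" "(b', t') \<in> fraction R S b t" for a' b' s' t'
  proof -
    obtain u where u: "u \<in> S" "u \<otimes> (s' \<otimes> a) = u \<otimes> (s \<otimes> a')"
      using in_frac(1) unfolding fraction_def by blast
    obtain v where v: "v \<in> S" "v \<otimes> (t' \<otimes> b) = v \<otimes> (t \<otimes> b')"
      using in_frac(2) unfolding fraction_def by blast
    have S': "s' \<in> S" "t' \<in> S" and R': "a' \<in> carrier R" "b' \<in> carrier R"
      using in_frac by (simp_all add: fraction_def)
    have [simp]: "s \<in> carrier R" "t \<in> carrier R" "s' \<in> carrier R" "t' \<in> carrier R"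
      "u \<in> carrier R" "v \<in> carrier R"
      using assms(3,4) u(1) v(1) S' S.subset by blast+
    have "(u \<otimes> v) \<otimes> (s \<otimes> t \<otimes> (t' \<otimes> a' \<oplus> s' \<otimes> b')) =
        (v \<otimes> t \<otimes> t') \<otimes> (u \<otimes> (s \<otimes> a')) \<oplus> (u \<otimes> s \<otimes> s') \<otimes> (v \<otimes> (t \<otimes> b'))"
      using R' by (simp add: m_ac r_distr)
    also have "\<dots> = (u \<otimes> v) \<otimes> (s' \<otimes> t' \<otimes> (t \<otimes> a \<oplus> s \<otimes> b))"
      unfolding u(2)[symmetric] v(2)[symmetric] using assms by (simp add: m_ac r_distr)
    finally have "\<exists>w\<in>S. w \<otimes> (s \<otimes> t \<otimes> (t' \<otimes> a' \<oplus> s' \<otimes> b')) =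
        w \<otimes> (s' \<otimes> t' \<otimes> (t \<otimes> a \<oplus> s \<otimes> b))"
      using S.m_closed[OF u(1) v(1)] by (rule bexI)
    then show ?thesis
      using assms R' S' by (subst fraction_eq_iff) simp_all
  qed
  moreover have "(a, s) \<in> fraction R S a s" "(b, t) \<in> fraction R S b t"
    using assms by (auto simp: fraction_def intro: S.one_closed)
  ultimately show ?thesis
    unfolding localization_def monoid.simps ring.simps by (rule UN_UN_eqI)
qed

lemma fraction_eqI:
  assumes "a \<in> carrier R" "b \<in> carrier R" "s \<in> S" "t \<in> S" "t \<otimes> a = s \<otimes> b"
  shows "fraction R S a s = fraction R S b t"
  unfolding fraction_eq_iff[OF assms(1-4)] assms(5) using S.one_closed by blast

lemma cring_localization: "cring (localization R S)" (is "cring ?L")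
proof -
  have fractionE: "\<exists>a s. a \<in> carrier R \<and> s \<in> S \<and> s \<in> carrier R \<and> x = fraction R S a s" if "x \<in> carrier ?L" for x
    using that S.subset by (auto simp: localization_def)
  have fractionI: "fraction R S a s \<in> carrier ?L" if "a \<in> carrier R" "s \<in> S" for a s
    using that by (auto simp: localization_def)
  have zero: "\<zero>\<^bsub>?L\<^esub> = fraction R S \<zero> \<one>" and one: "\<one>\<^bsub>?L\<^esub> = fraction R S \<one> \<one>"
    by (simp_all add: localization_def)
  note simps = localization_add localization_mult zero one
  show ?thesis
  proof (intro cringI abelian_groupI comm_monoidI)
    show "\<zero>\<^bsub>?L\<^esub> \<in> carrier ?L" "\<one>\<^bsub>?L\<^esub> \<in> carrier ?L"
      by (simp_all add: zero one fractionI)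
  next
    fix x assume "x \<in> carrier ?L"
    then obtain a s where x: "a \<in> carrier R" "s \<in> S" "s \<in> carrier R" "x = fraction R S a s"
      using fractionE by blast
    then show "\<zero>\<^bsub>?L\<^esub> \<oplus>\<^bsub>?L\<^esub> x = x" "\<one>\<^bsub>?L\<^esub> \<otimes>\<^bsub>?L\<^esub> x = x"
      by (simp_all add: simps)
    have "fraction R S (\<ominus> a) s \<oplus>\<^bsub>?L\<^esub> x = \<zero>\<^bsub>?L\<^esub>"
      using x by (simp add: simps r_minus l_neg) (rule fraction_eqI, simp_all)
    then show "\<exists>y\<in>carrier ?L. y \<oplus>\<^bsub>?L\<^esub> x = \<zero>\<^bsub>?L\<^esub>"
      by (rule bexI) (simp add: fractionI x)
  next
    fix x y assume "x \<in> carrier ?L" and y: "y \<in> carrier ?L"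
    then obtain a s where x: "a \<in> carrier R" "s \<in> S" "s \<in> carrier R" "x = fraction R S a s"
      using fractionE by blast
    obtain b t where y: "b \<in> carrier R" "t \<in> S" "t \<in> carrier R" "y = fraction R S b t"
      using fractionE[OF y] by blast
    note xy = x y
    show "x \<oplus>\<^bsub>?L\<^esub> y \<in> carrier ?L" "x \<otimes>\<^bsub>?L\<^esub> y \<in> carrier ?L"
      using xy by (auto simp: simps intro!: fractionI)
    show "x \<oplus>\<^bsub>?L\<^esub> y = y \<oplus>\<^bsub>?L\<^esub> x" "x \<otimes>\<^bsub>?L\<^esub> y = y \<otimes>\<^bsub>?L\<^esub> x"
      using xy by (simp_all add: simps m_comm a_comm)
  next
    fix x y z assume "x \<in> carrier ?L" and y: "y \<in> carrier ?L" and z: "z \<in> carrier ?L"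
    then obtain a s where x: "a \<in> carrier R" "s \<in> S" "s \<in> carrier R" "x = fraction R S a s"
      using fractionE by blast
    obtain b t where y: "b \<in> carrier R" "t \<in> S" "t \<in> carrier R" "y = fraction R S b t"
      using fractionE[OF y] by blast
    obtain c r where z: "c \<in> carrier R" "r \<in> S" "r \<in> carrier R" "z = fraction R S c r"
      using fractionE[OF z] by blast
    note xyz [simp] = x y z
    show "(x \<otimes>\<^bsub>?L\<^esub> y) \<otimes>\<^bsub>?L\<^esub> z = x \<otimes>\<^bsub>?L\<^esub> (y \<otimes>\<^bsub>?L\<^esub> z)"
      by (simp add: simps m_assoc)
    have "r \<otimes> (t \<otimes> a \<oplus> s \<otimes> b) \<oplus> s \<otimes> t \<otimes> c = t \<otimes> r \<otimes> a \<oplus> s \<otimes> (r \<otimes> b \<oplus> t \<otimes> c)"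
      by (simp add: r_distr a_assoc m_ac)
    then show "(x \<oplus>\<^bsub>?L\<^esub> y) \<oplus>\<^bsub>?L\<^esub> z = x \<oplus>\<^bsub>?L\<^esub> (y \<oplus>\<^bsub>?L\<^esub> z)"
      by (simp add: simps m_assoc)
    have "(s \<otimes> r \<otimes> (t \<otimes> r)) \<otimes> ((t \<otimes> a \<oplus> s \<otimes> b) \<otimes> c) =
        (s \<otimes> t \<otimes> r) \<otimes> (t \<otimes> r \<otimes> (a \<otimes> c) \<oplus> s \<otimes> r \<otimes> (b \<otimes> c))"
      by (simp add: l_distr r_distr m_ac)
    then have "fraction R S ((t \<otimes> a \<oplus> s \<otimes> b) \<otimes> c) (s \<otimes> t \<otimes> r) =
        fraction R S (t \<otimes> r \<otimes> (a \<otimes> c) \<oplus> s \<otimes> r \<otimes> (b \<otimes> c)) (s \<otimes> r \<otimes> (t \<otimes> r))"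
      by (intro fraction_eqI) auto
    then show "(x \<oplus>\<^bsub>?L\<^esub> y) \<otimes>\<^bsub>?L\<^esub> z = x \<otimes>\<^bsub>?L\<^esub> z \<oplus>\<^bsub>?L\<^esub> y \<otimes>\<^bsub>?L\<^esub> z"
      by (simp add: simps)
  qed
qed

end

definition non_zero_divisors :: "('a, 'b) ring_scheme \<Rightarrow> 'a set" where
  "non_zero_divisors R = {s \<in> carrier R. \<forall>a\<in>carrier R. s \<otimes>\<^bsub>R\<^esub> a = \<zero>\<^bsub>R\<^esub> \<longrightarrow> a = \<zero>\<^bsub>R\<^esub>}"

definition total_quotient_ring :: "('a, 'b) ring_scheme \<Rightarrow> ('a \<times> 'a) set ring" where
  "total_quotient_ring R = localization R (non_zero_divisors R)"

lemma cring_total_quotient_ring: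
  fixes R (structure)
  assumes "cring R"
  shows "cring (total_quotient_ring R)"
proof -
  interpret cring R by (rule assms)
  have "submonoid (non_zero_divisors R) R"
  proof
    show "non_zero_divisors R \<subseteq> carrier R"
      unfolding non_zero_divisors_def by blast
    show "\<one> \<in> non_zero_divisors R"
      unfolding non_zero_divisors_def by simp
  next
    fix s t assume s: "s \<in> non_zero_divisors R" and t: "t \<in> non_zero_divisors R"
    have R: "s \<in> carrier R" "t \<in> carrier R"
      using s t unfolding non_zero_divisors_def by blast+
    have "a = \<zero>" if a: "a \<in> carrier R" "s \<otimes> t \<otimes> a = \<zero>" for a
    proof -
      have "s \<otimes> (t \<otimes> a) = \<zero>" "t \<otimes> a \<in> carrier R"
        using a R by (simp_all add: m_assoc)
      then have "t \<otimes> a = \<zero>"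
        using s unfolding non_zero_divisors_def by blast
      then show ?thesis
        using t a(1) unfolding non_zero_divisors_def by blast
    qed
    then show "s \<otimes> t \<in> non_zero_divisors R"
      using R unfolding non_zero_divisors_def by blast
  qed
  with assms show ?thesis
    unfolding total_quotient_ring_def by (rule cring_localization)
qed

text \<open>
  The image of $\mathcal{Q}(A)$ in $\mathcal{Q}(R)$ under the natural map $a/s \mapsto a/s$, for a
  subring $A$ of $R$ whose non-zero-divisors are non-zero-divisors of $R$.
\<close>

definition total_quotient_image :: "('a, 'b) ring_scheme \<Rightarrow> ('a, 'c) ring_scheme \<Rightarrow> ('a \<times> 'a) set set" where
  "total_quotient_image R A =
    (\<lambda>z. \<Union>(a, s)\<in>z. fraction R (non_zero_divisors R) a s) ` carrier (total_quotient_ring A)"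

text \<open>The extension of an automorphism of $R$ to $\mathcal{Q}(R)$.\<close>

definition extend_to_quotients :: "('a, 'b) ring_scheme \<Rightarrow> ('a \<Rightarrow> 'a) \<Rightarrow> ('a \<times> 'a) set \<Rightarrow> ('a \<times> 'a) set" where
  "extend_to_quotients R h z = (\<Union>(a, s)\<in>z. fraction R (non_zero_divisors R) (h a) (h s))"

definition integral_over :: "('a, 'b) ring_scheme \<Rightarrow> 'a set \<Rightarrow> 'a \<Rightarrow> bool" where
  "integral_over S A z \<longleftrightarrow>
    (\<exists>p \<in> carrier (A[X]\<^bsub>S\<^esub>). p \<noteq> [] \<and> hd p = \<one>\<^bsub>S\<^esub> \<and> ring.eval S p z = \<zero>\<^bsub>S\<^esub>)"

definition normal_domain :: "('a, 'b) ring_scheme \<Rightarrow> bool" where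
  "normal_domain R \<longleftrightarrow> domain R \<and>
    (let Q = total_quotient_ring R;
         R' = (\<lambda>a. fraction R (non_zero_divisors R) a \<one>\<^bsub>R\<^esub>) ` carrier R
     in \<forall>z\<in>carrier Q. integral_over Q R' z \<longrightarrow> z \<in> R')"

definition affine_normal_variety :: "nat \<Rightarrow> 'k::field point set \<Rightarrow> bool" where
  "affine_normal_variety m V \<longleftrightarrow> closedin (zariski m) V \<and> normal_domain (coord_ring m V)"


section \<open>Heights and ramification indices\<close>

definition height :: "('a, 'b) ring_scheme \<Rightarrow> 'a set \<Rightarrow> enat" where
  "height R p = Sup {enat l | l. \<exists>C. (\<forall>i\<le>l. primeideal (C i) R) \<and> (\<forall>i<l. C i \<subset> C (Suc i)) \<and> C l = p}"

definition Ht1 :: "('a, 'b) ring_scheme \<Rightarrow> ('a, 'c) ring_scheme \<Rightarrow> 'a set set" where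
  "Ht1 B A = {p. primeideal p B \<and> height B p = 1 \<and> height A (p \<inter> carrier A) = 1}"

text \<open>
  \<open>prime_valuation B q\<close> is the normalised discrete valuation of $B_q$, restricted to $B$: the value
  at \<open>x\<close> is the largest \<open>l\<close> with $x \in (qB_q)^l$ (and $\infty$ at \<open>x = 0\<close>).
\<close>

definition prime_valuation :: "('a, 'b) ring_scheme \<Rightarrow> 'a set \<Rightarrow> 'a \<Rightarrow> enat" where
  "prime_valuation B q x =
    (let S = carrier B - q;
         Bq = localization B S;
         \<mm> = genideal Bq ((\<lambda>b. fraction B S b \<one>\<^bsub>B\<^esub>) ` q)
     in Sup {enat l | l. fraction B S x \<one>\<^bsub>B\<^esub> \<in> \<mm> [^]\<^bsub>ideals_set Bq\<^esub> l})"

text \<open>For \<open>p = q \<inter> A\<close> this is the value of the ideal \<open>p\<close>, i.e. the minimum over its elements.\<close>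

definition ramification_index :: "('a, 'b) ring_scheme \<Rightarrow> 'a set \<Rightarrow> 'a set \<Rightarrow> enat" where
  "ramification_index B q p = (INF x\<in>p. prime_valuation B q x)"


section \<open>Actions\<close>

text \<open>
  An action of a group with underlying set \<open>H\<close> on the elements of a ring is a map \<open>\<rho>\<close> with
  \<open>\<rho> \<sigma> f\<close> the image of \<open>f\<close> under \<open>\<sigma>\<close>.
\<close>

text \<open>
  The condition on \<open>B\<close> and \<open>c\<close> says that \<open>f\<close> lies in a finite-dimensional \<open>H\<close>-stable
  subspace (with basis \<open>B\<close>) on which \<open>H\<close> acts through a matrix of regular functions on \<open>H\<close>.
\<close>

definition rational_action ::
  "nat \<Rightarrow> 'k::field point set \<Rightarrow> nat \<Rightarrow> 'k point set \<Rightarrow> ('k point \<Rightarrow> ('k point \<Rightarrow> 'k) \<Rightarrow> 'k point \<Rightarrow> 'k) \<Rightarrow> bool"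
  where "rational_action n H m V \<rho> \<longleftrightarrow>
    (\<forall>f\<in>carrier (coord_ring m V). \<exists>B. finite B \<and> B \<subseteq> carrier (coord_ring m V) \<and>
      (\<forall>a. (\<forall>x\<in>V. (\<Sum>b\<in>B. a b * b x) = 0) \<longrightarrow> (\<forall>b\<in>B. a b = 0)) \<and>
      (\<exists>a. \<forall>x\<in>V. f x = (\<Sum>b\<in>B. a b * b x)) \<and>
      (\<exists>c. (\<forall>b\<in>B. \<forall>b'\<in>B. c b b' \<in> carrier (coord_ring n H)) \<and>
        (\<forall>\<sigma>\<in>H. \<forall>b\<in>B. \<forall>x\<in>V. \<rho> \<sigma> b x = (\<Sum>b'\<in>B. c b b' \<sigma> * b' x))))"

definition regular_action ::
  "nat \<Rightarrow> 'k::field point monoid \<Rightarrow> nat \<Rightarrow> 'k point set \<Rightarrow> ('k point \<Rightarrow> ('k point \<Rightarrow> 'k) \<Rightarrow> 'k point \<Rightarrow> 'k) \<Rightarrow> bool"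
  where "regular_action n H m V \<rho> \<longleftrightarrow>
    group_action H (carrier (coord_ring m V)) \<rho> \<and>
    (\<forall>\<sigma>\<in>carrier H. \<rho> \<sigma> \<in> ring_iso (coord_ring m V) (coord_ring m V) \<and>
      (\<forall>c. \<rho> \<sigma> (\<lambda>x\<in>V. c) = (\<lambda>x\<in>V. c))) \<and>
    rational_action n (carrier H) m V \<rho>"

definition effective_action :: "('g, 'c) monoid_scheme \<Rightarrow> ('a, 'b) ring_scheme \<Rightarrow> ('g \<Rightarrow> 'a \<Rightarrow> 'a) \<Rightarrow> bool" where
  "effective_action H R \<rho> \<longleftrightarrow> finite (kernel H (BijGroup (carrier R)) \<rho>)"

definition invariant_ring :: "('a, 'b) ring_scheme \<Rightarrow> ('g \<Rightarrow> 'a \<Rightarrow> 'a) \<Rightarrow> 'g set \<Rightarrow> ('a, 'b) ring_scheme" where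
  "invariant_ring R \<rho> \<Gamma> = R\<lparr>carrier := {f \<in> carrier R. \<forall>\<sigma>\<in>\<Gamma>. \<rho> \<sigma> f = f}\<rparr>"

definition inertia_group :: "('a, 'b) ring_scheme \<Rightarrow> ('g \<Rightarrow> 'a \<Rightarrow> 'a) \<Rightarrow> 'g set \<Rightarrow> 'a set \<Rightarrow> 'g set" where
  "inertia_group A \<rho> H P = {\<sigma> \<in> H. \<forall>x\<in>carrier A. \<rho> \<sigma> x \<ominus>\<^bsub>A\<^esub> x \<in> P}"

text \<open>For an action of \<open>H\<close> on \<open>A\<close> and \<open>A' = R\<^sup>H\<close>, this is $\mathfrak{R}(A,H)$.\<close>

definition reflection_group ::
  "('g, 'c) monoid_scheme \<Rightarrow> ('a, 'b) ring_scheme \<Rightarrow> ('g \<Rightarrow> 'a \<Rightarrow> 'a) \<Rightarrow> ('a, 'd) ring_scheme \<Rightarrow> 'g set" where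
  "reflection_group H A \<rho> A' = generate H (\<Union>P\<in>Ht1 A A'. inertia_group A \<rho> (carrier H) P)"

definition restrictions :: "('g \<Rightarrow> 'a \<Rightarrow> 'a) \<Rightarrow> 'g set \<Rightarrow> 'a set \<Rightarrow> ('a \<Rightarrow> 'a) set" where
  "restrictions \<rho> \<Gamma> S = (\<lambda>\<sigma>. restrict (\<rho> \<sigma>) S) ` \<Gamma>"

end

theory Submission
  imports Defs
begin

text \<open>
  Let \<open>T\<close> be the identity component, a torus, and \<open>Z\<close> its centralizer. A power \<open>\<tau>\<close> of an element
  outside \<open>Z\<close> satisfies \<open>\<tau> \<notin> Z\<close> and \<open>\<tau>\<^sup>q \<in> Z\<close> for a prime \<open>q\<close>, and \<open>H\<close> is the union of the cosets
  \<open>\<tau>\<^sup>j Z\<close>. The variety \<open>V\<close> is the product of a split torus \<open>S\<close>, isomorphic to \<open>T\<close>, and an open subset of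
  the affine line with coordinate \<open>v\<close>. It is the principal open subset of affine space where a
  polynomial does not vanish, so that its coordinate ring \<open>R\<close> is normal.

  On the line, \<open>H\<close> acts through \<open>H / Z\<close>, which is cyclic of order \<open>q\<close>: the generator maps \<open>v\<close> to \<open>\<zeta> v\<close> for
  a primitive \<open>q\<close>-th root of unity \<open>\<zeta>\<close> or, in characteristic \<open>q\<close>, to \<open>v / (1 + v)\<close>. In both cases the
  automorphism is totally ramified at \<open>v = 0\<close>: an invariant function that vanishes there has no linear
  term either, hence is divisible by \<open>v\<^sup>2\<close> (\<open>invariant_vanishing_order_two\<close>).

  On \<open>S\<close>, identified with \<open>T\<close>, the action must restrict to a transitive action of \<open>T\<close>, and an element
  outside \<open>Z\<close> must not act trivially. Conjugation by \<open>H\<close> has the second property only, and translation by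
  \<open>T\<close> does not extend to \<open>H\<close>. Both are reconciled by \<open>x \<mapsto> \<delta> h \<cdot> h x h\<inverse>\<close>, where the cocycle \<open>\<delta>\<close> with
  values in \<open>T\<close> is defined like the transfer, by multiplying over the cosets of \<open>T\<close>. On \<open>T\<close> it is
  \<open>t \<mapsto> t\<^sup>N\<close> for the index \<open>N\<close> of \<open>T\<close>. Hence \<open>T\<close> acts by the translations by \<open>t\<^sup>N\<close>, which is transitive because
  \<open>T\<close> is divisible, and the kernel is finite because \<open>T\<close> has finite \<open>N\<close>-torsion. If \<open>h\<close> acts trivially, then
  \<open>x = 1\<close> gives \<open>\<delta> h = 1\<close>, and so \<open>h\<close> centralizes \<open>T\<close>.

  The invariants of \<open>T\<close> are therefore the functions of \<open>v\<close> alone, and \<open>Z\<close> acts trivially on them. Let \<open>P\<close> be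
  the prime \<open>(v)\<close>. If an element \<open>h\<close> outside \<open>Z\<close> lies in the inertia group of a prime \<open>Q\<close> of height one,
  then \<open>Q\<close> contains the difference of \<open>v\<close> and its image under \<open>h\<close>, which is \<open>v\<close> or \<open>v\<^sup>2\<close> up to a unit, and
  \<open>Q = P\<close>. But then \<open>h\<close> fixes the divisor \<open>v = 0\<close> pointwise and acts trivially on \<open>S\<close>, a contradiction. So all
  inertia groups of height one primes of \<open>R\<close> lie in \<open>Z\<close> (\<open>inertia_subset_Z\<close>), whereas all of \<open>H\<close> is the
  inertia group of \<open>P\<close> restricted to the \<open>T\<close>-invariants (\<open>inertia_T\<close>). This makes the two reflection groups
  restrict differently (\<open>reflection_groups_differ\<close>), and it makes the ramification index in question that of
  \<open>(v)\<close> in the ring of functions of \<open>v\<close> over its \<open>H\<close>-invariants, which is at least two (\<open>ramification\<close>).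
  Finally, a \<open>T\<close>-invariant fraction is constant along the orbits of \<open>T\<close>, so numerator and denominator can be
  restricted to a slice \<open>{x0} \<times> line\<close>, which turns them into functions of \<open>v\<close> (\<open>invariant_fractions\<close>).

  Three general facts are needed besides. The index of \<open>T\<close> is finite because the Zariski topology is
  Noetherian. A function on the group that is regular on each coset of \<open>T\<close> is regular
  (\<open>regular_if_regular_on_cosets\<close>); as \<open>\<delta>\<close> is a power map up to translation on every coset, this gives the
  regularity of the action. A principal open subset of affine space has a normal coordinate ring
  (\<open>normal_domain_coord_ring\<close>), which is seen on the lines through a point.
\<close>

section \<open>Algebras of functions\<close>

text \<open>
  Regularity of maps into affine space is always checked coordinatewise, by showing that the coordinates lie in
  a set of functions that contains the constants and is closed under sums and products.
\<close>

locale function_algebra =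
  fixes \<F> :: "('a \<Rightarrow> 'k::field) set"
  assumes const: "(\<lambda>x. c) \<in> \<F>"
    and add: "f \<in> \<F> \<Longrightarrow> g \<in> \<F> \<Longrightarrow> (\<lambda>x. f x + g x) \<in> \<F>"
    and mult: "f \<in> \<F> \<Longrightarrow> g \<in> \<F> \<Longrightarrow> (\<lambda>x. f x * g x) \<in> \<F>"
begin

lemma uminus: "f \<in> \<F> \<Longrightarrow> (\<lambda>x. - f x) \<in> \<F>"
  using mult[OF const[of "-1"]] by simp

lemma diff: "f \<in> \<F> \<Longrightarrow> g \<in> \<F> \<Longrightarrow> (\<lambda>x. f x - g x) \<in> \<F>"
  using add[OF _ uminus] by simp

lemma sum: "(\<And>i. i \<in> I \<Longrightarrow> f i \<in> \<F>) \<Longrightarrow> (\<lambda>x. \<Sum>i\<in>I. f i x) \<in> \<F>"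
  by (induction I rule: infinite_finite_induct) (auto intro: const add)

lemma prod: "(\<And>i. i \<in> I \<Longrightarrow> f i \<in> \<F>) \<Longrightarrow> (\<lambda>x. \<Prod>i\<in>I. f i x) \<in> \<F>"
  by (induction I rule: infinite_finite_induct) (auto intro: const mult)

lemma power: "f \<in> \<F> \<Longrightarrow> (\<lambda>x. f x ^ k) \<in> \<F>"
  by (induction k) (auto intro: const mult)

lemma divide: "f \<in> \<F> \<Longrightarrow> (\<lambda>x. f x / c) \<in> \<F>"
  using mult[OF _ const[of "inverse c"]] by (simp add: field_simps)

lemmas closure = const add mult uminus diff sum prod power divide

end

text \<open>
  Regular functions are represented by functions on the whole space of which only the values on \<open>D\<close> matter.
\<close>

definition agree_on :: "'a set \<Rightarrow> ('a \<Rightarrow> 'k) set \<Rightarrow> ('a \<Rightarrow> 'k) set" where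
  "agree_on D \<F> = {f. \<exists>F\<in>\<F>. \<forall>x\<in>D. f x = F x}"

lemma agree_onI: "F \<in> \<F> \<Longrightarrow> (\<And>x. x \<in> D \<Longrightarrow> f x = F x) \<Longrightarrow> f \<in> agree_on D \<F>"
  unfolding agree_on_def by blast

lemma agree_onE:
  assumes "f \<in> agree_on D \<F>"
  obtains F where "F \<in> \<F>" "\<And>x. x \<in> D \<Longrightarrow> f x = F x"
  using assms unfolding agree_on_def by blast

lemma agree_on_incl: "f \<in> \<F> \<Longrightarrow> f \<in> agree_on D \<F>"
  by (rule agree_onI) auto

lemma agree_on_cong: "f \<in> agree_on D \<F> \<Longrightarrow> (\<And>x. x \<in> D \<Longrightarrow> g x = f x) \<Longrightarrow> g \<in> agree_on D \<F>"
  unfolding agree_on_def by auto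

lemma function_algebra_agree_on:
  assumes "function_algebra \<F>"
  shows "function_algebra (agree_on D \<F>)"
proof -
  interpret function_algebra \<F> by (rule assms)
  show ?thesis
  proof
    fix f g assume "f \<in> agree_on D \<F>" "g \<in> agree_on D \<F>"
    then obtain F E where F: "F \<in> \<F>" "\<forall>x\<in>D. f x = F x" "E \<in> \<F>" "\<forall>x\<in>D. g x = E x"
      unfolding agree_on_def by blast
    show "(\<lambda>x. f x + g x) \<in> agree_on D \<F>"
      by (rule agree_onI[OF add[OF F(1,3)]]) (use F in auto)
    show "(\<lambda>x. f x * g x) \<in> agree_on D \<F>"
      by (rule agree_onI[OF mult[OF F(1,3)]]) (use F in auto)
  qed (rule agree_on_incl[OF const])
qed

lemma function_algebra_polyfun: "function_algebra (polyfun n)"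
  by standard (auto intro: polyfun.intros)

global_interpretation polyfun: function_algebra "polyfun n" for n
  by (rule function_algebra_polyfun)

abbreviation regfun :: "nat \<Rightarrow> 'k::field point set \<Rightarrow> ('k point \<Rightarrow> 'k) set" where
  "regfun n D \<equiv> agree_on D (polyfun n)"

global_interpretation regfun: function_algebra "regfun n D" for n D
  by (intro function_algebra_agree_on function_algebra_polyfun)

lemma regfun_coord: "i < n \<Longrightarrow> (\<lambda>x. x i) \<in> regfun n D"
  by (intro agree_on_incl polyfun.coord)

lemma (in function_algebra) polyfun_subst:
  assumes "p \<in> polyfun m" "\<And>i. i < m \<Longrightarrow> (\<lambda>a. \<phi> a i) \<in> \<F>"
  shows "(\<lambda>a. p (\<phi> a)) \<in> \<F>"
  using assms by (induction) (auto intro: closure)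

lemma (in function_algebra) regfun_subst:
  assumes "f \<in> regfun m W" "\<And>i. i < m \<Longrightarrow> (\<lambda>a. \<phi> a i) \<in> agree_on D \<F>" "\<And>a. a \<in> D \<Longrightarrow> \<phi> a \<in> W"
  shows "(\<lambda>a. f (\<phi> a)) \<in> agree_on D \<F>"
proof -
  obtain p where p: "p \<in> polyfun m" "\<And>x. x \<in> W \<Longrightarrow> f x = p x"
    using assms(1) unfolding agree_on_def by blast
  interpret A: function_algebra "agree_on D \<F>"
    by (rule function_algebra_agree_on) (rule function_algebra_axioms)
  have "(\<lambda>a. p (\<phi> a)) \<in> agree_on D \<F>"
    using p(1) assms(2) by (rule A.polyfun_subst)
  then show ?thesis
    by (rule agree_on_cong) (simp add: p(2) assms(3))
qed

lemma polyfun_cong: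
  assumes "p \<in> polyfun n" "\<And>i. i < n \<Longrightarrow> x i = y i"
  shows "p x = p y"
  using assms by induction auto

lemma polyfun_mono:
  assumes "p \<in> polyfun n" "n \<le> m"
  shows "p \<in> polyfun m"
  using assms
proof induction
  case (coord i)
  then show ?case by (intro polyfun.coord) simp
qed (auto intro: polyfun.intros)

lemma carrier_coord_ring_iff:
  "f \<in> carrier (coord_ring n V) \<longleftrightarrow> f \<in> extensional V \<and> f \<in> regfun n V"
proof
  assume "f \<in> carrier (coord_ring n V)"
  then show "f \<in> extensional V \<and> f \<in> regfun n V"
    by (auto simp: coord_ring_def agree_on_def)
next
  assume f: "f \<in> extensional V \<and> f \<in> regfun n V"
  then obtain p where "p \<in> polyfun n" "\<forall>x\<in>V. f x = p x"
    by (auto simp: agree_on_def)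
  moreover from this have "f = restrict p V"
    using f by (auto simp: fun_eq_iff extensional_def)
  ultimately show "f \<in> carrier (coord_ring n V)"
    by (auto simp: coord_ring_def)
qed

lemma coord_ring_memI: "f \<in> regfun n V \<Longrightarrow> restrict f V \<in> carrier (coord_ring n V)"
  unfolding carrier_coord_ring_iff by (auto intro: agree_on_cong)

text \<open>
  If \<open>A\<close> and \<open>B\<close> are algebras of regular functions on two varieties, these are the regular functions on the
  product. The functions in \<open>A\<close> need not be closed under addition: \<open>A\<close> may also be a set of characters.
\<close>

inductive_set bisum :: "('a \<Rightarrow> 'k::field) set \<Rightarrow> ('b \<Rightarrow> 'k) set \<Rightarrow> ('a \<times> 'b \<Rightarrow> 'k) set"
  for A B where
  prod: "a \<in> A \<Longrightarrow> b \<in> B \<Longrightarrow> (\<lambda>p. a (fst p) * b (snd p)) \<in> bisum A B"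
| add: "F \<in> bisum A B \<Longrightarrow> E \<in> bisum A B \<Longrightarrow> (\<lambda>p. F p + E p) \<in> bisum A B"

lemma function_algebra_bisum:
  assumes A: "(\<lambda>_. 1) \<in> A" "\<And>f g. f \<in> A \<Longrightarrow> g \<in> A \<Longrightarrow> (\<lambda>x. f x * g x) \<in> A"
    and B: "function_algebra B"
  shows "function_algebra (bisum A B)"
proof
  interpret B: function_algebra B by (rule B)
  show "(\<lambda>p. c) \<in> bisum A B" for c
    using bisum.prod[OF A(1) B.const[of c]] by simp
  show "(\<lambda>p. F p + E p) \<in> bisum A B" if "F \<in> bisum A B" "E \<in> bisum A B" for F E
    using that by (rule bisum.add)
  show "(\<lambda>p. F p * E p) \<in> bisum A B" if "F \<in> bisum A B" "E \<in> bisum A B" for F E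
    using that
  proof (induction arbitrary: E)
    case (prod a b)
    from prod(3) show ?case
    proof induction
      case (prod a' b')
      have "(\<lambda>p. (a (fst p) * a' (fst p)) * (b (snd p) * b' (snd p))) \<in> bisum A B"
        using bisum.prod[OF A(2)[OF \<open>a \<in> A\<close> prod(1)] B.mult[OF \<open>b \<in> B\<close> prod(2)]] .
      then show ?case by (simp add: mult_ac)
    next
      case (add F E)
      then show ?case
        using bisum.add by (fastforce simp: distrib_left)
    qed
  next
    case (add F1 F2)
    then show ?case
      using bisum.add by (fastforce simp: distrib_right)
  qed
qed

lemma bisum_fst: "a \<in> A \<Longrightarrow> (\<lambda>_. 1) \<in> B \<Longrightarrow> (\<lambda>p. a (fst p)) \<in> bisum A B"
  using bisum.prod[of a A "\<lambda>_. 1" B] by simp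

lemma bisum_snd: "(\<lambda>_. 1) \<in> A \<Longrightarrow> b \<in> B \<Longrightarrow> (\<lambda>p. b (snd p)) \<in> bisum A B"
  using bisum.prod[of "\<lambda>_. 1" A b B] by simp

section \<open>Noetherianity of the Zariski topology\<close>

text \<open>
  The ideal of \<open>K[x\<^sub>0, \<dots>, x\<^sub>n\<^sub>-\<^sub>1]\<close> generated by \<open>S\<close>.
\<close>

inductive_set idl :: "nat \<Rightarrow> ('k::field point \<Rightarrow> 'k) set \<Rightarrow> ('k point \<Rightarrow> 'k) set" for n S where
  zero: "(\<lambda>x. 0) \<in> idl n S"
| step: "s \<in> S \<Longrightarrow> r \<in> polyfun n \<Longrightarrow> f \<in> idl n S \<Longrightarrow> (\<lambda>x. r x * s x + f x) \<in> idl n S"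

lemma idl_add:
  assumes "f \<in> idl n S" "g \<in> idl n S"
  shows "(\<lambda>x. f x + g x) \<in> idl n S"
  using assms(1)
proof induction
  case (step s r f)
  then show ?case using idl.step[OF step(1,2) step(4)] by (simp add: add.assoc)
qed (simp add: assms(2))

lemma idl_mult:
  assumes "f \<in> idl n S" "p \<in> polyfun n"
  shows "(\<lambda>x. p x * f x) \<in> idl n S"
  using assms(1)
proof induction
  case (step s r f)
  then show ?case
    using idl.step[OF step(1) polyfun.mult[OF assms(2) step(2)] step(4)]
    by (simp add: algebra_simps)
qed (simp add: idl.zero)

lemma idl_base: "s \<in> S \<Longrightarrow> s \<in> idl n S"
  using idl.step[OF _ polyfun.const[of 1] idl.zero] by auto

lemma idl_sum: "(\<And>i. i \<in> I \<Longrightarrow> f i \<in> idl n S) \<Longrightarrow> (\<lambda>x. \<Sum>i\<in>I. f i x) \<in> idl n S"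
  by (induction I rule: infinite_finite_induct) (auto intro: idl.zero idl_add)

lemma idl_least: "f \<in> idl n S \<Longrightarrow> S \<subseteq> idl n S' \<Longrightarrow> f \<in> idl n S'"
proof (induction rule: idl.induct)
  case (step s r f)
  then show ?case by (intro idl_add idl_mult) auto
qed (rule idl.zero)

lemma idl_mono: "S \<subseteq> S' \<Longrightarrow> idl n S \<subseteq> idl n S'"
  using idl_least idl_base by blast

lemma idl_subset_polyfun: "S \<subseteq> polyfun n \<Longrightarrow> idl n S \<subseteq> polyfun n"
proof
  fix f assume "S \<subseteq> polyfun n" "f \<in> idl n S"
  from this(2,1) show "f \<in> polyfun n"
    by induction (auto intro!: polyfun.intros)
qed

lemma idl_combination:
  fixes a :: "nat \<Rightarrow> 'k::field point \<Rightarrow> 'k"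
  assumes "f \<in> idl n (a ` {..<N})"
  shows "\<exists>r. (\<forall>i. r i \<in> polyfun n) \<and> f = (\<lambda>x. \<Sum>i<N. r i x * a i x)"
  using assms
proof induction
  case zero
  show ?case by (rule exI[of _ "\<lambda>_ _. 0"]) (auto intro: polyfun.const)
next
  case (step s r f)
  then obtain r' j where r': "\<forall>i. r' i \<in> polyfun n" "f = (\<lambda>x. \<Sum>i<N. r' i x * a i x)" "j < N" "s = a j"
    by auto
  show ?case
  proof (intro exI[of _ "\<lambda>i. if i = j then (\<lambda>x. r x + r' i x) else r' i"] conjI allI ext)
    fix x
    have "(\<Sum>i<N. (if i = j then (\<lambda>x. r x + r' i x) else r' i) x * a i x) =
      (\<Sum>i<N. (if i = j then r x * a j x else 0) + r' i x * a i x)"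
      by (intro sum.cong) (auto simp: algebra_simps)
    also have "\<dots> = r x * s x + f x"
      using r'(3) by (simp add: sum.distrib r')
    finally show "r x * s x + f x = (\<Sum>i<N. (if i = j then (\<lambda>x. r x + r' i x) else r' i) x * a i x)" ..
  qed (use r' step in \<open>auto intro: polyfun.add\<close>)
qed

text \<open>
  Polynomials in \<open>n + 1\<close> variables of degree less than \<open>d\<close> in the last one.
\<close>

definition degree_less :: "nat \<Rightarrow> nat \<Rightarrow> ('k::field point \<Rightarrow> 'k) set" where
  "degree_less n d = {f. \<exists>c. (\<forall>i. c i \<in> polyfun n) \<and> f = (\<lambda>x. \<Sum>i<d. c i x * x n ^ i)}"

lemma degree_less_mono: "f \<in> degree_less n d \<Longrightarrow> d \<le> e \<Longrightarrow> f \<in> degree_less n e"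
proof -
  assume "f \<in> degree_less n d" "d \<le> e"
  then obtain c where c: "\<forall>i. c i \<in> polyfun n" "f = (\<lambda>x. \<Sum>i<d. c i x * x n ^ i)"
    by (auto simp: degree_less_def)
  have "(\<Sum>i<d. c i x * x n ^ i) = (\<Sum>i<e. (if i < d then c i else (\<lambda>x. 0)) x * x n ^ i)" for x :: "'a point"
    using \<open>d \<le> e\<close> by (intro sum.mono_neutral_cong_left) auto
  then show ?thesis
    using c unfolding degree_less_def
    by (intro CollectI exI[of _ "\<lambda>i. if i < d then c i else (\<lambda>x. 0)"]) (auto intro: polyfun.const)
qed

lemma degree_less_add:
  assumes "f \<in> degree_less n d" "g \<in> degree_less n d"
  shows "(\<lambda>x. f x + g x) \<in> degree_less n d"
proof -
  obtain c b where "\<forall>i. c i \<in> polyfun n" "f = (\<lambda>x. \<Sum>i<d. c i x * x n ^ i)"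
    "\<forall>i. b i \<in> polyfun n" "g = (\<lambda>x. \<Sum>i<d. b i x * x n ^ i)"
    using assms unfolding degree_less_def by blast
  then show ?thesis unfolding degree_less_def
    by (intro CollectI exI[of _ "\<lambda>i x. c i x + b i x"])
       (auto simp: sum.distrib algebra_simps intro: polyfun.add)
qed

lemma degree_less_monom_mult:
  assumes "f \<in> degree_less n d" "p \<in> polyfun n"
  shows "(\<lambda>x. p x * x n ^ e * f x) \<in> degree_less n (d + e)"
proof -
  obtain c where c: "\<forall>i. c i \<in> polyfun n" "f = (\<lambda>x. \<Sum>i<d. c i x * x n ^ i)"
    using assms unfolding degree_less_def by blast
  define b where "b i = (if i < e then (\<lambda>x. 0) else (\<lambda>x. p x * c (i - e) x))" for i
  have "p x * x n ^ e * f x = (\<Sum>i<d + e. b i x * x n ^ i)" for x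
  proof -
    have "(\<Sum>i<d + e. b i x * x n ^ i) = (\<Sum>i\<in>{e..<d + e}. b i x * x n ^ i)"
      by (rule sum.mono_neutral_right) (auto simp: b_def)
    also have "\<dots> = (\<Sum>i\<in>{0..<d}. b (i + e) x * x n ^ (i + e))"
      using sum.shift_bounds_nat_ivl[of "\<lambda>i. b i x * x n ^ i" 0 e d] by (simp add: add.commute)
    also have "\<dots> = p x * x n ^ e * f x"
      by (simp add: c(2) b_def sum_distrib_left lessThan_atLeast0 power_add algebra_simps)
    finally show ?thesis by simp
  qed
  moreover have "\<forall>i. b i \<in> polyfun n"
    using c(1) assms(2) by (auto simp: b_def intro: polyfun.intros)
  ultimately show ?thesis
    unfolding degree_less_def by blast
qed

lemma degree_less_sum:
  "(\<And>i. i \<in> I \<Longrightarrow> f i \<in> degree_less n d) \<Longrightarrow> (\<lambda>x. \<Sum>i\<in>I. f i x) \<in> degree_less n d"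
proof (induction I rule: infinite_finite_induct)
  case (insert i I)
  then show ?case by (auto intro: degree_less_add)
qed (auto simp: degree_less_def intro!: exI[of _ "\<lambda>_ _. 0"] polyfun.const)

lemma polyfun_Suc_degree_less:
  assumes "f \<in> polyfun (Suc n)"
  shows "\<exists>d. f \<in> degree_less n d"
  using assms
proof induction
  case (const c)
  have "(\<lambda>x. c) \<in> degree_less n 1"
    unfolding degree_less_def by (auto intro!: exI[of _ "\<lambda>_ _. c"] polyfun.const)
  then show ?case ..
next
  case (coord i)
  have one: "(\<lambda>x. 1 :: 'a) \<in> degree_less n 1"
    unfolding degree_less_def by (auto intro!: exI[of _ "\<lambda>_ _. 1"] polyfun.const)
  show ?case
  proof (cases "i = n")
    case True
    then show ?thesis
      using degree_less_monom_mult[OF one polyfun.const, of 1 1] by auto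
  next
    case False
    then have "(\<lambda>x. x i) \<in> polyfun n"
      using coord by (intro polyfun.coord) simp
    then show ?thesis
      using degree_less_monom_mult[OF one, of "\<lambda>x. x i" 0] by auto
  qed
next
  case (add f g)
  then obtain d e where "f \<in> degree_less n d" "g \<in> degree_less n e" by blast
  then have "f \<in> degree_less n (max d e)" "g \<in> degree_less n (max d e)"
    by (auto intro: degree_less_mono)
  then show ?case using degree_less_add by blast
next
  case (mult f g)
  then obtain d e where d: "f \<in> degree_less n d" and e: "g \<in> degree_less n e" by blast
  obtain c where c: "\<forall>i. c i \<in> polyfun n" "f = (\<lambda>x. \<Sum>i<d. c i x * x n ^ i)"
    using d unfolding degree_less_def by blast
  have "(\<lambda>x. \<Sum>i<d. c i x * x n ^ i * g x) \<in> degree_less n (e + d)"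
  proof (rule degree_less_sum)
    fix i assume "i \<in> {..<d}"
    then show "(\<lambda>x. c i x * x n ^ i * g x) \<in> degree_less n (e + d)"
      by (intro degree_less_mono[OF degree_less_monom_mult[OF e, of "c i" i]]) (use c in auto)
  qed
  then show ?case
    by (auto simp: c(2) sum_distrib_right)
qed

lemma greedy_sequence:
  assumes "\<And>S. finite S \<Longrightarrow> S \<subseteq> I \<Longrightarrow> \<exists>r\<in>I. Q S r"
  shows "\<exists>h :: nat \<Rightarrow> 'a. \<forall>k. h k \<in> I \<and> Q (h ` {..<k}) (h k)"
proof (rule dependent_wellorder_choice[where P = "\<lambda>h k r. r \<in> I \<and> Q (h ` {..<k}) r"])
  fix f g :: "nat \<Rightarrow> 'a" and k r
  assume "\<And>y. y < k \<Longrightarrow> f y = g y"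
  then have "f ` {..<k} = g ` {..<k}" by auto
  then show "(r \<in> I \<and> Q (f ` {..<k}) r) = (r \<in> I \<and> Q (g ` {..<k}) r)" by simp
next
  fix k :: nat and h :: "nat \<Rightarrow> 'a"
  assume "\<And>y. y < k \<Longrightarrow> h y \<in> I \<and> Q (h ` {..<y}) (h y)"
  then show "\<exists>r. r \<in> I \<and> Q (h ` {..<k}) r"
    using assms[of "h ` {..<k}"] by auto
qed

text \<open>
  Hilbert's basis theorem, by its classical proof: if an ideal in \<open>n + 1\<close> variables were not finitely
  generated, one could choose \<open>h\<^sub>0, h\<^sub>1, \<dots>\<close> in it, each of least degree in the last variable among the elements
  outside the ideal generated by its predecessors. By induction some leading coefficient is a combination of
  the earlier ones, and subtracting the corresponding combination of the \<open>h\<^sub>i\<close> lowers the degree.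
\<close>

theorem polyfun_noetherian:
  fixes F :: "nat \<Rightarrow> 'k::field point \<Rightarrow> 'k"
  assumes "\<And>i. F i \<in> polyfun n"
  shows "\<exists>N. F N \<in> idl n (F ` {..<N})"
  using assms
proof (induction n arbitrary: F)
  case 0
  have const: "\<exists>c. f = (\<lambda>x. c)" if "f \<in> polyfun 0" for f :: "'k point \<Rightarrow> 'k"
    using that by induction auto
  obtain a b where ab: "F 0 = (\<lambda>x. a)" "F 1 = (\<lambda>x. b)"
    using const[OF 0] by metis
  show ?case
  proof (cases "a = 0")
    case True
    then show ?thesis using ab idl.zero by (intro exI[of _ 0]) auto
  next
    case False
    have "(\<lambda>x. b / a * F 0 x) \<in> idl 0 (F ` {..<1})"
      by (intro idl_mult idl_base polyfun.const) auto
    then show ?thesis using ab False by (intro exI[of _ 1]) auto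
  qed
next
  case (Suc n)
  \<comment> \<open>if the claim fails, the ideal generated by the whole sequence has no finite set of generators\<close>
  define I where "I = idl (Suc n) (range F)"
  show ?case
  proof (rule ccontr)
    assume bad: "\<nexists>N. F N \<in> idl (Suc n) (F ` {..<N})"
    have fin: "\<exists>M. f \<in> idl (Suc n) (F ` {..<M})" if "f \<in> I" for f
      using that unfolding I_def
    proof induction
      case (step s r f)
      then obtain M j where M: "f \<in> idl (Suc n) (F ` {..<M})" "s = F j" by blast
      have sub: "F ` {..<M} \<subseteq> F ` {..<max M (Suc j)}"
        by (intro image_mono) auto
      have "f \<in> idl (Suc n) (F ` {..<max M (Suc j)})"
        by (rule set_mp[OF idl_mono[OF sub] M(1)])
      moreover have "s \<in> F ` {..<max M (Suc j)}"
        using M by auto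
      ultimately show ?case
        using idl.step[OF _ step(2)] by (intro exI)
    qed (auto intro: idl.zero)
    have out: "\<exists>f\<in>I. f \<notin> idl (Suc n) S" if S: "finite S" "S \<subseteq> I" for S
    proof -
      from S have "\<exists>M. S \<subseteq> idl (Suc n) (F ` {..<M})"
      proof induction
        case (insert s S)
        then obtain M M' where M: "S \<subseteq> idl (Suc n) (F ` {..<M})" "s \<in> idl (Suc n) (F ` {..<M'})"
          using fin by blast
        have "idl (Suc n) (F ` {..<M}) \<subseteq> idl (Suc n) (F ` {..<max M M'})"
          "idl (Suc n) (F ` {..<M'}) \<subseteq> idl (Suc n) (F ` {..<max M M'})"
          by (intro idl_mono image_mono; simp)+
        then show ?case using M by blast
      qed simp
      then obtain M where "S \<subseteq> idl (Suc n) (F ` {..<M})" by blast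
      then have "F M \<notin> idl (Suc n) S"
        using bad idl_least by blast
      moreover have "F M \<in> I" unfolding I_def by (intro idl_base) auto
      ultimately show ?thesis by blast
    qed
    have I_poly: "I \<subseteq> polyfun (Suc n)"
      unfolding I_def using Suc.prems by (intro idl_subset_polyfun) auto
    define deg where "deg f = (LEAST d. f \<in> degree_less n d)" for f :: "'k point \<Rightarrow> 'k"
    have deg: "f \<in> degree_less n (deg f)" if "f \<in> I" for f
      unfolding deg_def using polyfun_Suc_degree_less that I_poly by (metis LeastI_ex subsetD)
    have deg_le: "deg f \<le> d" if "f \<in> degree_less n d" for f d
      unfolding deg_def using that by (rule Least_le)
    let ?Q = "\<lambda>S r. r \<notin> idl (Suc n) S \<and> (\<forall>f\<in>I. f \<notin> idl (Suc n) S \<longrightarrow> deg r \<le> deg f)"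
    have "\<exists>r\<in>I. ?Q S r" if S: "finite S" "S \<subseteq> I" for S
    proof -
      let ?D = "\<lambda>d. \<exists>f\<in>I. f \<notin> idl (Suc n) S \<and> deg f = d"
      have ex: "\<exists>d. ?D d" using out[OF S] by metis
      obtain f where f: "f \<in> I" "f \<notin> idl (Suc n) S" "deg f = (LEAST d. ?D d)"
        using LeastI_ex[OF ex] by metis
      have "deg f \<le> deg e" if "e \<in> I" "e \<notin> idl (Suc n) S" for e
        unfolding f(3) by (rule Least_le) (use that in metis)
      then show ?thesis using f by metis
    qed
    then have "\<exists>h :: nat \<Rightarrow> 'k point \<Rightarrow> 'k. \<forall>k. h k \<in> I \<and> ?Q (h ` {..<k}) (h k)"
      by (rule greedy_sequence)
    then obtain h :: "nat \<Rightarrow> 'k point \<Rightarrow> 'k" where hh: "\<forall>k. h k \<in> I \<and> ?Q (h ` {..<k}) (h k)" ..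
    have h: "h k \<in> I" "h k \<notin> idl (Suc n) (h ` {..<k})" for k
      using spec[OF hh, of k] by (rule conjunct1, rule conjunct1[OF conjunct2])
    have h_least: "deg (h k) \<le> deg f" if "f \<in> I" "f \<notin> idl (Suc n) (h ` {..<k})" for k f
      using conjunct2[OF conjunct2[OF spec[OF hh, of k]]] that by (meson bspec mp)
    have "\<forall>k. \<exists>c. (\<forall>i. c i \<in> polyfun n) \<and> h k = (\<lambda>x. \<Sum>i<deg (h k). c i x * x n ^ i)"
      using deg[OF h(1)] unfolding degree_less_def by blast
    then obtain c where c: "\<And>k i. c k i \<in> polyfun n"
      "\<And>k. h k = (\<lambda>x. \<Sum>i<deg (h k). c k i x * x n ^ i)"
      by metis
    have pos: "deg (h k) > 0" for k
    proof (rule ccontr)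
      assume "\<not> ?thesis"
      then have "h k = (\<lambda>x. 0)" using c(2)[of k] by simp
      then show False using h(2)[of k] idl.zero by metis
    qed
    define d where "d k = deg (h k) - 1" for k
    define l where "l k = (\<lambda>x. \<Sum>i<d k. c k i x * x n ^ i)" for k
    have h_eq: "h k x = c k (d k) x * x n ^ d k + l k x" for k x
    proof -
      have "h k x = (\<Sum>i<deg (h k). c k i x * x n ^ i)"
        using c(2)[of k] by (rule fun_cong)
      also have "deg (h k) = Suc (d k)"
        using pos[of k] by (simp add: d_def)
      finally show ?thesis by (simp add: l_def add.commute)
    qed
    have l: "l k \<in> degree_less n (d k)" for k
      unfolding degree_less_def l_def using c(1) by blast
    obtain N where "c N (d N) \<in> idl n ((\<lambda>k. c k (d k)) ` {..<N})"
      using Suc.IH[of "\<lambda>k. c k (d k)"] c(1) by blast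
    then obtain r where r: "\<And>i. r i \<in> polyfun n" "c N (d N) = (\<lambda>x. \<Sum>i<N. r i x * c i (d i) x)"
      using idl_combination by blast
    have d_le: "d i \<le> d N" if "i < N" for i
    proof -
      have "h ` {..<i} \<subseteq> h ` {..<N}" using that by auto
      then have "h N \<notin> idl (Suc n) (h ` {..<i})"
        using h(2)[of N] idl_mono by blast
      then show ?thesis using h_least[OF h(1)[of N]] unfolding d_def by (intro diff_le_mono)
    qed
    define q where "q i = (\<lambda>x. r i x * x n ^ (d N - d i))" for i
    have q: "q i \<in> polyfun (Suc n)" for i
      unfolding q_def by (intro polyfun.mult polyfun.power polyfun.coord polyfun_mono[OF r(1)]) auto
    \<comment> \<open>the leading terms cancel, so \<open>f\<close> has smaller degree than \<open>h N\<close>\<close>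
    define f where "f = (\<lambda>x. h N x - (\<Sum>i<N. q i x * h i x))"
    have comb: "(\<lambda>x. \<Sum>i<N. q i x * h i x) \<in> idl (Suc n) (h ` {..<N})"
      by (intro idl_sum idl_mult q idl_base) auto
    have "f \<in> I"
    proof -
      have "(\<lambda>x. h N x + (-1) * (\<Sum>i<N. q i x * h i x)) \<in> I"
        unfolding I_def
        by (intro idl_add idl_mult[of _ _ _ "\<lambda>x. -1"] polyfun.const idl_sum idl_mult q)
           (use h(1) I_def in auto)
      then show ?thesis by (simp add: f_def)
    qed
    moreover have "f \<notin> idl (Suc n) (h ` {..<N})"
      using idl_add[OF _ comb, of f] h(2)[of N] by (auto simp: f_def)
    ultimately have "deg (h N) \<le> deg f"
      by (rule h_least)
    moreover have "f \<in> degree_less n (d N)"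
    proof -
      have "f x = l N x + (\<Sum>i<N. - r i x * x n ^ (d N - d i) * l i x)" for x
      proof -
        have "q i x * h i x = r i x * c i (d i) x * x n ^ d N + r i x * x n ^ (d N - d i) * l i x" if "i < N" for i
          using d_le[OF that] by (simp add: q_def h_eq algebra_simps flip: power_add)
        then have "(\<Sum>i<N. q i x * h i x) =
          c N (d N) x * x n ^ d N + (\<Sum>i<N. r i x * x n ^ (d N - d i) * l i x)"
          by (simp add: r(2) sum.distrib sum_distrib_right)
        then show ?thesis by (simp add: f_def h_eq[of N] sum_negf)
      qed
      moreover have "(\<lambda>x. l N x + (\<Sum>i<N. - r i x * x n ^ (d N - d i) * l i x)) \<in> degree_less n (d N)"
      proof (intro degree_less_add l degree_less_sum)
        fix i assume "i \<in> {..<N}"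
        then show "(\<lambda>x. - r i x * x n ^ (d N - d i) * l i x) \<in> degree_less n (d N)"
          using degree_less_monom_mult[OF l[of i] polyfun.uminus[OF r(1)[of i]], of "d N - d i"] d_le[of i]
          by simp
      qed
      ultimately show ?thesis by presburger
    qed
    ultimately show False
      using deg_le[of f "d N"] pos[of N] by (simp add: d_def)
  qed
qed

lemma no_descending_closed_chain:
  assumes "\<And>k. closedin (zariski n) (A k)"
  shows "\<exists>k. \<not> A (Suc k) \<subset> (A k :: 'k::field point set)"
proof (rule ccontr)
  assume "\<not> ?thesis"
  then have desc: "A (Suc k) \<subset> A k" for k by blast
  have anti: "A j \<subseteq> A i" if "i \<le> j" for i j
    using lift_Suc_antimono_le[of A] desc that by (metis less_imp_le)
  have "\<forall>k. \<exists>f. f \<in> polyfun n \<and> (\<forall>x\<in>A (Suc k). f x = 0) \<and> (\<exists>x\<in>A k. f x \<noteq> 0)"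
  proof
    fix k
    obtain F where F: "F \<subseteq> polyfun n" "A (Suc k) = zero_locus n F"
      using assms closedin_zariski by blast
    obtain x where x: "x \<in> A k" "x \<notin> A (Suc k)" using desc by blast
    have "x \<in> affine_space n"
      using x(1) assms closedin_subset topspace_zariski by blast
    then obtain f where "f \<in> F" "f x \<noteq> 0"
      using x(2) F(2) by (auto simp: zero_locus_def)
    then show "\<exists>f. f \<in> polyfun n \<and> (\<forall>x\<in>A (Suc k). f x = 0) \<and> (\<exists>x\<in>A k. f x \<noteq> 0)"
      using F x by (auto simp: zero_locus_def)
  qed
  then obtain f where f: "\<And>k. f k \<in> polyfun n" "\<And>k x. x \<in> A (Suc k) \<Longrightarrow> f k x = 0"
    "\<And>k. \<exists>x\<in>A k. f k x \<noteq> 0"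
    by metis
  obtain N where "f N \<in> idl n (f ` {..<N})"
    using polyfun_noetherian f(1) by blast
  then obtain r where "f N = (\<lambda>x. \<Sum>i<N. r i x * f i x)"
    using idl_combination by blast
  moreover have "f i x = 0" if "i < N" "x \<in> A N" for i x
    using f(2) anti[of "Suc i" N] that by auto
  ultimately have "f N x = 0" if "x \<in> A N" for x
    using that by simp
  then show False using f(3) by blast
qed

text \<open>
  Noetherian induction: a closed set that is not connected splits into two smaller closed sets.
\<close>

lemma closed_finite_union_connected:
  assumes "closedin (zariski n) A"
  shows "\<exists>\<C>. finite \<C> \<and> \<Union>\<C> = (A :: 'k::field point set) \<and> (\<forall>C\<in>\<C>. connectedin (zariski n) C)"
proof -
  let ?r = "{(A, B :: 'k point set). closedin (zariski n) A \<and> closedin (zariski n) B \<and> A \<subset> B}"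
  have "wf ?r"
    unfolding wf_iff_no_infinite_down_chain
  proof
    assume "\<exists>f. \<forall>i. (f (Suc i), f i) \<in> ?r"
    then obtain f where f: "\<forall>i. (f (Suc i), f i) \<in> ?r" ..
    have "closedin (zariski n) (f k)" "f (Suc k) \<subset> f k" for k
      using spec[OF f, of k] by auto
    then show False using no_descending_closed_chain[of n f] by metis
  qed
  then show ?thesis using assms
  proof (induction A rule: wf_induct_rule)
    case (less A)
    show ?case
    proof (cases "connectedin (zariski n) A")
      case True
      then show ?thesis by (intro exI[of _ "{A}"]) auto
    next
      case False
      then obtain E1 E2 where E: "closedin (zariski n) E1" "closedin (zariski n) E2" "A \<subseteq> E1 \<union> E2"
        "E1 \<inter> E2 \<inter> A = {}" "E1 \<inter> A \<noteq> {}" "E2 \<inter> A \<noteq> {}"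
        using closedin_subset[OF less.prems] unfolding connectedin_closedin by meson
      have cl: "closedin (zariski n) (E1 \<inter> A)" "closedin (zariski n) (E2 \<inter> A)"
        using E less.prems by (auto intro: closedin_Int)
      have "E1 \<inter> A \<subset> A" "E2 \<inter> A \<subset> A" using E by blast+
      then obtain \<C> \<D> where "finite \<C>" "\<Union>\<C> = E1 \<inter> A" "\<forall>C\<in>\<C>. connectedin (zariski n) C"
        "finite \<D>" "\<Union>\<D> = E2 \<inter> A" "\<forall>C\<in>\<D>. connectedin (zariski n) C"
        using less.IH[of "E1 \<inter> A"] less.IH[of "E2 \<inter> A"] cl less.prems by auto
      then show ?thesis using E(3) by (intro exI[of _ "\<C> \<union> \<D>"]) auto
    qed
  qed
qed

section \<open>The identity component\<close>

lemma regular_map_iff: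
  "regular_map n V m W \<phi> \<longleftrightarrow> \<phi> \<in> V \<rightarrow> W \<and> (\<forall>i<m. (\<lambda>x. \<phi> x i) \<in> regfun n V)"
  unfolding regular_map_def agree_on_def by auto

lemma regular_map_continuous:
  assumes "regular_map n V m W \<phi>" "V \<subseteq> affine_space n" "W \<subseteq> affine_space m"
  shows "continuous_map (subtopology (zariski n) V) (subtopology (zariski m) W) \<phi>"
  unfolding continuous_map_closedin
proof (intro conjI allI impI)
  have top: "topspace (subtopology (zariski n) V) = V" "topspace (subtopology (zariski m) W) = W"
    using assms(2,3) by (auto simp: topspace_zariski)
  have \<phi>: "\<phi> x \<in> W" if "x \<in> V" for x
    using assms(1) that unfolding regular_map_def by blast
  show "\<phi> \<in> topspace (subtopology (zariski n) V) \<rightarrow> topspace (subtopology (zariski m) W)"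
    unfolding top using \<phi> by blast
  fix C assume "closedin (subtopology (zariski m) W) C"
  then obtain F where F: "F \<subseteq> polyfun m" "C = zero_locus m F \<inter> W"
    unfolding closedin_subtopology closedin_zariski by auto
  have "\<exists>E\<in>polyfun n. \<forall>x\<in>V. f (\<phi> x) = E x" if "f \<in> F" for f
  proof -
    have "(\<lambda>x. f (\<phi> x)) \<in> regfun n V"
      by (rule regfun.polyfun_subst[of _ m]) (use that F(1) assms(1) in \<open>auto simp: regular_map_iff\<close>)
    then show ?thesis unfolding agree_on_def by simp
  qed
  then obtain E where E: "\<And>f. f \<in> F \<Longrightarrow> E f \<in> polyfun n" "\<And>f x. f \<in> F \<Longrightarrow> x \<in> V \<Longrightarrow> f (\<phi> x) = E f x"
    by metis
  have "{x \<in> topspace (subtopology (zariski n) V). \<phi> x \<in> C} = zero_locus n (E ` F) \<inter> V"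
    unfolding top F(2) using E(2) \<phi> assms(2,3) by (auto simp: zero_locus_def subset_iff)
  moreover have "E ` F \<subseteq> polyfun n" using E(1) by auto
  ultimately show "closedin (subtopology (zariski n) V) {x \<in> topspace (subtopology (zariski n) V). \<phi> x \<in> C}"
    unfolding closedin_subtopology closedin_zariski by metis
qed

context affine_algebraic_group
begin

lemma carrier_subset: "carrier G \<subseteq> affine_space n"
  using closedin_subset[OF closed] by (simp add: topspace_zariski)

text \<open>
  The group law is a polynomial in the coordinates of both factors, so products of regular maps into the group
  are regular, on any domain and for any algebra of functions.
\<close>

lemma mult_subst:
  assumes "function_algebra \<F>" "i < n"
    and "\<And>d. d \<in> D \<Longrightarrow> A d \<in> carrier G" "\<And>i. i < n \<Longrightarrow> (\<lambda>d. A d i) \<in> agree_on D \<F>"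
    and "\<And>d. d \<in> D \<Longrightarrow> B d \<in> carrier G" "\<And>i. i < n \<Longrightarrow> (\<lambda>d. B d i) \<in> agree_on D \<F>"
  shows "(\<lambda>d. (A d \<otimes> B d) i) \<in> agree_on D \<F>"
proof -
  interpret function_algebra "agree_on D \<F>"
    by (rule function_algebra_agree_on[OF assms(1)])
  obtain f where f: "f \<in> polyfun (2 * n)" "\<forall>x\<in>carrier G. \<forall>y\<in>carrier G. (x \<otimes> y) i = f (pair_point n x y)"
    using regular_mult assms(2) by blast
  have "(\<lambda>d. f (pair_point n (A d) (B d))) \<in> agree_on D \<F>"
  proof (rule polyfun_subst[OF f(1)])
    fix j assume j: "j < 2 * n"
    show "(\<lambda>d. pair_point n (A d) (B d) j) \<in> agree_on D \<F>"
      using assms(4)[of j] assms(6)[of "j - n"] j by (cases "j < n") (auto simp: pair_point_def)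
  qed
  then show ?thesis
    by (rule agree_on_cong) (use f(2) assms(3,5) in blast)
qed

lemma inv_subst:
  assumes "function_algebra \<F>" "i < n"
    and "\<And>d. d \<in> D \<Longrightarrow> A d \<in> carrier G" "\<And>i. i < n \<Longrightarrow> (\<lambda>d. A d i) \<in> agree_on D \<F>"
  shows "(\<lambda>d. (inv (A d)) i) \<in> agree_on D \<F>"
proof -
  interpret function_algebra \<F> by (rule assms(1))
  have "(\<lambda>x. (inv x) i) \<in> regfun n (carrier G)"
    using regular_inv assms(2) unfolding regular_map_iff by blast
  from regfun_subst[OF this assms(4,3)] show ?thesis .
qed

lemma translation_regular:
  assumes "a \<in> carrier G" "b \<in> carrier G"
  shows "regular_map n (carrier G) n (carrier G) (\<lambda>x. a \<otimes> x \<otimes> b)"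
  unfolding regular_map_iff
proof (intro conjI allI impI)
  show "(\<lambda>x. a \<otimes> x \<otimes> b) \<in> carrier G \<rightarrow> carrier G"
    using assms by auto
  show "(\<lambda>x. (a \<otimes> x \<otimes> b) i) \<in> regfun n (carrier G)" if "i < n" for i
    by (intro mult_subst that regfun_coord regfun.const function_algebra_polyfun) (use assms in auto)
qed

lemma translation_connected:
  assumes "a \<in> carrier G" "b \<in> carrier G"
    "connectedin (subtopology (zariski n) (carrier G)) K"
  shows "connectedin (subtopology (zariski n) (carrier G)) ((\<lambda>x. a \<otimes> x \<otimes> b) ` K)"
  by (rule connectedin_continuous_map_image[OF _ assms(3)])
     (intro regular_map_continuous translation_regular assms carrier_subset)

lemma subset_identity_component:
  assumes "connectedin (subtopology (zariski n) (carrier G)) K" "\<one> \<in> K"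
  shows "K \<subseteq> identity_component n G"
  unfolding identity_component_def using assms by (rule connected_component_of_maximal)

lemma identity_component_connected:
  "connectedin (subtopology (zariski n) (carrier G)) (identity_component n G)"
  unfolding identity_component_def by (rule connectedin_connected_component_of)

lemma identity_component_subset: "identity_component n G \<subseteq> carrier G"
  using connectedin_subset_topspace[OF identity_component_connected] by auto

lemma one_identity_component: "\<one> \<in> identity_component n G"
  unfolding identity_component_def using carrier_subset
  by (auto simp: connected_component_of_refl topspace_zariski)

context
  assumes sub: "subgroup (identity_component n G) G"
begin

text \<open>
  Conjugates of the identity component are connected and contain \<open>\<one>\<close>.
\<close>

lemma identity_component_normal: "identity_component n G \<lhd> G"
proof -
  have "x \<otimes> h \<otimes> inv x \<in> identity_component n G"
    if x: "x \<in> carrier G" and h: "h \<in> identity_component n G" for x h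
  proof -
    have "(\<lambda>y. x \<otimes> y \<otimes> inv x) ` identity_component n G \<subseteq> identity_component n G"
    proof (rule subset_identity_component)
      show "connectedin (subtopology (zariski n) (carrier G)) ((\<lambda>y. x \<otimes> y \<otimes> inv x) ` identity_component n G)"
        using x by (intro translation_connected identity_component_connected) auto
      show "\<one> \<in> (\<lambda>y. x \<otimes> y \<otimes> inv x) ` identity_component n G"
        using x one_identity_component by (intro image_eqI[of _ _ \<one>]) auto
    qed
    then show ?thesis using h by blast
  qed
  then show ?thesis
    unfolding normal_inv_iff using sub by blast
qed

text \<open>
  The group is a finite union of connected sets, and a translate of a connected set to \<open>\<one>\<close> lies in the identity
  component; so each of these sets lies in one coset.
\<close>

lemma identity_component_finite_index: "finite (rcosets (identity_component n G))"
proof -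
  obtain \<C> where \<C>: "finite \<C>" "\<Union>\<C> = carrier G" "\<And>C. C \<in> \<C> \<Longrightarrow> connectedin (zariski n) C"
    using closed_finite_union_connected[OF closed] by auto
  let ?T = "identity_component n G"
  have "rcosets ?T \<subseteq> (\<lambda>C. ?T #> (SOME g. g \<in> C)) ` \<C>"
  proof
    fix Y assume "Y \<in> rcosets ?T"
    then obtain a where a: "a \<in> carrier G" "Y = ?T #> a" unfolding RCOSETS_def by blast
    then obtain C where C: "C \<in> \<C>" "a \<in> C" using \<C>(2) by blast
    define g where "g = (SOME g. g \<in> C)"
    have g: "g \<in> C" unfolding g_def using C(2) by (rule someI[where P = "\<lambda>g. g \<in> C"])
    have CG: "C \<subseteq> carrier G" using \<C>(2) C by blast
    have con: "connectedin (subtopology (zariski n) (carrier G)) C"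
      using \<C>(3)[OF C(1)] CG by (simp add: connectedin_subtopology)
    have "(\<lambda>x. \<one> \<otimes> x \<otimes> inv g) ` C \<subseteq> ?T"
    proof (rule subset_identity_component)
      show "connectedin (subtopology (zariski n) (carrier G)) ((\<lambda>x. \<one> \<otimes> x \<otimes> inv g) ` C)"
        using g CG by (intro translation_connected con) auto
      show "\<one> \<in> (\<lambda>x. \<one> \<otimes> x \<otimes> inv g) ` C"
        using g CG by (intro image_eqI[of _ _ g]) (auto simp: subset_iff)
    qed
    then have "\<one> \<otimes> a \<otimes> inv g \<in> ?T" using C(2) by blast
    then have "a \<otimes> inv g \<in> ?T" using a by simp
    then have "a \<in> ?T #> g"
      using a g CG by (intro subgroup.rcos_module_rev[OF sub is_group]) auto
    then have "Y = ?T #> g"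
      using a(2) g CG sub by (metis repr_independence subset_iff)
    then show "Y \<in> (\<lambda>C. ?T #> (SOME g. g \<in> C)) ` \<C>"
      using C(1) unfolding g_def by blast
  qed
  then show ?thesis using \<C>(1) finite_surj by blast
qed

end

end

section \<open>Characters of a torus and separation of its cosets\<close>

definition characters :: "('a, 'b) monoid_scheme \<Rightarrow> 'a set \<Rightarrow> ('a \<Rightarrow> 'k::field) set" where
  "characters G T = {\<chi>. (\<forall>s\<in>T. \<forall>t\<in>T. \<chi> (s \<otimes>\<^bsub>G\<^esub> t) = \<chi> s * \<chi> t) \<and> \<chi> \<one>\<^bsub>G\<^esub> = 1}"

text \<open>
  Dedekind's argument. Two characters differ at some \<open>s\<close>, and subtracting \<open>\<psi> s\<close> times a relation from its
  translate by \<open>s\<close> eliminates \<open>\<psi>\<close>. Characters are normalised to be undefined outside \<open>T\<close>, so that different ones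
  differ at a point of \<open>T\<close>.
\<close>

lemma characters_independent:
  fixes c :: "('a \<Rightarrow> 'k::field) \<Rightarrow> 'k"
  assumes "subgroup T G" "finite U" "U \<subseteq> characters G T \<inter> extensional T"
    and "\<And>t. t \<in> T \<Longrightarrow> (\<Sum>\<chi>\<in>U. c \<chi> * \<chi> t) = 0"
  shows "\<forall>\<chi>\<in>U. c \<chi> = 0"
  using assms(2-4)
proof (induction U arbitrary: c)
  case (insert \<psi> U)
  have mult: "\<chi> (s \<otimes>\<^bsub>G\<^esub> t) = \<chi> s * \<chi> t" if "\<chi> \<in> insert \<psi> U" "s \<in> T" "t \<in> T" for \<chi> s t
    using insert.prems(1) that unfolding characters_def by auto
  have zero: "c \<chi> = 0" if \<chi>: "\<chi> \<in> U" for \<chi>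
  proof -
    have "\<chi> \<in> extensional T" "\<psi> \<in> extensional T" "\<chi> \<noteq> \<psi>"
      using insert \<chi> unfolding characters_def by auto
    then obtain s where s: "s \<in> T" "\<chi> s \<noteq> \<psi> s"
      by (meson extensionalityI)
    have "\<forall>\<chi>\<in>U. c \<chi> * (\<chi> s - \<psi> s) = 0"
    proof (rule insert.IH)
      show "U \<subseteq> characters G T \<inter> extensional T" using insert.prems(1) by simp
      fix t assume t: "t \<in> T"
      have st: "s \<otimes>\<^bsub>G\<^esub> t \<in> T" using subgroup.m_closed[OF assms(1) s(1) t] .
      have "(\<Sum>\<chi>\<in>U. c \<chi> * \<chi> (s \<otimes>\<^bsub>G\<^esub> t)) = (\<Sum>\<chi>\<in>U. c \<chi> * (\<chi> s * \<chi> t))"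
        using mult[OF _ s(1) t] by (intro sum.cong) auto
      then have "(\<Sum>\<chi>\<in>U. c \<chi> * (\<chi> s - \<psi> s) * \<chi> t) =
        (\<Sum>\<chi>\<in>insert \<psi> U. c \<chi> * \<chi> (s \<otimes>\<^bsub>G\<^esub> t)) - \<psi> s * (\<Sum>\<chi>\<in>insert \<psi> U. c \<chi> * \<chi> t)"
        using insert.hyps mult[of \<psi>, OF _ s(1) t]
        by (simp add: sum_distrib_left algebra_simps sum_subtractf)
      also have "\<dots> = 0" using insert.prems(2)[OF st] insert.prems(2)[OF t] by simp
      finally show "(\<Sum>\<chi>\<in>U. c \<chi> * (\<chi> s - \<psi> s) * \<chi> t) = 0" .
    qed
    from bspec[OF this \<chi>] show ?thesis using s(2) by simp
  qed
  moreover have "c \<psi> = 0"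
    using insert.prems(1) insert.prems(2)[OF subgroup.one_closed[OF assms(1)]] insert.hyps zero
    by (simp add: characters_def)
  ultimately show ?case by simp
qed simp

text \<open>
  Collecting the summands with the same left factor turns a sum of products into an expansion indexed by
  finitely many of these factors.
\<close>

lemma bisum_collect:
  assumes "F \<in> bisum A B" "function_algebra B"
  shows "\<exists>U b. finite U \<and> U \<subseteq> (\<lambda>a. restrict a T) ` A \<and> (\<forall>\<chi>. b \<chi> \<in> B) \<and>
    (\<forall>t\<in>T. \<forall>y. F (t, y) = (\<Sum>\<chi>\<in>U. \<chi> t * b \<chi> y))"
proof -
  interpret B: function_algebra B by (rule assms(2))
  from assms(1) show ?thesis
  proof induction
    case (prod a b)
    have "{restrict a T} \<subseteq> (\<lambda>a. restrict a T) ` A" using prod(1) by blast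
    moreover have "\<forall>t\<in>T. \<forall>y. a (fst (t, y)) * b (snd (t, y)) = (\<Sum>\<chi>\<in>{restrict a T}. \<chi> t * b y)" by simp
    ultimately show ?case
      by (intro exI[of _ "{restrict a T}"] exI[of _ "\<lambda>_. b"] conjI allI prod(2)) simp
  next
    case (add F E)
    from add.IH(1) obtain U b where U: "finite U" "U \<subseteq> (\<lambda>a. restrict a T) ` A" "\<forall>\<chi>. b \<chi> \<in> B"
        "\<forall>t\<in>T. \<forall>y. F (t, y) = (\<Sum>\<chi>\<in>U. \<chi> t * b \<chi> y)"
      by (elim exE conjE) (rule that; assumption)
    from add.IH(2) obtain Y d where Y: "finite Y" "Y \<subseteq> (\<lambda>a. restrict a T) ` A" "\<forall>\<chi>. d \<chi> \<in> B"
        "\<forall>t\<in>T. \<forall>y. E (t, y) = (\<Sum>\<chi>\<in>Y. \<chi> t * d \<chi> y)"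
      by (elim exE conjE) (rule that; assumption)
    define b' where "b' \<chi> = (if \<chi> \<in> U then b \<chi> else (\<lambda>_. 0))" for \<chi>
    define d' where "d' \<chi> = (if \<chi> \<in> Y then d \<chi> else (\<lambda>_. 0))" for \<chi>
    have "F (t, y) + E (t, y) = (\<Sum>\<chi>\<in>U \<union> Y. \<chi> t * (b' \<chi> y + d' \<chi> y))" if "t \<in> T" for t y
    proof -
      have "F (t, y) = (\<Sum>\<chi>\<in>U \<union> Y. \<chi> t * b' \<chi> y)" "E (t, y) = (\<Sum>\<chi>\<in>U \<union> Y. \<chi> t * d' \<chi> y)"
        using U Y that unfolding b'_def d'_def by (auto intro!: sum.mono_neutral_cong_left)
      then show ?thesis by (simp add: sum.distrib distrib_left)
    qed
    moreover have "\<forall>\<chi>. (\<lambda>x. b' \<chi> x + d' \<chi> x) \<in> B"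
      using U(3) Y(3) unfolding b'_def d'_def by (auto intro!: B.add B.const)
    ultimately show ?case
      by (intro exI[of _ "U \<union> Y"] exI[of _ "\<lambda>\<chi> x. b' \<chi> x + d' \<chi> x"] conjI Un_least finite_UnI ballI allI
        U(1,2) Y(1,2)) simp_all
  qed
qed

abbreviation (in affine_algebraic_group) regular_characters :: "'k point set \<Rightarrow> ('k point \<Rightarrow> 'k) set" where
  "regular_characters T \<equiv> characters G T \<inter> regfun n T"

text \<open>
  The coordinates of \<open>T\<close> are linear combinations of regular characters. For a torus this holds since the coordinates of
  the split torus are characters, and products of characters are characters. The coefficients are allowed to depend on a
  point of the group so that the condition is an instance of the expansions considered below.
\<close>

locale diagonalizable_subgroup = affine_algebraic_group +
  fixes T
  assumes T_normal: "T \<lhd> G"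
    and T_closed: "closedin (zariski n) T"
    and T_coord: "i < n \<Longrightarrow> (\<lambda>p. fst p i) \<in> agree_on (T \<times> carrier G) (bisum (regular_characters T) (regfun n (carrier G)))"
begin

lemma T_sub: "subgroup T G"
  using T_normal by (rule normal_imp_subgroup)

lemma T_carrier: "t \<in> T \<Longrightarrow> t \<in> carrier G"
  using subgroup.mem_carrier[OF T_sub] .

lemma one_character: "(\<lambda>_. 1) \<in> regular_characters T"
  by (auto simp: characters_def intro: regfun.const)

lemma mult_character:
  assumes "\<chi> \<in> regular_characters T" "\<psi> \<in> regular_characters T"
  shows "(\<lambda>t. \<chi> t * \<psi> t) \<in> regular_characters T"
  using assms by (auto simp: characters_def algebra_simps intro: regfun.mult)

lemma inv_character:
  assumes "\<chi> \<in> regular_characters T"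
  shows "(\<lambda>t. \<chi> (inv t)) \<in> regular_characters T"
proof -
  have "(\<lambda>t. \<chi> (inv t)) \<in> regfun n T"
  proof (rule polyfun.regfun_subst[of \<chi> T n])
    show "(\<lambda>t. (inv t) i) \<in> regfun n T" if "i < n" for i
      by (rule inv_subst[OF function_algebra_polyfun that]) (auto intro: T_carrier regfun_coord)
  qed (use assms subgroup.m_inv_closed[OF T_sub] in auto)
  moreover have "inv (s \<otimes> t) = inv t \<otimes> inv s" if "s \<in> T" "t \<in> T" for s t
    using that by (simp add: T_carrier inv_mult_group)
  ultimately show ?thesis
    using assms subgroup.m_inv_closed[OF T_sub] by (auto simp: characters_def)
qed

lemma character_inv_mult:
  assumes "\<chi> \<in> regular_characters T" "t \<in> T"
  shows "\<chi> t * \<chi> (inv t) = 1"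
proof -
  have "\<chi> t * \<chi> (inv t) = \<chi> (t \<otimes> inv t)"
    using assms subgroup.m_inv_closed[OF T_sub] unfolding characters_def by auto
  then show ?thesis using assms by (simp add: T_carrier characters_def)
qed

abbreviation "expansions \<equiv> bisum (regular_characters T) (regfun n (carrier G))"

lemma function_algebra_expansions: "function_algebra expansions"
  by (intro function_algebra_bisum one_character mult_character function_algebra_agree_on function_algebra_polyfun)

lemma translate_expansion:
  assumes "f \<in> regfun n (carrier G)"
  obtains U b where "finite U" "U \<subseteq> regular_characters T \<inter> extensional T"
    "\<And>\<chi>. b \<chi> \<in> regfun n (carrier G)"
    "\<And>t g. t \<in> T \<Longrightarrow> g \<in> carrier G \<Longrightarrow> f (t \<otimes> g) = (\<Sum>\<chi>\<in>U. \<chi> t * b \<chi> g)"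
proof -
  interpret E: function_algebra expansions by (rule function_algebra_expansions)
  have snd: "(\<lambda>p. snd p i) \<in> agree_on (T \<times> carrier G) expansions" if "i < n" for i
    using bisum_snd[OF one_character regfun_coord[OF that]] by (rule agree_on_incl)
  have "(\<lambda>p. (fst p \<otimes> snd p) i) \<in> agree_on (T \<times> carrier G) expansions" if "i < n" for i
    by (rule mult_subst[OF function_algebra_expansions that])
       (auto intro: T_coord snd T_carrier)
  moreover have "fst p \<otimes> snd p \<in> carrier G" if "p \<in> T \<times> carrier G" for p
    using that T_carrier by auto
  ultimately have "(\<lambda>p. f (fst p \<otimes> snd p)) \<in> agree_on (T \<times> carrier G) expansions"
    by (rule E.regfun_subst[OF assms])
  then obtain F where F: "F \<in> expansions" "\<And>p. p \<in> T \<times> carrier G \<Longrightarrow> f (fst p \<otimes> snd p) = F p"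
    by (rule agree_onE) blast
  obtain U b where U: "finite U" "U \<subseteq> (\<lambda>a. restrict a T) ` regular_characters T"
    "\<forall>\<chi>. b \<chi> \<in> regfun n (carrier G)" "\<forall>t\<in>T. \<forall>y. F (t, y) = (\<Sum>\<chi>\<in>U. \<chi> t * b \<chi> y)"
    using bisum_collect[OF F(1) function_algebra_agree_on[OF function_algebra_polyfun], of T]
    by (elim exE conjE) (rule that; assumption)
  have "restrict \<chi> T \<in> regular_characters T" if "\<chi> \<in> regular_characters T" for \<chi>
    using that subgroup.one_closed[OF T_sub] subgroup.m_closed[OF T_sub]
    by (auto simp: characters_def intro: agree_on_cong)
  then have "U \<subseteq> regular_characters T \<inter> extensional T" using U(2) by auto
  moreover have "f (t \<otimes> g) = (\<Sum>\<chi>\<in>U. \<chi> t * b \<chi> g)" if "t \<in> T" "g \<in> carrier G" for t g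
    using F(2)[of "(t, g)"] U(4) that by simp
  ultimately show ?thesis
    using U(1) spec[OF U(3)] by (intro that)
qed

text \<open>
  The regular functions on the group decompose into weight spaces for the translations by \<open>T\<close>: in the expansion of
  \<open>f (t g)\<close> the coefficient at a character \<open>\<chi>\<close> is itself of weight \<open>\<chi>\<close>, by comparing both expansions of \<open>f (t s g)\<close> and
  the independence of characters.
\<close>

lemma weight_expansion:
  assumes "f \<in> regfun n (carrier G)"
  obtains U b where "finite U" "U \<subseteq> regular_characters T \<inter> extensional T"
    "\<And>\<chi>. b \<chi> \<in> regfun n (carrier G)"
    "\<And>t g. t \<in> T \<Longrightarrow> g \<in> carrier G \<Longrightarrow> f (t \<otimes> g) = (\<Sum>\<chi>\<in>U. \<chi> t * b \<chi> g)"
    "\<And>\<chi> t g. \<chi> \<in> U \<Longrightarrow> t \<in> T \<Longrightarrow> g \<in> carrier G \<Longrightarrow> b \<chi> (t \<otimes> g) = \<chi> t * b \<chi> g"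
proof -
  obtain U b where U: "finite U" "U \<subseteq> regular_characters T \<inter> extensional T"
    "\<And>\<chi>. b \<chi> \<in> regfun n (carrier G)"
    "\<And>t g. t \<in> T \<Longrightarrow> g \<in> carrier G \<Longrightarrow> f (t \<otimes> g) = (\<Sum>\<chi>\<in>U. \<chi> t * b \<chi> g)"
    by (rule translate_expansion[OF assms]) blast
  have "b \<chi> (s \<otimes> g) = \<chi> s * b \<chi> g" if "\<chi> \<in> U" and s: "s \<in> T" and g: "g \<in> carrier G" for \<chi> s g
  proof -
    have "\<forall>\<chi>\<in>U. b \<chi> (s \<otimes> g) - \<chi> s * b \<chi> g = 0"
    proof (rule characters_independent[OF T_sub U(1)])
      show "U \<subseteq> characters G T \<inter> extensional T" using U(2) by blast
      fix t assume t: "t \<in> T"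
      have ts: "t \<otimes> s \<in> T" using subgroup.m_closed[OF T_sub t s] .
      have sg: "s \<otimes> g \<in> carrier G" using s g by (simp add: T_carrier)
      have "(\<Sum>\<chi>\<in>U. \<chi> t * b \<chi> (s \<otimes> g)) = f (t \<otimes> (s \<otimes> g))"
        using U(4) t sg by simp
      also have "\<dots> = f (t \<otimes> s \<otimes> g)"
        using t s g by (simp add: T_carrier m_assoc)
      also have "\<dots> = (\<Sum>\<chi>\<in>U. \<chi> (t \<otimes> s) * b \<chi> g)"
        using U(4) ts g by simp
      also have "\<dots> = (\<Sum>\<chi>\<in>U. \<chi> t * \<chi> s * b \<chi> g)"
        using U(2) t s by (intro sum.cong) (auto simp: characters_def)
      finally show "(\<Sum>\<chi>\<in>U. (b \<chi> (s \<otimes> g) - \<chi> s * b \<chi> g) * \<chi> t) = 0"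
        by (simp add: algebra_simps sum_subtractf)
    qed
    then show ?thesis using that by simp
  qed
  then show ?thesis by (intro that[OF U])
qed

text \<open>
  Start with a function that vanishes on \<open>T\<close> and not at \<open>c\<close>, and take a weight component with this property. It becomes
  invariant after multiplication with a function of the opposite weight that does not vanish at \<open>c\<close>; the latter is a
  component of an extension to the group of the inverse character on \<open>T c\<close>. This argument replaces the Nullstellensatz,
  which would also separate disjoint closed sets by regular functions.
\<close>

lemma invariant_separating_function:
  assumes "c \<in> carrier G" "c \<notin> T"
  obtains F where "F \<in> regfun n (carrier G)" "\<And>t g. t \<in> T \<Longrightarrow> g \<in> carrier G \<Longrightarrow> F (t \<otimes> g) = F g"
    "\<And>t. t \<in> T \<Longrightarrow> F t = 0" "F c = 1"
proof -
  have T1: "\<one> \<in> T" by (rule subgroup.one_closed[OF T_sub])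
  obtain E where E: "E \<subseteq> polyfun n" "T = zero_locus n E"
    using T_closed[unfolded closedin_zariski] by metis
  have "c \<in> affine_space n" using assms(1) carrier_subset by auto
  then obtain f where "f \<in> E" and f_c: "f c \<noteq> 0"
    using assms(2) E(2) unfolding zero_locus_def by auto
  then have f: "f \<in> polyfun n" "f c \<noteq> 0" "\<forall>t\<in>T. f t = 0"
    using E unfolding zero_locus_def by auto
  obtain U b where U: "finite U" "U \<subseteq> regular_characters T \<inter> extensional T"
    "\<And>\<chi>. b \<chi> \<in> regfun n (carrier G)"
    "\<And>t g. t \<in> T \<Longrightarrow> g \<in> carrier G \<Longrightarrow> f (t \<otimes> g) = (\<Sum>\<chi>\<in>U. \<chi> t * b \<chi> g)"
    "\<And>\<chi> t g. \<chi> \<in> U \<Longrightarrow> t \<in> T \<Longrightarrow> g \<in> carrier G \<Longrightarrow> b \<chi> (t \<otimes> g) = \<chi> t * b \<chi> g"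
    by (rule weight_expansion[OF agree_on_incl[OF f(1)]]) blast
  have b_T: "\<forall>\<chi>\<in>U. b \<chi> s = 0" if s: "s \<in> T" for s
  proof (rule characters_independent[OF T_sub U(1)])
    show "U \<subseteq> characters G T \<inter> extensional T" using U(2) by blast
    show "(\<Sum>\<chi>\<in>U. b \<chi> s * \<chi> t) = 0" if "t \<in> T" for t
      using U(4)[OF that T_carrier[OF s]] f(3) subgroup.m_closed[OF T_sub that s]
      by (simp add: mult.commute)
  qed
  have "\<exists>\<chi>\<in>U. b \<chi> c \<noteq> 0"
  proof (rule ccontr)
    assume "\<not> ?thesis"
    then have "f (\<one> \<otimes> c) = 0"
      unfolding U(4)[OF T1 assms(1)] by simp
    then show False using f(2) assms(1) by simp
  qed
  then obtain \<chi> where \<chi>: "\<chi> \<in> U" "b \<chi> c \<noteq> 0" by blast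
  then have \<chi>_char: "\<chi> \<in> regular_characters T" using U(2) by blast
  (* a function of the opposite weight that does not vanish at c *)
  obtain u0 where u0: "u0 \<in> polyfun n" "\<And>t. t \<in> T \<Longrightarrow> \<chi> (inv t) = u0 t"
    using IntD2[OF inv_character[OF \<chi>_char]] by (rule agree_onE) blast
  define u where "u g = u0 (g \<otimes> inv c)" for g
  have u: "u \<in> regfun n (carrier G)"
    unfolding u_def
    by (rule regfun.polyfun_subst[OF u0(1)], rule mult_subst[OF function_algebra_polyfun])
       (use assms(1) in \<open>auto intro: regfun_coord regfun.const\<close>)
  obtain Y d where Y: "finite Y" "Y \<subseteq> regular_characters T \<inter> extensional T"
    "\<And>\<chi>. d \<chi> \<in> regfun n (carrier G)"
    "\<And>t g. t \<in> T \<Longrightarrow> g \<in> carrier G \<Longrightarrow> u (t \<otimes> g) = (\<Sum>\<chi>\<in>Y. \<chi> t * d \<chi> g)"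
    "\<And>\<chi> t g. \<chi> \<in> Y \<Longrightarrow> t \<in> T \<Longrightarrow> g \<in> carrier G \<Longrightarrow> d \<chi> (t \<otimes> g) = \<chi> t * d \<chi> g"
    by (rule weight_expansion[OF u]) blast
  define \<psi> where "\<psi> = (\<lambda>t\<in>T. \<chi> (inv t))"
  have u_c: "u (t \<otimes> c) = \<psi> t" if "t \<in> T" for t
    using that u0(2) assms(1) by (simp add: u_def \<psi>_def m_assoc T_carrier)
  have \<psi>: "\<psi> \<in> characters G T \<inter> extensional T"
    using inv_character[OF \<chi>_char] subgroup.one_closed[OF T_sub] subgroup.m_closed[OF T_sub]
    unfolding \<psi>_def by (auto simp: characters_def)
  have "\<psi> \<in> Y \<and> d \<psi> c = 1"
  proof (rule ccontr)
    assume neg: "\<not> ?thesis"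
    define e where "e \<phi> = (if \<phi> \<in> Y then d \<phi> c else 0) - (if \<phi> = \<psi> then 1 else 0)" for \<phi>
    have "\<forall>\<phi>\<in>insert \<psi> Y. e \<phi> = 0"
    proof (rule characters_independent[OF T_sub])
      show "insert \<psi> Y \<subseteq> characters G T \<inter> extensional T" using Y(2) \<psi> by blast
      fix t assume t: "t \<in> T"
      have "(\<Sum>\<phi>\<in>insert \<psi> Y. e \<phi> * \<phi> t) =
        (\<Sum>\<phi>\<in>insert \<psi> Y. (if \<phi> \<in> Y then d \<phi> c * \<phi> t else 0)) - (\<Sum>\<phi>\<in>insert \<psi> Y. if \<phi> = \<psi> then \<phi> t else 0)"
        unfolding e_def sum_subtractf[symmetric] by (intro sum.cong) (auto simp: algebra_simps)
      also have "(\<Sum>\<phi>\<in>insert \<psi> Y. if \<phi> \<in> Y then d \<phi> c * \<phi> t else 0) = (\<Sum>\<phi>\<in>Y. d \<phi> c * \<phi> t)"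
        using Y(1) by (intro sum.mono_neutral_cong_right) auto
      also have "\<dots> = \<psi> t"
        using Y(4) t assms(1) u_c[OF t] by (simp add: mult.commute)
      also have "(\<Sum>\<phi>\<in>insert \<psi> Y. if \<phi> = \<psi> then \<phi> t else 0) = \<psi> t"
        using Y(1) by (subst sum.delta) auto
      finally show "(\<Sum>\<phi>\<in>insert \<psi> Y. e \<phi> * \<phi> t) = 0" by simp
    qed (use Y(1) in simp)
    then have "e \<psi> = 0" by simp
    then show False using neg by (simp add: e_def split: if_splits)
  qed
  then have d: "d \<psi> c = 1" "d \<psi> (t \<otimes> g) = \<psi> t * d \<psi> g" if "t \<in> T" "g \<in> carrier G" for t g
    using Y(5) that by auto
  define F where "F g = b \<chi> g * d \<psi> g / b \<chi> c" for g
  have "F \<in> regfun n (carrier G)"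
    unfolding F_def using U(3) Y(3) by (intro regfun.divide regfun.mult) auto
  moreover have "F (t \<otimes> g) = F g" if "t \<in> T" "g \<in> carrier G" for t g
  proof -
    have "F (t \<otimes> g) = (\<chi> t * \<chi> (inv t)) * (b \<chi> g * d \<psi> g) / b \<chi> c"
      using U(5) \<chi>(1) d(2)[OF that] that by (simp add: F_def \<psi>_def)
    then show ?thesis
      using character_inv_mult[OF \<chi>_char that(1)] by (simp add: F_def)
  qed
  moreover have "F t = 0" if "t \<in> T" for t
    using b_T[OF that] \<chi>(1) by (simp add: F_def)
  moreover have "F c = 1"
    using d(1)[OF T1 assms(1)] \<chi>(2) by (simp add: F_def)
  ultimately show ?thesis by (rule that)
qed

text \<open>
  An invariant function that is \<open>0\<close> on \<open>T\<close> and \<open>1\<close> at \<open>c\<close> is constant on \<open>T c\<close>. The product of \<open>1 - F\<close> over such functions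
  \<open>F\<close> for all other cosets is the indicator function of \<open>T\<close>.
\<close>

lemma coset_indicator_regular:
  assumes fin: "finite (rcosets T)" and a: "a \<in> carrier G"
  shows "(\<lambda>g. if g \<in> T #> a then 1 else 0) \<in> regfun n (carrier G)"
proof -
  have "\<forall>C\<in>rcosets T - {T}. \<exists>F\<in>regfun n (carrier G). (\<forall>t\<in>T. F t = 0) \<and> (\<forall>g\<in>C. F g = 1)"
  proof
    fix C assume C: "C \<in> rcosets T - {T}"
    then obtain c where c: "c \<in> carrier G" "C = T #> c" unfolding RCOSETS_def by blast
    have "c \<notin> T"
    proof
      assume "c \<in> T"
      then have "T #> c = T" using coset_join2[OF c(1) T_sub] by blast
      then show False using C c(2) by blast
    qed
    then obtain F where F: "F \<in> regfun n (carrier G)" "\<And>t g. t \<in> T \<Longrightarrow> g \<in> carrier G \<Longrightarrow> F (t \<otimes> g) = F g"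
      "\<And>t. t \<in> T \<Longrightarrow> F t = 0" "F c = 1"
      by (rule invariant_separating_function[OF c(1)]) blast
    have "\<forall>g\<in>C. F g = 1" using F(2,4) c unfolding r_coset_def by auto
    then show "\<exists>F\<in>regfun n (carrier G). (\<forall>t\<in>T. F t = 0) \<and> (\<forall>g\<in>C. F g = 1)" using F(1,3) by blast
  qed
  then obtain F where F: "\<And>C. C \<in> rcosets T - {T} \<Longrightarrow> F C \<in> regfun n (carrier G)"
    "\<And>C t. C \<in> rcosets T - {T} \<Longrightarrow> t \<in> T \<Longrightarrow> F C t = 0"
    "\<And>C g. C \<in> rcosets T - {T} \<Longrightarrow> g \<in> C \<Longrightarrow> F C g = 1"
    by metis
  define I where "I g = (\<Prod>C\<in>rcosets T - {T}. 1 - F C g)" for g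
  have I: "I \<in> regfun n (carrier G)"
    unfolding I_def by (intro regfun.prod regfun.diff regfun.const F(1))
  have I_eq: "I g = (if g \<in> T then 1 else 0)" if g: "g \<in> carrier G" for g
  proof (cases "g \<in> T")
    case True
    then show ?thesis by (simp add: I_def F(2))
  next
    case False
    have "T #> g \<in> rcosets T" using g unfolding RCOSETS_def by blast
    moreover have "g \<in> T #> g" using rcos_self[OF g T_sub] .
    ultimately show ?thesis
      using False fin F(3)[of "T #> g" g] by (auto simp: I_def intro!: bexI[of _ "T #> g"])
  qed
  have "(\<lambda>g. I (g \<otimes> inv a)) \<in> regfun n (carrier G)"
    by (rule polyfun.regfun_subst[OF I], rule mult_subst[OF function_algebra_polyfun])
       (use a in \<open>auto intro: regfun_coord regfun.const\<close>)
  then show ?thesis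
  proof (rule agree_on_cong)
    fix g assume g: "g \<in> carrier G"
    have "g \<in> T #> a \<longleftrightarrow> g \<otimes> inv a \<in> T"
      using subgroup.rcos_module[OF T_sub is_group a g] .
    then show "(if g \<in> T #> a then 1 else 0) = I (g \<otimes> inv a)"
      using a g by (simp add: I_eq)
  qed
qed

end

section \<open>Divisibility of polynomial functions along lines\<close>

lemma infinite_alg_closed: "infinite (UNIV :: 'k::alg_closed_field set)"
proof
  assume fin: "finite (UNIV :: 'k set)"
  define p where "p = (\<Prod>a\<in>(UNIV :: 'k set). [:- a, 1:])"
  have deg: "Polynomial.degree (p + 1) > 0"
  proof -
    have "Polynomial.degree p = card (UNIV :: 'k set)"
      unfolding p_def by (subst degree_prod_eq_sum_degree) auto
    then have "Polynomial.degree p > 0"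
      using fin by (simp add: finite_UNIV_card_ge_0)
    then show ?thesis by (subst degree_add_eq_left) auto
  qed
  obtain x where "poly (p + 1) x = 0"
    using alg_closed_imp_poly_has_root[OF deg] ..
  moreover have "poly p x = 0"
    using fin unfolding p_def poly_prod by (intro prod_zero) auto
  ultimately show False by simp
qed

lemma poly_zero_infinite:
  fixes p :: "'k::idom poly"
  assumes "infinite A" "\<And>x. x \<in> A \<Longrightarrow> poly p x = 0"
  shows "p = 0"
proof (rule ccontr)
  assume "p \<noteq> 0"
  then have "finite {x. poly p x = 0}" by (rule poly_roots_finite)
  moreover have "A \<subseteq> {x. poly p x = 0}" using assms(2) by auto
  ultimately show False using assms(1) by (simp add: finite_subset)
qed

lemma poly_eq_off_zeros:
  fixes p q g :: "'k::alg_closed_field poly"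
  assumes "g \<noteq> 0" "\<And>x. poly g x \<noteq> 0 \<Longrightarrow> poly p x = poly q x"
  shows "p = q"
proof -
  have "finite {x. poly g x = 0}" using assms(1) by (rule poly_roots_finite)
  then have "infinite {x. poly g x \<noteq> 0}"
    using infinite_alg_closed[where 'k = 'k] finite_Un[of "{x. poly g x = 0}" "{x. poly g x \<noteq> 0}"]
    by (auto simp: Un_def)
  then have "p - q = 0"
    by (rule poly_zero_infinite) (use assms(2) in auto)
  then show ?thesis by simp
qed

text \<open>
  Over an algebraically closed field, \<open>K[t]\<close> is integrally closed because every root of \<open>b\<close> is a root of \<open>a\<close>: the
  equation shows \<open>a ^ l = 0\<close> there. Cancelling the common linear factor preserves the shape of the equation.
\<close>

lemma poly_integral_dvd:
  fixes a b :: "'k::alg_closed_field poly"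
  assumes "b \<noteq> 0" "a ^ l + (\<Sum>i<l. f i * a ^ (l - 1 - i) * b ^ Suc i) = 0"
  shows "b dvd a"
  using assms
proof (induction "Polynomial.degree b" arbitrary: a b)
  case 0
  then obtain c where "b = [:c:]" "c \<noteq> 0"
    by (metis degree_eq_zeroE pCons_0_0)
  then show ?case by (intro dvdI[of _ _ "Polynomial.smult (inverse c) a"]) simp
next
  case (Suc d)
  then obtain x where x: "poly b x = 0"
    using alg_closed_imp_poly_has_root[of b] by auto
  then obtain b' where b': "b = [:-x, 1:] * b'"
    by (metis poly_eq_0_iff_dvd dvdE)
  have "poly a x ^ l = 0"
    using arg_cong[OF Suc.prems(2), of "\<lambda>p. poly p x"] x by (simp add: poly_sum)
  then have "poly a x = 0" by simp
  then obtain a' where a': "a = [:-x, 1:] * a'"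
    by (metis poly_eq_0_iff_dvd dvdE)
  let ?c = "[:-x, 1:]"
  have "f i * a ^ (l - 1 - i) * b ^ Suc i = ?c ^ l * (f i * a' ^ (l - 1 - i) * b' ^ Suc i)" if "i < l" for i
  proof -
    have "?c ^ l = ?c ^ (l - 1 - i) * ?c ^ Suc i"
      using that by (simp flip: power_add power_Suc)
    then show ?thesis unfolding a' b' power_mult_distrib by (simp only: mult_ac)
  qed
  then have "(\<Sum>i<l. f i * a ^ (l - 1 - i) * b ^ Suc i) = ?c ^ l * (\<Sum>i<l. f i * a' ^ (l - 1 - i) * b' ^ Suc i)"
    unfolding sum_distrib_left by (intro sum.cong) auto
  moreover have "a ^ l = ?c ^ l * a' ^ l"
    unfolding a' power_mult_distrib ..
  ultimately have "?c ^ l * (a' ^ l + (\<Sum>i<l. f i * a' ^ (l - 1 - i) * b' ^ Suc i)) = 0"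
    using Suc.prems(2) by (simp add: distrib_left)
  then have eq: "a' ^ l + (\<Sum>i<l. f i * a' ^ (l - 1 - i) * b' ^ Suc i) = 0"
    by (simp del: mult_pCons_left)
  have "b' \<noteq> 0" using Suc.prems(1) b' by auto
  moreover from this have "d = Polynomial.degree b'"
    using Suc.hyps(2) unfolding b' by (subst (asm) degree_mult_eq) auto
  ultimately have "b' dvd a'"
    using Suc.hyps(1) eq by blast
  then show ?case unfolding a' b' by (rule mult_dvd_mono[OF dvd_refl])
qed

text \<open>
  Restricting to the lines \<open>t \<mapsto> o' + t u\<close> yields polynomials in \<open>t\<close> whose degree is bounded and whose coefficients
  depend polynomially on the direction \<open>u\<close>.
\<close>

lemma line_expansion:
  fixes p :: "'k::field point \<Rightarrow> 'k"
  assumes "p \<in> polyfun N"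
  obtains P D where "\<And>d. (\<lambda>u. Polynomial.coeff (P u) d) \<in> polyfun N" "\<And>u. Polynomial.degree (P u) \<le> D"
    "\<And>u t. p (\<lambda>i. o' i + t * u i) = poly (P u) t"
proof -
  have "\<exists>P D. (\<forall>d. (\<lambda>u. Polynomial.coeff (P u) d) \<in> polyfun N) \<and> (\<forall>u. Polynomial.degree (P u) \<le> D) \<and>
    (\<forall>u t. p (\<lambda>i. o' i + t * u i) = poly (P u) t)"
    using assms
  proof induction
    case (const c)
    show ?case
      by (intro exI[of _ "\<lambda>u. [:c:]"] exI[of _ 0]) (auto intro: polyfun.const)
  next
    case (coord i)
    have "Polynomial.coeff [:o' i, u i:] d = (if d = 0 then o' i else if d = 1 then u i else 0)" for u :: "'k point" and d
      by (auto simp: coeff_pCons split: nat.splits)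
    then have "(\<lambda>u. Polynomial.coeff [:o' i, u i:] d) \<in> polyfun N" for d
      using coord by (cases "d = 0"; cases "d = 1") (simp_all add: polyfun.coord polyfun.const)
    then show ?case
      by (intro exI[of _ "\<lambda>u. [:o' i, u i:]"] exI[of _ 1]) auto
  next
    case (add f g)
    then obtain P D Q E where "\<forall>d. (\<lambda>u. Polynomial.coeff (P u) d) \<in> polyfun N" "\<forall>u. Polynomial.degree (P u) \<le> D"
      "\<forall>u t. f (\<lambda>i. o' i + t * u i) = poly (P u) t"
      "\<forall>d. (\<lambda>u. Polynomial.coeff (Q u) d) \<in> polyfun N" "\<forall>u. Polynomial.degree (Q u) \<le> E"
      "\<forall>u t. g (\<lambda>i. o' i + t * u i) = poly (Q u) t"
      by (elim exE conjE) (rule that; assumption)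
    then show ?case
      by (intro exI[of _ "\<lambda>u. P u + Q u"] exI[of _ "max D E"])
         (auto intro!: degree_add_le polyfun.add intro: le_max_iff_disj[THEN iffD2])
  next
    case (mult f g)
    then obtain P D Q E where *: "\<forall>d. (\<lambda>u. Polynomial.coeff (P u) d) \<in> polyfun N" "\<forall>u. Polynomial.degree (P u) \<le> D"
      "\<forall>u t. f (\<lambda>i. o' i + t * u i) = poly (P u) t"
      "\<forall>d. (\<lambda>u. Polynomial.coeff (Q u) d) \<in> polyfun N" "\<forall>u. Polynomial.degree (Q u) \<le> E"
      "\<forall>u t. g (\<lambda>i. o' i + t * u i) = poly (Q u) t"
      by (elim exE conjE) (rule that; assumption)
    have "Polynomial.degree (P u * Q u) \<le> D + E" for u
      using degree_mult_le[of "P u" "Q u"] *(2,5) by (meson add_mono order_trans)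
    moreover have "(\<lambda>u. Polynomial.coeff (P u * Q u) d) \<in> polyfun N" for d
      unfolding coeff_mult using *(1,4) by (intro polyfun.sum polyfun.mult) auto
    ultimately show ?case
      using *(3,6) by (intro exI[of _ "\<lambda>u. P u * Q u"] exI[of _ "D + E"]) auto
  qed
  then obtain P D where *: "\<forall>d. (\<lambda>u. Polynomial.coeff (P u) d) \<in> polyfun N" "\<forall>u. Polynomial.degree (P u) \<le> D"
    "\<forall>u t. p (\<lambda>i. o' i + t * u i) = poly (P u) t"
    by (elim exE conjE) (rule that; assumption)
  show ?thesis
    by (rule that[OF spec[OF *(1)] spec[OF *(2)] spec[OF spec[OF *(3)]]])
qed

lemma affine_space_line:
  "x \<in> affine_space N \<Longrightarrow> u \<in> affine_space N \<Longrightarrow> (\<lambda>i. x i + t * u i) \<in> affine_space N"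
  by (simp add: affine_space_def)

text \<open>
  If \<open>B\<close> divides \<open>A\<close> along every line through a point where \<open>B\<close> does not vanish, then \<open>B\<close> divides \<open>A\<close>. The constant
  term of \<open>B\<close> on each line is the same nonzero number, so the coefficients of the quotients are computed recursively and are
  polynomials in the direction; the value of the quotient at \<open>z\<close> is that at \<open>t = 1\<close> on the line with direction \<open>z - o'\<close>.
\<close>

lemma polyfun_quotient:
  fixes A B :: "'k::alg_closed_field point \<Rightarrow> 'k"
  assumes A: "A \<in> polyfun N" and B: "B \<in> polyfun N" and o': "o' \<in> affine_space N" "B o' \<noteq> 0"
    and dvd: "\<And>u. u \<in> affine_space N \<Longrightarrow> \<exists>Q. \<forall>t. A (\<lambda>i. o' i + t * u i) = B (\<lambda>i. o' i + t * u i) * poly Q t"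
  shows "\<exists>C\<in>polyfun N. \<forall>z\<in>affine_space N. A z = B z * C z"
proof -
  obtain PA D where PA: "\<And>d. (\<lambda>u. Polynomial.coeff (PA u) d) \<in> polyfun N" "\<And>u. Polynomial.degree (PA u) \<le> D"
    "\<And>u t. A (\<lambda>i. o' i + t * u i) = poly (PA u) t"
    by (rule line_expansion[OF A, of o']) blast
  obtain PB E where PB: "\<And>d. (\<lambda>u. Polynomial.coeff (PB u) d) \<in> polyfun N" "\<And>u. Polynomial.degree (PB u) \<le> E"
    "\<And>u t. B (\<lambda>i. o' i + t * u i) = poly (PB u) t"
    by (rule line_expansion[OF B, of o']) blast
  have \<beta>: "Polynomial.coeff (PB u) 0 = B o'" for u
    using PB(3)[of 0 u] by (simp add: poly_0_coeff_0)
  have "\<exists>Q. PA u = PB u * Q" if u: "u \<in> affine_space N" for u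
  proof -
    obtain Q where "\<forall>t. A (\<lambda>i. o' i + t * u i) = B (\<lambda>i. o' i + t * u i) * poly Q t"
      using dvd[OF u] ..
    then have "PA u = PB u * Q"
      unfolding PA(3) PB(3) by (intro poly_eq_off_zeros[of 1]) auto
    then show ?thesis ..
  qed
  then obtain Q where Q: "\<And>u. u \<in> affine_space N \<Longrightarrow> PA u = PB u * Q u"
    by metis
  have Q_deg: "Polynomial.degree (Q u) \<le> D" if u: "u \<in> affine_space N" for u
  proof (cases "Q u = 0")
    case False
    moreover have "PB u \<noteq> 0" using \<beta>[of u] o'(2) by auto
    ultimately have "Polynomial.degree (PA u) = Polynomial.degree (PB u) + Polynomial.degree (Q u)"
      using Q[OF u] degree_mult_eq by metis
    then show ?thesis using PA(2)[of u] by simp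
  qed simp
  have Q_coeff: "(\<lambda>u. Polynomial.coeff (Q u) d) \<in> regfun N (affine_space N)" for d
  proof (induction d rule: less_induct)
    case (less d)
    let ?R = "\<lambda>u. (Polynomial.coeff (PA u) d - (\<Sum>i\<in>{1..d}. Polynomial.coeff (PB u) i * Polynomial.coeff (Q u) (d - i))) / B o'"
    have "?R \<in> regfun N (affine_space N)"
      by (intro regfun.divide regfun.diff regfun.sum regfun.mult less agree_on_incl PA(1) PB(1)) auto
    then show ?case
    proof (rule agree_on_cong)
      fix u :: "'k point" assume u: "u \<in> affine_space N"
      have "Polynomial.coeff (PA u) d = (\<Sum>i\<le>d. Polynomial.coeff (PB u) i * Polynomial.coeff (Q u) (d - i))"
        unfolding Q[OF u] coeff_mult ..
      also have "\<dots> = B o' * Polynomial.coeff (Q u) d +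
          (\<Sum>i\<in>{1..d}. Polynomial.coeff (PB u) i * Polynomial.coeff (Q u) (d - i))"
        unfolding atMost_atLeast0 by (subst sum.atLeast_Suc_atMost) (auto simp: \<beta>)
      finally show "Polynomial.coeff (Q u) d = ?R u" using o'(2) by simp
    qed
  qed
  have "(\<lambda>z. \<Sum>d\<le>D. Polynomial.coeff (Q (\<lambda>i. z i - o' i)) d) \<in> regfun N (affine_space N)"
  proof (intro regfun.sum)
    fix d
    show "(\<lambda>z. Polynomial.coeff (Q (\<lambda>i. z i - o' i)) d) \<in> regfun N (affine_space N)"
      by (rule polyfun.regfun_subst[OF Q_coeff, where \<phi> = "\<lambda>z i. z i - o' i"])
         (use o'(1) in \<open>auto simp: affine_space_def intro: regfun.diff regfun_coord regfun.const\<close>)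
  qed
  then obtain C where C: "C \<in> polyfun N"
    "\<And>z. z \<in> affine_space N \<Longrightarrow> (\<Sum>d\<le>D. Polynomial.coeff (Q (\<lambda>i. z i - o' i)) d) = C z"
    by (rule agree_onE) blast
  have "A z = B z * C z" if z: "z \<in> affine_space N" for z
  proof -
    define u where "u = (\<lambda>i. z i - o' i)"
    have u: "u \<in> affine_space N" using z o'(1) by (simp add: u_def affine_space_def)
    have zu: "(\<lambda>i. o' i + 1 * u i) = z" by (simp add: u_def)
    have "poly (Q u) 1 = (\<Sum>d\<le>D. Polynomial.coeff (Q u) d)"
      unfolding poly_altdef using Q_deg[OF u]
      by (simp) (intro sum.mono_neutral_left, auto simp: coeff_eq_0)
    also have "\<dots> = C z" using C(2)[OF z] by (simp add: u_def)
    finally have "poly (PA u) 1 = poly (PB u) 1 * C z"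
      unfolding Q[OF u] by simp
    then show ?thesis
      using PA(3)[of 1 u] PB(3)[of 1 u] unfolding zu by simp
  qed
  then show ?thesis by (intro bexI[OF _ C(1)] ballI)
qed

text \<open>
  The core of the normality of a principal open set: an integral equation for \<open>A / B\<close> whose coefficients have
  denominators \<open>G\<^sup>M\<close> is one for \<open>A G\<^sup>M / B\<close> with polynomial coefficients. On each line through a point this quotient is a
  polynomial, since \<open>K[t]\<close> is integrally closed.
\<close>

lemma principal_open_integral_dvd:
  fixes A B G :: "'k::alg_closed_field point \<Rightarrow> 'k"
  assumes A: "A \<in> polyfun N" and B: "B \<in> polyfun N" and G: "G \<in> polyfun N"
    and F: "\<And>i. F i \<in> polyfun N"
    and o': "o' \<in> affine_space N" "B o' \<noteq> 0" "G o' \<noteq> 0"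
    and eq: "\<And>z. z \<in> affine_space N \<Longrightarrow> B z \<noteq> 0 \<Longrightarrow> G z \<noteq> 0 \<Longrightarrow>
      A z ^ l + (\<Sum>i<l. F i z / G z ^ M * A z ^ (l - 1 - i) * B z ^ Suc i) = 0"
  shows "\<exists>C\<in>polyfun N. \<forall>z\<in>affine_space N. A z * G z ^ M = B z * C z"
proof -
  have A': "(\<lambda>z. A z * G z ^ M) \<in> polyfun N"
    by (rule polyfun.mult[OF A polyfun.power[OF G]])
  have dvd: "\<exists>Q. \<forall>t. A (\<lambda>i. o' i + t * u i) * G (\<lambda>i. o' i + t * u i) ^ M = B (\<lambda>i. o' i + t * u i) * poly Q t"
    if u: "u \<in> affine_space N" for u
  proof -
    have F': "(\<lambda>z. F i z * G z ^ (M * i)) \<in> polyfun N" for i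
      by (rule polyfun.mult[OF F polyfun.power[OF G]])
    have "\<exists>P. \<forall>t. F i (\<lambda>i. o' i + t * u i) * G (\<lambda>i. o' i + t * u i) ^ (M * i) = poly P t" for i
      by (rule line_expansion[OF F'[of i], of o']) blast
    then have "\<forall>i. \<exists>P. \<forall>t. F i (\<lambda>i. o' i + t * u i) * G (\<lambda>i. o' i + t * u i) ^ (M * i) = poly P t" ..
    from choice[OF this] obtain P where
      "\<forall>i t. F i (\<lambda>i. o' i + t * u i) * G (\<lambda>i. o' i + t * u i) ^ (M * i) = poly (P i) t" ..
    then have P: "F i (\<lambda>i. o' i + t * u i) * G (\<lambda>i. o' i + t * u i) ^ (M * i) = poly (P i) t" for i t
      by simp
    obtain a where a: "\<And>t. A (\<lambda>i. o' i + t * u i) * G (\<lambda>i. o' i + t * u i) ^ M = poly a t"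
      by (rule line_expansion[OF A', of o']) blast
    obtain b where b: "\<And>t. B (\<lambda>i. o' i + t * u i) = poly b t"
      by (rule line_expansion[OF B, of o']) blast
    obtain g where g: "\<And>t. G (\<lambda>i. o' i + t * u i) = poly g t"
      by (rule line_expansion[OF G, of o']) blast
    have b0: "b \<noteq> 0" using b[of 0] o'(2) by auto
    have g0: "g \<noteq> 0" using g[of 0] o'(3) by auto
    have "a ^ l + (\<Sum>i<l. P i * a ^ (l - 1 - i) * b ^ Suc i) = 0"
    proof (rule poly_eq_off_zeros[of "b * g"])
      show "b * g \<noteq> 0" using b0 g0 by simp
      fix t assume t: "poly (b * g) t \<noteq> 0"
      define z where "z = (\<lambda>i. o' i + t * u i)"
      have nz: "B z \<noteq> 0" "G z \<noteq> 0" using t b[of t] g[of t] by (auto simp: z_def)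
      have z: "z \<in> affine_space N" unfolding z_def using o'(1) u by (rule affine_space_line)
      have "poly (P i) t * poly a t ^ (l - 1 - i) * poly b t ^ Suc i =
        (G z ^ M) ^ l * (F i z / G z ^ M * A z ^ (l - 1 - i) * B z ^ Suc i)" if "i < l" for i
      proof -
        have "l = Suc (i + (l - 1 - i))" using that by simp
        then have "(G z ^ M) ^ l = G z ^ M * (G z ^ M) ^ i * (G z ^ M) ^ (l - 1 - i)"
          by (metis power_Suc power_add mult.assoc)
        then show ?thesis
          using nz unfolding P[of i t, symmetric] a[of t, symmetric] b[of t, symmetric] z_def[symmetric]
          by (simp add: power_mult_distrib power_mult mult_ac)
      qed
      then have "(\<Sum>i<l. poly (P i) t * poly a t ^ (l - 1 - i) * poly b t ^ Suc i) =
        (G z ^ M) ^ l * (\<Sum>i<l. F i z / G z ^ M * A z ^ (l - 1 - i) * B z ^ Suc i)"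
        unfolding sum_distrib_left by (intro sum.cong) auto
      moreover have "poly a t ^ l = (G z ^ M) ^ l * A z ^ l"
        unfolding a[of t, symmetric] z_def[symmetric] by (simp add: power_mult_distrib)
      ultimately have "poly a t ^ l + (\<Sum>i<l. poly (P i) t * poly a t ^ (l - 1 - i) * poly b t ^ Suc i) = 0"
        using arg_cong[OF eq[OF z nz], of "\<lambda>s. (G z ^ M) ^ l * s"] by (simp only: distrib_left mult_zero_right)
      then show "poly (a ^ l + (\<Sum>i<l. P i * a ^ (l - 1 - i) * b ^ Suc i)) t = poly 0 t"
        by (simp add: poly_sum)
    qed
    from poly_integral_dvd[OF b0 this] obtain Q where "a = b * Q" ..
    then show ?thesis
      unfolding a b by (intro exI[of _ Q]) simp
  qed
  show ?thesis
    using polyfun_quotient[where A = "\<lambda>z. A z * G z ^ M" and B = B and o' = o' and N = N, OF A' B o'(1) o'(2) dvd] .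
qed

section \<open>The coordinate ring of a principal open set\<close>

lemma coord_ring_apply [simp]:
  "y \<in> V \<Longrightarrow> (f \<otimes>\<^bsub>coord_ring m V\<^esub> g) y = f y * g y"
  "y \<in> V \<Longrightarrow> (f \<oplus>\<^bsub>coord_ring m V\<^esub> g) y = f y + g y"
  "y \<in> V \<Longrightarrow> \<one>\<^bsub>coord_ring m V\<^esub> y = 1"
  "y \<in> V \<Longrightarrow> \<zero>\<^bsub>coord_ring m V\<^esub> y = 0"
  by (simp_all add: coord_ring_def)

lemma coord_ring_eqI:
  assumes "f \<in> carrier (coord_ring m V)" "g \<in> carrier (coord_ring m V)" "\<And>y. y \<in> V \<Longrightarrow> f y = g y"
  shows "f = g"
  using assms extensionalityI[of f V g] unfolding carrier_coord_ring_iff by simp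

lemma coord_ring_pow [simp]:
  "y \<in> V \<Longrightarrow> (f [^]\<^bsub>coord_ring m V\<^esub> (k::nat)) y = f y ^ k"
proof (induction k)
  case 0
  then show ?case using coord_ring_apply(3) by (simp add: nat_pow_def)
next
  case (Suc k)
  then show ?case using coord_ring_apply(1)[OF Suc.prems, of m] by (simp add: nat_pow_def mult.commute)
qed

lemma coord_ring_uminus:
  assumes "f \<in> carrier (coord_ring m V)" "y \<in> V"
  shows "(\<ominus>\<^bsub>coord_ring m V\<^esub> f) y = - f y"
proof -
  interpret cring "coord_ring m V" by (rule cring_coord_ring)
  have "(\<ominus>\<^bsub>coord_ring m V\<^esub> f \<oplus>\<^bsub>coord_ring m V\<^esub> f) y = 0"
    using assms by (simp only: l_neg coord_ring_apply)
  then have "(\<ominus>\<^bsub>coord_ring m V\<^esub> f) y + f y = 0"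
    using assms(2) by (simp only: coord_ring_apply)
  then show ?thesis by (rule eq_neg_iff_add_eq_0[THEN iffD2])
qed

context domain
begin

lemma non_zero_divisors_eq: "non_zero_divisors R = carrier R - {\<zero>}"
proof -
  have "\<zero> \<notin> non_zero_divisors R"
    unfolding non_zero_divisors_def using one_not_zero by (auto intro!: bexI[OF _ one_closed])
  then show ?thesis
    unfolding non_zero_divisors_def by (auto simp: integral_iff)
qed

lemma submonoid_nonzero: "submonoid (carrier R - {\<zero>}) R"
  by standard (auto simp: integral_iff)

lemma quotient_eq_iff:
  assumes "a \<in> carrier R" "b \<in> carrier R" "s \<in> carrier R - {\<zero>}" "t \<in> carrier R - {\<zero>}"
  shows "fraction R (carrier R - {\<zero>}) a s = fraction R (carrier R - {\<zero>}) b t \<longleftrightarrow> t \<otimes> a = s \<otimes> b"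
proof
  assume "fraction R (carrier R - {\<zero>}) a s = fraction R (carrier R - {\<zero>}) b t"
  then obtain u where u: "u \<in> carrier R - {\<zero>}" "u \<otimes> (t \<otimes> a) = u \<otimes> (s \<otimes> b)"
    unfolding fraction_eq_iff[OF is_cring submonoid_nonzero assms] by auto
  then show "t \<otimes> a = s \<otimes> b"
    using assms m_lcancel[of u "t \<otimes> a" "s \<otimes> b"] by auto
qed (rule fraction_eqI[OF is_cring submonoid_nonzero assms])

lemma quotient_carrierE:
  assumes "z \<in> carrier (total_quotient_ring R)"
  obtains a s where "a \<in> carrier R" "s \<in> carrier R - {\<zero>}" "z = fraction R (carrier R - {\<zero>}) a s"
  using assms unfolding total_quotient_ring_def non_zero_divisors_eq localization_def by auto

lemma quotient_carrierI:
  "a \<in> carrier R \<Longrightarrow> s \<in> carrier R - {\<zero>} \<Longrightarrow> fraction R (carrier R - {\<zero>}) a s \<in> carrier (total_quotient_ring R)"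
  unfolding total_quotient_ring_def non_zero_divisors_eq localization_def by auto

end

text \<open>
  Clearing denominators in an integral equation for \<open>a / b\<close> and evaluating at the points where \<open>b\<close> does not vanish gives an
  equation between functions, in which no quotient ring appears.
\<close>

lemma integral_equation:
  fixes m :: nat and V :: "'k::field point set" and R defines "R \<equiv> coord_ring m V"
  defines "S \<equiv> carrier R - {\<zero>\<^bsub>R\<^esub>}"
  assumes "domain R" and a: "a \<in> carrier R" and b: "b \<in> S"
    and int: "integral_over (total_quotient_ring R) ((\<lambda>f. fraction R S f \<one>\<^bsub>R\<^esub>) ` carrier R) (fraction R S a b)"
  obtains l f where "\<And>i. f i \<in> regfun m V"
    "\<And>y. y \<in> V \<Longrightarrow> b y \<noteq> 0 \<Longrightarrow> a y ^ l + (\<Sum>i<l. f i y * a y ^ (l - 1 - i) * b y ^ Suc i) = 0"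
proof -
  interpret R: domain R by (rule assms(3))
  let ?Q = "total_quotient_ring R"
  interpret Q: cring ?Q by (rule cring_total_quotient_ring[OF R.is_cring])
  have S: "submonoid S R" unfolding S_def by (rule R.submonoid_nonzero)
  have Q_eq: "?Q = localization R S"
    unfolding total_quotient_ring_def R.non_zero_divisors_eq S_def ..
  note Q_mult = localization_mult[OF R.is_cring S, folded Q_eq]
  note Q_add = localization_add[OF R.is_cring S, folded Q_eq]
  have bR: "b \<in> carrier R" using b unfolding S_def by blast
  have S1: "\<one>\<^bsub>R\<^esub> \<in> S" using S by (rule submonoid.one_closed)
  have Smult: "s \<otimes>\<^bsub>R\<^esub> t \<in> S" if "s \<in> S" "t \<in> S" for s t using S that by (rule submonoid.m_closed)
  have b_pow: "b [^]\<^bsub>R\<^esub> (k::nat) \<in> S" for k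
    using b by (induction k) (auto simp: S1 Smult)
  have S_R: "s \<in> carrier R" if "s \<in> S" for s using that unfolding S_def by blast
  have Q_pow: "fraction R S a b [^]\<^bsub>?Q\<^esub> (k::nat) = fraction R S (a [^]\<^bsub>R\<^esub> k) (b [^]\<^bsub>R\<^esub> k)" for k
  proof (induction k)
    case 0
    show ?case by (simp add: Q_eq localization_def nat_pow_def)
  next
    case (Suc k)
    then show ?case
      using a b b_pow[of k] by (simp add: Q_mult)
  qed
  have coord_R: "(f \<otimes>\<^bsub>R\<^esub> g) y = f y * g y" "(f \<oplus>\<^bsub>R\<^esub> g) y = f y + g y" "\<zero>\<^bsub>R\<^esub> y = 0" "\<one>\<^bsub>R\<^esub> y = 1"
    "(f [^]\<^bsub>R\<^esub> (k::nat)) y = f y ^ k" if "y \<in> V" for f g y k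
    using that unfolding R_def by simp_all
  \<comment> \<open>by induction on its list of coefficients, the value of a polynomial at \<open>a / b\<close> is written with a power of \<open>b\<close> as denominator\<close>
  have eval: "\<exists>fs h. length fs = length p \<and> set fs \<subseteq> carrier R \<and> h \<in> carrier R \<and>
      Q.eval p (fraction R S a b) = fraction R S h (b [^]\<^bsub>R\<^esub> length p) \<and>
      (\<forall>y\<in>V. h y = (\<Sum>i<length p. (fs ! i) y * a y ^ (length p - 1 - i) * b y ^ Suc i))"
    if "set p \<subseteq> (\<lambda>f. fraction R S f \<one>\<^bsub>R\<^esub>) ` carrier R" for p
    using that
  proof (induction p)
    case Nil
    show ?case
      by (intro exI[of _ "[]"] exI[of _ "\<zero>\<^bsub>R\<^esub>"]) (simp add: coord_R, simp add: Q_eq localization_def)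
  next
    case (Cons c p)
    then obtain fs h where IH: "length fs = length p" "set fs \<subseteq> carrier R" "h \<in> carrier R"
      "Q.eval p (fraction R S a b) = fraction R S h (b [^]\<^bsub>R\<^esub> length p)"
      "\<forall>y\<in>V. h y = (\<Sum>i<length p. (fs ! i) y * a y ^ (length p - 1 - i) * b y ^ Suc i)"
      by auto
    obtain f where f: "f \<in> carrier R" "c = fraction R S f \<one>\<^bsub>R\<^esub>"
      using Cons.prems by auto
    let ?l = "length p"
    define h' where "h' = b \<otimes>\<^bsub>R\<^esub> (f \<otimes>\<^bsub>R\<^esub> a [^]\<^bsub>R\<^esub> ?l \<oplus>\<^bsub>R\<^esub> h)"
    have h'R: "h' \<in> carrier R" unfolding h'_def using f(1) a bR IH(3) by simp
    have "Q.eval (c # p) (fraction R S a b) =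
      fraction R S (f \<otimes>\<^bsub>R\<^esub> a [^]\<^bsub>R\<^esub> ?l) (\<one>\<^bsub>R\<^esub> \<otimes>\<^bsub>R\<^esub> b [^]\<^bsub>R\<^esub> ?l) \<oplus>\<^bsub>?Q\<^esub> fraction R S h (b [^]\<^bsub>R\<^esub> ?l)"
      using f(1) a S1 b_pow[of ?l] by (simp add: f(2) Q_pow IH(4) Q_mult)
    also have "\<dots> = fraction R S (b [^]\<^bsub>R\<^esub> ?l \<otimes>\<^bsub>R\<^esub> (f \<otimes>\<^bsub>R\<^esub> a [^]\<^bsub>R\<^esub> ?l) \<oplus>\<^bsub>R\<^esub> (\<one>\<^bsub>R\<^esub> \<otimes>\<^bsub>R\<^esub> b [^]\<^bsub>R\<^esub> ?l) \<otimes>\<^bsub>R\<^esub> h)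
        (\<one>\<^bsub>R\<^esub> \<otimes>\<^bsub>R\<^esub> b [^]\<^bsub>R\<^esub> ?l \<otimes>\<^bsub>R\<^esub> b [^]\<^bsub>R\<^esub> ?l)"
      using f(1) a b_pow[of ?l] S1 IH(3) by (intro Q_add) (auto simp: Smult)
    also have "\<dots> = fraction R S h' (b [^]\<^bsub>R\<^esub> length (c # p))"
    proof (rule fraction_eqI[OF R.is_cring S])
      show "b [^]\<^bsub>R\<^esub> length (c # p) \<otimes>\<^bsub>R\<^esub> (b [^]\<^bsub>R\<^esub> ?l \<otimes>\<^bsub>R\<^esub> (f \<otimes>\<^bsub>R\<^esub> a [^]\<^bsub>R\<^esub> ?l) \<oplus>\<^bsub>R\<^esub> (\<one>\<^bsub>R\<^esub> \<otimes>\<^bsub>R\<^esub> b [^]\<^bsub>R\<^esub> ?l) \<otimes>\<^bsub>R\<^esub> h)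
        = \<one>\<^bsub>R\<^esub> \<otimes>\<^bsub>R\<^esub> b [^]\<^bsub>R\<^esub> ?l \<otimes>\<^bsub>R\<^esub> b [^]\<^bsub>R\<^esub> ?l \<otimes>\<^bsub>R\<^esub> h'"
      proof (rule coord_ring_eqI[of _ m V, folded R_def])
        fix y assume "y \<in> V"
        then show "(b [^]\<^bsub>R\<^esub> length (c # p) \<otimes>\<^bsub>R\<^esub> (b [^]\<^bsub>R\<^esub> ?l \<otimes>\<^bsub>R\<^esub> (f \<otimes>\<^bsub>R\<^esub> a [^]\<^bsub>R\<^esub> ?l) \<oplus>\<^bsub>R\<^esub> (\<one>\<^bsub>R\<^esub> \<otimes>\<^bsub>R\<^esub> b [^]\<^bsub>R\<^esub> ?l) \<otimes>\<^bsub>R\<^esub> h)) y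
          = (\<one>\<^bsub>R\<^esub> \<otimes>\<^bsub>R\<^esub> b [^]\<^bsub>R\<^esub> ?l \<otimes>\<^bsub>R\<^esub> b [^]\<^bsub>R\<^esub> ?l \<otimes>\<^bsub>R\<^esub> h') y"
          unfolding h'_def by (simp only: coord_R) (simp add: algebra_simps)
      qed (use f(1) a bR IH(3) h'R in simp_all)
    qed (use f(1) a bR IH(3) h'R b_pow S1 Smult Smult[OF b_pow b] in auto)
    finally have ev: "Q.eval (c # p) (fraction R S a b) = fraction R S h' (b [^]\<^bsub>R\<^esub> length (c # p))" .
    have "h' y = (\<Sum>i<length (c # p). ((f # fs) ! i) y * a y ^ (length (c # p) - 1 - i) * b y ^ Suc i)"
      if y: "y \<in> V" for y
    proof -
      have "h' y = b y * (f y * a y ^ ?l + (\<Sum>i<?l. (fs ! i) y * a y ^ (?l - 1 - i) * b y ^ Suc i))"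
        unfolding h'_def using y bspec[OF IH(5) y] by (simp only: coord_R)
      also have "\<dots> = f y * a y ^ ?l * b y + (\<Sum>i<?l. (fs ! i) y * a y ^ (?l - 1 - i) * b y ^ Suc (Suc i))"
        by (simp add: algebra_simps sum_distrib_left)
      also have "\<dots> = (\<Sum>i<Suc ?l. ((f # fs) ! i) y * a y ^ (?l - i) * b y ^ Suc i)"
        unfolding sum.lessThan_Suc_shift by simp
      finally show ?thesis by simp
    qed
    then show ?case
      using ev IH(1,2) f(1) h'R by (intro exI[of _ "f # fs"] exI[of _ h']) auto
  qed
  obtain p where p: "p \<in> carrier (((\<lambda>f. fraction R S f \<one>\<^bsub>R\<^esub>) ` carrier R)[X]\<^bsub>?Q\<^esub>)" "p \<noteq> []"
    "hd p = \<one>\<^bsub>?Q\<^esub>" "Q.eval p (fraction R S a b) = \<zero>\<^bsub>?Q\<^esub>"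
    using int unfolding integral_over_def by blast
  then obtain ps where ps: "p = \<one>\<^bsub>?Q\<^esub> # ps" by (cases p) auto
  have "set ps \<subseteq> (\<lambda>f. fraction R S f \<one>\<^bsub>R\<^esub>) ` carrier R"
    using p(1,2) unfolding ps univ_poly_carrier[symmetric] polynomial_def by auto
  from eval[OF this] obtain fs h where fs: "length fs = length ps" "set fs \<subseteq> carrier R" "h \<in> carrier R"
    "Q.eval ps (fraction R S a b) = fraction R S h (b [^]\<^bsub>R\<^esub> length ps)"
    "\<forall>y\<in>V. h y = (\<Sum>i<length ps. (fs ! i) y * a y ^ (length ps - 1 - i) * b y ^ Suc i)"
    by (elim exE conjE) (rule that; assumption)
  let ?l = "length ps"
  have frac_carrier: "fraction R S g s \<in> carrier ?Q" if "g \<in> carrier R" "s \<in> S" for g s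
    unfolding Q_eq localization_def using that by auto
  have "fraction R S (a [^]\<^bsub>R\<^esub> ?l) (b [^]\<^bsub>R\<^esub> ?l) \<oplus>\<^bsub>?Q\<^esub> fraction R S h (b [^]\<^bsub>R\<^esub> ?l) = \<zero>\<^bsub>?Q\<^esub>"
    using p(4) a frac_carrier[OF R.nat_pow_closed[OF a] b_pow, of ?l ?l]
    by (simp add: ps fs(4) Q_pow)
  then have "fraction R S (b [^]\<^bsub>R\<^esub> ?l \<otimes>\<^bsub>R\<^esub> a [^]\<^bsub>R\<^esub> ?l \<oplus>\<^bsub>R\<^esub> b [^]\<^bsub>R\<^esub> ?l \<otimes>\<^bsub>R\<^esub> h) (b [^]\<^bsub>R\<^esub> ?l \<otimes>\<^bsub>R\<^esub> b [^]\<^bsub>R\<^esub> ?l) =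
      fraction R S \<zero>\<^bsub>R\<^esub> \<one>\<^bsub>R\<^esub>"
    using a fs(3) b_pow[of ?l] by (simp add: Q_add) (simp add: Q_eq localization_def)
  then have "\<one>\<^bsub>R\<^esub> \<otimes>\<^bsub>R\<^esub> (b [^]\<^bsub>R\<^esub> ?l \<otimes>\<^bsub>R\<^esub> a [^]\<^bsub>R\<^esub> ?l \<oplus>\<^bsub>R\<^esub> b [^]\<^bsub>R\<^esub> ?l \<otimes>\<^bsub>R\<^esub> h) =
      (b [^]\<^bsub>R\<^esub> ?l \<otimes>\<^bsub>R\<^esub> b [^]\<^bsub>R\<^esub> ?l) \<otimes>\<^bsub>R\<^esub> \<zero>\<^bsub>R\<^esub>"
    by (subst (asm) R.quotient_eq_iff[folded S_def])
       (use a fs(3) b_pow[of ?l] S_R[OF b_pow[of ?l]] S1 Smult in auto)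
  then have zero: "b y ^ ?l * a y ^ ?l + b y ^ ?l * h y = 0" if "y \<in> V" for y
    using fun_cong[of _ _ y] coord_R[OF that] by (metis mult_1 mult_zero_right)
  show ?thesis
  proof (rule that[of "\<lambda>i. if i < ?l then fs ! i else (\<lambda>_. 0)" ?l])
    show "(if i < ?l then fs ! i else (\<lambda>_. 0)) \<in> regfun m V" for i
    proof (cases "i < ?l")
      case True
      then have "fs ! i \<in> carrier R" using fs(1,2) by (metis nth_mem subsetD)
      then show ?thesis using True unfolding R_def carrier_coord_ring_iff by simp
    qed (simp add: regfun.const)
    fix y assume y: "y \<in> V" "b y \<noteq> 0"
    have "b y ^ ?l * (a y ^ ?l + h y) = 0"
      using zero[OF y(1)] by (simp add: distrib_left)
    then have "a y ^ ?l + h y = 0" using y(2) by simp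
    then show "a y ^ ?l + (\<Sum>i<?l. (if i < ?l then fs ! i else (\<lambda>_. 0)) y * a y ^ (?l - 1 - i) * b y ^ Suc i) = 0"
      unfolding bspec[OF fs(5) y(1)] by simp
  qed
qed

text \<open>
  The open set \<open>G \<noteq> 0\<close> of affine \<open>N\<close>-space as a closed subset of \<open>N + 1\<close>-space, the last coordinate being \<open>1 / G\<close>.
\<close>

definition principal_open :: "nat \<Rightarrow> ('k::field point \<Rightarrow> 'k) \<Rightarrow> 'k point set" where
  "principal_open N G = {y \<in> affine_space (Suc N). y N * G y = 1}"

lemma closedin_principal_open:
  assumes "G \<in> polyfun N"
  shows "closedin (zariski (Suc N)) (principal_open N G)"
proof -
  have "(\<lambda>y. y N * G y - 1) \<in> polyfun (Suc N)"
    using assms by (intro polyfun.diff polyfun.mult polyfun.const polyfun.coord polyfun_mono[OF assms]) auto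
  moreover have "principal_open N G = zero_locus (Suc N) {\<lambda>y. y N * G y - 1}"
    by (auto simp: principal_open_def zero_locus_def)
  ultimately show ?thesis
    unfolding closedin_zariski by (intro exI[of _ "{\<lambda>y. y N * G y - 1}"]) simp
qed

lemma principal_open_numerator:
  assumes "p \<in> polyfun (Suc N)" "G \<in> polyfun N"
  shows "\<exists>P\<in>polyfun N. \<exists>k. \<forall>y\<in>principal_open N G. p y * G y ^ k = P y"
  using assms(1)
proof induction
  case (const c)
  show ?case by (intro bexI[of _ "\<lambda>_. c"] exI[of _ 0]) (auto intro: polyfun.const)
next
  case (coord i)
  show ?case
  proof (cases "i = N")
    case True
    then show ?thesis
      by (intro bexI[of _ "\<lambda>_. 1"] exI[of _ 1]) (auto intro: polyfun.const simp: principal_open_def)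
  next
    case False
    then show ?thesis
      using coord by (intro bexI[of _ "\<lambda>x. x i"] exI[of _ 0]) (auto intro: polyfun.coord)
  qed
next
  case (add f g)
  then obtain P k Q l where *: "P \<in> polyfun N" "\<forall>y\<in>principal_open N G. f y * G y ^ k = P y"
    "Q \<in> polyfun N" "\<forall>y\<in>principal_open N G. g y * G y ^ l = Q y"
    by (elim bexE exE) (rule that; assumption)
  show ?case
  proof (intro bexI[of _ "\<lambda>y. P y * G y ^ l + Q y * G y ^ k"] exI[of _ "k + l"] ballI)
    fix y assume y: "y \<in> principal_open N G"
    show "(f y + g y) * G y ^ (k + l) = P y * G y ^ l + Q y * G y ^ k"
      unfolding bspec[OF *(2) y, symmetric] bspec[OF *(4) y, symmetric] by (simp add: algebra_simps power_add)
  qed (intro polyfun.add polyfun.mult polyfun.power * assms(2))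
next
  case (mult f g)
  then obtain P k Q l where *: "P \<in> polyfun N" "\<forall>y\<in>principal_open N G. f y * G y ^ k = P y"
    "Q \<in> polyfun N" "\<forall>y\<in>principal_open N G. g y * G y ^ l = Q y"
    by (elim bexE exE) (rule that; assumption)
  show ?case
  proof (intro bexI[of _ "\<lambda>y. P y * Q y"] exI[of _ "k + l"] ballI)
    fix y assume y: "y \<in> principal_open N G"
    show "f y * g y * G y ^ (k + l) = P y * Q y"
      unfolding bspec[OF *(2) y, symmetric] bspec[OF *(4) y, symmetric] by (simp add: algebra_simps power_add)
  qed (intro polyfun.mult * )
qed

locale principal_open_set =
  fixes N :: nat and G :: "'k::alg_closed_field point \<Rightarrow> 'k"
  assumes G: "G \<in> polyfun N" and nonempty: "\<exists>z\<in>affine_space N. G z \<noteq> 0"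
begin

abbreviation "V \<equiv> principal_open N G"

lemma G_nonzero: "y \<in> V \<Longrightarrow> G y \<noteq> 0"
  by (auto simp: principal_open_def)

lemma base_point:
  assumes "y \<in> V"
  shows "y(N := 0) \<in> affine_space N" "p \<in> polyfun N \<Longrightarrow> p (y(N := 0)) = p y"
  using assms by (auto simp: principal_open_def affine_space_def intro: polyfun_cong)

lemma lift_point:
  assumes "z \<in> affine_space N" "G z \<noteq> 0"
  shows "z(N := inverse (G z)) \<in> V" "p \<in> polyfun N \<Longrightarrow> p (z(N := inverse (G z))) = p z"
proof -
  have *: "p (z(N := inverse (G z))) = p z" if "p \<in> polyfun N" for p
    using that by (rule polyfun_cong) simp
  then show "p \<in> polyfun N \<Longrightarrow> p (z(N := inverse (G z))) = p z" .
  show "z(N := inverse (G z)) \<in> V"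
    using assms *[OF G] by (simp add: principal_open_def affine_space_def)
qed

lemma V_nonempty: "V \<noteq> {}"
proof -
  obtain z where z: "z \<in> affine_space N" "G z \<noteq> 0" using nonempty by auto
  then show ?thesis using lift_point(1) by auto
qed

text \<open>
  The exponent \<open>l\<close> is a convenience: two functions can be brought to the same power of \<open>G\<close>.
\<close>

lemma numerator:
  assumes "f \<in> regfun (Suc N) V"
  obtains P k where "P \<in> polyfun N" "\<And>y l. y \<in> V \<Longrightarrow> f y * G y ^ (k + l) = P y * G y ^ l"
proof -
  obtain p where p: "p \<in> polyfun (Suc N)" "\<And>y. y \<in> V \<Longrightarrow> f y = p y"
    using assms by (rule agree_onE) (rule that)
  obtain P k where P: "P \<in> polyfun N" "\<forall>y\<in>V. p y * G y ^ k = P y"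
    using principal_open_numerator[OF p(1) G] by (elim bexE exE) (rule that; assumption)
  show ?thesis
  proof (rule that[OF P(1)])
    fix y l assume y: "y \<in> V"
    show "f y * G y ^ (k + l) = P y * G y ^ l"
      using bspec[OF P(2) y] p(2)[OF y] by (simp add: power_add)
  qed
qed

text \<open>
  Two nonzero functions do not vanish at points \<open>x\<close> and \<open>y\<close> respectively. On the line through \<open>x\<close> and \<open>y\<close> their numerators
  and \<open>G\<close> are nonzero polynomials in one variable.
\<close>

lemma domain_coord_ring: "domain (coord_ring (Suc N) V)"
proof -
  let ?R = "coord_ring (Suc N) V"
  interpret R: cring ?R by (rule cring_coord_ring)
  show ?thesis
  proof
    obtain y where "y \<in> V" using V_nonempty by auto
    then show "\<one>\<^bsub>?R\<^esub> \<noteq> \<zero>\<^bsub>?R\<^esub>" using coord_ring_apply(3,4) by (metis zero_neq_one)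
  next
    fix f g assume f: "f \<in> carrier ?R" and g: "g \<in> carrier ?R" and fg: "f \<otimes>\<^bsub>?R\<^esub> g = \<zero>\<^bsub>?R\<^esub>"
    show "f = \<zero>\<^bsub>?R\<^esub> \<or> g = \<zero>\<^bsub>?R\<^esub>"
    proof (rule ccontr)
      assume "\<not> ?thesis"
      then obtain x y where x: "x \<in> V" "f x \<noteq> 0" and y: "y \<in> V" "g y \<noteq> 0"
        using coord_ring_eqI[OF f R.zero_closed] coord_ring_eqI[OF g R.zero_closed] by auto
      obtain P k where P: "P \<in> polyfun N" "\<And>y l. y \<in> V \<Longrightarrow> f y * G y ^ (k + l) = P y * G y ^ l"
        by (rule numerator[of f]) (use f carrier_coord_ring_iff in blast)+
      obtain Q l where Q: "Q \<in> polyfun N" "\<And>y k. y \<in> V \<Longrightarrow> g y * G y ^ (l + k) = Q y * G y ^ k"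
        by (rule numerator[of g]) (use g carrier_coord_ring_iff in blast)+
      define x0 where "x0 = x(N := 0)"
      define y0 where "y0 = y(N := 0)"
      define u where "u = (\<lambda>i. y0 i - x0 i)"
      have x0: "x0 \<in> affine_space N" and y0: "y0 \<in> affine_space N"
        unfolding x0_def y0_def using x(1) y(1) by (simp_all add: base_point)
      have u: "u \<in> affine_space N" using x0 y0 by (simp add: u_def affine_space_def)
      obtain a D where a: "\<And>t. P (\<lambda>i. x0 i + t * u i) = poly a t"
        by (rule line_expansion[OF P(1), of x0]) (rule that)
      obtain b where b: "\<And>t. Q (\<lambda>i. x0 i + t * u i) = poly b t"
        by (rule line_expansion[OF Q(1), of x0]) (rule that)
      obtain c where c: "\<And>t. G (\<lambda>i. x0 i + t * u i) = poly c t"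
        by (rule line_expansion[OF G, of x0]) (rule that)
      have "P x0 = P x" "G x0 = G x"
        unfolding x0_def using base_point(2)[OF x(1)] P(1) G by blast+
      then have "poly a 0 = P x" "poly c 0 = G x"
        using a[of 0] c[of 0] by simp_all
      moreover have "P x \<noteq> 0" using P(2)[OF x(1), of 0] x(2) G_nonzero[OF x(1)] by auto
      ultimately have ac: "a \<noteq> 0" "c \<noteq> 0" using G_nonzero[OF x(1)] by auto
      have "(\<lambda>i. x0 i + 1 * u i) = y0" by (simp add: u_def)
      then have "poly b 1 = Q y"
        using b[of 1] base_point(2)[OF y(1) Q(1), folded y0_def] by simp
      moreover have "Q y \<noteq> 0" using Q(2)[OF y(1), of 0] y(2) G_nonzero[OF y(1)] by auto
      ultimately have b0: "b \<noteq> 0" by auto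
      have "a * b = 0"
      proof (rule poly_eq_off_zeros[OF ac(2)])
        fix t assume t: "poly c t \<noteq> 0"
        define z where "z = (\<lambda>i. x0 i + t * u i)"
        have z: "z \<in> affine_space N" "G z \<noteq> 0"
          using affine_space_line[OF x0 u] t c[of t] by (simp_all add: z_def)
        define w where "w = z(N := inverse (G z))"
        have w: "w \<in> V" "p w = p z" if "p \<in> polyfun N" for p
          unfolding w_def using lift_point[OF z] that by auto
        have wV: "w \<in> V" using w(1) G by blast
        have "f w * g w = 0"
          using fun_cong[OF fg, of w] wV by simp
        then have "P w * Q w = 0"
          using P(2)[OF wV, of 0] Q(2)[OF wV, of 0] by auto
        then show "poly (a * b) t = poly 0 t"
          using a[of t] b[of t] w(2)[OF P(1)] w(2)[OF Q(1)] by (simp add: z_def)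
      qed
      then show False using ac(1) b0 by simp
    qed
  qed
qed

text \<open>
  The fraction \<open>a / b\<close> and the coefficients of its integral equation are written as polynomials over a common power of \<open>G\<close>.
  Then \<open>principal_open_integral_dvd\<close> yields a polynomial \<open>C\<close>, and \<open>C\<close> divided by a power of \<open>G\<close> is the quotient.
\<close>

theorem normal_domain_coord_ring: "normal_domain (coord_ring (Suc N) V)"
proof -
  let ?R = "coord_ring (Suc N) V"
  interpret R: domain ?R by (rule domain_coord_ring)
  let ?S = "carrier ?R - {\<zero>\<^bsub>?R\<^esub>}"
  have "z \<in> (\<lambda>a. fraction ?R ?S a \<one>\<^bsub>?R\<^esub>) ` carrier ?R"
    if z: "z \<in> carrier (total_quotient_ring ?R)"
      and int: "integral_over (total_quotient_ring ?R) ((\<lambda>a. fraction ?R ?S a \<one>\<^bsub>?R\<^esub>) ` carrier ?R) z" for z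
  proof -
    obtain a b where a: "a \<in> carrier ?R" and b: "b \<in> ?S" and z_eq: "z = fraction ?R ?S a b"
      using z by (rule R.quotient_carrierE)
    obtain l f where f: "\<And>i. f i \<in> regfun (Suc N) V"
      "\<And>y. y \<in> V \<Longrightarrow> b y \<noteq> 0 \<Longrightarrow> a y ^ l + (\<Sum>i<l. f i y * a y ^ (l - 1 - i) * b y ^ Suc i) = 0"
      by (rule integral_equation[OF domain_coord_ring a b int[unfolded z_eq]]) (rule that)
    have bR: "b \<in> carrier ?R" using b by blast
    obtain A k where A: "A \<in> polyfun N" "\<And>y l. y \<in> V \<Longrightarrow> a y * G y ^ (k + l) = A y * G y ^ l"
      by (rule numerator[of a]) (use a carrier_coord_ring_iff in blast)+
    obtain B k' where B: "B \<in> polyfun N" "\<And>y l. y \<in> V \<Longrightarrow> b y * G y ^ (k' + l) = B y * G y ^ l"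
      by (rule numerator[of b]) (use bR carrier_coord_ring_iff in blast)+
    have "\<exists>F k. F \<in> polyfun N \<and> (\<forall>y\<in>V. \<forall>j. f i y * G y ^ (k + j) = F y * G y ^ j)" for i
      by (rule numerator[OF f(1)[of i]]) blast
    then obtain F e where F: "\<And>i. F i \<in> polyfun N"
      "\<And>i y j. y \<in> V \<Longrightarrow> f i y * G y ^ (e i + j) = F i y * G y ^ j"
      by metis
    (* common exponents for the denominators *)
    define M where "M = (\<Sum>i<l. e i)"
    define F' where "F' i = (if i < l then (\<lambda>y. F i y * G y ^ (M - e i)) else (\<lambda>_. 0))" for i
    have F'_poly: "F' i \<in> polyfun N" for i
      unfolding F'_def using F(1) G by (auto intro!: polyfun.mult polyfun.power polyfun.const)
    have F': "f i y = F' i y / G y ^ M" if "i < l" "y \<in> V" for i y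
    proof -
      have "e i \<le> M" unfolding M_def using that(1) by (intro member_le_sum) auto
      then show ?thesis
        using F(2)[OF that(2), of i "M - e i"] that G_nonzero[OF that(2)] by (simp add: F'_def field_simps)
    qed
    define A' where "A' y = A y * G y ^ k'" for y
    define B' where "B' y = B y * G y ^ k" for y
    have A': "A' \<in> polyfun N" and B': "B' \<in> polyfun N"
      unfolding A'_def B'_def using A(1) B(1) G by (auto intro!: polyfun.mult polyfun.power)
    have aA: "A' y = a y * G y ^ (k + k')" and bB: "B' y = b y * G y ^ (k + k')" if "y \<in> V" for y
      using A(2)[OF that, of k'] B(2)[OF that, of k] by (simp_all add: A'_def B'_def add.commute)
    obtain y0 where y0: "y0 \<in> V" "b y0 \<noteq> 0"
      using b coord_ring_eqI[OF bR R.zero_closed] by auto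
    define o' where "o' = y0(N := 0)"
    have "B' o' = B' y0" "G o' = G y0"
      unfolding o'_def using base_point(2)[OF y0(1)] B' G by blast+
    then have o': "o' \<in> affine_space N" "B' o' \<noteq> 0" "G o' \<noteq> 0"
      using base_point(1)[OF y0(1), folded o'_def] y0(2) G_nonzero[OF y0(1)] bB[OF y0(1)] by simp_all
    have "\<exists>C\<in>polyfun N. \<forall>z\<in>affine_space N. A' z * G z ^ M = B' z * C z"
    proof (rule principal_open_integral_dvd[where A = A' and B = B' and G = G and N = N and o' = o' and F = F' and M = M and l = l,
          OF A' B' G F'_poly o'])
      fix z assume z: "z \<in> affine_space N" "B' z \<noteq> 0" "G z \<noteq> 0"
      define w where "w = z(N := inverse (G z))"
      have w: "w \<in> V"
        unfolding w_def by (rule lift_point(1)[OF z(1,3)])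
      have p_w: "p z = p w" if "p \<in> polyfun N" for p
        unfolding w_def by (rule lift_point(2)[OF z(1,3) that, symmetric])
      have "b w \<noteq> 0" using bB[OF w] p_w[OF B'] z(2) by auto
      from f(2)[OF w this]
      have "(G w ^ (k + k')) ^ l * (a w ^ l + (\<Sum>i<l. f i w * a w ^ (l - 1 - i) * b w ^ Suc i)) = 0"
        by simp
      moreover have "(G w ^ (k + k')) ^ l * (f i w * a w ^ (l - 1 - i) * b w ^ Suc i) =
          F' i w / G w ^ M * A' w ^ (l - 1 - i) * B' w ^ Suc i" if "i < l" for i
      proof -
        have "l = (l - 1 - i) + Suc i" using that by simp
        then have "(G w ^ (k + k')) ^ l = (G w ^ (k + k')) ^ (l - 1 - i) * (G w ^ (k + k')) ^ Suc i"
          by (metis power_add)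
        then show ?thesis
          unfolding F'[OF that w] aA[OF w] bB[OF w] power_mult_distrib by (simp only: mult_ac times_divide_eq_left times_divide_eq_right)
      qed
      ultimately have "A' w ^ l + (\<Sum>i<l. F' i w / G w ^ M * A' w ^ (l - 1 - i) * B' w ^ Suc i) = 0"
        unfolding distrib_left sum_distrib_left by (simp add: aA[OF w] power_mult_distrib mult.commute)
      then show "A' z ^ l + (\<Sum>i<l. F' i z / G z ^ M * A' z ^ (l - 1 - i) * B' z ^ Suc i) = 0"
        using p_w[OF A'] p_w[OF B'] p_w[OF G] p_w[OF F'_poly] by simp
    qed
    then obtain C where C: "C \<in> polyfun N" "\<forall>z\<in>affine_space N. A' z * G z ^ M = B' z * C z" ..
    define c where "c = restrict (\<lambda>y. C y * y N ^ M) V"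
    have c: "c \<in> carrier ?R"
      unfolding c_def
      by (intro coord_ring_memI regfun.mult regfun.power regfun_coord agree_on_incl polyfun_mono[OF C(1)]) auto
    have "\<one>\<^bsub>?R\<^esub> \<otimes>\<^bsub>?R\<^esub> a = b \<otimes>\<^bsub>?R\<^esub> c"
    proof (rule coord_ring_eqI)
      fix y assume y: "y \<in> V"
      have "A' y * G y ^ M = B' y * C y"
        using bspec[OF C(2) base_point(1)[OF y]]
        unfolding base_point(2)[OF y A'] base_point(2)[OF y B'] base_point(2)[OF y G] base_point(2)[OF y C(1)] .
      then have "a y * G y ^ M * G y ^ (k + k') = b y * C y * G y ^ (k + k')"
        unfolding aA[OF y] bB[OF y] by (simp only: mult_ac)
      then have *: "a y * G y ^ M = b y * C y"
        using G_nonzero[OF y] by simp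
      have "y N * G y = 1" using y by (simp add: principal_open_def)
      then have "a y = a y * G y ^ M * y N ^ M"
        by (metis mult.assoc mult.commute mult.right_neutral power_mult_distrib power_one)
      then show "(\<one>\<^bsub>?R\<^esub> \<otimes>\<^bsub>?R\<^esub> a) y = (b \<otimes>\<^bsub>?R\<^esub> c) y"
        using y * by (simp add: c_def)
    qed (use a bR c in auto)
    then have "z = fraction ?R ?S c \<one>\<^bsub>?R\<^esub>"
      unfolding z_eq using a b c by (subst R.quotient_eq_iff) auto
    then show ?thesis using c by blast
  qed
  then show ?thesis
    unfolding normal_domain_def Let_def R.non_zero_divisors_eq using domain_coord_ring by blast
qed

end

section \<open>The transfer cocycle\<close>

lemma (in group) inv_mult_cancel:
  assumes "g \<in> carrier G" "b \<in> carrier G"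
  shows "inv g \<otimes> (g \<otimes> b) = b" "g \<otimes> (inv g \<otimes> b) = b"
  using assms by (simp_all flip: m_assoc)

locale abelian_normal_subgroup = group G for G (structure) +
  fixes T
  assumes T_normal: "T \<lhd> G"
    and T_comm: "s \<in> T \<Longrightarrow> t \<in> T \<Longrightarrow> s \<otimes> t = t \<otimes> s"
    and T_finite_index: "finite (rcosets T)"
begin

lemma T_sub: "subgroup T G"
  using T_normal by (rule normal_imp_subgroup)

lemma T_carrier: "t \<in> T \<Longrightarrow> t \<in> carrier G"
  using subgroup.mem_carrier[OF T_sub] .

lemma T_conj: "g \<in> carrier G \<Longrightarrow> t \<in> T \<Longrightarrow> g \<otimes> t \<otimes> inv g \<in> T"
  using normal.inv_op_closed2[OF T_normal] .

abbreviation A where "A \<equiv> G\<lparr>carrier := T\<rparr>"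

lemma comm_group_A: "comm_group A"
  by (rule group.group_comm_groupI[OF subgroup.subgroup_is_group[OF T_sub is_group]]) (simp add: T_comm)

definition rep where "rep C = (SOME c. c \<in> C)"

lemma rep_in: "a \<in> carrier G \<Longrightarrow> rep (T #> a) \<in> T #> a"
  unfolding rep_def using rcos_self[OF _ T_sub] by (metis someI_ex)

lemma rep_carrier: "a \<in> carrier G \<Longrightarrow> rep (T #> a) \<in> carrier G"
  using rep_in r_coset_subset_G[OF subgroup.subset[OF T_sub]] by blast

lemma coset_rep: "a \<in> carrier G \<Longrightarrow> T #> rep (T #> a) = T #> a"
  using repr_independence[OF rep_in _ T_sub] by metis

lemma coset_mult_left:
  assumes "g \<in> carrier G" "a \<in> carrier G" "b \<in> carrier G" "T #> a = T #> b"
  shows "T #> (g \<otimes> a) = T #> (g \<otimes> b)"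
proof -
  have "a \<in> T #> b" using assms(2,4) rcos_self[OF _ T_sub] by metis
  then obtain t where t: "t \<in> T" "a = t \<otimes> b" unfolding r_coset_def by auto
  then have "g \<otimes> a = (g \<otimes> t \<otimes> inv g) \<otimes> (g \<otimes> b)"
    using assms(1,3) by (simp add: T_carrier m_assoc inv_mult_cancel)
  then have "g \<otimes> a \<in> T #> (g \<otimes> b)"
    using T_conj[OF assms(1) t(1)] assms(1,3) rcosI[OF _ subgroup.subset[OF T_sub]] by simp
  then show ?thesis
    using repr_independence[OF _ _ T_sub] assms(1,3) by (metis m_closed)
qed

text \<open>
  The permutation of the cosets of \<open>T\<close> induced by left multiplication; \<open>T\<close> is normal, so that it is well defined on right
  cosets.
\<close>

definition shift where "shift g C = T #> (g \<otimes> rep C)"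

lemma shift_coset: "g \<in> carrier G \<Longrightarrow> a \<in> carrier G \<Longrightarrow> shift g (T #> a) = T #> (g \<otimes> a)"
  unfolding shift_def by (intro coset_mult_left rep_carrier coset_rep)

lemma rcosetsE: "C \<in> rcosets T \<Longrightarrow> (\<And>a. a \<in> carrier G \<Longrightarrow> C = T #> a \<Longrightarrow> thesis) \<Longrightarrow> thesis"
  unfolding RCOSETS_def by blast

lemma rcosetsI: "a \<in> carrier G \<Longrightarrow> T #> a \<in> rcosets T"
  unfolding RCOSETS_def by blast

lemma shift_closed: "g \<in> carrier G \<Longrightarrow> C \<in> rcosets T \<Longrightarrow> shift g C \<in> rcosets T"
  by (elim rcosetsE) (simp add: shift_coset rcosetsI)

lemma shift_mult:
  "g \<in> carrier G \<Longrightarrow> h \<in> carrier G \<Longrightarrow> C \<in> rcosets T \<Longrightarrow> shift (g \<otimes> h) C = shift g (shift h C)"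
  by (elim rcosetsE) (simp add: shift_coset m_assoc)

lemma shift_one: "C \<in> rcosets T \<Longrightarrow> shift \<one> C = C"
  by (elim rcosetsE) (simp add: shift_coset)

lemma shift_inj: "g \<in> carrier G \<Longrightarrow> inj_on (shift g) (rcosets T)"
  by (rule inj_on_inverseI[of _ "shift (inv g)"]) (simp add: shift_one flip: shift_mult)

lemma shift_surj: "g \<in> carrier G \<Longrightarrow> shift g ` (rcosets T) = rcosets T"
  by (intro endo_inj_surj T_finite_index shift_inj) (auto simp: shift_closed)

text \<open>
  The deviation from equivariance of the choice of representatives. It is a cocycle up to the permutation of the cosets, and
  multiplying over all cosets removes this dependence.
\<close>

definition cocycle_term where "cocycle_term g C = g \<otimes> rep C \<otimes> inv (rep (shift g C))"

lemma rep_rcosets: "C \<in> rcosets T \<Longrightarrow> rep C \<in> carrier G"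
  by (elim rcosetsE) (simp add: rep_carrier)

lemma cocycle_term_closed:
  assumes "g \<in> carrier G" "C \<in> rcosets T"
  shows "cocycle_term g C \<in> T"
proof -
  have c: "g \<otimes> rep C \<in> carrier G" using assms rep_rcosets by simp
  have "rep (shift g C) \<in> T #> (g \<otimes> rep C)"
    unfolding shift_def by (rule rep_in[OF c])
  moreover have r: "rep (shift g C) \<in> carrier G"
    unfolding shift_def by (rule rep_carrier[OF c])
  ultimately have "g \<otimes> rep C \<in> T #> rep (shift g C)"
    using repr_independence[OF _ c T_sub] rcos_self[OF c T_sub] by metis
  then show ?thesis
    unfolding cocycle_term_def using subgroup.rcos_module_imp[OF T_sub is_group r] by simp
qed

lemma cocycle_term_mult:
  assumes "g \<in> carrier G" "h \<in> carrier G" "C \<in> rcosets T"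
  shows "cocycle_term (g \<otimes> h) C = (g \<otimes> cocycle_term h C \<otimes> inv g) \<otimes> cocycle_term g (shift h C)"
proof -
  have *: "rep C \<in> carrier G" "rep (shift h C) \<in> carrier G" "rep (shift g (shift h C)) \<in> carrier G"
    using assms by (auto intro: rep_rcosets shift_closed)
  have "(g \<otimes> (h \<otimes> rep C \<otimes> inv (rep (shift h C))) \<otimes> inv g) \<otimes> (g \<otimes> rep (shift h C) \<otimes> inv (rep (shift g (shift h C))))
    = g \<otimes> h \<otimes> rep C \<otimes> (inv (rep (shift h C)) \<otimes> (inv g \<otimes> g) \<otimes> rep (shift h C)) \<otimes> inv (rep (shift g (shift h C)))"
    using assms(1,2) * by (simp add: m_assoc inv_mult_cancel)
  also have "\<dots> = g \<otimes> h \<otimes> rep C \<otimes> inv (rep (shift g (shift h C)))"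
    using assms(1,2) * by simp
  finally show ?thesis
    unfolding cocycle_term_def shift_mult[OF assms] by simp
qed

definition transfer_cocycle where
  "transfer_cocycle g = finprod A (cocycle_term g) (rcosets T)"

lemma cocycle_closed:
  assumes "g \<in> carrier G"
  shows "transfer_cocycle g \<in> T"
proof -
  interpret A: comm_group A by (rule comm_group_A)
  have "cocycle_term g \<in> rcosets T \<rightarrow> carrier A" using cocycle_term_closed[OF assms] by auto
  from A.finprod_closed[OF this] show ?thesis unfolding transfer_cocycle_def by simp
qed

lemma finprod_conj:
  assumes g: "g \<in> carrier G" and "finite S" "f \<in> S \<rightarrow> T"
  shows "g \<otimes> finprod A f S \<otimes> inv g = finprod A (\<lambda>C. g \<otimes> f C \<otimes> inv g) S"
  using assms(2,3)
proof (induction S)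
  interpret A: comm_group A by (rule comm_group_A)
  case empty
  then show ?case using g by (simp add: A.finprod_empty)
next
  interpret A: comm_group A by (rule comm_group_A)
  case (insert C S)
  have f: "f \<in> S \<rightarrow> carrier A" "f C \<in> carrier A" using insert.prems by auto
  have P: "finprod A f S \<in> T" using A.finprod_closed[OF f(1)] by simp
  have conj: "(\<lambda>C. g \<otimes> f C \<otimes> inv g) \<in> S \<rightarrow> carrier A" "g \<otimes> f C \<otimes> inv g \<in> carrier A"
    using f T_conj[OF g] by auto
  have "finprod A f (insert C S) = f C \<otimes> finprod A f S"
    using A.finprod_insert[OF insert.hyps f] by simp
  then have "g \<otimes> finprod A f (insert C S) \<otimes> inv g = (g \<otimes> f C \<otimes> inv g) \<otimes> (g \<otimes> finprod A f S \<otimes> inv g)"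
    using g f(2) P by (simp add: T_carrier m_assoc inv_mult_cancel)
  also have "\<dots> = finprod A (\<lambda>C. g \<otimes> f C \<otimes> inv g) (insert C S)"
    using A.finprod_insert[OF insert.hyps conj] insert.IH insert.prems by simp
  finally show ?case .
qed

text \<open>
  The product over all cosets \<open>C\<close> of \<open>cocycle_term_mult\<close>, where the second factor is reindexed by \<open>shift h\<close>.
\<close>

lemma cocycle_mult:
  assumes g: "g \<in> carrier G" and h: "h \<in> carrier G"
  shows "transfer_cocycle (g \<otimes> h) = (g \<otimes> transfer_cocycle h \<otimes> inv g) \<otimes> transfer_cocycle g"
proof -
  interpret A: comm_group A by (rule comm_group_A)
  have tg: "cocycle_term g \<in> rcosets T \<rightarrow> carrier A" and th: "cocycle_term h \<in> rcosets T \<rightarrow> T"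
    using cocycle_term_closed g h by auto
  have tc: "(\<lambda>C. g \<otimes> cocycle_term h C \<otimes> inv g) \<in> rcosets T \<rightarrow> carrier A"
    using cocycle_term_closed[OF h] T_conj[OF g] by auto
  have ts: "(\<lambda>C. cocycle_term g (shift h C)) \<in> rcosets T \<rightarrow> carrier A"
    using tg shift_closed[OF h] by auto
  have "transfer_cocycle (g \<otimes> h) = finprod A (\<lambda>C. (g \<otimes> cocycle_term h C \<otimes> inv g) \<otimes>\<^bsub>A\<^esub> cocycle_term g (shift h C)) (rcosets T)"
    unfolding transfer_cocycle_def
    by (rule A.finprod_cong') (use tc ts cocycle_term_mult[OF g h] subgroup.m_closed[OF T_sub] in \<open>auto simp: Pi_iff\<close>)
  also have "\<dots> = finprod A (\<lambda>C. g \<otimes> cocycle_term h C \<otimes> inv g) (rcosets T) \<otimes>\<^bsub>A\<^esub>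
      finprod A (\<lambda>C. cocycle_term g (shift h C)) (rcosets T)"
    using tc ts by (rule A.finprod_multf)
  also have "finprod A (\<lambda>C. cocycle_term g (shift h C)) (rcosets T) = finprod A (cocycle_term g) (shift h ` (rcosets T))"
    by (rule A.finprod_reindex[symmetric]) (use tg shift_surj[OF h] shift_inj[OF h] in auto)
  also have "finprod A (\<lambda>C. g \<otimes> cocycle_term h C \<otimes> inv g) (rcosets T) = g \<otimes> transfer_cocycle h \<otimes> inv g"
    unfolding transfer_cocycle_def by (rule finprod_conj[OF g T_finite_index th, symmetric])
  finally show ?thesis unfolding shift_surj[OF h] transfer_cocycle_def by simp
qed

text \<open>
  An element of \<open>T\<close> fixes every coset, so that each of the cocycle terms equals this element.
\<close>

lemma cocycle_T:
  assumes t: "t \<in> T"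
  shows "transfer_cocycle t = t [^] card (rcosets T)"
proof -
  interpret A: comm_group A by (rule comm_group_A)
  have "cocycle_term t C = t" if C: "C \<in> rcosets T" for C
  proof -
    obtain a where a: "a \<in> carrier G" "C = T #> a" using C by (rule rcosetsE)
    have "T #> (t \<otimes> a) = T #> a"
      using repr_independence[OF rcosI[OF t subgroup.subset[OF T_sub] a(1)] a(1) T_sub] by simp
    then have "shift t C = C" using a t by (simp add: shift_coset T_carrier)
    then show ?thesis
      unfolding cocycle_term_def using t rep_rcosets[OF C] by (simp add: T_carrier m_assoc)
  qed
  then have "transfer_cocycle t = finprod A (\<lambda>C. t) (rcosets T)"
    unfolding transfer_cocycle_def by (intro A.finprod_cong') (use t in auto)
  also have "\<dots> = t [^]\<^bsub>A\<^esub> card (rcosets T)"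
    using t by (intro A.finprod_const) simp
  finally show ?thesis by (simp add: nat_pow_consistent[symmetric])
qed

lemma card_rcosets_pos: "card (rcosets T) > 0"
  using T_finite_index rcosetsI[OF one_closed] by (auto simp: card_gt_0_iff)

end

section \<open>Elements of prime order in a quotient group\<close>

text \<open>
  The class in \<open>G / Z\<close> of an element \<open>\<sigma>\<close> outside \<open>Z\<close> has a finite order \<open>N > 1\<close>, as its powers meet the finitely many
  cosets of \<open>T\<close> repeatedly. For a prime divisor \<open>q\<close> of \<open>N\<close> the class of \<open>\<tau> = \<sigma> [^] (N / q)\<close> has order \<open>q\<close>.
\<close>

lemma (in group) prime_power_in_normal:
  assumes Z: "Z \<lhd> G" and T: "subgroup T G" "T \<subseteq> Z" "finite (rcosets T)" and ne: "carrier G \<noteq> Z"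
  obtains \<tau> q where "\<tau> \<in> carrier G" "Factorial_Ring.prime q" "\<And>k :: nat. \<tau> [^] k \<in> Z \<longleftrightarrow> q dvd k"
proof -
  have Zs: "subgroup Z G" using Z by (rule normal_imp_subgroup)
  obtain \<sigma> where \<sigma>: "\<sigma> \<in> carrier G" "\<sigma> \<notin> Z" using ne subgroup.subset[OF Zs] by blast
  have "\<exists>k>0. \<sigma> [^] (k :: nat) \<in> Z"
  proof -
    have "(\<lambda>i::nat. T #> \<sigma> [^] i) ` UNIV \<subseteq> rcosets T"
      using \<sigma>(1) unfolding RCOSETS_def by auto
    then have "finite (range (\<lambda>i::nat. T #> \<sigma> [^] i))" using T(3) by (rule finite_subset)
    then have "\<not> inj (\<lambda>i::nat. T #> \<sigma> [^] i)" using finite_imageD by blast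
    then obtain i j :: nat where ij: "i < j" "T #> \<sigma> [^] i = T #> \<sigma> [^] j"
      unfolding inj_def by (metis linorder_neqE_nat)
    have "\<sigma> [^] j \<in> T #> \<sigma> [^] i"
      using ij(2) rcos_self[OF nat_pow_closed[OF \<sigma>(1)] T(1)] by metis
    then have "\<sigma> [^] j \<otimes> inv (\<sigma> [^] i) \<in> T"
      using subgroup.rcos_module_imp[OF T(1) is_group nat_pow_closed[OF \<sigma>(1)]] by simp
    moreover have "\<sigma> [^] j = \<sigma> [^] (j - i) \<otimes> \<sigma> [^] i"
      using ij(1) \<sigma>(1) by (simp add: nat_pow_mult)
    ultimately have "\<sigma> [^] (j - i) \<in> T" using \<sigma>(1) by (simp add: m_assoc)
    then show ?thesis using T(2) ij(1) by (intro exI[of _ "j - i"]) auto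
  qed
  then obtain N where N: "N > 0" "\<sigma> [^] (N :: nat) \<in> Z" "\<forall>k<N. \<not> (k > 0 \<and> \<sigma> [^] k \<in> Z)"
    using exists_least_iff[of "\<lambda>k. k > 0 \<and> \<sigma> [^] (k :: nat) \<in> Z"] by auto
  have "N \<noteq> 1" using N(2) \<sigma> by auto
  then obtain q where q: "Factorial_Ring.prime q" "q dvd N" using prime_factor_nat by auto
  then obtain d where d: "N = q * d" by blast
  have d0: "0 < d" using N(1) d by auto
  moreover have "1 < q" using q(1) by (rule prime_gt_1_nat)
  ultimately have "d < N" unfolding d by simp
  define \<tau> where "\<tau> = \<sigma> [^] d"
  have \<tau>: "\<tau> \<in> carrier G" "\<tau> \<notin> Z" "\<tau> [^] q \<in> Z"
    using \<sigma>(1) N(2) N(3)[rule_format, OF \<open>d < N\<close>] d0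
    by (auto simp: \<tau>_def nat_pow_pow d mult.commute)
  have pow_Z: "z [^] (k::nat) \<in> Z" if "z \<in> Z" for z k
    using that subgroup.m_closed[OF Zs] subgroup.one_closed[OF Zs] by (induction k) auto
  have "q dvd k" if k: "\<tau> [^] (k :: nat) \<in> Z" for k
  proof (rule ccontr)
    assume "\<not> q dvd k"
    then have "coprime q k" using q(1) by (intro prime_imp_coprime)
    then have "coprime k q" by (rule coprime_imp_coprime) auto
    then obtain x y where xy: "k * x = q * y + 1"
      using coprime_bezout_strong[of k q] prime_gt_1_nat[OF q(1)] by auto
    have "\<tau> [^] (k * x) \<in> Z" "\<tau> [^] (q * y) \<in> Z"
      using pow_Z[OF k, of x] pow_Z[OF \<tau>(3), of y] \<tau>(1) by (simp_all add: nat_pow_pow)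
    moreover have "\<tau> = inv (\<tau> [^] (q * y)) \<otimes> \<tau> [^] (k * x)"
      unfolding xy using \<tau>(1) by (simp flip: m_assoc)
    ultimately have "\<tau> \<in> Z"
      using subgroup.m_closed[OF Zs] subgroup.m_inv_closed[OF Zs] by metis
    then show False using \<tau>(2) by simp
  qed
  moreover have "\<tau> [^] (k :: nat) \<in> Z" if qk: "q dvd k" for k
  proof -
    obtain j where "k = q * j" using qk by blast
    then show ?thesis using pow_Z[OF \<tau>(3), of j] \<tau>(1) by (simp add: nat_pow_pow)
  qed
  ultimately show ?thesis by (intro that[OF \<tau>(1) q(1)] iffI)
qed

text \<open>
  The preimage \<open>H\<close> of the subgroup of \<open>G / Z\<close> generated by the class of \<open>\<tau>\<close>, which has order \<open>q\<close>. The isomorphism of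
  \<open>H / Z\<close> with the integers modulo \<open>q\<close> is represented by a choice \<open>expo\<close> of exponents, meaningful modulo \<open>q\<close> only.
\<close>

locale cyclic_extension = group G for G (structure) +
  fixes Z \<tau> and q :: nat
  assumes Z_normal: "Z \<lhd> G" and \<tau>: "\<tau> \<in> carrier G" and q: "Factorial_Ring.prime q"
    and \<tau>_pow: "\<And>k :: nat. \<tau> [^] k \<in> Z \<longleftrightarrow> q dvd k"
begin

lemma Z_sub: "subgroup Z G"
  using Z_normal by (rule normal_imp_subgroup)

lemma Z_carrier: "z \<in> Z \<Longrightarrow> z \<in> carrier G"
  using subgroup.mem_carrier[OF Z_sub] .

definition H where "H = {\<tau> [^] j \<otimes> z | (j :: nat) z. z \<in> Z}"

definition expo where "expo h = (SOME j :: nat. \<exists>z\<in>Z. h = \<tau> [^] j \<otimes> z)"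

lemma H_I: "z \<in> Z \<Longrightarrow> \<tau> [^] (j::nat) \<otimes> z \<in> H"
  unfolding H_def by blast

lemma H_carrier: "h \<in> H \<Longrightarrow> h \<in> carrier G"
  unfolding H_def using \<tau> Z_carrier by auto

lemma Z_subset_H: "Z \<subseteq> H"
proof
  fix z assume "z \<in> Z"
  then show "z \<in> H" using H_I[of z 0] by (simp add: Z_carrier)
qed

lemma expo: "h \<in> H \<Longrightarrow> \<exists>z\<in>Z. h = \<tau> [^] expo h \<otimes> z"
  unfolding expo_def by (rule someI_ex) (auto simp: H_def)

lemma expo_unique:
  assumes "\<tau> [^] (j::nat) \<otimes> z = \<tau> [^] (k::nat) \<otimes> w" "z \<in> Z" "w \<in> Z"
  shows "j mod q = k mod q"
proof -
  have *: "j mod q = k mod q" if "\<tau> [^] j \<otimes> z = \<tau> [^] k \<otimes> w" "z \<in> Z" "w \<in> Z" "j \<le> k" for j k :: nat and z w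
  proof -
    have "\<tau> [^] k = \<tau> [^] j \<otimes> \<tau> [^] (k - j)" using that(4) \<tau> by (simp add: nat_pow_mult)
    then have "\<tau> [^] j \<otimes> z = \<tau> [^] j \<otimes> (\<tau> [^] (k - j) \<otimes> w)"
      using that(1,3) \<tau> by (simp add: m_assoc Z_carrier)
    then have "z = \<tau> [^] (k - j) \<otimes> w" using that(2,3) \<tau> by (simp add: Z_carrier)
    then have "\<tau> [^] (k - j) = z \<otimes> inv w" using that(2,3) \<tau> by (simp add: Z_carrier inv_solve_right)
    then have "\<tau> [^] (k - j) \<in> Z"
      using that(2,3) subgroup.m_closed[OF Z_sub] subgroup.m_inv_closed[OF Z_sub] by simp
    then have "q dvd k - j" by (simp add: \<tau>_pow)
    then show ?thesis using that(4) by (metis mod_eq_dvd_iff_nat)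
  qed
  show ?thesis
  proof (cases "j \<le> k")
    case True
    then show ?thesis by (rule *[OF assms])
  next
    case False
    then show ?thesis using *[OF assms(1)[symmetric] assms(3,2)] by simp
  qed
qed

lemma mult_form:
  assumes "z \<in> Z" "w \<in> Z"
  shows "\<exists>u\<in>Z. (\<tau> [^] (j::nat) \<otimes> z) \<otimes> (\<tau> [^] (k::nat) \<otimes> w) = \<tau> [^] (j + k) \<otimes> u"
proof (intro bexI[of _ "(inv (\<tau> [^] k) \<otimes> z \<otimes> \<tau> [^] k) \<otimes> w"])
  have *: "inv (\<tau> [^] k) \<otimes> z \<otimes> \<tau> [^] k \<in> Z"
    using normal.inv_op_closed1[OF Z_normal _ assms(1)] \<tau> by simp
  then show "(inv (\<tau> [^] k) \<otimes> z \<otimes> \<tau> [^] k) \<otimes> w \<in> Z"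
    using assms(2) subgroup.m_closed[OF Z_sub] by blast
  have "\<tau> [^] (j + k) \<otimes> ((inv (\<tau> [^] k) \<otimes> z \<otimes> \<tau> [^] k) \<otimes> w) =
    \<tau> [^] j \<otimes> (\<tau> [^] k \<otimes> inv (\<tau> [^] k)) \<otimes> z \<otimes> (\<tau> [^] k \<otimes> w)"
    using \<tau> assms by (simp add: m_assoc Z_carrier nat_pow_mult[symmetric] inv_mult_cancel)
  then show "(\<tau> [^] j \<otimes> z) \<otimes> (\<tau> [^] k \<otimes> w) = \<tau> [^] (j + k) \<otimes> ((inv (\<tau> [^] k) \<otimes> z \<otimes> \<tau> [^] k) \<otimes> w)"
    using \<tau> assms by (simp add: m_assoc Z_carrier)
qed

lemma H_mult: "g \<in> H \<Longrightarrow> h \<in> H \<Longrightarrow> g \<otimes> h \<in> H"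
proof -
  assume "g \<in> H" "h \<in> H"
  then obtain j z k w where "z \<in> Z" "w \<in> Z" "g = \<tau> [^] (j::nat) \<otimes> z" "h = \<tau> [^] (k::nat) \<otimes> w"
    unfolding H_def by blast
  then show ?thesis using mult_form[of z w j k] H_I by metis
qed

lemma H_subgroup: "subgroup H G"
proof (rule subgroupI)
  show "H \<subseteq> carrier G" using H_carrier by blast
  show "H \<noteq> {}" using Z_subset_H subgroup.one_closed[OF Z_sub] by blast
  show "g \<otimes> h \<in> H" if "g \<in> H" "h \<in> H" for g h using that by (rule H_mult)
  fix h assume h: "h \<in> H"
  then obtain j z where jz: "z \<in> Z" "h = \<tau> [^] (j::nat) \<otimes> z" unfolding H_def by blast
  have q0: "q > 0" using q by (rule prime_gt_0_nat)
  obtain u where u: "u \<in> Z" "h \<otimes> \<tau> [^] ((q - 1) * j) = \<tau> [^] (j + (q - 1) * j) \<otimes> u"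
    using mult_form[OF jz(1) subgroup.one_closed[OF Z_sub], of j "(q - 1) * j"] jz(2) \<tau> by auto
  have "j + (q - 1) * j = q * j" using q0 by (cases q) auto
  then have "h \<otimes> \<tau> [^] ((q - 1) * j) \<in> Z"
    using u \<tau>_pow[of "q * j"] subgroup.m_closed[OF Z_sub] by simp
  then have v: "inv (h \<otimes> \<tau> [^] ((q - 1) * j)) \<in> Z" by (rule subgroup.m_inv_closed[OF Z_sub])
  have "inv h = \<tau> [^] ((q - 1) * j) \<otimes> inv (h \<otimes> \<tau> [^] ((q - 1) * j))"
    using H_carrier[OF h] \<tau> by (simp add: inv_mult_group flip: m_assoc)
  then show "inv h \<in> H" using H_I[OF v] by metis
qed

lemma expo_mult:
  assumes "g \<in> H" "h \<in> H"
  shows "expo (g \<otimes> h) mod q = (expo g + expo h) mod q"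
proof -
  obtain z w where zw: "z \<in> Z" "g = \<tau> [^] expo g \<otimes> z" "w \<in> Z" "h = \<tau> [^] expo h \<otimes> w"
    using expo assms by metis
  obtain u where u: "u \<in> Z" "g \<otimes> h = \<tau> [^] (expo g + expo h) \<otimes> u"
    using mult_form[OF zw(1,3), of "expo g" "expo h"] zw(2,4) by metis
  obtain v where v: "v \<in> Z" "g \<otimes> h = \<tau> [^] expo (g \<otimes> h) \<otimes> v"
    using expo[OF H_mult[OF assms]] by blast
  show ?thesis using expo_unique[of "expo (g \<otimes> h)" v "expo g + expo h" u] u v by metis
qed

lemma expo_Z:
  assumes "h \<in> H"
  shows "q dvd expo h \<longleftrightarrow> h \<in> Z"
proof -
  obtain z where z: "z \<in> Z" "h = \<tau> [^] expo h \<otimes> z" using expo[OF assms] by blast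
  have "\<tau> [^] expo h = h \<otimes> inv z"
    using z \<tau> by (metis Z_carrier inv_closed m_assoc nat_pow_closed r_inv r_one)
  then have "h \<in> Z \<longleftrightarrow> \<tau> [^] expo h \<in> Z"
    using z subgroup.m_closed[OF Z_sub] subgroup.m_inv_closed[OF Z_sub] by metis
  then show ?thesis by (simp add: \<tau>_pow)
qed

lemma \<tau>_H: "\<tau> \<in> H" "\<tau> \<notin> Z"
proof -
  show "\<tau> \<in> H"
    using H_I[OF subgroup.one_closed[OF Z_sub], of 1] \<tau> by simp
  show "\<tau> \<notin> Z"
    using \<tau>_pow[of 1] \<tau> q by auto
qed

end

section \<open>Functions that are regular on every coset\<close>

context diagonalizable_subgroup
begin

text \<open>
  Multiply the function that represents \<open>f\<close> over a coset by the indicator function of this coset and add up. The map \<open>\<pi>\<close> to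
  the group allows for functions on a product of the group with another variety.
\<close>

lemma regular_if_regular_on_cosets:
  assumes "function_algebra \<F>" "finite (rcosets T)"
    and \<pi>: "\<And>d. d \<in> D \<Longrightarrow> \<pi> d \<in> carrier G" "\<And>i. i < n \<Longrightarrow> (\<lambda>d. \<pi> d i) \<in> agree_on D \<F>"
    and f: "\<And>a. a \<in> carrier G \<Longrightarrow> \<exists>F\<in>agree_on D \<F>. \<forall>d\<in>D. \<pi> d \<in> T #> a \<longrightarrow> f d = F d"
  shows "f \<in> agree_on D \<F>"
proof -
  interpret F: function_algebra \<F> by (rule assms(1))
  interpret FD: function_algebra "agree_on D \<F>" by (rule function_algebra_agree_on[OF assms(1)])
  have "\<forall>C\<in>rcosets T. \<exists>a. a \<in> carrier G \<and> C = T #> a" unfolding RCOSETS_def by blast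
  from bchoice[OF this] obtain a where a: "\<And>C. C \<in> rcosets T \<Longrightarrow> a C \<in> carrier G" "\<And>C. C \<in> rcosets T \<Longrightarrow> C = T #> a C"
    by auto
  have "\<forall>C\<in>rcosets T. \<exists>F. F \<in> agree_on D \<F> \<and> (\<forall>d\<in>D. \<pi> d \<in> C \<longrightarrow> f d = F d)"
  proof
    fix C assume C: "C \<in> rcosets T"
    show "\<exists>F. F \<in> agree_on D \<F> \<and> (\<forall>d\<in>D. \<pi> d \<in> C \<longrightarrow> f d = F d)"
      using f[OF a(1)[OF C]] unfolding a(2)[OF C, symmetric] Bex_def .
  qed
  from bchoice[OF this] obtain F where F: "\<And>C. C \<in> rcosets T \<Longrightarrow> F C \<in> agree_on D \<F>"
    "\<And>C d. C \<in> rcosets T \<Longrightarrow> d \<in> D \<Longrightarrow> \<pi> d \<in> C \<Longrightarrow> f d = F C d"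
    by auto
  have ind: "(\<lambda>d. if \<pi> d \<in> C then 1 else 0) \<in> agree_on D \<F>" if C: "C \<in> rcosets T" for C
    using F.regfun_subst[OF coset_indicator_regular[OF assms(2) a(1)[OF C]] \<pi>(2,1)] a(2)[OF C] by simp
  have "(\<lambda>d. \<Sum>C\<in>rcosets T. (if \<pi> d \<in> C then 1 else 0) * F C d) \<in> agree_on D \<F>"
    by (intro FD.sum FD.mult ind F(1))
  then show ?thesis
  proof (rule agree_on_cong)
    fix d assume d: "d \<in> D"
    define C where "C = T #> \<pi> d"
    have C: "C \<in> rcosets T" "\<pi> d \<in> C"
      using \<pi>(1)[OF d] rcos_self[OF _ T_sub] unfolding C_def RCOSETS_def by auto
    have "\<pi> d \<in> E \<longleftrightarrow> E = C" if "E \<in> rcosets T" for E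
      using rcos_disjoint[OF T_sub] that C by (auto simp: pairwise_def disjnt_def)
    then have "(if \<pi> d \<in> E then 1 else 0) * F E d = (if E = C then F C d else 0)" if "E \<in> rcosets T" for E
      using that by simp
    then have "(\<Sum>E\<in>rcosets T. (if \<pi> d \<in> E then 1 else 0) * F E d) = (\<Sum>E\<in>rcosets T. if E = C then F C d else 0)"
      by (rule sum.cong[OF refl])
    also have "\<dots> = F C d" using C(1) assms(2) by simp
    finally show "f d = (\<Sum>C\<in>rcosets T. (if \<pi> d \<in> C then 1 else 0) * F C d)"
      using F(2)[OF C(1) d C(2)] by simp
  qed
qed

text \<open>The indicator function of the complement is constant on cosets, hence regular.\<close>

lemma closed_if_coset_stable:
  assumes fin: "finite (rcosets T)" and U: "U \<subseteq> carrier G" "\<And>u. u \<in> U \<Longrightarrow> T #> u \<subseteq> U"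
  shows "closedin (zariski n) U"
proof -
  have "(\<lambda>g. if g \<in> U then 0 else 1) \<in> regfun n (carrier G)"
  proof (rule regular_if_regular_on_cosets[where \<pi> = "\<lambda>g. g", OF function_algebra_polyfun fin])
    fix a assume a: "a \<in> carrier G"
    have "g \<in> U \<longleftrightarrow> a \<in> U" if "g \<in> T #> a" for g
    proof -
      have "T #> g = T #> a" using repr_independence[OF that a T_sub] by simp
      then show ?thesis using U(2)[of a] U(2)[of g] that rcos_self[OF a T_sub] by auto
    qed
    then show "\<exists>F\<in>regfun n (carrier G). \<forall>g\<in>carrier G. g \<in> T #> a \<longrightarrow> (if g \<in> U then 0 else 1) = F g"
      by (intro bexI[OF _ regfun.const[of "if a \<in> U then 0 else 1"]]) auto
  qed (auto intro: regfun_coord)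
  then obtain p where p: "p \<in> polyfun n" "\<And>g. g \<in> carrier G \<Longrightarrow> (if g \<in> U then 0 else 1) = p g"
    by (rule agree_onE) (rule that)
  obtain E where E: "E \<subseteq> polyfun n" "carrier G = zero_locus n E"
    using closed[unfolded closedin_zariski] by metis
  have "U = zero_locus n (insert p E)"
  proof (intro Set.equalityI subsetI)
    fix g assume "g \<in> U"
    then show "g \<in> zero_locus n (insert p E)"
      using U(1) p(2)[of g] E(2) by (auto simp: zero_locus_def)
  next
    fix g assume g: "g \<in> zero_locus n (insert p E)"
    then have "g \<in> carrier G" "p g = 0" unfolding E(2) by (auto simp: zero_locus_def)
    then show "g \<in> U" using p(2)[of g] by (simp split: if_splits)
  qed
  then show ?thesis
    unfolding closedin_zariski using p(1) E(1) by (intro exI[of _ "insert p E"]) simp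
qed

end

section \<open>An affine curve with a totally ramified automorphism of prime order\<close>

text \<open>
  The two cases of an automorphism of order \<open>q\<close> of the line with fixed point \<open>0\<close> are treated at once:
  \<open>v \<mapsto> \<zeta>\<^sup>j v / (1 + j c v)\<close> is multiplication by powers of a primitive root of unity \<open>\<zeta>\<close> if \<open>c = 0\<close>, and a parabolic
  transformation if \<open>\<zeta> = 1\<close>. In the latter case \<open>c = 1\<close>, and \<open>c_q\<close> says that the characteristic is \<open>q\<close>.
\<close>

locale twisted_curve =
  fixes q :: nat and \<zeta> c :: "'k::alg_closed_field"
  assumes q: "Factorial_Ring.prime q" and \<zeta>_pow: "\<zeta> ^ q = 1" and c_q: "of_nat q * c = 0"
    and \<zeta>_c_cases: "\<zeta> \<noteq> 1 \<and> c = 0 \<or> \<zeta> = 1 \<and> c = 1"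
begin

definition den :: "nat \<Rightarrow> 'k \<Rightarrow> 'k" where "den j v = 1 + of_nat j * c * v"

definition s :: "nat \<Rightarrow> 'k \<Rightarrow> 'k" where "s j v = \<zeta> ^ j * v / den j v"

text \<open>
  The product of the denominators of all powers of the automorphism: the curve is the open set \<open>g v \<noteq> 0\<close> of the line.
\<close>

definition g :: "'k \<Rightarrow> 'k" where "g v = (\<Prod>j<q. den j v)"

lemma q_pos: "q > 0"
  using q by (rule prime_gt_0_nat)

lemma \<zeta>_c: "\<zeta> ^ j * c = c"
  using \<zeta>_c_cases by auto

lemma of_nat_mod_c: "of_nat (j mod q) * c = of_nat j * c"
proof -
  have "of_nat j * c = of_nat (q * (j div q) + j mod q) * c" by simp
  also have "\<dots> = of_nat (j div q) * (of_nat q * c) + of_nat (j mod q) * c"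
    unfolding of_nat_add of_nat_mult by (simp add: algebra_simps)
  finally have "of_nat j * c = of_nat (j mod q) * c"
    by (simp only: c_q mult_zero_right add_0)
  then show ?thesis ..
qed

lemma \<zeta>_mod: "\<zeta> ^ (j mod q) = \<zeta> ^ j"
proof -
  have "\<zeta> ^ j = \<zeta> ^ (q * (j div q) + j mod q)" by simp
  then show ?thesis unfolding power_add power_mult \<zeta>_pow by simp
qed

lemma den_mod: "den (j mod q) v = den j v"
  by (simp add: den_def of_nat_mod_c)

lemma s_mod: "s (j mod q) v = s j v"
  by (simp add: s_def den_mod \<zeta>_mod)

lemma den_nonzero:
  assumes "g v \<noteq> 0"
  shows "den j v \<noteq> 0"
proof -
  have "j mod q \<in> {..<q}" using q_pos by simp
  then have "den (j mod q) v \<noteq> 0" using assms unfolding g_def by (simp add: prod_zero_iff)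
  then show ?thesis by (simp add: den_mod)
qed

text \<open>The cocycle rule for denominators of fractional linear maps.\<close>

lemma den_s:
  assumes "den k v \<noteq> 0"
  shows "den j (s k v) = den (j + k) v / den k v"
proof -
  have "den j (s k v) = (den k v + of_nat j * (\<zeta> ^ k * c) * v) / den k v"
    using assms by (simp add: den_def[of j] s_def add_divide_distrib mult_ac)
  also have "den k v + of_nat j * (\<zeta> ^ k * c) * v = den (j + k) v"
    unfolding \<zeta>_c by (simp add: den_def algebra_simps)
  finally show ?thesis .
qed

lemma s_s: "g v \<noteq> 0 \<Longrightarrow> s j (s k v) = s (j + k) v"
  using den_nonzero[of v k] den_nonzero[of v "j + k"]
  unfolding s_def[of j] den_s[OF den_nonzero] by (simp add: s_def power_add)

lemma s_0 [simp]: "s 0 v = v"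
  by (simp add: s_def den_def)

lemma s_at_0 [simp]: "s j 0 = 0"
  by (simp add: s_def)

lemma g_at_0 [simp]: "g 0 = 1"
  by (simp add: g_def den_def)

lemma shift_bij: "bij_betw (\<lambda>j. (j + k) mod q) {..<q} {..<q}"
proof (rule bij_betw_byWitness[where f' = "\<lambda>j. (j + (q - k mod q)) mod q"])
  have *: "q - k mod q + k = q * (k div q + 1)"
    using mult_div_mod_eq[of q k] mod_less_divisor[OF q_pos, of k]
    by (simp only: distrib_left mult_1_right)
  have 1: "((j + k) mod q + (q - k mod q)) mod q = j" if "j < q" for j
  proof -
    have "((j + k) mod q + (q - k mod q)) mod q = (j + (q - k mod q + k)) mod q"
      by (simp add: mod_simps add_ac)
    then show ?thesis unfolding * mod_mult_self2 using that by simp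
  qed
  have 2: "((j + (q - k mod q)) mod q + k) mod q = j" if "j < q" for j
  proof -
    have "((j + (q - k mod q)) mod q + k) mod q = (j + (q - k mod q + k)) mod q"
      by (simp add: mod_simps add_ac)
    then show ?thesis unfolding * mod_mult_self2 using that by simp
  qed
  show "\<forall>j\<in>{..<q}. ((j + k) mod q + (q - k mod q)) mod q = j"
    "\<forall>j\<in>{..<q}. ((j + (q - k mod q)) mod q + k) mod q = j"
    using 1 2 by auto
qed (use q_pos in auto)

lemma prod_shift:
  assumes "\<And>j. F (j mod q) = (F j :: 'k)"
  shows "(\<Prod>j<q. F (j + k)) = (\<Prod>j<q. F j)"
  using prod.reindex_bij_betw[OF shift_bij, of F k] by (simp add: assms)

text \<open>
  The factors of \<open>g\<close> at \<open>s k v\<close> are those of \<open>g v\<close> in a different order, each divided by \<open>den k v\<close>.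
\<close>

lemma g_s: "g v \<noteq> 0 \<Longrightarrow> g (s k v) = g v / den k v ^ q"
  unfolding g_def[of "s k v"] den_s[OF den_nonzero] prod_dividef
  by (simp add: prod_shift[of "\<lambda>j. den j v"] den_mod g_def)

lemma g_s_nonzero: "g v \<noteq> 0 \<Longrightarrow> g (s k v) \<noteq> 0"
  by (simp add: g_s den_nonzero)

text \<open>Both parts use that \<open>j\<close> is invertible modulo \<open>q\<close>.\<close>

lemma nontrivial:
  assumes "\<not> q dvd j"
  shows "\<zeta> \<noteq> 1 \<Longrightarrow> \<zeta> ^ j \<noteq> 1" "\<zeta> = 1 \<Longrightarrow> of_nat j \<noteq> (0 :: 'k)"
proof -
  have "coprime q j" using q assms by (intro prime_imp_coprime)
  then have "coprime j q" by (rule coprime_imp_coprime) auto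
  then obtain x y where xy: "j * x = q * y + 1"
    using coprime_bezout_strong[of j q] prime_gt_1_nat[OF q] by auto
  show "\<zeta> ^ j \<noteq> 1" if "\<zeta> \<noteq> 1"
  proof
    assume "\<zeta> ^ j = 1"
    then have "\<zeta> ^ (j * x) = 1" by (simp add: power_mult)
    then show False using that unfolding xy power_add power_mult \<zeta>_pow by simp
  qed
  show "of_nat j \<noteq> (0 :: 'k)" if "\<zeta> = 1"
  proof
    assume "of_nat j = (0 :: 'k)"
    then have "of_nat (j * x) = (0 :: 'k)" by simp
    moreover have "of_nat q = (0 :: 'k)" using c_q \<zeta>_c_cases that by auto
    ultimately show False unfolding xy by simp
  qed
qed

definition gpoly :: "'k poly" where "gpoly = (\<Prod>j<q. [:1, of_nat j * c:])"

lemma poly_gpoly: "poly gpoly v = g v"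
  by (simp add: gpoly_def g_def den_def poly_prod mult.commute)

text \<open>
  The divisibility of \<open>g - 1\<close> by \<open>v\<close> is used to divide the inverse of \<open>g\<close> with remainder by \<open>v\<close>.
\<close>

lemma g_eq: "\<exists>p. \<forall>v. g v = 1 + v * poly p v"
proof -
  obtain a p where "gpoly = pCons a p" by (rule pCons_cases)
  then have *: "g v = a + v * poly p v" for v using poly_gpoly[of v] by simp
  have "a = 1" using *[of 0] by simp
  then show ?thesis using * by blast
qed

end

section \<open>The product of a torus and the curve\<close>

lemma (in function_algebra) poly_closed:
  "f \<in> \<F> \<Longrightarrow> (\<lambda>x. poly p (f x)) \<in> \<F>"
  unfolding poly_altdef by (intro sum mult power const)

locale torus_curve = twisted_curve q \<zeta> c for q :: nat and \<zeta> c :: "'k::alg_closed_field" +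
  fixes r :: nat
begin

text \<open>
  The points of the variety are \<open>(x\<^sub>0, \<dots>, x\<^sub>r\<^sub>-\<^sub>1, v)\<close> with nonzero \<open>x\<^sub>i\<close> and \<open>g v\<close>. Writing the product of the torus and the
  curve as a principal open set gives the normality of its coordinate ring.
\<close>

definition Gp :: "'k point \<Rightarrow> 'k" where "Gp y = (\<Prod>i<r. y i) * g (y r)"

sublocale principal_open_set "Suc r" Gp
proof
  show "Gp \<in> polyfun (Suc r)"
    unfolding Gp_def poly_gpoly[symmetric]
    by (intro polyfun.mult polyfun.prod polyfun.poly_closed polyfun.coord) auto
  show "\<exists>z\<in>affine_space (Suc r). Gp z \<noteq> 0"
    by (intro bexI[of _ "\<lambda>i. if i < r then 1 else 0"]) (auto simp: Gp_def affine_space_def)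
qed

abbreviation m :: nat where "m \<equiv> Suc (Suc r)"
abbreviation R where "R \<equiv> coord_ring m V"
abbreviation S :: "'k point set" where "S \<equiv> carrier (split_torus r)"

text \<open>
  The isomorphism of the product of the split torus and the curve with \<open>V\<close>; \<open>tor\<close> is the first component of its inverse,
  and the second component is the coordinate with index \<open>r\<close>.
\<close>

definition mk :: "'k point \<Rightarrow> 'k \<Rightarrow> 'k point" where
  "mk x v = (\<lambda>i. if i < r then x i else if i = r then v else if i = Suc r then (\<Prod>j<r. x (r + j)) / g v else 0)"

definition tor :: "'k point \<Rightarrow> 'k point" where
  "tor y = (\<lambda>i. if i < r then y i else if i < 2 * r then inverse (y (i - r)) else 0)"

lemma S_iff: "x \<in> S \<longleftrightarrow> x \<in> affine_space (2 * r) \<and> (\<forall>i<r. x i * x (r + i) = 1)"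
  by (simp add: split_torus_def)

lemma V_iff: "y \<in> V \<longleftrightarrow> y \<in> affine_space m \<and> y (Suc r) * ((\<Prod>i<r. y i) * g (y r)) = 1"
  by (simp add: principal_open_def Gp_def)

lemma V_nonzero:
  assumes "y \<in> V"
  shows "g (y r) \<noteq> 0" "i < r \<Longrightarrow> y i \<noteq> 0"
proof -
  have *: "(\<Prod>i<r. y i) * g (y r) \<noteq> 0"
    using assms unfolding V_iff by (metis mult_zero_right zero_neq_one)
  then show "g (y r) \<noteq> 0" by simp
  assume "i < r"
  then show "y i \<noteq> 0" using * by (auto simp: prod_zero_iff)
qed

lemma mk_V: "x \<in> S \<Longrightarrow> g v \<noteq> 0 \<Longrightarrow> mk x v \<in> V"
proof -
  assume x: "x \<in> S" and v: "g v \<noteq> 0"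
  have "(\<Prod>j<r. x (r + j)) * (\<Prod>j<r. x j) = (\<Prod>j<r. x j * x (r + j))"
    by (simp add: prod.distrib mult.commute)
  also have "\<dots> = 1" using x by (auto simp: S_iff)
  finally show ?thesis using v by (simp add: V_iff mk_def affine_space_def)
qed

lemma tor_S: "y \<in> V \<Longrightarrow> tor y \<in> S"
  using V_nonzero(2)[of y] by (auto simp: S_iff tor_def affine_space_def)

lemma mk_tor: "y \<in> V \<Longrightarrow> mk (tor y) (y r) = y"
proof
  fix i assume y: "y \<in> V"
  have "(\<Prod>j<r. tor y (r + j)) = (\<Prod>j<r. inverse (y j))"
    by (intro prod.cong) (auto simp: tor_def)
  also have "\<dots> = inverse (\<Prod>j<r. y j)"
    using prod_inversef[of y "{..<r}"] by (simp add: o_def)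
  also have "\<dots> / g (y r) = inverse ((\<Prod>j<r. y j) * g (y r))"
    by (simp add: field_simps)
  also have "\<dots> = y (Suc r)"
    using y unfolding V_iff by (metis inverse_unique mult.commute)
  finally show "mk (tor y) (y r) i = y i"
    using y by (auto simp: mk_def tor_def V_iff affine_space_def)
qed

lemma tor_mk: "x \<in> S \<Longrightarrow> tor (mk x v) = x"
proof
  fix i assume x: "x \<in> S"
  have "inverse (x (i - r)) = x i" if "r \<le> i" "i < 2 * r"
  proof -
    have "i - r < r" using that by simp
    then have "x (i - r) * x (r + (i - r)) = 1" using x unfolding S_iff by blast
    then show ?thesis using that by (simp add: inverse_unique)
  qed
  then show "tor (mk x v) i = x i"
    using x by (auto simp: tor_def mk_def S_iff affine_space_def)
qed

lemma mk_r [simp]: "mk x v r = v"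
  by (simp add: mk_def)

lemma inv_g_regular: "(\<lambda>y. 1 / g (y r)) \<in> regfun m V"
proof (rule agree_on_cong)
  show "(\<lambda>y. y (Suc r) * (\<Prod>i<r. y i)) \<in> regfun m V"
    by (intro regfun.mult regfun.prod regfun_coord) auto
  fix y :: "'k point" assume y: "y \<in> V"
  then show "1 / g (y r) = y (Suc r) * (\<Prod>i<r. y i)"
    using V_nonzero(1)[OF y] by (simp add: V_iff field_simps)
qed

lemma v_regular: "(\<lambda>y. y r) \<in> regfun m V"
  by (rule regfun_coord) simp

lemma den_regular: "(\<lambda>y. den j (y r)) \<in> regfun m V"
  unfolding den_def by (intro regfun.add regfun.mult regfun.const v_regular)

lemma inv_den_regular: "(\<lambda>y. 1 / den k (y r)) \<in> regfun m V"
proof (rule agree_on_cong)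
  show "(\<lambda>y. 1 / g (y r) * (\<Prod>j\<in>{..<q} - {k mod q}. den j (y r))) \<in> regfun m V"
    by (intro regfun.mult regfun.prod den_regular inv_g_regular)
  fix y :: "'k point" assume y: "y \<in> V"
  have "g (y r) = den (k mod q) (y r) * (\<Prod>j\<in>{..<q} - {k mod q}. den j (y r))"
    unfolding g_def using q_pos by (intro prod.remove) auto
  then show "1 / den k (y r) = 1 / g (y r) * (\<Prod>j\<in>{..<q} - {k mod q}. den j (y r))"
    using V_nonzero(1)[OF y] den_nonzero[OF V_nonzero(1)[OF y]] by (auto simp: den_mod)
qed

lemma s_regular: "(\<lambda>y. s k (y r)) \<in> regfun m V"
proof (rule agree_on_cong)
  show "(\<lambda>y. \<zeta> ^ k * y r * (1 / den k (y r))) \<in> regfun m V"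
    by (intro regfun.mult regfun.const v_regular inv_den_regular)
qed (simp add: s_def)

lemma inv_g_s_regular: "(\<lambda>y. 1 / g (s k (y r))) \<in> regfun m V"
proof (rule agree_on_cong)
  show "(\<lambda>y. den k (y r) ^ q * (1 / g (y r))) \<in> regfun m V"
    by (intro regfun.mult regfun.power den_regular inv_g_regular)
qed (simp add: g_s V_nonzero)

lemma tor_regular: "i < 2 * r \<Longrightarrow> (\<lambda>y. tor y i) \<in> regfun m V"
proof (cases "i < r")
  case True
  then show ?thesis by (simp add: tor_def regfun_coord)
next
  case False
  assume i: "i < 2 * r"
  let ?F = "\<lambda>y :: 'k point. y (Suc r) * (\<Prod>j\<in>{..<r} - {i - r}. y j) * poly gpoly (y r)"
  have "?F \<in> regfun m V"
    by (intro regfun.mult regfun.prod regfun.poly_closed regfun_coord) auto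
  then show ?thesis
  proof (rule agree_on_cong)
    fix y :: "'k point" assume y: "y \<in> V"
    have "(\<Prod>j<r. y j) = y (i - r) * (\<Prod>j\<in>{..<r} - {i - r}. y j)"
      using i False by (intro prod.remove) auto
    then have "y (i - r) * ?F y = 1"
      using y by (simp add: V_iff poly_gpoly mult_ac)
    then show "tor y i = ?F y" using i False by (simp add: tor_def inverse_unique)
  qed
qed

text \<open>
  Division with remainder by \<open>v\<close>: the remainder is the restriction to the divisor \<open>v = 0\<close>, extended constantly in \<open>v\<close>.
\<close>

lemma divide_by_v:
  assumes "p \<in> polyfun m"
  shows "\<exists>p1\<in>polyfun m. \<forall>y\<in>V. p y = p (mk (tor y) 0) + y r * p1 y"
  using assms
proof induction
  case (const a)
  show ?case by (intro bexI[of _ "\<lambda>_. 0"]) (auto intro: polyfun.const)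
next
  case (coord i)
  show ?case
  proof (cases "i = Suc r")
    case False
    show ?thesis
    proof (intro bexI[of _ "\<lambda>_. if i = r then 1 else 0"] ballI polyfun.const)
      fix y assume "y \<in> V"
      show "y i = mk (tor y) 0 i + y r * (if i = r then 1 else 0)"
        using False coord by (cases "i < r"; cases "i = r") (simp_all add: mk_def tor_def)
    qed
  next
    case True
    obtain p where p: "\<And>v. g v = 1 + v * poly p v" using g_eq by auto
    show ?thesis
    proof (intro bexI[of _ "\<lambda>y. - (y (Suc r) * poly p (y r))"] ballI)
      fix y assume y: "y \<in> V"
      have "mk (tor y) (y r) (Suc r) * g (y r) = mk (tor y) 0 (Suc r)"
        using V_nonzero(1)[OF y] by (simp add: mk_def)
      then have "y (Suc r) * (1 + y r * poly p (y r)) = mk (tor y) 0 (Suc r)"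
        unfolding mk_tor[OF y] by (simp only: p)
      then show "y i = mk (tor y) 0 i + y r * - (y (Suc r) * poly p (y r))"
        unfolding True by (simp add: algebra_simps)
    next
      show "(\<lambda>y. - (y (Suc r) * poly p (y r))) \<in> polyfun m"
        by (intro polyfun.uminus polyfun.mult polyfun.poly_closed polyfun.coord) auto
    qed
  qed
next
  case (add p p')
  then obtain a b where *: "a \<in> polyfun m" "\<forall>y\<in>V. p y = p (mk (tor y) 0) + y r * a y"
    "b \<in> polyfun m" "\<forall>y\<in>V. p' y = p' (mk (tor y) 0) + y r * b y"
    by (elim bexE) (rule that; assumption)
  show ?case
  proof (intro bexI[of _ "\<lambda>y. a y + b y"] ballI)
    fix y assume y: "y \<in> V"
    show "p y + p' y = p (mk (tor y) 0) + p' (mk (tor y) 0) + y r * (a y + b y)"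
      using bspec[OF *(2) y] bspec[OF *(4) y] by (simp add: algebra_simps)
  qed (intro polyfun.add * )
next
  case (mult p p')
  then obtain a b where *: "a \<in> polyfun m" "\<forall>y\<in>V. p y = p (mk (tor y) 0) + y r * a y"
    "b \<in> polyfun m" "\<forall>y\<in>V. p' y = p' (mk (tor y) 0) + y r * b y"
    by (elim bexE) (rule that; assumption)
  show ?case
  proof (intro bexI[of _ "\<lambda>y. a y * p' y + p y * b y - y r * (a y * b y)"] ballI)
    fix y assume y: "y \<in> V"
    have p0: "p (mk (tor y) 0) = p y - y r * a y" "p' (mk (tor y) 0) = p' y - y r * b y"
      using bspec[OF *(2) y] bspec[OF *(4) y] by simp_all
    show "p y * p' y = p (mk (tor y) 0) * p' (mk (tor y) 0) + y r * (a y * p' y + p y * b y - y r * (a y * b y))"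
      unfolding p0 by (simp add: algebra_simps)
  qed (intro polyfun.add polyfun.diff polyfun.mult polyfun.coord * mult.hyps, simp)
qed

end

section \<open>Dual bases of evaluation points\<close>

text \<open>
  A space \<open>W\<close> of functions of finite dimension has a basis that is dual to the evaluations at finitely many points \<open>D\<close>, so
  the coordinates of a function are its values at these points. The basis is found by induction: if \<open>w0 x0 \<noteq> 0\<close>, the subspace of the
  functions that vanish at \<open>x0\<close> is spanned by one function less, and \<open>w0\<close> is corrected to vanish at the other points.
\<close>

lemma dual_points:
  fixes e :: "'i \<Rightarrow> 'a \<Rightarrow> 'k::field"
  assumes "finite I"
    and "\<And>a b w w'. w \<in> W \<Longrightarrow> w' \<in> W \<Longrightarrow> (\<lambda>y. a * w y + b * w' y) \<in> W"
    and "\<And>w. w \<in> W \<Longrightarrow> \<exists>d. \<forall>y\<in>V. w y = (\<Sum>i\<in>I. d i * e i y)"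
  shows "\<exists>D u. finite D \<and> D \<subseteq> V \<and> (\<forall>x\<in>D. u x \<in> W) \<and> (\<forall>x\<in>D. \<forall>y\<in>D. u x y = (if x = y then 1 else 0)) \<and>
    (\<forall>w\<in>W. \<forall>y\<in>V. w y = (\<Sum>x\<in>D. w x * u x y))"
  using assms
proof (induction I arbitrary: W e rule: finite_psubset_induct)
  case (psubset I)
  note lin = psubset.prems(1) and span = psubset.prems(2)
  show ?case
  proof (cases "\<exists>w\<in>W. \<exists>y\<in>V. w y \<noteq> 0")
    case False
    then show ?thesis by (intro exI[of _ "{}"]) auto
  next
    case True
    then obtain w0 x0 where w0: "w0 \<in> W" "x0 \<in> V" "w0 x0 \<noteq> 0" by auto
    obtain d0 where d0: "\<forall>y\<in>V. w0 y = (\<Sum>i\<in>I. d0 i * e i y)"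
      using span[OF w0(1)] ..
    have "\<exists>i\<in>I. e i x0 \<noteq> 0"
    proof (rule ccontr)
      assume "\<not> ?thesis"
      then have "w0 x0 = 0" using bspec[OF d0 w0(2)] by simp
      then show False using w0(3) by simp
    qed
    then obtain i0 where i0: "i0 \<in> I" "e i0 x0 \<noteq> 0" by auto
    define W' where "W' = {w \<in> W. w x0 = 0}"
    define e' where "e' i y = e i y - e i x0 / e i0 x0 * e i0 y" for i y
    have span': "\<exists>d. \<forall>y\<in>V. w y = (\<Sum>i\<in>I - {i0}. d i * e' i y)" if w: "w \<in> W'" for w
    proof -
      obtain d where d: "\<forall>y\<in>V. w y = (\<Sum>i\<in>I. d i * e i y)"
        using span[of w] w unfolding W'_def by auto
      have "w y = (\<Sum>i\<in>I - {i0}. d i * e' i y)" if y: "y \<in> V" for y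
      proof -
        have "(\<Sum>i\<in>I. d i * e' i y) = w y - (\<Sum>i\<in>I. d i * e i x0) / e i0 x0 * e i0 y"
          using bspec[OF d y]
          by (simp add: e'_def right_diff_distrib sum_subtractf sum_distrib_left sum_distrib_right sum_divide_distrib mult_ac)
        moreover have "(\<Sum>i\<in>I. d i * e i x0) = 0"
          using bspec[OF d w0(2)] w unfolding W'_def by simp
        moreover have "(\<Sum>i\<in>I. d i * e' i y) = (\<Sum>i\<in>I - {i0}. d i * e' i y)"
          using psubset.hyps i0 by (subst sum.remove[OF _ i0(1)]) (auto simp: e'_def)
        ultimately show ?thesis by simp
      qed
      then show ?thesis by blast
    qed
    have "\<exists>D u. finite D \<and> D \<subseteq> V \<and> (\<forall>x\<in>D. u x \<in> W') \<and> (\<forall>x\<in>D. \<forall>y\<in>D. u x y = (if x = y then 1 else 0)) \<and>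
      (\<forall>w\<in>W'. \<forall>y\<in>V. w y = (\<Sum>x\<in>D. w x * u x y))"
    proof (rule psubset.IH[of "I - {i0}" W' e'])
      show "I - {i0} \<subset> I" using i0(1) by auto
      show "(\<lambda>y. a * w y + b * w' y) \<in> W'" if "w \<in> W'" "w' \<in> W'" for a b w w'
        using that lin[of w w' a b] unfolding W'_def by simp
      show "\<exists>d. \<forall>y\<in>V. w y = (\<Sum>i\<in>I - {i0}. d i * e' i y)" if "w \<in> W'" for w
        using that by (rule span')
    qed
    then obtain D u where u: "finite D" "D \<subseteq> V" "\<forall>x\<in>D. u x \<in> W'"
      "\<forall>x\<in>D. \<forall>y\<in>D. u x y = (if x = y then 1 else 0)" "\<forall>w\<in>W'. \<forall>y\<in>V. w y = (\<Sum>x\<in>D. w x * u x y)"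
      by (elim exE conjE) (rule that; assumption)
    have ux0: "u x x0 = 0" if "x \<in> D" for x using u(3) that unfolding W'_def by auto
    have x0: "x0 \<notin> D" using ux0 u(4) by force
    define u0 where "u0 y = (w0 y - (\<Sum>x\<in>D. w0 x * u x y)) / w0 x0" for y
    define u' where "u' x = (if x = x0 then u0 else u x)" for x
    have uW: "u x \<in> W" if "x \<in> D" for x using u(3) that unfolding W'_def by auto
    have sum_W: "(\<lambda>y. w0 y - (\<Sum>x\<in>F. w0 x * u x y)) \<in> W" if "F \<subseteq> D" for F
    proof -
      have "finite F" using that u(1) by (rule finite_subset)
      then show ?thesis using that
      proof induction
        case empty
        then show ?case using w0(1) by simp
      next
        case (insert x F)
        then have "(\<lambda>y. 1 * (w0 y - (\<Sum>x\<in>F. w0 x * u x y)) + (- w0 x) * u x y) \<in> W"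
          by (intro lin uW) auto
        then show ?case using insert.hyps by (simp add: algebra_simps)
      qed
    qed
    have "(\<lambda>y. (1 / w0 x0) * (w0 y - (\<Sum>x\<in>D. w0 x * u x y)) + 0 * w0 y) \<in> W"
      by (rule lin[OF sum_W[OF subset_refl] w0(1)])
    then have u0W: "u0 \<in> W" by (simp add: u0_def[abs_def])
    have u0x: "u0 y = 0" if y: "y \<in> D" for y
    proof -
      have "(\<Sum>x\<in>D. w0 x * u x y) = (\<Sum>x\<in>D. if x = y then w0 y else 0)"
        using u(4) y by (intro sum.cong) auto
      then show ?thesis using u(1) y by (simp add: u0_def)
    qed
    have u0x0: "u0 x0 = 1" using w0(3) ux0 by (simp add: u0_def)
    have rep: "w y = (\<Sum>x\<in>insert x0 D. w x * u' x y)" if w: "w \<in> W" and y: "y \<in> V" for w y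
    proof -
      define k where "k = w x0 / w0 x0"
      have "(\<lambda>y. 1 * w y + (- k) * w0 y) \<in> W'"
        using lin[OF w w0(1), of 1 "- k"] w0(3) unfolding W'_def by (simp add: k_def)
      from bspec[OF bspec[OF u(5) this] y]
      have "w y = k * w0 y + (\<Sum>x\<in>D. (w x - k * w0 x) * u x y)" by (simp add: diff_eq_eq add.commute)
      also have "\<dots> = k * (w0 y - (\<Sum>x\<in>D. w0 x * u x y)) + (\<Sum>x\<in>D. w x * u x y)"
        by (simp add: algebra_simps sum_subtractf sum_distrib_left)
      also have "k * (w0 y - (\<Sum>x\<in>D. w0 x * u x y)) = w x0 * u' x0 y"
        by (simp add: k_def u'_def u0_def)
      also have "(\<Sum>x\<in>D. w x * u x y) = (\<Sum>x\<in>D. w x * u' x y)"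
        using x0 by (intro sum.cong) (auto simp: u'_def)
      finally show ?thesis using u(1) x0 by simp
    qed
    show ?thesis
    proof (intro exI[of _ "insert x0 D"] exI[of _ u'] conjI ballI)
      show "finite (insert x0 D)" using u(1) by simp
      show "insert x0 D \<subseteq> V" using u(2) w0(2) by simp
      show "u' x \<in> W" if "x \<in> insert x0 D" for x
        using that u0W uW by (auto simp: u'_def)
      show "u' x y = (if x = y then 1 else 0)" if "x \<in> insert x0 D" "y \<in> insert x0 D" for x y
        using that u(4) ux0 u0x u0x0 x0 by (auto simp: u'_def)
      show "w y = (\<Sum>x\<in>insert x0 D. w x * u' x y)" if "w \<in> W" "y \<in> V" for w y
        using that by (rule rep)
    qed
  qed
qed

section \<open>The action on the product\<close>

text \<open>
  The properties of \<open>H\<close> and of its action \<open>A\<close> on the torus from which the assertions about the product follow. The exponent map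
  \<open>J\<close> identifies \<open>H / Z\<close> with the integers modulo \<open>q\<close> and drives the action on the curve.
\<close>

locale torus_curve_action =
  torus_curve q \<zeta> c r + group G
  for q :: nat and \<zeta> c :: "'k::alg_closed_field" and r :: nat and G :: "'k point monoid" (structure) +
  fixes n :: nat and H T Z :: "'k point set" and A :: "'k point \<Rightarrow> 'k point \<Rightarrow> 'k point"
    and J :: "'k point \<Rightarrow> nat"
  assumes H_sub: "subgroup H G" and Z_sub: "subgroup Z G" and T_sub: "subgroup T G"
    and T_Z: "T \<subseteq> Z" and Z_H: "Z \<subseteq> H" and Z_proper: "Z \<noteq> H"
    and A_closed: "h \<in> H \<Longrightarrow> x \<in> S \<Longrightarrow> A h x \<in> S"
    and A_one: "x \<in> S \<Longrightarrow> A \<one> x = x"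
    and A_mult: "h \<in> H \<Longrightarrow> k \<in> H \<Longrightarrow> x \<in> S \<Longrightarrow> A (h \<otimes> k) x = A h (A k x)"
    and J_mult: "h \<in> H \<Longrightarrow> k \<in> H \<Longrightarrow> J (h \<otimes> k) mod q = (J h + J k) mod q"
    and J_Z: "h \<in> H \<Longrightarrow> q dvd J h \<longleftrightarrow> h \<in> Z"
    and J_surj: "\<exists>h\<in>H. J h mod q = j mod q"
    and A_transitive: "x \<in> S \<Longrightarrow> y \<in> S \<Longrightarrow> \<exists>t\<in>T. A t x = y"
    and A_faithful: "h \<in> H \<Longrightarrow> (\<And>x. x \<in> S \<Longrightarrow> A h x = x) \<Longrightarrow> h \<in> Z"
    and A_finite: "finite {h \<in> H. \<forall>x\<in>S. A h x = x}"
    and A_regular: "i < 2 * r \<Longrightarrow>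
      (\<lambda>p. A (fst p) (tor (snd p)) i) \<in> agree_on (H \<times> V) (bisum (regfun n H) (regfun m V))"
    and J_regular: "(\<lambda>h. if J h mod q = j then 1 else 0) \<in> regfun n H"
    and inv_regular: "i < n \<Longrightarrow> (\<lambda>h. (inv h) i) \<in> regfun n H"
begin

lemma H_carrier: "h \<in> H \<Longrightarrow> h \<in> carrier G"
  using subgroup.mem_carrier[OF H_sub] .

lemma H_mult: "h \<in> H \<Longrightarrow> k \<in> H \<Longrightarrow> h \<otimes> k \<in> H"
  using subgroup.m_closed[OF H_sub] .

lemma H_inv: "h \<in> H \<Longrightarrow> inv h \<in> H"
  using subgroup.m_inv_closed[OF H_sub] .

lemma H_one: "\<one> \<in> H"
  using subgroup.one_closed[OF H_sub] .

lemma T_H: "t \<in> T \<Longrightarrow> t \<in> H"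
  using T_Z Z_H by blast

definition act :: "'k point \<Rightarrow> 'k point \<Rightarrow> 'k point" where
  "act h y = mk (A h (tor y)) (s (J h) (y r))"

lemma act_V: "h \<in> H \<Longrightarrow> y \<in> V \<Longrightarrow> act h y \<in> V"
  unfolding act_def by (intro mk_V A_closed tor_S g_s_nonzero V_nonzero)

lemma act_r: "act h y r = s (J h) (y r)"
  by (simp add: act_def)

lemma tor_act: "h \<in> H \<Longrightarrow> y \<in> V \<Longrightarrow> tor (act h y) = A h (tor y)"
  unfolding act_def by (intro tor_mk A_closed tor_S)

lemma s_Z: "z \<in> Z \<Longrightarrow> s (J z) v = v"
  using J_Z[of z] Z_H s_mod[of "J z" v] by (auto simp: dvd_eq_mod_eq_0)

lemma act_one: "y \<in> V \<Longrightarrow> act \<one> y = y"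
  using s_Z[OF subgroup.one_closed[OF Z_sub]] by (simp add: act_def A_one tor_S mk_tor)

lemma act_mult:
  assumes "h \<in> H" "k \<in> H" "y \<in> V"
  shows "act (h \<otimes> k) y = act h (act k y)"
proof -
  have "s (J (h \<otimes> k)) (y r) = s (J h + J k) (y r)"
    using s_mod[of "J (h \<otimes> k)" "y r"] s_mod[of "J h + J k" "y r"] J_mult[OF assms(1,2)] by simp
  then show ?thesis
    unfolding act_def[of "h \<otimes> k"] act_def[of h] act_r tor_act[OF assms(2,3)]
    using assms by (simp add: A_mult tor_S s_s V_nonzero)
qed

abbreviation Bi where "Bi \<equiv> bisum (regfun n H) (regfun m V)"

sublocale Bi: function_algebra "agree_on (H \<times> V) Bi"
  by (intro function_algebra_agree_on function_algebra_bisum regfun.const regfun.mult function_algebra_polyfun)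

text \<open>
  On the curve, \<open>h\<close> acts by one of the \<open>q\<close> maps \<open>s j\<close>, depending on the coset of \<open>Z\<close>. The action is a sum over \<open>j\<close> of regular
  functions on \<open>V\<close> multiplied by the indicator functions of these cosets.
\<close>

lemma act_regular:
  assumes "i < m"
  shows "(\<lambda>p. act (fst p) (snd p) i) \<in> agree_on (H \<times> V) Bi"
proof -
  have J_sum: "(\<lambda>p. F (J (fst p) mod q) (snd p)) \<in> agree_on (H \<times> V) Bi" if "\<And>k. F k \<in> regfun m V" for F
  proof -
    have "(\<lambda>p. \<Sum>k<q. (if J (fst p) mod q = k then 1 else 0) * F k (snd p)) \<in> agree_on (H \<times> V) Bi"
      by (intro Bi.sum agree_on_incl bisum.prod J_regular that)
    then show ?thesis
    proof (rule agree_on_cong)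
      fix p :: "'k point \<times> 'k point"
      have "(\<Sum>k<q. (if J (fst p) mod q = k then 1 else 0) * F k (snd p)) =
        (\<Sum>k<q. if J (fst p) mod q = k then F k (snd p) else 0)"
        by (intro sum.cong) auto
      also have "\<dots> = F (J (fst p) mod q) (snd p)" using q_pos by simp
      finally show "F (J (fst p) mod q) (snd p) = (\<Sum>k<q. (if J (fst p) mod q = k then 1 else 0) * F k (snd p))" ..
    qed
  qed
  consider "i < r" | "i = r" | "i = Suc r" using assms by linarith
  then show ?thesis
  proof cases
    case 1
    then show ?thesis using A_regular[of i] by (simp add: act_def mk_def)
  next
    case 2
    then show ?thesis using J_sum[of "\<lambda>k y. s k (y r)", OF s_regular] by (simp add: act_r s_mod)
  next
    case 3
    have "(\<lambda>p. (\<Prod>j<r. A (fst p) (tor (snd p)) (r + j)) * (1 / g (s (J (fst p) mod q) (snd p r)))) \<in> agree_on (H \<times> V) Bi"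
      by (intro Bi.mult Bi.prod A_regular J_sum[of "\<lambda>k y. 1 / g (s k (y r))"] inv_g_s_regular) auto
    then show ?thesis using 3 by (simp add: act_def mk_def s_mod)
  qed
qed

lemma act_pullback: "f \<in> regfun m V \<Longrightarrow> (\<lambda>p. f (act (fst p) (snd p))) \<in> agree_on (H \<times> V) Bi"
proof -
  assume f: "f \<in> regfun m V"
  interpret B: function_algebra Bi
    by (intro function_algebra_agree_on function_algebra_bisum regfun.const regfun.mult function_algebra_polyfun)
  show ?thesis
    by (rule B.regfun_subst[OF f act_regular]) (auto intro: act_V)
qed

lemma Bi_fix_fst:
  assumes "F \<in> agree_on (H \<times> V) Bi" "h \<in> H"
  shows "(\<lambda>y. F (h, y)) \<in> regfun m V"
proof -
  obtain E where E: "E \<in> Bi" "\<And>p. p \<in> H \<times> V \<Longrightarrow> F p = E p"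
    using assms(1) by (rule agree_onE) (rule that)
  have "(\<lambda>y. E (h, y)) \<in> regfun m V"
    using E(1) by induction (auto intro: regfun.mult regfun.const regfun.add)
  then show ?thesis by (rule agree_on_cong) (simp add: E(2) assms(2))
qed

lemma Bi_fix_snd_inv:
  assumes "F \<in> agree_on (H \<times> V) Bi" "y \<in> V"
  shows "(\<lambda>h. F (inv h, y)) \<in> regfun n H"
proof -
  obtain E where E: "E \<in> Bi" "\<And>p. p \<in> H \<times> V \<Longrightarrow> F p = E p"
    using assms(1) by (rule agree_onE) (rule that)
  have "(\<lambda>h. E (h, y)) \<in> regfun n H"
    using E(1) by induction (auto intro: regfun.mult regfun.const regfun.add)
  then have "(\<lambda>h. E (inv h, y)) \<in> regfun n H"
    by (rule polyfun.regfun_subst[where \<phi> = "m_inv G"]) (auto intro: inv_regular H_inv)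
  then show ?thesis by (rule agree_on_cong) (simp add: E(2) assms(2) H_inv)
qed

text \<open>The inverse makes this a left action on functions.\<close>

definition \<rho> :: "'k point \<Rightarrow> ('k point \<Rightarrow> 'k) \<Rightarrow> 'k point \<Rightarrow> 'k" where
  "\<rho> h = restrict (\<lambda>f. restrict (\<lambda>y. f (act (inv h) y)) V) (carrier R)"

lemma \<rho>_apply: "f \<in> carrier R \<Longrightarrow> y \<in> V \<Longrightarrow> \<rho> h f y = f (act (inv h) y)"
  by (simp add: \<rho>_def)

lemma carrier_R_regfun: "f \<in> carrier R \<Longrightarrow> f \<in> regfun m V"
  by (simp add: carrier_coord_ring_iff)

lemma \<rho>_closed: "h \<in> H \<Longrightarrow> f \<in> carrier R \<Longrightarrow> \<rho> h f \<in> carrier R"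
  using Bi_fix_fst[OF act_pullback[OF carrier_R_regfun] H_inv]
  by (simp add: \<rho>_def coord_ring_memI)

lemma \<rho>_mult:
  assumes "h \<in> H" "k \<in> H" "f \<in> carrier R"
  shows "\<rho> (h \<otimes> k) f = \<rho> h (\<rho> k f)"
proof (rule coord_ring_eqI)
  fix y assume y: "y \<in> V"
  show "\<rho> (h \<otimes> k) f y = \<rho> h (\<rho> k f) y"
    using assms y by (simp add: \<rho>_apply \<rho>_closed act_V H_inv inv_mult_group H_carrier act_mult)
qed (use assms in \<open>auto intro: \<rho>_closed H_mult\<close>)

lemma \<rho>_one: "f \<in> carrier R \<Longrightarrow> \<rho> \<one> f = f"
  by (rule coord_ring_eqI) (auto simp: \<rho>_apply act_one intro: \<rho>_closed H_one)

lemma \<rho>_Bij: "h \<in> H \<Longrightarrow> \<rho> h \<in> Bij (carrier R)"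
proof -
  assume h: "h \<in> H"
  have "bij_betw (\<rho> h) (carrier R) (carrier R)"
    by (rule bij_betw_byWitness[where f' = "\<rho> (inv h)"])
       (use h in \<open>auto simp: \<rho>_closed H_inv \<rho>_one H_carrier simp flip: \<rho>_mult\<close>)
  then show ?thesis by (simp add: Bij_def \<rho>_def)
qed

abbreviation HG where "HG \<equiv> G\<lparr>carrier := H\<rparr>"

lemma group_HG: "group HG"
  using subgroup.subgroup_is_group[OF H_sub is_group] .

lemma \<rho>_group_action: "group_action HG (carrier R) \<rho>"
proof -
  have "\<rho> \<in> hom HG (BijGroup (carrier R))"
  proof (rule homI)
    show "\<rho> h \<in> carrier (BijGroup (carrier R))" if "h \<in> carrier HG" for h
      using that by (simp add: BijGroup_def \<rho>_Bij)
    fix h k assume "h \<in> carrier HG" "k \<in> carrier HG"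
    then have hk: "h \<in> H" "k \<in> H" by auto
    have "\<rho> (h \<otimes> k) = compose (carrier R) (\<rho> h) (\<rho> k)"
    proof
      fix f
      show "\<rho> (h \<otimes> k) f = compose (carrier R) (\<rho> h) (\<rho> k) f"
        using \<rho>_mult[OF hk] by (cases "f \<in> carrier R") (simp_all add: compose_def \<rho>_def)
    qed
    then show "\<rho> (h \<otimes>\<^bsub>HG\<^esub> k) = \<rho> h \<otimes>\<^bsub>BijGroup (carrier R)\<^esub> \<rho> k"
      using hk by (simp add: BijGroup_def \<rho>_Bij)
  qed
  then show ?thesis
    unfolding group_action_def group_hom_def group_hom_axioms_def
    using group_HG group_BijGroup by blast
qed

lemma \<rho>_ring_iso: "h \<in> H \<Longrightarrow> \<rho> h \<in> ring_iso R R"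
proof -
  assume h: "h \<in> H"
  interpret R: cring R by (rule cring_coord_ring)
  have "\<rho> h \<in> ring_hom R R"
  proof (rule ring_hom_memI)
    fix f f' assume f: "f \<in> carrier R" "f' \<in> carrier R"
    show "\<rho> h (f \<otimes>\<^bsub>R\<^esub> f') = \<rho> h f \<otimes>\<^bsub>R\<^esub> \<rho> h f'"
      by (rule coord_ring_eqI) (use h f in \<open>auto simp: \<rho>_apply act_V H_inv \<rho>_closed\<close>)
    show "\<rho> h (f \<oplus>\<^bsub>R\<^esub> f') = \<rho> h f \<oplus>\<^bsub>R\<^esub> \<rho> h f'"
      by (rule coord_ring_eqI) (use h f in \<open>auto simp: \<rho>_apply act_V H_inv \<rho>_closed\<close>)
  next
    show "\<rho> h \<one>\<^bsub>R\<^esub> = \<one>\<^bsub>R\<^esub>"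
      by (rule coord_ring_eqI) (use h in \<open>auto simp: \<rho>_apply act_V H_inv \<rho>_closed\<close>)
  qed (use h \<rho>_closed in auto)
  then show ?thesis
    using \<rho>_Bij[OF h] by (simp add: ring_iso_def Bij_def)
qed

lemma \<rho>_const: "h \<in> H \<Longrightarrow> \<rho> h (\<lambda>x\<in>V. a) = (\<lambda>x\<in>V. a)"
proof (rule coord_ring_eqI)
  assume h: "h \<in> H"
  show const: "(\<lambda>x\<in>V. a) \<in> carrier R" by (intro coord_ring_memI regfun.const)
  then show "\<rho> h (\<lambda>x\<in>V. a) \<in> carrier R" using h by (intro \<rho>_closed)
  show "\<rho> h (\<lambda>x\<in>V. a) y = (\<lambda>x\<in>V. a) y" if "y \<in> V" for y
    using that h const by (simp add: \<rho>_apply act_V H_inv)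
qed

text \<open>
  The linear span of the translates of \<open>f\<close>. Membership depends only on the values on \<open>V\<close>.
\<close>

inductive_set orbit_span :: "('k point \<Rightarrow> 'k) \<Rightarrow> ('k point \<Rightarrow> 'k) set" for f where
  orbit: "h \<in> H \<Longrightarrow> (\<And>y. y \<in> V \<Longrightarrow> w y = f (act h y)) \<Longrightarrow> w \<in> orbit_span f"
| lin: "w1 \<in> orbit_span f \<Longrightarrow> w2 \<in> orbit_span f \<Longrightarrow> (\<And>y. y \<in> V \<Longrightarrow> w y = a * w1 y + b * w2 y) \<Longrightarrow> w \<in> orbit_span f"

lemma orbit_span_act:
  assumes "w \<in> orbit_span f" "h \<in> H"
  shows "(\<lambda>y. w (act h y)) \<in> orbit_span f"
  using assms(1)
proof induction
  case (orbit k w)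
  show ?case
    by (rule orbit_span.orbit[OF H_mult[OF orbit(1) assms(2)]])
       (simp add: orbit act_V act_mult assms(2))
next
  case (lin w1 w2 w a b)
  show ?case
    by (rule orbit_span.lin[OF lin.IH, of _ a b]) (simp add: lin.hyps act_V assms(2))
qed

lemma orbit_span_regular:
  assumes "f \<in> regfun m V" "w \<in> orbit_span f"
  shows "w \<in> regfun m V"
  using assms(2)
proof induction
  case (orbit h w)
  show ?case
    by (rule agree_on_cong[OF Bi_fix_fst[OF act_pullback[OF assms(1)] orbit(1)]]) (simp add: orbit)
next
  case (lin w1 w2 w a b)
  have "(\<lambda>y. a * w1 y + b * w2 y) \<in> regfun m V"
    by (intro regfun.add regfun.mult regfun.const lin.IH)
  then show ?case by (rule agree_on_cong) (rule lin.hyps)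
qed

text \<open>
  Since \<open>f (act h y)\<close> is a finite sum of products of regular functions of \<open>h\<close> and of \<open>y\<close>, the translates of \<open>f\<close> span a space of
  finite dimension. In a basis that is dual to evaluations at points, the matrix coefficients of the action are values at these
  points of translated basis functions, hence regular on \<open>H\<close>.
\<close>

lemma \<rho>_rational: "rational_action n H m V \<rho>"
  unfolding rational_action_def
proof
  fix f assume fR: "f \<in> carrier R"
  then have f: "f \<in> regfun m V" by (rule carrier_R_regfun)
  obtain F where F: "F \<in> Bi" "\<And>p. p \<in> H \<times> V \<Longrightarrow> f (act (fst p) (snd p)) = F p"
    using act_pullback[OF f] by (rule agree_onE) (rule that)
  obtain U e where U: "finite U" "U \<subseteq> (\<lambda>a. restrict a H) ` regfun n H" "\<forall>\<chi>. e \<chi> \<in> regfun m V"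
    "\<forall>h\<in>H. \<forall>y. F (h, y) = (\<Sum>\<chi>\<in>U. \<chi> h * e \<chi> y)"
    using bisum_collect[OF F(1) function_algebra_agree_on[OF function_algebra_polyfun], of H]
    by (elim exE conjE) (rule that; assumption)
  have span: "\<exists>d. \<forall>y\<in>V. w y = (\<Sum>\<chi>\<in>U. d \<chi> * e \<chi> y)" if "w \<in> orbit_span f" for w
    using that
  proof induction
    case (orbit h w)
    show ?case
    proof (intro exI[of _ "\<lambda>\<chi>. \<chi> h"] ballI)
      fix y assume y: "y \<in> V"
      then show "w y = (\<Sum>\<chi>\<in>U. \<chi> h * e \<chi> y)"
        using U(4) orbit F(2)[of "(h, y)"] by simp
    qed
  next
    case (lin w1 w2 w a b)
    then obtain d1 d2 where d: "\<forall>y\<in>V. w1 y = (\<Sum>\<chi>\<in>U. d1 \<chi> * e \<chi> y)" "\<forall>y\<in>V. w2 y = (\<Sum>\<chi>\<in>U. d2 \<chi> * e \<chi> y)"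
      by auto
    show ?case
    proof (intro exI[of _ "\<lambda>\<chi>. a * d1 \<chi> + b * d2 \<chi>"] ballI)
      fix y assume y: "y \<in> V"
      then show "w y = (\<Sum>\<chi>\<in>U. (a * d1 \<chi> + b * d2 \<chi>) * e \<chi> y)"
        using d lin.hyps by (simp add: algebra_simps sum.distrib sum_distrib_left)
    qed
  qed
  have lin: "(\<lambda>y. a * w y + b * w' y) \<in> orbit_span f" if "w \<in> orbit_span f" "w' \<in> orbit_span f" for a b w w'
    using that by (rule orbit_span.lin) simp
  have "\<exists>D u. finite D \<and> D \<subseteq> V \<and> (\<forall>x\<in>D. u x \<in> orbit_span f) \<and>
    (\<forall>x\<in>D. \<forall>y\<in>D. u x y = (if x = y then 1 else 0)) \<and>
    (\<forall>w\<in>orbit_span f. \<forall>y\<in>V. w y = (\<Sum>x\<in>D. w x * u x y))"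
  proof (rule dual_points[where I = U and e = e])
    show "(\<lambda>y. a * w y + b * w' y) \<in> orbit_span f" if "w \<in> orbit_span f" "w' \<in> orbit_span f" for a b w w'
      using that by (rule lin)
    show "\<exists>d. \<forall>y\<in>V. w y = (\<Sum>i\<in>U. d i * e i y)" if "w \<in> orbit_span f" for w
      using that by (rule span)
  qed (rule U(1))
  then obtain D u where u: "finite D" "D \<subseteq> V" "\<forall>x\<in>D. u x \<in> orbit_span f"
    "\<forall>x\<in>D. \<forall>y\<in>D. u x y = (if x = y then 1 else 0)"
    "\<forall>w\<in>orbit_span f. \<forall>y\<in>V. w y = (\<Sum>x\<in>D. w x * u x y)"
    by (elim exE conjE) (rule that; assumption)
  define bas where "bas x = restrict (u x) V" for x
  have bas: "bas x y = u x y" if "y \<in> V" for x y using that by (simp add: bas_def)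
  have bas_D: "bas x y = (if x = y then 1 else 0)" if "x \<in> D" "y \<in> D" for x y
    using that u(2,4) bas by auto
  have inj: "inj_on bas D"
  proof (rule inj_onI)
    fix x y assume xy: "x \<in> D" "y \<in> D" and eq: "bas x = bas y"
    have "(if x = y then 1 else 0) = (1 :: 'k)"
      using bas_D[OF xy] bas_D[OF xy(2,2)] unfolding eq by simp
    then show "x = y" by (simp split: if_splits)
  qed
  define pt where "pt = inv_into D bas"
  have pt: "pt (bas x) = x" if "x \<in> D" for x
    unfolding pt_def using inj that by (rule inv_into_f_f)
  have sum_bas: "(\<Sum>b\<in>bas ` D. E b) = (\<Sum>x\<in>D. E (bas x))" for E :: "_ \<Rightarrow> 'k"
    using inj by (simp add: sum.reindex)
  have w_eq: "w y = (\<Sum>b\<in>bas ` D. w (pt b) * b y)" if "w \<in> orbit_span f" "y \<in> V" for w y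
    unfolding sum_bas using bspec[OF bspec[OF u(5) that(1)] that(2)] bas[OF that(2)] pt by simp
  have bas_span: "bas x \<in> orbit_span f" if "x \<in> D" for x
    using orbit_span.lin[of "u x" f "u x" "bas x" 1 0] u(3) that bas by simp
  show "\<exists>B. finite B \<and> B \<subseteq> carrier R \<and>
      (\<forall>a. (\<forall>x\<in>V. (\<Sum>b\<in>B. a b * b x) = 0) \<longrightarrow> (\<forall>b\<in>B. a b = 0)) \<and>
      (\<exists>a. \<forall>x\<in>V. f x = (\<Sum>b\<in>B. a b * b x)) \<and>
      (\<exists>c. (\<forall>b\<in>B. \<forall>b'\<in>B. c b b' \<in> carrier (coord_ring n H)) \<and>
        (\<forall>\<sigma>\<in>H. \<forall>b\<in>B. \<forall>x\<in>V. \<rho> \<sigma> b x = (\<Sum>b'\<in>B. c b b' \<sigma> * b' x)))"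
  proof (intro exI[of _ "bas ` D"] conjI allI impI)
    show "finite (bas ` D)" using u(1) by simp
    show B: "bas ` D \<subseteq> carrier R"
      using orbit_span_regular[OF f] u(3) unfolding bas_def by (auto intro: coord_ring_memI)
    show "\<forall>b\<in>bas ` D. a b = 0" if a: "\<forall>x\<in>V. (\<Sum>b\<in>bas ` D. a b * b x) = 0" for a
    proof
      fix b assume "b \<in> bas ` D"
      then obtain x where x: "x \<in> D" "b = bas x" by auto
      have "0 = (\<Sum>y\<in>D. a (bas y) * bas y x)"
        using a x(1) u(2) unfolding sum_bas by auto
      also have "\<dots> = (\<Sum>y\<in>D. if y = x then a (bas x) else 0)"
        using x(1) bas_D by (intro sum.cong) auto
      also have "\<dots> = a b" using u(1) x by simp
      finally show "a b = 0" by simp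
    qed
    have "f \<in> orbit_span f"
      by (rule orbit_span.orbit[OF H_one]) (simp add: act_one)
    then show "\<exists>a. \<forall>x\<in>V. f x = (\<Sum>b\<in>bas ` D. a b * b x)"
      using w_eq by (intro exI[of _ "\<lambda>b. f (pt b)"]) blast
    show "\<exists>c. (\<forall>b\<in>bas ` D. \<forall>b'\<in>bas ` D. c b b' \<in> carrier (coord_ring n H)) \<and>
        (\<forall>\<sigma>\<in>H. \<forall>b\<in>bas ` D. \<forall>x\<in>V. \<rho> \<sigma> b x = (\<Sum>b'\<in>bas ` D. c b b' \<sigma> * b' x))"
    proof (intro exI[of _ "\<lambda>b b'. restrict (\<lambda>h. b (act (inv h) (pt b'))) H"] conjI ballI)
      fix b b' assume b: "b \<in> bas ` D" "b' \<in> bas ` D"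
      then have "pt b' \<in> V" using u(2) pt by auto
      moreover have "b \<in> regfun m V" using b(1) B carrier_R_regfun by blast
      ultimately have "(\<lambda>h. b (act (inv h) (pt b'))) \<in> regfun n H"
        using Bi_fix_snd_inv[OF act_pullback] by simp
      then show "restrict (\<lambda>h. b (act (inv h) (pt b'))) H \<in> carrier (coord_ring n H)"
        by (rule coord_ring_memI)
    next
      fix h b x assume h: "h \<in> H" and b: "b \<in> bas ` D" and x: "x \<in> V"
      have "(\<lambda>y. b (act (inv h) y)) \<in> orbit_span f"
        using b bas_span by (intro orbit_span_act H_inv h) auto
      from w_eq[OF this x] have "b (act (inv h) x) = (\<Sum>b'\<in>bas ` D. b (act (inv h) (pt b')) * b' x)" .
      moreover have "\<rho> h b x = b (act (inv h) x)"
        using b B x by (intro \<rho>_apply) auto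
      ultimately show "\<rho> h b x = (\<Sum>b'\<in>bas ` D. restrict (\<lambda>h. b (act (inv h) (pt b'))) H h * b' x)"
        using h by simp
    qed
  qed
qed

lemma \<rho>_regular_action: "regular_action n HG m V \<rho>"
  unfolding regular_action_def using \<rho>_group_action \<rho>_ring_iso \<rho>_const \<rho>_rational by simp

lemma coord_in_R: "f \<in> regfun m V \<Longrightarrow> restrict f V \<in> carrier R"
  by (rule coord_ring_memI)

lemma \<rho>_effective: "effective_action HG R \<rho>"
proof -
  have "kernel HG (BijGroup (carrier R)) \<rho> \<subseteq> {h \<in> H. \<forall>x\<in>S. A h x = x}"
  proof
    fix h assume "h \<in> kernel HG (BijGroup (carrier R)) \<rho>"
    then have h: "h \<in> H" and \<rho>h: "\<rho> h = (\<lambda>f\<in>carrier R. f)"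
      by (auto simp: kernel_def BijGroup_def)
    have "A h x = x" if x: "x \<in> S" for x
    proof -
      define y where "y = mk x 0"
      have y: "y \<in> V" unfolding y_def using x by (simp add: mk_V)
      have "act (inv h) y i = y i" if i: "i < m" for i
      proof -
        let ?f = "restrict (\<lambda>y. y i) V"
        have f: "?f \<in> carrier R" by (intro coord_in_R regfun_coord i)
        have "\<rho> h ?f y = ?f y" using f by (simp add: \<rho>h)
        then show ?thesis using f h y by (simp add: \<rho>_apply act_V H_inv)
      qed
      moreover have "act (inv h) y i = y i" if "\<not> i < m" for i
        using act_V[OF H_inv[OF h] y] y that by (simp add: V_iff affine_space_def)
      ultimately have "act (inv h) y = y" by blast
      then have "A (inv h) x = x"
        using tor_act[OF H_inv[OF h] y] x by (simp add: y_def tor_mk)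
      then have "A h x = A (h \<otimes> inv h) x" using h x by (simp add: A_mult H_inv)
      then show ?thesis using h x by (simp add: H_carrier A_one)
    qed
    then show "h \<in> {h \<in> H. \<forall>x\<in>S. A h x = x}" using h by simp
  qed
  then show ?thesis
    unfolding effective_action_def using A_finite by (rule finite_subset)
qed

end

section \<open>Primes of height one and valuations\<close>

text \<open>
  If some power of each nonzero \<open>f\<close> is a power of \<open>\<pi>\<close> times an element outside \<open>p\<close>, there is no prime strictly between \<open>0\<close> and
  \<open>p\<close>: such a prime contains \<open>\<pi>\<close>, hence a power of every element of \<open>p\<close>. Powers are needed for \<open>H\<close>-invariants, where
  \<open>\<pi>\<close> is a norm and generates \<open>p\<close> only up to radical.
\<close>

lemma (in domain) height_eq_one:
  assumes p: "primeideal p R" and \<pi>: "\<pi> \<in> p" "\<pi> \<noteq> \<zero>"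
    and fac: "\<And>f. f \<in> carrier R \<Longrightarrow> f \<noteq> \<zero> \<Longrightarrow>
      \<exists>e>0. \<exists>(k::nat) h. h \<in> carrier R \<and> h \<notin> p \<and> f [^] (e::nat) = \<pi> [^] k \<otimes> h"
  shows "height R p = 1"
proof -
  interpret p: primeideal p R by (rule p)
  have pow_mem: "x \<in> Q" if "primeideal Q R" "x \<in> carrier R" "x [^] (k::nat) \<in> Q" for Q x k
  proof -
    interpret Q: primeideal Q R by (rule that(1))
    show ?thesis using that(3)
    proof (induction k)
      case 0
      then have "Q = carrier R" using Q.one_imp_carrier by simp
      then show ?case using Q.I_notcarr by simp
    next
      case (Suc k)
      then show ?case using Q.I_prime[of "x [^] k" x] that(2) by auto
    qed
  qed
  have max: "Q = p" if Q: "primeideal Q R" "Q \<subseteq> p" "Q \<noteq> {\<zero>}" for Q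
  proof
    interpret Q: primeideal Q R by (rule Q(1))
    have "\<zero> \<in> Q" using Q.zero_closed .
    then obtain f where f: "f \<in> Q" "f \<noteq> \<zero>" using Q(3) by blast
    have fR: "f \<in> carrier R" using f(1) Q.Icarr by blast
    obtain e k h where h: "e > 0" "h \<in> carrier R" "h \<notin> p" "f [^] (e::nat) = \<pi> [^] (k::nat) \<otimes> h"
      using fac[OF fR f(2)] by blast
    have \<pi>R: "\<pi> \<in> carrier R" using \<pi>(1) p.Icarr by blast
    have "f [^] e = f [^] (e - 1) \<otimes> f" using h(1) nat_pow_Suc[of f "e - 1"] by simp
    then have "f [^] e \<in> Q" using Q.I_l_closed[OF f(1)] fR by simp
    then have "\<pi> [^] k \<in> Q"
      using Q.I_prime[of "\<pi> [^] k" h] h(2-4) \<pi>R Q(2) by auto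
    then have \<pi>Q: "\<pi> \<in> Q" using pow_mem[OF Q(1) \<pi>R] by blast
    show "p \<subseteq> Q"
    proof
      fix x assume x: "x \<in> p"
      then have xR: "x \<in> carrier R" using p.Icarr by blast
      show "x \<in> Q"
      proof (cases "x = \<zero>")
        case False
        obtain e k h where h: "e > 0" "h \<in> carrier R" "h \<notin> p" "x [^] (e::nat) = \<pi> [^] (k::nat) \<otimes> h"
          using fac[OF xR False] by blast
        have "x [^] e = x [^] (e - 1) \<otimes> x" using h(1) nat_pow_Suc[of x "e - 1"] by simp
        then have "x [^] e \<in> p" using p.I_l_closed[OF x] xR by simp
        then have "k \<noteq> 0" using h by (intro notI) simp
        then have "\<pi> [^] k = \<pi> [^] (k - 1) \<otimes> \<pi>" using nat_pow_Suc[of \<pi> "k - 1"] by simp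
        then have "\<pi> [^] k \<in> Q" using Q.I_l_closed[OF \<pi>Q] \<pi>R by simp
        then have "x [^] e \<in> Q" unfolding h(4) by (rule Q.I_r_closed[OF _ h(2)])
        then show ?thesis by (rule pow_mem[OF Q(1) xR])
      qed (simp add: \<open>\<zero> \<in> Q\<close>)
    qed
  qed (rule Q(2))
  let ?L = "{enat l |l. \<exists>C. (\<forall>i\<le>l. primeideal (C i) R) \<and> (\<forall>i<l. C i \<subset> C (Suc i)) \<and> C l = p}"
  have "l \<le> 1" if C: "\<forall>i\<le>l. primeideal (C i) R" "\<forall>i<l. C i \<subset> C (Suc i)" "C l = p" for l C
  proof (rule ccontr)
    assume "\<not> l \<le> 1"
    then obtain l' where l: "l = Suc (Suc l')" by (metis Suc_le_eq less_eq_Suc_le not_less_eq_eq nat.exhaust One_nat_def le0)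
    have *: "primeideal (C (Suc l')) R" "primeideal (C l') R" "C l' \<subset> C (Suc l')" "C (Suc l') \<subset> p"
      using C l by auto
    have "\<zero> \<in> C l'"
      by (rule additive_subgroup.zero_closed[OF ideal.axioms(1)[OF primeideal.axioms(1)[OF *(2)]]])
    then have "C (Suc l') \<noteq> {\<zero>}" using *(3) by auto
    then have "C (Suc l') = p" using *(1,4) by (intro max) auto
    then show False using *(4) by simp
  qed
  then have "x \<le> 1" if "x \<in> ?L" for x using that by (auto simp: one_enat_def)
  then have le: "Sup ?L \<le> 1" by (rule Sup_least)
  have "enat 1 \<in> ?L"
  proof -
    define C where "C i = (if i = 0 then {\<zero>} else p)" for i :: nat
    have "\<forall>i\<le>1. primeideal (C i) R" using zeroprimeideal p by (simp add: C_def)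
    moreover have "\<forall>i<1. C i \<subset> C (Suc i)" using \<pi> p.zero_closed by (auto simp: C_def)
    ultimately show ?thesis by (intro CollectI exI[of _ 1] exI[of _ C] conjI refl) (simp add: C_def)+
  qed
  then have "1 \<le> Sup ?L" unfolding one_enat_def by (rule Sup_upper)
  with le have "Sup ?L = 1" by (rule antisym)
  then show ?thesis by (simp only: height_def)
qed

lemma height_ge_two:
  assumes "primeideal p0 R" "primeideal p1 R" "primeideal p2 R" "p0 \<subset> p1" "p1 \<subset> p2"
  shows "height R p2 \<ge> 2"
proof -
  define C where "C i = (if i = 0 then p0 else if i = 1 then p1 else p2)" for i :: nat
  have "\<forall>i\<le>2. primeideal (C i) R" using assms by (simp add: C_def)
  moreover have "\<forall>i<2. C i \<subset> C (Suc i)" using assms by (simp add: C_def less_2_cases_iff)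
  moreover have "C 2 = p2" by (simp add: C_def)
  ultimately have "enat 2 \<in> {enat l |l. \<exists>C. (\<forall>i\<le>l. primeideal (C i) R) \<and> (\<forall>i<l. C i \<subset> C (Suc i)) \<and> C l = p2}"
    by (intro CollectI exI[of _ 2] exI[of _ C] conjI refl)
  then have "enat 2 \<le> height R p2" unfolding height_def by (rule Sup_upper)
  then show ?thesis by (simp add: numeral_eq_enat)
qed

lemma (in domain) prime_valuation_mult_ge_two:
  assumes p: "primeideal p R" and ab: "a \<in> p" "b \<in> p"
  shows "prime_valuation R p (a \<otimes> b) \<ge> 2"
proof -
  interpret p: primeideal p R by (rule p)
  define S where "S = carrier R - p"
  have S: "submonoid S R"
  proof
    show "\<one> \<in> S" using p.one_imp_carrier p.I_notcarr unfolding S_def by auto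
    show "x \<otimes> y \<in> S" if "x \<in> S" "y \<in> S" for x y
      using that p.I_prime[of x y] unfolding S_def by auto
  qed (simp add: S_def)
  let ?L = "localization R S"
  interpret L: cring ?L by (rule cring_localization[OF is_cring S])
  let ?X = "(\<lambda>b. fraction R S b \<one>) ` p"
  have one: "\<one> \<in> S" using S by (rule submonoid.one_closed)
  have X: "?X \<subseteq> carrier ?L"
  proof (rule image_subsetI)
    fix x assume "x \<in> p"
    then have "x \<in> carrier R" by (rule p.Icarr)
    then show "fraction R S x \<one> \<in> carrier ?L"
      unfolding localization_def partial_object.simps using one by blast
  qed
  define M where "M = genideal ?L ?X"
  have M: "ideal M ?L" unfolding M_def by (rule L.genideal_ideal[OF X])
  have X_M: "?X \<subseteq> M" unfolding M_def by (rule L.genideal_self[OF X])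
  have MM: "M [^]\<^bsub>ideals_set ?L\<^esub> (2::nat) = ideal_prod ?L (ideal_prod ?L (carrier ?L) M) M"
    by (simp add: numeral_2_eq_2 nat_pow_def ideals_set_def)
  have "fraction R S a \<one> = \<one>\<^bsub>?L\<^esub> \<otimes>\<^bsub>?L\<^esub> fraction R S a \<one>"
    using X ab(1) by (intro L.l_one[symmetric]) auto
  then have "fraction R S a \<one> \<in> ideal_prod ?L (carrier ?L) M"
    using ideal_prod.prod[of "\<one>\<^bsub>?L\<^esub>" "carrier ?L" "fraction R S a \<one>" M ?L] X_M ab(1) by auto
  then have "fraction R S a \<one> \<otimes>\<^bsub>?L\<^esub> fraction R S b \<one> \<in> M [^]\<^bsub>ideals_set ?L\<^esub> (2::nat)"
    unfolding MM using X_M ab(2) by (intro ideal_prod.prod) auto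
  moreover have "fraction R S a \<one> \<otimes>\<^bsub>?L\<^esub> fraction R S b \<one> = fraction R S (a \<otimes> b) \<one>"
    using localization_mult[OF is_cring S, of a b \<one> \<one>] ab p.Icarr one by simp
  ultimately have "enat 2 \<in> {enat l |l. fraction R S (a \<otimes> b) \<one> \<in> M [^]\<^bsub>ideals_set ?L\<^esub> l}"
    by auto
  then have "enat 2 \<le> prime_valuation R p (a \<otimes> b)"
    unfolding prime_valuation_def Let_def S_def[symmetric] M_def[symmetric] by (rule Sup_upper)
  then show ?thesis by (simp add: numeral_eq_enat)
qed

section \<open>Rings of invariants and the divisor \<open>v = 0\<close>\<close>

context torus_curve_action
begin

abbreviation Inv where "Inv \<Gamma> \<equiv> invariant_ring R \<rho> \<Gamma>"

lemma R_domain: "domain R"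
  by (rule domain_coord_ring)

sublocale R: domain R
  by (rule R_domain)

lemma Inv_carrier: "f \<in> carrier (Inv \<Gamma>) \<longleftrightarrow> f \<in> carrier R \<and> (\<forall>h\<in>\<Gamma>. \<rho> h f = f)"
  by (auto simp: invariant_ring_def)

lemma Inv_ops:
  "f \<otimes>\<^bsub>Inv \<Gamma>\<^esub> f' = f \<otimes>\<^bsub>R\<^esub> f'" "f \<oplus>\<^bsub>Inv \<Gamma>\<^esub> f' = f \<oplus>\<^bsub>R\<^esub> f'" "\<one>\<^bsub>Inv \<Gamma>\<^esub> = \<one>\<^bsub>R\<^esub>" "\<zero>\<^bsub>Inv \<Gamma>\<^esub> = \<zero>\<^bsub>R\<^esub>"
  by (simp_all add: invariant_ring_def)

lemma Inv_pow: "f [^]\<^bsub>Inv \<Gamma>\<^esub> (k::nat) = f [^]\<^bsub>R\<^esub> k"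
  by (simp add: invariant_ring_def nat_pow_def)

lemma Inv_empty: "Inv {} = R"
  by (simp add: invariant_ring_def)

lemma \<rho>_eq_iff:
  assumes "h \<in> H" "f \<in> carrier R"
  shows "\<rho> h f = f \<longleftrightarrow> (\<forall>y\<in>V. f (act (inv h) y) = f y)"
proof
  assume "\<rho> h f = f"
  then show "\<forall>y\<in>V. f (act (inv h) y) = f y" using assms \<rho>_apply by metis
next
  assume "\<forall>y\<in>V. f (act (inv h) y) = f y"
  then show "\<rho> h f = f" using assms by (intro coord_ring_eqI) (auto simp: \<rho>_apply \<rho>_closed)
qed

lemma Inv_subring:
  assumes "\<Gamma> \<subseteq> H"
  shows "subring (carrier (Inv \<Gamma>)) R"
proof (rule R.subringI)
  show "carrier (Inv \<Gamma>) \<subseteq> carrier R" by (auto simp: Inv_carrier)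
  have iff: "f \<in> carrier (Inv \<Gamma>) \<longleftrightarrow> f \<in> carrier R \<and> (\<forall>h\<in>\<Gamma>. \<forall>y\<in>V. f (act (inv h) y) = f y)" for f
    using assms \<rho>_eq_iff unfolding Inv_carrier by blast
  have actV: "act (inv h) y \<in> V" if "h \<in> \<Gamma>" "y \<in> V" for h y
    using that assms by (intro act_V H_inv) auto
  show "\<one>\<^bsub>R\<^esub> \<in> carrier (Inv \<Gamma>)" unfolding iff using actV by simp
  show "\<ominus>\<^bsub>R\<^esub> f \<in> carrier (Inv \<Gamma>)" if "f \<in> carrier (Inv \<Gamma>)" for f
    using that actV unfolding iff by (simp add: coord_ring_uminus)
  show "f \<otimes>\<^bsub>R\<^esub> f' \<in> carrier (Inv \<Gamma>)" "f \<oplus>\<^bsub>R\<^esub> f' \<in> carrier (Inv \<Gamma>)"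
    if "f \<in> carrier (Inv \<Gamma>)" "f' \<in> carrier (Inv \<Gamma>)" for f f'
    using that actV unfolding iff by simp_all
qed

lemma Inv_eq: "Inv \<Gamma> = R\<lparr>carrier := carrier (Inv \<Gamma>)\<rparr>"
  by (simp add: invariant_ring_def)

lemma Inv_domain: "\<Gamma> \<subseteq> H \<Longrightarrow> domain (Inv \<Gamma>)"
  using R.subring_is_domain[OF Inv_subring] Inv_eq by metis

lemma Inv_minus:
  assumes "\<Gamma> \<subseteq> H" "f \<in> carrier (Inv \<Gamma>)" "f' \<in> carrier (Inv \<Gamma>)" "y \<in> V"
  shows "(f \<ominus>\<^bsub>Inv \<Gamma>\<^esub> f') y = f y - f' y"
proof -
  interpret I: domain "Inv \<Gamma>" by (rule Inv_domain[OF assms(1)])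
  have "\<ominus>\<^bsub>Inv \<Gamma>\<^esub> f' \<oplus>\<^bsub>Inv \<Gamma>\<^esub> f' = \<zero>\<^bsub>Inv \<Gamma>\<^esub>" by (rule I.l_neg[OF assms(3)])
  from fun_cong[OF this, of y] have "(\<ominus>\<^bsub>Inv \<Gamma>\<^esub> f') y + f' y = 0"
    using assms(4) by (simp add: Inv_ops)
  then have "(\<ominus>\<^bsub>Inv \<Gamma>\<^esub> f') y = - f' y"
    by (rule eq_neg_iff_add_eq_0[THEN iffD2])
  then show ?thesis using assms(4) by (simp add: a_minus_def Inv_ops)
qed

definition vf where "vf = restrict (\<lambda>y. y r) V"

definition P where "P = {f \<in> carrier R. \<forall>y\<in>V. y r = 0 \<longrightarrow> f y = 0}"

lemma vf_apply: "y \<in> V \<Longrightarrow> vf y = y r"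
  by (simp add: vf_def)

lemma vf_R: "vf \<in> carrier R"
  unfolding vf_def by (intro coord_in_R v_regular)

lemma vf_P: "vf \<in> P"
  using vf_R by (simp add: P_def vf_apply)

definition x1 where "x1 = \<one>\<^bsub>split_torus r\<^esub>"

lemma x1_S: "x1 \<in> S"
  by (simp add: x1_def S_iff split_torus_def affine_space_def)

lemma exists_nonzero_v: "\<exists>v. v \<noteq> 0 \<and> g v \<noteq> 0"
proof (rule ccontr)
  assume "\<not> ?thesis"
  then have "[:0, 1:] * gpoly = 0"
    by (intro poly_zero_infinite[OF infinite_alg_closed]) (auto simp: poly_gpoly)
  then have "gpoly = 0" by simp
  then show False using poly_gpoly[of 0] by simp
qed

text \<open>The curve has a point other than \<open>v = 0\<close>.\<close>

lemma vf_nonzero: "vf \<noteq> \<zero>\<^bsub>R\<^esub>"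
proof
  assume eq: "vf = \<zero>\<^bsub>R\<^esub>"
  obtain v where v: "v \<noteq> 0" "g v \<noteq> 0" using exists_nonzero_v by auto
  have "mk x1 v \<in> V" using x1_S v(2) by (rule mk_V)
  then have "vf (mk x1 v) = 0" unfolding eq by simp
  then show False using \<open>mk x1 v \<in> V\<close> v(1) by (simp add: vf_apply)
qed

lemma at_zero_V: "y \<in> V \<Longrightarrow> mk (tor y) 0 \<in> V"
  by (simp add: mk_V tor_S)

lemma divide_R:
  assumes "f \<in> carrier R"
  shows "\<exists>f0\<in>carrier R. \<exists>f1\<in>carrier R. f = f0 \<oplus>\<^bsub>R\<^esub> vf \<otimes>\<^bsub>R\<^esub> f1 \<and> (\<forall>y\<in>V. f0 y = f (mk (tor y) 0))"
proof -
  obtain p where p: "p \<in> polyfun m" "\<And>y. y \<in> V \<Longrightarrow> f y = p y"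
    using carrier_R_regfun[OF assms] by (rule agree_onE) (rule that)
  obtain p1 where p1: "p1 \<in> polyfun m" "\<forall>y\<in>V. p y = p (mk (tor y) 0) + y r * p1 y"
    using divide_by_v[OF p(1)] by (elim bexE) (rule that)
  define f0 where "f0 = restrict (\<lambda>y. p y - y r * p1 y) V"
  define f1 where "f1 = restrict p1 V"
  have f0: "f0 \<in> carrier R" unfolding f0_def
    by (intro coord_in_R regfun.diff regfun.mult v_regular agree_on_incl p(1) p1(1))
  have f1: "f1 \<in> carrier R" unfolding f1_def by (intro coord_in_R agree_on_incl p1(1))
  have f0_eq: "f0 y = f (mk (tor y) 0)" if "y \<in> V" for y
    using bspec[OF p1(2) that] p(2)[OF at_zero_V[OF that]] that by (simp add: f0_def)
  have "f = f0 \<oplus>\<^bsub>R\<^esub> vf \<otimes>\<^bsub>R\<^esub> f1"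
    by (rule coord_ring_eqI) (use assms f0 f1 vf_R p(2) in \<open>auto simp: f0_def f1_def vf_apply\<close>)
  then show ?thesis using f0 f1 f0_eq by blast
qed

lemma P_factor:
  assumes "f \<in> P"
  shows "\<exists>f1\<in>carrier R. f = vf \<otimes>\<^bsub>R\<^esub> f1"
proof -
  have f: "f \<in> carrier R" using assms by (simp add: P_def)
  obtain f0 f1 where *: "f0 \<in> carrier R" "f1 \<in> carrier R" "f = f0 \<oplus>\<^bsub>R\<^esub> vf \<otimes>\<^bsub>R\<^esub> f1" "\<forall>y\<in>V. f0 y = f (mk (tor y) 0)"
    using divide_R[OF f] by blast
  have "f0 = \<zero>\<^bsub>R\<^esub>"
  proof (rule coord_ring_eqI[OF *(1) R.zero_closed])
    fix y assume y: "y \<in> V"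
    have "f (mk (tor y) 0) = 0" using assms at_zero_V[OF y] unfolding P_def by simp
    then show "f0 y = \<zero>\<^bsub>R\<^esub> y" using bspec[OF *(4) y] y by simp
  qed
  then show ?thesis using *(2,3) vf_R by (intro bexI[OF _ *(2)]) simp
qed

text \<open>
  A function lies in \<open>P\<close> if and only if its restriction to \<open>v = 0\<close>, extended constantly in \<open>v\<close>, is zero. These extensions are
  elements of the domain \<open>R\<close>.
\<close>

lemma P_prime: "primeideal P R"
proof (rule primeidealI)
  show "ideal P R"
  proof (rule idealI)
    show "subgroup P (add_monoid R)"
      by (rule R.add.subgroupI) (use vf_P in \<open>auto simp: P_def coord_ring_uminus a_inv_def[symmetric]\<close>)
  qed (auto simp: P_def R.ring_axioms)
  have "mk x1 0 \<in> V" using x1_S by (simp add: mk_V)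
  then have "\<one>\<^bsub>R\<^esub> \<notin> P" unfolding P_def by (auto intro!: bexI[of _ "mk x1 0"])
  then show "carrier R \<noteq> P" by auto
  fix a b assume a: "a \<in> carrier R" and b: "b \<in> carrier R" and ab: "a \<otimes>\<^bsub>R\<^esub> b \<in> P"
  obtain a0 where a0: "a0 \<in> carrier R" "\<forall>y\<in>V. a0 y = a (mk (tor y) 0)" using divide_R[OF a] by blast
  obtain b0 where b0: "b0 \<in> carrier R" "\<forall>y\<in>V. b0 y = b (mk (tor y) 0)" using divide_R[OF b] by blast
  have "a0 \<otimes>\<^bsub>R\<^esub> b0 = \<zero>\<^bsub>R\<^esub>"
  proof (rule coord_ring_eqI)
    fix y assume y: "y \<in> V"
    have "(a \<otimes>\<^bsub>R\<^esub> b) (mk (tor y) 0) = 0"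
      using ab at_zero_V[OF y] unfolding P_def by simp
    then show "(a0 \<otimes>\<^bsub>R\<^esub> b0) y = \<zero>\<^bsub>R\<^esub> y"
      using y a0(2) b0(2) at_zero_V[OF y] by simp
  qed (use a0 b0 in auto)
  then have disj: "a0 = \<zero>\<^bsub>R\<^esub> \<or> b0 = \<zero>\<^bsub>R\<^esub>" using a0(1) b0(1) by (rule R.integral)
  have P_mem: "f \<in> P" if "f \<in> carrier R" "\<forall>y\<in>V. \<zero>\<^bsub>R\<^esub> y = f (mk (tor y) 0)" for f
  proof -
    have "f y = 0" if y: "y \<in> V" "y r = 0" for y
      using bspec[OF \<open>\<forall>y\<in>V. \<zero>\<^bsub>R\<^esub> y = f (mk (tor y) 0)\<close> y(1)] mk_tor[OF y(1)] y by simp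
    then show ?thesis using \<open>f \<in> carrier R\<close> by (simp add: P_def)
  qed
  show "a \<in> P \<or> b \<in> P"
    using disj P_mem[OF a] P_mem[OF b] a0(2) b0(2) by auto
qed (rule R.is_cring)

lemma P_Inv_prime:
  assumes "\<Gamma> \<subseteq> H"
  shows "primeideal (P \<inter> carrier (Inv \<Gamma>)) (Inv \<Gamma>)"
proof -
  interpret I: domain "Inv \<Gamma>" by (rule Inv_domain[OF assms])
  have "ring_hom_ring (Inv \<Gamma>) R id"
    by (rule ring_hom_ringI2[OF I.ring_axioms R.ring_axioms])
       (rule ring_hom_memI, auto simp: Inv_ops Inv_carrier)
  from ring_hom_ring.primeideal_vimage[OF this I.is_cring P_prime]
  show ?thesis by (simp add: Int_def conj_commute)
qed

text \<open>
  At a point where \<open>f\<close> does not vanish, restrict a numerator of \<open>f\<close> to the line in the direction of \<open>v\<close>. The order of this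
  nonzero polynomial at \<open>v = 0\<close> bounds the power of \<open>v\<close> that divides \<open>f\<close>, since \<open>G\<close> does not vanish at \<open>v = 0\<close> on this line.
\<close>

lemma v_order_bounded:
  assumes f: "f \<in> carrier R" "f \<noteq> \<zero>\<^bsub>R\<^esub>"
  shows "\<exists>B. \<forall>k h. h \<in> carrier R \<longrightarrow> f = vf [^]\<^bsub>R\<^esub> (k::nat) \<otimes>\<^bsub>R\<^esub> h \<longrightarrow> k \<le> B"
proof -
  obtain y where y: "y \<in> V" "f y \<noteq> 0"
    using f coord_ring_eqI[OF f(1) R.zero_closed] by auto
  (* the line through y in the direction of v, parametrised by v *)
  define o' where "o' i = (if i < r then y i else 0)" for i
  define u :: "'k point" where "u i = (if i = r then 1 else 0)" for i
  have o': "o' \<in> affine_space (Suc r)" and u: "u \<in> affine_space (Suc r)"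
    by (auto simp: o'_def u_def affine_space_def)
  have line_r: "(\<lambda>i. o' i + t * u i) r = t" for t by (simp add: o'_def u_def)
  have y_eq: "p (\<lambda>i. o' i + y r * u i) = p y" if "p \<in> polyfun (Suc r)" for p
    by (rule polyfun_cong[OF that]) (auto simp: o'_def u_def less_Suc_eq)
  obtain G' where G': "\<And>t. Gp (\<lambda>i. o' i + t * u i) = poly G' t"
    by (rule line_expansion[OF G, of o']) (rule that)
  have "Gp o' = poly G' 0" using G'[of 0] by simp
  moreover have "Gp o' \<noteq> 0" using V_nonzero(2)[OF y(1)] by (simp add: Gp_def o'_def)
  ultimately have G0: "poly G' 0 \<noteq> 0" by simp
  then have G'0: "G' \<noteq> 0" by auto
  obtain E k0 where E: "E \<in> polyfun (Suc r)" "\<And>y l. y \<in> V \<Longrightarrow> f y * Gp y ^ (k0 + l) = E y * Gp y ^ l"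
    by (rule numerator[OF carrier_R_regfun[OF f(1)]]) (rule that)
  obtain a where a: "\<And>t. E (\<lambda>i. o' i + t * u i) = poly a t"
    by (rule line_expansion[OF E(1), of o']) (rule that)
  have "E y \<noteq> 0" using E(2)[OF y(1), of 0] y(2) G_nonzero[OF y(1)] by auto
  then have a0: "a \<noteq> 0" using a[of "y r"] y_eq[OF E(1)] by auto
  have "k \<le> Polynomial.order 0 a" if h: "h \<in> carrier R" "f = vf [^]\<^bsub>R\<^esub> (k::nat) \<otimes>\<^bsub>R\<^esub> h" for k h
  proof -
    obtain F k1 where F: "F \<in> polyfun (Suc r)" "\<And>y l. y \<in> V \<Longrightarrow> h y * Gp y ^ (k1 + l) = F y * Gp y ^ l"
      by (rule numerator[OF carrier_R_regfun[OF h(1)]]) (rule that)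
    obtain b where b: "\<And>t. F (\<lambda>i. o' i + t * u i) = poly b t"
      by (rule line_expansion[OF F(1), of o']) (rule that)
    have "a * G' ^ k1 = [:0, 1:] ^ k * (b * G' ^ k0)"
    proof (rule poly_eq_off_zeros[OF G'0])
      fix t assume t: "poly G' t \<noteq> 0"
      define z where "z = (\<lambda>i. o' i + t * u i)"
      have z: "z \<in> affine_space (Suc r)" "Gp z \<noteq> 0"
        using affine_space_line[OF o' u] t G'[of t] by (simp_all add: z_def)
      define w where "w = z(Suc r := inverse (Gp z))"
      have wV: "w \<in> V" unfolding w_def by (rule lift_point(1)[OF z])
      have wp: "p w = p z" if "p \<in> polyfun (Suc r)" for p
        unfolding w_def by (rule lift_point(2)[OF z that])
      have wr: "w r = t" using line_r[of t] by (simp add: w_def z_def)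
      have "f w = t ^ k * h w"
        using h(2) wV by (simp add: vf_apply wr)
      then have "f w * Gp w ^ (k0 + k1) = t ^ k * (h w * Gp w ^ (k1 + k0))"
        by (simp add: add.commute)
      then have "E w * Gp w ^ k1 = t ^ k * (F w * Gp w ^ k0)"
        unfolding E(2)[OF wV] F(2)[OF wV] .
      then have "E z * Gp z ^ k1 = t ^ k * (F z * Gp z ^ k0)"
        unfolding wp[OF E(1)] wp[OF F(1)] wp[OF G] .
      then show "poly (a * G' ^ k1) t = poly ([:0, 1:] ^ k * (b * G' ^ k0)) t"
        unfolding z_def a b G' by simp
    qed
    then have "[:- 0, 1:] ^ k dvd a * G' ^ k1" by simp
    then have "k \<le> Polynomial.order 0 (a * G' ^ k1)"
      using order_divides[of 0 k "a * G' ^ k1"] a0 G'0 by simp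
    also have "\<dots> = Polynomial.order 0 a + Polynomial.order 0 (G' ^ k1)"
      using a0 G'0 by (intro order_mult) simp
    also have "Polynomial.order 0 (G' ^ k1) = 0"
      using G0 by (intro order_0I) simp
    finally show ?thesis by simp
  qed
  then show ?thesis by blast
qed

lemma v_factorization:
  assumes f: "f \<in> carrier R" "f \<noteq> \<zero>\<^bsub>R\<^esub>"
  shows "\<exists>(k::nat) h. h \<in> carrier R \<and> h \<notin> P \<and> f = vf [^]\<^bsub>R\<^esub> k \<otimes>\<^bsub>R\<^esub> h"
proof (rule ccontr)
  assume neg: "\<not> ?thesis"
  have "\<exists>h\<in>carrier R. f = vf [^]\<^bsub>R\<^esub> (k::nat) \<otimes>\<^bsub>R\<^esub> h" for k
  proof (induction k)
    case 0
    show ?case using f(1) by (intro bexI[of _ f]) simp_all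
  next
    case (Suc k)
    then obtain h where h: "h \<in> carrier R" "f = vf [^]\<^bsub>R\<^esub> k \<otimes>\<^bsub>R\<^esub> h" by auto
    then have "h \<in> P" using neg by blast
    then obtain h1 where h1: "h1 \<in> carrier R" "h = vf \<otimes>\<^bsub>R\<^esub> h1" using P_factor by blast
    then have "f = vf [^]\<^bsub>R\<^esub> Suc k \<otimes>\<^bsub>R\<^esub> h1"
      using h vf_R by (simp add: R.m_assoc)
    then show ?case using h1(1) by blast
  qed
  moreover obtain B where "\<forall>k h. h \<in> carrier R \<longrightarrow> f = vf [^]\<^bsub>R\<^esub> (k::nat) \<otimes>\<^bsub>R\<^esub> h \<longrightarrow> k \<le> B"
    using v_order_bounded[OF f] ..
  ultimately have "Suc B \<le> B" by blast
  then show False by simp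
qed

lemma height_P: "height R P = 1"
proof (rule R.height_eq_one[OF P_prime vf_P vf_nonzero])
  fix f assume f: "f \<in> carrier R" "f \<noteq> \<zero>\<^bsub>R\<^esub>"
  then show "\<exists>e>0. \<exists>(k::nat) h. h \<in> carrier R \<and> h \<notin> P \<and> f [^]\<^bsub>R\<^esub> (e::nat) = vf [^]\<^bsub>R\<^esub> k \<otimes>\<^bsub>R\<^esub> h"
    using v_factorization[OF f] by (intro exI[of _ 1]) simp
qed

section \<open>The torus invariants are the functions of \<open>v\<close>\<close>

abbreviation CT where "CT \<equiv> carrier (Inv T)"
abbreviation CH where "CH \<equiv> carrier (Inv H)"

lemma T_subset_H: "T \<subseteq> H"
  using T_H by blast

text \<open>
  \<open>T\<close> acts transitively on the torus and trivially on the curve, so its orbits are the fibres of \<open>v\<close>.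
\<close>

lemma CT_iff: "f \<in> CT \<longleftrightarrow> f \<in> carrier R \<and> (\<forall>y\<in>V. \<forall>y'\<in>V. y r = y' r \<longrightarrow> f y = f y')"
proof
  assume f: "f \<in> CT"
  then have fR: "f \<in> carrier R" by (simp add: Inv_carrier)
  have "f y = f y'" if y: "y \<in> V" "y' \<in> V" "y r = y' r" for y y'
  proof -
    obtain t where t: "t \<in> T" "A t (tor y) = tor y'"
      using A_transitive[OF tor_S[OF y(1)] tor_S[OF y(2)]] by auto
    have "act t y = y'"
      unfolding act_def t(2) using s_Z[of t] T_Z t(1) mk_tor[OF y(2)] y(3) by auto
    moreover have "\<rho> (inv t) f = f"
      using f subgroup.m_inv_closed[OF T_sub t(1)] by (simp add: Inv_carrier)
    then have "f (act (inv (inv t)) y) = f y"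
      using \<rho>_eq_iff[OF H_inv[OF T_H[OF t(1)]] fR] y(1) by blast
    ultimately show ?thesis using H_carrier[OF T_H[OF t(1)]] by simp
  qed
  then show "f \<in> carrier R \<and> (\<forall>y\<in>V. \<forall>y'\<in>V. y r = y' r \<longrightarrow> f y = f y')" using fR by blast
next
  assume f: "f \<in> carrier R \<and> (\<forall>y\<in>V. \<forall>y'\<in>V. y r = y' r \<longrightarrow> f y = f y')"
  have "\<rho> t f = f" if t: "t \<in> T" for t
  proof -
    have "f (act (inv t) y) = f y" if y: "y \<in> V" for y
    proof -
      have "act (inv t) y r = y r"
        using s_Z[of "inv t"] T_Z subgroup.m_inv_closed[OF T_sub t] by (auto simp: act_r)
      then show ?thesis using f act_V[OF H_inv[OF T_H[OF t]] y] y by blast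
    qed
    then show ?thesis using \<rho>_eq_iff[OF T_H[OF t]] f by blast
  qed
  then show "f \<in> CT" using f by (simp add: Inv_carrier)
qed

text \<open>
  A \<open>T\<close>-invariant function as a function of \<open>v\<close>; its values are read off at a fixed point \<open>x1\<close> of the torus.
\<close>

definition val :: "('k point \<Rightarrow> 'k) \<Rightarrow> 'k \<Rightarrow> 'k" where "val f v = f (mk x1 v)"

lemma CT_R: "f \<in> CT \<Longrightarrow> f \<in> carrier R"
  by (simp add: Inv_carrier)

lemma val_eq: "f \<in> CT \<Longrightarrow> y \<in> V \<Longrightarrow> f y = val f (y r)"
  unfolding val_def using CT_iff mk_V[OF x1_S V_nonzero(1)] by (metis mk_r)

lemma point_over:
  assumes "g v \<noteq> 0"
  shows "mk x1 v \<in> V" "mk x1 v r = v"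
  using mk_V[OF x1_S assms] by simp_all

lemma vf_CT: "vf \<in> CT"
  unfolding CT_iff using vf_R by (auto simp: vf_apply)

lemma val_vf: "g v \<noteq> 0 \<Longrightarrow> val vf v = v"
  unfolding val_def using point_over[of v] by (simp add: vf_apply)

lemma CT_act: "f \<in> CT \<Longrightarrow> h \<in> H \<Longrightarrow> y \<in> V \<Longrightarrow> f (act h y) = val f (s (J h) (y r))"
  using val_eq[of f "act h y"] by (simp add: act_V act_r)

lemma CH_subset_CT: "CH \<subseteq> CT"
proof
  fix f assume "f \<in> CH"
  then have "f \<in> carrier R" "\<forall>h\<in>H. \<rho> h f = f" by (simp_all add: Inv_carrier)
  then have "\<forall>h\<in>T. \<rho> h f = f" using T_H by blast
  with \<open>f \<in> carrier R\<close> show "f \<in> CT" by (simp add: Inv_carrier)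
qed

lemma CH_iff: "f \<in> CH \<longleftrightarrow> f \<in> CT \<and> (\<forall>j v. g v \<noteq> 0 \<longrightarrow> val f (s j v) = val f v)"
proof
  assume f: "f \<in> CH"
  then have fT: "f \<in> CT" using CH_subset_CT by blast
  have "val f (s j v) = val f v" if v: "g v \<noteq> 0" for j v
  proof -
    obtain h where h: "h \<in> H" "J h mod q = j mod q" using J_surj by blast
    have "\<rho> (inv h) f = f" using f H_inv[OF h(1)] by (simp add: Inv_carrier)
    then have "f (act (inv (inv h)) (mk x1 v)) = f (mk x1 v)"
      using \<rho>_eq_iff[OF H_inv[OF h(1)] CT_R[OF fT]] point_over(1)[OF v] by blast
    then have "val f (s (J h) v) = val f v"
      using CT_act[OF fT h(1) point_over(1)[OF v]] h(1) by (simp add: H_carrier val_def)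
    moreover have "s (J h) v = s j v" using h(2) s_mod by metis
    ultimately show ?thesis by simp
  qed
  then show "f \<in> CT \<and> (\<forall>j v. g v \<noteq> 0 \<longrightarrow> val f (s j v) = val f v)" using fT by blast
next
  assume f: "f \<in> CT \<and> (\<forall>j v. g v \<noteq> 0 \<longrightarrow> val f (s j v) = val f v)"
  then have fT: "f \<in> CT" by blast
  have "\<rho> h f = f" if h: "h \<in> H" for h
  proof -
    have "f (act (inv h) y) = f y" if y: "y \<in> V" for y
      using CT_act[OF fT H_inv[OF h] y] f V_nonzero(1)[OF y] val_eq[OF fT y] by simp
    then show ?thesis using \<rho>_eq_iff[OF h CT_R[OF fT]] by blast
  qed
  then show "f \<in> CH" using CT_R[OF fT] by (simp add: Inv_carrier)
qed

text \<open>
  Composing with \<open>s j\<close> is the action of an element of \<open>H\<close> with exponent \<open>j\<close>.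
\<close>

lemma shifted_CT:
  assumes f: "f \<in> CT"
  shows "restrict (\<lambda>y. val f (s j (y r))) V \<in> CT"
proof -
  obtain h where h: "h \<in> H" "J h mod q = j mod q" using J_surj by blast
  then have sj: "s (J h) v = s j v" for v using s_mod by metis
  have "(\<lambda>y. f (act h y)) \<in> regfun m V"
    using Bi_fix_fst[OF act_pullback[OF carrier_R_regfun[OF CT_R[OF f]]] h(1)] by simp
  then have "(\<lambda>y. val f (s j (y r))) \<in> regfun m V"
    by (rule agree_on_cong) (simp add: CT_act[OF f h(1)] sj)
  then show ?thesis unfolding CT_iff by (auto intro: coord_in_R)
qed

lemma CT_cancel:
  assumes "f \<in> CT" "f1 \<in> carrier R" "e \<in> CT" "e \<noteq> \<zero>\<^bsub>R\<^esub>" "f = e \<otimes>\<^bsub>R\<^esub> f1"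
  shows "f1 \<in> CT"
proof -
  have e: "e \<in> carrier R" using assms(3) by (rule CT_R)
  have "\<rho> t f1 = f1" if t: "t \<in> T" for t
  proof -
    have t': "t \<in> H" using t by (rule T_H)
    have "\<rho> t f = \<rho> t e \<otimes>\<^bsub>R\<^esub> \<rho> t f1"
      using ring_hom_mult[of "\<rho> t" R R e f1] \<rho>_ring_iso[OF t'] e assms(2,5) by (simp add: ring_iso_def)
    moreover have "\<rho> t f = f" "\<rho> t e = e" using assms(1,3) t by (simp_all add: Inv_carrier)
    ultimately have "e \<otimes>\<^bsub>R\<^esub> \<rho> t f1 = e \<otimes>\<^bsub>R\<^esub> f1" using assms(5) by simp
    then show ?thesis
      using R.m_lcancel[OF assms(4) e \<rho>_closed[OF t' assms(2)] assms(2)] by simp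
  qed
  then show ?thesis using assms(2) by (simp add: Inv_carrier)
qed

lemma vf_pow_nonzero: "vf [^]\<^bsub>R\<^esub> (k::nat) \<noteq> \<zero>\<^bsub>R\<^esub>"
proof (induction k)
  case (Suc k)
  then show ?case using vf_R vf_nonzero R.integral_iff[of "vf [^]\<^bsub>R\<^esub> k" vf] by simp
qed simp

lemma vf_pow_CT: "vf [^]\<^bsub>R\<^esub> (k::nat) \<in> CT"
  unfolding CT_iff using vf_R by (auto simp: vf_apply)

section \<open>Norms and heights\<close>

text \<open>
  The norm of a \<open>T\<close>-invariant function for the group \<open>H / Z\<close>.
\<close>

definition Norm where "Norm f = restrict (\<lambda>y. \<Prod>j<q. val f (s j (y r))) V"

lemma Norm_CH:
  assumes f: "f \<in> CT"
  shows "Norm f \<in> CH"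
proof -
  have "(\<lambda>y. \<Prod>j<q. val f (s j (y r))) \<in> regfun m V"
  proof (rule regfun.prod)
    fix j
    show "(\<lambda>y. val f (s j (y r))) \<in> regfun m V"
      by (rule agree_on_cong[OF carrier_R_regfun[OF CT_R[OF shifted_CT[OF f, of j]]]]) simp
  qed
  then have NT: "Norm f \<in> CT" unfolding CT_iff Norm_def by (auto intro: coord_in_R)
  have val_N: "val (Norm f) v = (\<Prod>j<q. val f (s j v))" if "g v \<noteq> 0" for v
    by (subst val_def) (simp add: Norm_def point_over that)
  have "val (Norm f) (s k v) = val (Norm f) v" if v: "g v \<noteq> 0" for k v
  proof -
    have "val (Norm f) (s k v) = (\<Prod>j<q. val f (s (j + k) v))"
      using val_N[OF g_s_nonzero[OF v]] v by (simp add: s_s)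
    also have "\<dots> = (\<Prod>j<q. val f (s j v))"
      by (rule prod_shift[of "\<lambda>j. val f (s j v)"]) (simp add: s_mod)
    finally show ?thesis using val_N[OF v] by simp
  qed
  then show ?thesis unfolding CH_iff using NT by blast
qed

lemma Norm_apply: "y \<in> V \<Longrightarrow> Norm f y = (\<Prod>j<q. val f (s j (y r)))"
  by (simp add: Norm_def)

lemma Norm_vf_apply: "y \<in> V \<Longrightarrow> Norm vf y = (\<Prod>j<q. s j (y r))"
  unfolding Norm_apply by (intro prod.cong refl val_vf g_s_nonzero V_nonzero)

lemma Norm_vf_P: "Norm vf \<in> P"
proof -
  have "Norm vf y = 0" if "y \<in> V" "y r = 0" for y
    unfolding Norm_vf_apply[OF that(1)] using that(2) q_pos by (intro prod_zero) auto
  then show ?thesis using CT_R[OF subsetD[OF CH_subset_CT Norm_CH[OF vf_CT]]] by (simp add: P_def)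
qed

lemma s_nonzero: "g v \<noteq> 0 \<Longrightarrow> v \<noteq> 0 \<Longrightarrow> s j v \<noteq> 0"
  using den_nonzero[of v j] \<zeta>_pow q_pos by (auto simp: s_def power_0_left)

lemma Norm_vf_nonzero: "Norm vf \<noteq> \<zero>\<^bsub>R\<^esub>"
proof
  assume eq: "Norm vf = \<zero>\<^bsub>R\<^esub>"
  obtain v where v: "v \<noteq> 0" "g v \<noteq> 0" using exists_nonzero_v by auto
  have "Norm vf (mk x1 v) = 0" unfolding eq using point_over[OF v(2)] by simp
  then have "(\<Prod>j<q. s j v) = 0" using point_over[OF v(2)] by (simp add: Norm_vf_apply)
  then show False using s_nonzero[OF v(2,1)] by auto
qed

lemma height_P_T: "height (Inv T) (P \<inter> CT) = 1"
proof -
  interpret I: domain "Inv T" by (rule Inv_domain[OF T_subset_H])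
  show ?thesis
  proof (rule I.height_eq_one[OF P_Inv_prime[OF T_subset_H]])
    show "vf \<in> P \<inter> CT" using vf_P vf_CT by blast
    show "vf \<noteq> \<zero>\<^bsub>Inv T\<^esub>" using vf_nonzero by (simp add: Inv_ops)
    fix f assume f: "f \<in> CT" "f \<noteq> \<zero>\<^bsub>Inv T\<^esub>"
    obtain k h where h: "h \<in> carrier R" "h \<notin> P" "f = vf [^]\<^bsub>R\<^esub> (k::nat) \<otimes>\<^bsub>R\<^esub> h"
      using v_factorization[OF CT_R[OF f(1)]] f(2) by (auto simp: Inv_ops)
    have "h \<in> CT" by (rule CT_cancel[OF f(1) h(1) vf_pow_CT vf_pow_nonzero h(3)])
    then show "\<exists>e>0. \<exists>(k::nat) h. h \<in> CT \<and> h \<notin> P \<inter> CT \<and> f [^]\<^bsub>Inv T\<^esub> (e::nat) = vf [^]\<^bsub>Inv T\<^esub> k \<otimes>\<^bsub>Inv T\<^esub> h"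
      using h f(1) CT_R[OF f(1)] by (intro exI[of _ 1] conjI exI[of _ k] exI[of _ h]) (simp_all add: Inv_ops Inv_pow)
  qed
qed

text \<open>
  The norm of \<open>v\<close> plays the role of a uniformizer: the norm of an \<open>H\<close>-invariant function \<open>f = v\<^sup>k h\<close> is \<open>f\<^sup>q\<close>, and the norm of
  \<open>h\<close> does not lie in \<open>P\<close> because \<open>v = 0\<close> is fixed by all \<open>s j\<close>.
\<close>

lemma height_P_H: "height (Inv H) (P \<inter> CH) = 1"
proof -
  interpret I: domain "Inv H" by (rule Inv_domain[OF subset_refl])
  show ?thesis
  proof (rule I.height_eq_one[OF P_Inv_prime[OF subset_refl]])
    show "Norm vf \<in> P \<inter> CH" using Norm_vf_P Norm_CH[OF vf_CT] by blast
    show "Norm vf \<noteq> \<zero>\<^bsub>Inv H\<^esub>" using Norm_vf_nonzero by (simp add: Inv_ops)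
    fix f assume f: "f \<in> CH" "f \<noteq> \<zero>\<^bsub>Inv H\<^esub>"
    have fT: "f \<in> CT" using f(1) CH_subset_CT by blast
    have fR: "f \<in> carrier R" using fT by (rule CT_R)
    obtain k h where h: "h \<in> carrier R" "h \<notin> P" "f = vf [^]\<^bsub>R\<^esub> (k::nat) \<otimes>\<^bsub>R\<^esub> h"
      using v_factorization[OF fR] f(2) by (auto simp: Inv_ops)
    have hT: "h \<in> CT" by (rule CT_cancel[OF fT h(1) vf_pow_CT vf_pow_nonzero h(3)])
    have NR: "Norm e \<in> carrier R" if "e \<in> CT" for e
      using CT_R CH_subset_CT Norm_CH[OF that] by blast
    have "f [^]\<^bsub>R\<^esub> q = Norm vf [^]\<^bsub>R\<^esub> k \<otimes>\<^bsub>R\<^esub> Norm h"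
    proof (rule coord_ring_eqI)
      fix y assume y: "y \<in> V"
      have gy: "g (y r) \<noteq> 0" using y by (rule V_nonzero)
      have "f y = s j (y r) ^ k * val h (s j (y r))" for j
      proof -
        have gs: "g (s j (y r)) \<noteq> 0" using gy by (rule g_s_nonzero)
        have "f y = val f (s j (y r))" using f(1) gy val_eq[OF fT y] unfolding CH_iff by simp
        also have "\<dots> = s j (y r) ^ k * val h (s j (y r))"
          using h(3) point_over[OF gs] by (simp add: val_def vf_apply)
        finally show ?thesis .
      qed
      then have "(\<Prod>j<q. f y) = (\<Prod>j<q. s j (y r) ^ k * val h (s j (y r)))" by (intro prod.cong refl)
      then show "(f [^]\<^bsub>R\<^esub> q) y = (Norm vf [^]\<^bsub>R\<^esub> k \<otimes>\<^bsub>R\<^esub> Norm h) y"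
        using y by (simp add: Norm_vf_apply prod.distrib prod_power_distrib) (simp add: Norm_apply)
    qed (use fR NR[OF vf_CT] NR[OF hT] in auto)
    moreover have "Norm h \<notin> P"
    proof
      assume N: "Norm h \<in> P"
      obtain y where y: "y \<in> V" "y r = 0" "h y \<noteq> 0" using h(1,2) unfolding P_def by auto
      have "Norm h y = 0" using N y(1,2) unfolding P_def by blast
      then have "val h 0 = 0" using y(1,2) by (simp add: Norm_apply)
      then show False using val_eq[OF hT y(1)] y(2,3) by simp
    qed
    ultimately show "\<exists>e>0. \<exists>(k::nat) h. h \<in> CH \<and> h \<notin> P \<inter> CH \<and> f [^]\<^bsub>Inv H\<^esub> (e::nat) = Norm vf [^]\<^bsub>Inv H\<^esub> k \<otimes>\<^bsub>Inv H\<^esub> h"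
      using q_pos Norm_CH[OF hT]
      by (intro exI[of _ q] conjI exI[of _ k] exI[of _ "Norm h"]) (simp_all add: Inv_ops Inv_pow)
  qed
qed

lemma P_Ht1: "P \<in> Ht1 R (Inv H)"
  unfolding Ht1_def using P_prime height_P height_P_H by simp

lemma P_T_Ht1: "P \<inter> CT \<in> Ht1 (Inv T) (Inv H)"
proof -
  have "P \<inter> CT \<inter> CH = P \<inter> CH" using CH_subset_CT by blast
  then show ?thesis
    unfolding Ht1_def using P_Inv_prime[OF T_subset_H] height_P_T height_P_H by simp
qed

section \<open>Inertia groups\<close>

lemma act_eqI:
  assumes "h \<in> H" "y \<in> V" "\<And>f. f \<in> carrier R \<Longrightarrow> f (act h y) = f y"
  shows "act h y = y"
proof
  fix i
  show "act h y i = y i"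
  proof (cases "i < m")
    case True
    then have "restrict (\<lambda>y. y i) V \<in> carrier R" by (intro coord_in_R regfun_coord)
    from assms(3)[OF this] show ?thesis using assms(1,2) by (simp add: act_V)
  next
    case False
    then show ?thesis using act_V[OF assms(1,2)] assms(2) by (simp add: V_iff affine_space_def)
  qed
qed

lemma R_minus: "f \<in> carrier R \<Longrightarrow> f' \<in> carrier R \<Longrightarrow> y \<in> V \<Longrightarrow> (f \<ominus>\<^bsub>R\<^esub> f') y = f y - f' y"
  using Inv_minus[of "{}" f f' y] by (simp add: Inv_empty)

lemma J_not_dvd: "h \<in> H \<Longrightarrow> h \<notin> Z \<Longrightarrow> \<not> q dvd J (inv h)"
proof
  assume h: "h \<in> H" "h \<notin> Z" and "q dvd J (inv h)"
  then have "inv h \<in> Z" using J_Z[OF H_inv[OF h(1)]] by blast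
  then have "inv (inv h) \<in> Z" by (rule subgroup.m_inv_closed[OF Z_sub])
  then show False using h by (simp add: H_carrier)
qed

text \<open>
  The image of \<open>v\<close> under \<open>h\<close> differs from \<open>v\<close> by \<open>(\<zeta>\<^sup>j - 1) v\<close> if \<open>\<zeta> \<noteq> 1\<close>, and by \<open>- j v\<^sup>2\<close> up to the unit \<open>den j\<close>
  otherwise. In both cases the prime \<open>Q\<close> contains \<open>v\<close>, hence \<open>P\<close>, and both have height one.
\<close>

lemma inertia_prime_eq_P:
  assumes Q: "Q \<in> Ht1 R (Inv H)" and h: "h \<in> inertia_group R \<rho> H Q" "h \<notin> Z"
  shows "Q = P"
proof -
  have Qp: "primeideal Q R" and Qh: "height R Q = 1" using Q unfolding Ht1_def by auto
  interpret Q: primeideal Q R by (rule Qp)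
  have hH: "h \<in> H" and inertia: "\<And>f. f \<in> carrier R \<Longrightarrow> \<rho> h f \<ominus>\<^bsub>R\<^esub> f \<in> Q"
    using h(1) unfolding inertia_group_def by auto
  define j where "j = J (inv h)"
  have j: "\<not> q dvd j" unfolding j_def by (rule J_not_dvd[OF hH h(2)])
  have diff: "(\<rho> h vf \<ominus>\<^bsub>R\<^esub> vf) y = s j (y r) - y r" if y: "y \<in> V" for y
  proof -
    have "\<rho> h vf y = s j (y r)"
      using y vf_R H_inv[OF hH] by (simp add: \<rho>_apply vf_apply act_V act_r j_def)
    then show ?thesis using R_minus[OF \<rho>_closed[OF hH vf_R] vf_R y] y by (simp add: vf_apply)
  qed
  \<comment> \<open>\<open>e\<close> is the inverse of the unit in this difference\<close>
  define a where "a = (if \<zeta> = 1 then - 1 / of_nat j else 1 / (\<zeta> ^ j - 1))"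
  define e where "e = restrict (\<lambda>y. den j (y r) * a) V"
  have eR: "e \<in> carrier R" unfolding e_def by (intro coord_in_R regfun.mult den_regular regfun.const)
  have prod: "(\<rho> h vf \<ominus>\<^bsub>R\<^esub> vf) \<otimes>\<^bsub>R\<^esub> e \<in> Q"
    using Q.I_r_closed[OF inertia[OF vf_R] eR] .
  have minus_R: "\<rho> h vf \<ominus>\<^bsub>R\<^esub> vf \<in> carrier R"
    using \<rho>_closed[OF hH vf_R] vf_R by simp
  have prod_apply: "((\<rho> h vf \<ominus>\<^bsub>R\<^esub> vf) \<otimes>\<^bsub>R\<^esub> e) y = (\<zeta> ^ j * y r - y r * den j (y r)) * a" if y: "y \<in> V" for y
    using y diff[OF y] den_nonzero[OF V_nonzero(1)[OF y], of j]
    by (simp add: e_def s_def left_diff_distrib)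
  have "vf \<in> Q"
  proof (cases "\<zeta> = 1")
    case True
    then have c: "c = 1" using \<zeta>_c_cases by auto
    have "(\<rho> h vf \<ominus>\<^bsub>R\<^esub> vf) \<otimes>\<^bsub>R\<^esub> e = vf \<otimes>\<^bsub>R\<^esub> vf"
    proof (rule coord_ring_eqI)
      fix y assume y: "y \<in> V"
      have den: "den j (y r) = 1 + of_nat j * y r" by (subst den_def) (simp add: c)
      have a: "a = - 1 / of_nat j" and \<zeta>j: "\<zeta> ^ j = 1" using True by (simp_all add: a_def)
      show "((\<rho> h vf \<ominus>\<^bsub>R\<^esub> vf) \<otimes>\<^bsub>R\<^esub> e) y = (vf \<otimes>\<^bsub>R\<^esub> vf) y"
        unfolding prod_apply[OF y] a \<zeta>j den using y nontrivial(2)[OF j True]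
        by (simp add: vf_apply field_simps)
    qed (use eR minus_R vf_R in auto)
    then have "vf \<otimes>\<^bsub>R\<^esub> vf \<in> Q" using prod by simp
    then show ?thesis using Q.I_prime[OF vf_R vf_R] by blast
  next
    case False
    then have c: "c = 0" using \<zeta>_c_cases by auto
    have "(\<rho> h vf \<ominus>\<^bsub>R\<^esub> vf) \<otimes>\<^bsub>R\<^esub> e = vf"
    proof (rule coord_ring_eqI)
      fix y assume y: "y \<in> V"
      have den: "den j (y r) = 1" by (subst den_def) (simp add: c)
      have a: "a = 1 / (\<zeta> ^ j - 1)" using False by (simp add: a_def)
      show "((\<rho> h vf \<ominus>\<^bsub>R\<^esub> vf) \<otimes>\<^bsub>R\<^esub> e) y = vf y"
        unfolding prod_apply[OF y] a den using y nontrivial(1)[OF j False]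
        by (simp add: vf_apply field_simps)
    qed (use eR minus_R vf_R in auto)
    then show ?thesis using prod by simp
  qed
  have sub: "P \<subseteq> Q"
  proof
    fix f assume "f \<in> P"
    then obtain f1 where "f1 \<in> carrier R" "f = vf \<otimes>\<^bsub>R\<^esub> f1" using P_factor by blast
    then show "f \<in> Q" using Q.I_r_closed[OF \<open>vf \<in> Q\<close>] by simp
  qed
  show "Q = P"
  proof (rule ccontr)
    assume "Q \<noteq> P"
    then have "P \<subset> Q" using sub by blast
    moreover have "{\<zero>\<^bsub>R\<^esub>} \<subset> P" using vf_P vf_nonzero by (auto simp: P_def)
    ultimately have "height R Q \<ge> 2"
      using height_ge_two[OF R.zeroprimeideal P_prime Qp] by blast
    then have "(2 :: enat) \<le> 1" unfolding Qh .
    then show False by (simp add: numeral_eq_enat one_enat_def)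
  qed
qed

text \<open>
  An element outside \<open>Z\<close> in an inertia group would lie in that of \<open>P\<close>. Then it would fix all points with \<open>v = 0\<close>, hence the whole
  torus, which only elements of \<open>Z\<close> do.
\<close>

lemma inertia_subset_Z:
  assumes Q: "Q \<in> Ht1 R (Inv H)"
  shows "inertia_group R \<rho> H Q \<subseteq> Z"
proof
  fix h assume h: "h \<in> inertia_group R \<rho> H Q"
  show "h \<in> Z"
  proof (rule ccontr)
    assume hZ: "h \<notin> Z"
    have "Q = P" by (rule inertia_prime_eq_P[OF Q h hZ])
    then have hH: "h \<in> H" and inertia: "\<And>f. f \<in> carrier R \<Longrightarrow> \<rho> h f \<ominus>\<^bsub>R\<^esub> f \<in> P"
      using h unfolding inertia_group_def by auto
    have "A (inv h) x = x" if x: "x \<in> S" for x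
    proof -
      define y where "y = mk x 0"
      have y: "y \<in> V" "y r = 0" unfolding y_def using x by (simp_all add: mk_V)
      have "act (inv h) y = y"
      proof (rule act_eqI[OF H_inv[OF hH] y(1)])
        fix f assume f: "f \<in> carrier R"
        have "(\<rho> h f \<ominus>\<^bsub>R\<^esub> f) y = 0" using inertia[OF f] y unfolding P_def by blast
        then show "f (act (inv h) y) = f y"
          using R_minus[OF \<rho>_closed[OF hH f] f y(1)] f y(1) by (simp add: \<rho>_apply)
      qed
      then show ?thesis using tor_act[OF H_inv[OF hH] y(1)] x by (simp add: y_def tor_mk)
    qed
    then have "inv h \<in> Z" by (intro A_faithful H_inv hH)
    then have "inv (inv h) \<in> Z" by (rule subgroup.m_inv_closed[OF Z_sub])
    then show False using hZ hH by (simp add: H_carrier)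
  qed
qed

text \<open>Every element of \<open>H\<close> fixes the point \<open>v = 0\<close> of the curve.\<close>

lemma inertia_T: "inertia_group (Inv T) \<rho> H (P \<inter> CT) = H"
proof -
  interpret I: domain "Inv T" by (rule Inv_domain[OF T_subset_H])
  have "\<rho> h f \<ominus>\<^bsub>Inv T\<^esub> f \<in> P \<inter> CT" if h: "h \<in> H" and f: "f \<in> CT" for h f
  proof -
    have \<rho>f: "\<rho> h f y = val f (s (J (inv h)) (y r))" if "y \<in> V" for y
      using that CT_R[OF f] CT_act[OF f H_inv[OF h] that] by (simp add: \<rho>_apply)
    have \<rho>T: "\<rho> h f \<in> CT"
      unfolding CT_iff using \<rho>_closed[OF h CT_R[OF f]] \<rho>f by simp
    have "\<rho> h f \<ominus>\<^bsub>Inv T\<^esub> f \<in> CT" using \<rho>T f by simp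
    moreover have "(\<rho> h f \<ominus>\<^bsub>Inv T\<^esub> f) y = 0" if y: "y \<in> V" "y r = 0" for y
      using Inv_minus[OF T_subset_H \<rho>T f y(1)] \<rho>f[OF y(1)] val_eq[OF f y(1)] y(2) by simp
    ultimately show ?thesis using CT_R by (simp add: P_def)
  qed
  then show ?thesis unfolding inertia_group_def by blast
qed

lemma Inv_between:
  assumes "T \<subseteq> \<Gamma>" "\<Gamma> \<subseteq> Z"
  shows "Inv \<Gamma> = Inv T"
proof -
  have "\<rho> z f = f" if z: "z \<in> Z" and f: "f \<in> CT" for z f
  proof -
    have zH: "z \<in> H" using z Z_H by blast
    have "inv z \<in> Z" using z by (rule subgroup.m_inv_closed[OF Z_sub])
    then have "f (act (inv z) y) = f y" if "y \<in> V" for y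
      using CT_act[OF f H_inv[OF zH] that] val_eq[OF f that] by (simp add: s_Z)
    then show ?thesis using \<rho>_eq_iff[OF zH CT_R[OF f]] by blast
  qed
  then have fixed: "\<forall>h\<in>\<Gamma>. \<rho> h f = f" if "f \<in> CT" for f using that assms(2) by blast
  have "carrier (Inv \<Gamma>) = CT"
  proof (intro Set.equalityI subsetI)
    fix f assume "f \<in> carrier (Inv \<Gamma>)"
    then have "f \<in> carrier R" "\<forall>h\<in>\<Gamma>. \<rho> h f = f" by (simp_all add: Inv_carrier)
    then have "\<forall>h\<in>T. \<rho> h f = f" using assms(1) by blast
    with \<open>f \<in> carrier R\<close> show "f \<in> CT" by (simp add: Inv_carrier)
  next
    fix f assume f: "f \<in> CT"
    show "f \<in> carrier (Inv \<Gamma>)" using fixed[OF f] CT_R[OF f] by (simp add: Inv_carrier)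
  qed
  then show ?thesis using Inv_eq by metis
qed

lemma inertia_one: "\<one> \<in> inertia_group R \<rho> H P"
proof -
  have "\<rho> \<one> f \<ominus>\<^bsub>R\<^esub> f \<in> P" if f: "f \<in> carrier R" for f
  proof -
    have "(f \<ominus>\<^bsub>R\<^esub> f) y = 0" if "y \<in> V" for y using R_minus[OF f f that] by simp
    then show ?thesis using f by (simp add: \<rho>_one P_def)
  qed
  then show ?thesis using H_one unfolding inertia_group_def by blast
qed

lemma Inv_inertia_T: "Inv (inertia_group R \<rho> H P <#>\<^bsub>G\<^esub> T) = Inv T"
proof (rule Inv_between)
  show "T \<subseteq> inertia_group R \<rho> H P <#>\<^bsub>G\<^esub> T"
  proof
    fix t assume t: "t \<in> T"
    have "t = \<one> \<otimes> t" using H_carrier[OF T_H[OF t]] by simp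
    then show "t \<in> inertia_group R \<rho> H P <#>\<^bsub>G\<^esub> T"
      unfolding set_mult_def using inertia_one t by blast
  qed
  show "inertia_group R \<rho> H P <#>\<^bsub>G\<^esub> T \<subseteq> Z"
    unfolding set_mult_def using inertia_subset_Z[OF P_Ht1] T_Z subgroup.m_closed[OF Z_sub] by blast
qed

section \<open>Ramification along \<open>v = 0\<close>\<close>

text \<open>
  Write \<open>f = v f1\<close>. Invariance gives \<open>\<zeta>\<^sup>j f1 (s j v) = (1 + j c v) f1 v\<close> with \<open>j\<close> prime to \<open>q\<close>, and it has to be shown that \<open>f1\<close>
  vanishes at \<open>v = 0\<close>. If \<open>\<zeta> \<noteq> 1\<close>, this is the equation at \<open>v = 0\<close>. If \<open>\<zeta> = 1\<close>, the equation at \<open>v = 0\<close> is empty, and its linear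
  term is needed: with \<open>f1 = f1 0 + v f2\<close> one may divide by \<open>v\<close> once more and finds \<open>j \<cdot> f1 0 = 0\<close>.
\<close>

lemma invariant_vanishing_order_two:
  assumes f: "f \<in> CH" "f \<in> P"
  shows "\<exists>f2\<in>CT. f = vf \<otimes>\<^bsub>R\<^esub> (vf \<otimes>\<^bsub>R\<^esub> f2)"
proof -
  have fT: "f \<in> CT" using f(1) CH_subset_CT by blast
  obtain f1 where f1R: "f1 \<in> carrier R" and f1: "f = vf \<otimes>\<^bsub>R\<^esub> f1" using P_factor[OF f(2)] by blast
  have f1T: "f1 \<in> CT" by (rule CT_cancel[OF fT f1R vf_CT vf_nonzero f1])
  obtain \<tau> where \<tau>: "\<tau> \<in> H" "\<tau> \<notin> Z" using Z_proper Z_H by blast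
  define j where "j = J \<tau>"
  have j: "\<not> q dvd j" unfolding j_def using J_Z[OF \<tau>(1)] \<tau>(2) by blast
  have val_f: "val f v = v * val f1 v" if "g v \<noteq> 0" for v
    using f1 point_over[OF that] by (simp add: val_def vf_apply)
  (* compare f with its translate and cancel v *)
  define d where "d = restrict (\<lambda>y. den j (y r)) V"
  define f1' where "f1' = restrict (\<lambda>y. val f1 (s j (y r))) V"
  define z where "z = restrict (\<lambda>y. \<zeta> ^ j) V"
  have R1: "d \<in> carrier R" "f1' \<in> carrier R" "z \<in> carrier R"
    unfolding d_def z_def f1'_def using CT_R[OF shifted_CT[OF f1T]]
    by (auto intro: coord_in_R den_regular regfun.const)
  have "vf \<otimes>\<^bsub>R\<^esub> (z \<otimes>\<^bsub>R\<^esub> f1') = vf \<otimes>\<^bsub>R\<^esub> (d \<otimes>\<^bsub>R\<^esub> f1)"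
  proof (rule coord_ring_eqI)
    fix y assume y: "y \<in> V"
    have gy: "g (y r) \<noteq> 0" using y by (rule V_nonzero)
    have dn: "den j (y r) \<noteq> 0" using gy by (rule den_nonzero)
    have "s j (y r) * val f1 (s j (y r)) = y r * val f1 (y r)"
      using f(1) gy val_f[OF gy] val_f[OF g_s_nonzero[OF gy]] unfolding CH_iff by simp
    then have "y r * (\<zeta> ^ j * val f1 (s j (y r))) = y r * (den j (y r) * val f1 (y r))"
      using dn by (simp add: s_def field_simps)
    then show "(vf \<otimes>\<^bsub>R\<^esub> (z \<otimes>\<^bsub>R\<^esub> f1')) y = (vf \<otimes>\<^bsub>R\<^esub> (d \<otimes>\<^bsub>R\<^esub> f1)) y"
      using y val_eq[OF f1T y] by (simp add: vf_apply z_def f1'_def d_def)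
  qed (use R1 vf_R f1R in auto)
  then have zd: "z \<otimes>\<^bsub>R\<^esub> f1' = d \<otimes>\<^bsub>R\<^esub> f1"
    using R.m_lcancel[OF vf_nonzero vf_R] R1 f1R by simp
  have E1: "\<zeta> ^ j * val f1 (s j v) = den j v * val f1 v" if "g v \<noteq> 0" for v
    using fun_cong[OF zd, of "mk x1 v"] point_over[OF that]
    by (simp add: z_def f1'_def d_def) (simp add: val_def)
  have "val f1 0 = 0"
  proof (cases "\<zeta> = 1")
    case False
    then show ?thesis using E1[of 0] nontrivial(1)[OF j False] by (simp add: den_def)
  next
    case True
    then have c: "c = 1" using \<zeta>_c_cases by auto
    obtain f0 f2 where f2: "f0 \<in> carrier R" "f2 \<in> carrier R" "f1 = f0 \<oplus>\<^bsub>R\<^esub> vf \<otimes>\<^bsub>R\<^esub> f2"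
      "\<forall>y\<in>V. f0 y = f1 (mk (tor y) 0)" using divide_R[OF f1R] by blast
    have f0: "f0 y = val f1 0" if "y \<in> V" for y
      using bspec[OF f2(4) that] val_eq[OF f1T at_zero_V[OF that]] by simp
    have f2T: "f2 \<in> CT"
    proof (rule CT_cancel[OF _ f2(2) vf_CT vf_nonzero refl])
      have eq: "(vf \<otimes>\<^bsub>R\<^esub> f2) y = val f1 (y r) - val f1 0" if "y \<in> V" for y
        using arg_cong[OF f2(3), of "\<lambda>f. f y"] f0[OF that] that val_eq[OF f1T that] by simp
      have "vf \<otimes>\<^bsub>R\<^esub> f2 \<in> carrier R" using vf_R f2(2) by simp
      then show "vf \<otimes>\<^bsub>R\<^esub> f2 \<in> CT" unfolding CT_iff by (simp add: eq del: coord_ring_apply)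
    qed
    have val_f1: "val f1 v = val f1 0 + v * val f2 v" if "g v \<noteq> 0" for v
      using arg_cong[OF f2(3), of "\<lambda>f. f (mk x1 v)"] f0[OF point_over(1)[OF that]] point_over[OF that]
      by (simp add: val_def vf_apply)
    define f2' where "f2' = restrict (\<lambda>y. val f2 (s j (y r))) V"
    define w where "w = restrict (\<lambda>y. of_nat j * den j (y r) * val f1 (y r)) V"
    have f1_reg: "(\<lambda>y. val f1 (y r)) \<in> regfun m V"
      by (rule agree_on_cong[OF carrier_R_regfun[OF f1R]]) (simp add: val_eq[OF f1T])
    have R2: "f2' \<in> carrier R" "w \<in> carrier R"
      unfolding f2'_def w_def using CT_R[OF shifted_CT[OF f2T]]
      by (auto intro!: coord_in_R regfun.mult regfun.const den_regular f1_reg)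
    \<comment> \<open>the equation for \<open>f1\<close> after inserting \<open>f1 = f1 0 + v f2\<close>, multiplied by \<open>v\<close> so that it can be checked pointwise\<close>
    have "vf \<otimes>\<^bsub>R\<^esub> f2' = vf \<otimes>\<^bsub>R\<^esub> (d \<otimes>\<^bsub>R\<^esub> f2 \<oplus>\<^bsub>R\<^esub> w)"
    proof (rule coord_ring_eqI)
      fix y assume y: "y \<in> V"
      have gy: "g (y r) \<noteq> 0" using y by (rule V_nonzero)
      have dn: "den j (y r) \<noteq> 0" using gy by (rule den_nonzero)
      have den: "den j (y r) = 1 + of_nat j * y r" by (subst den_def) (simp add: c)
      have "val f1 0 + s j (y r) * val f2 (s j (y r)) = den j (y r) * val f1 (y r)"
        using E1[OF gy] val_f1[OF g_s_nonzero[OF gy]] by (simp add: True)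
      also have "\<dots> = val f1 0 + y r * val f2 (y r) + of_nat j * y r * val f1 (y r)"
        unfolding den using val_f1[OF gy] by (simp add: algebra_simps)
      finally have "s j (y r) * val f2 (s j (y r)) = y r * val f2 (y r) + of_nat j * y r * val f1 (y r)"
        by (simp add: add.assoc)
      moreover have "den j (y r) * s j (y r) = y r" using dn by (subst s_def) (simp add: True)
      ultimately have "y r * val f2 (s j (y r)) = den j (y r) * (y r * val f2 (y r) + of_nat j * y r * val f1 (y r))"
        by (metis mult.assoc)
      then show "(vf \<otimes>\<^bsub>R\<^esub> f2') y = (vf \<otimes>\<^bsub>R\<^esub> (d \<otimes>\<^bsub>R\<^esub> f2 \<oplus>\<^bsub>R\<^esub> w)) y"
        using y val_eq[OF f2T y] by (simp add: vf_apply f2'_def d_def w_def algebra_simps)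
    qed (use R1 R2 vf_R f2(2) in auto)
    then have eq: "f2' = d \<otimes>\<^bsub>R\<^esub> f2 \<oplus>\<^bsub>R\<^esub> w"
      using R.m_lcancel[OF vf_nonzero vf_R] R1 R2 f2(2) by simp
    have "val f2 (s j 0) = den j 0 * val f2 0 + of_nat j * den j 0 * val f1 0"
      using fun_cong[OF eq, of "mk x1 0"] point_over[of 0]
      by (simp add: f2'_def d_def w_def) (simp add: val_def)
    then have "of_nat j * val f1 0 = 0" by (simp add: den_def)
    then show ?thesis using nontrivial(2)[OF j True] by simp
  qed
  then have "f1 \<in> P" using f1R val_eq[OF f1T] by (simp add: P_def)
  then obtain f2 where f2: "f2 \<in> carrier R" "f1 = vf \<otimes>\<^bsub>R\<^esub> f2" using P_factor by blast
  have "f2 \<in> CT" by (rule CT_cancel[OF f1T f2(1) vf_CT vf_nonzero f2(2)])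
  then show ?thesis using f1 f2(2) by blast
qed

lemma ramification:
  "ramification_index (Inv T) (P \<inter> CT) (P \<inter> CH) > 1"
proof -
  interpret I: domain "Inv T" by (rule Inv_domain[OF T_subset_H])
  have "2 \<le> prime_valuation (Inv T) (P \<inter> CT) f" if f: "f \<in> P \<inter> CH" for f
  proof -
    obtain f2 where f2: "f2 \<in> CT" "f = vf \<otimes>\<^bsub>R\<^esub> (vf \<otimes>\<^bsub>R\<^esub> f2)"
      using invariant_vanishing_order_two f by blast
    have "vf \<otimes>\<^bsub>Inv T\<^esub> f2 \<in> P \<inter> CT"
      using vf_P CT_R[OF f2(1)] I.m_closed[OF vf_CT f2(1)] by (auto simp: Inv_ops P_def)
    then have "2 \<le> prime_valuation (Inv T) (P \<inter> CT) (vf \<otimes>\<^bsub>Inv T\<^esub> (vf \<otimes>\<^bsub>Inv T\<^esub> f2))"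
      using vf_P vf_CT by (intro I.prime_valuation_mult_ge_two[OF P_Inv_prime[OF T_subset_H]]) auto
    then show ?thesis unfolding f2(2) Inv_ops .
  qed
  then have "2 \<le> ramification_index (Inv T) (P \<inter> CT) (P \<inter> CH)"
    unfolding ramification_index_def by (rule INF_greatest)
  moreover have "(1 :: enat) < 2" by (simp add: numeral_eq_enat one_enat_def)
  ultimately show ?thesis by (rule less_le_trans[rotated])
qed

section \<open>Invariant fractions\<close>

abbreviation SR where "SR \<equiv> carrier R - {\<zero>\<^bsub>R\<^esub>}"
abbreviation ST where "ST \<equiv> CT - {\<zero>\<^bsub>R\<^esub>}"

lemma fraction_image_R:
  assumes a: "a \<in> carrier R" and b: "b \<in> SR" and h: "h \<in> H"
  shows "extend_to_quotients R (\<rho> h) (fraction R SR a b) = fraction R SR (\<rho> h a) (\<rho> h b)"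
proof -
  have nz: "\<rho> h t \<in> SR" if "t \<in> SR" for t
  proof -
    have "\<rho> h t \<noteq> \<zero>\<^bsub>R\<^esub>"
    proof
      assume "\<rho> h t = \<zero>\<^bsub>R\<^esub>"
      also have "\<zero>\<^bsub>R\<^esub> = \<rho> h \<zero>\<^bsub>R\<^esub>"
        using \<rho>_const[OF h, of 0] by (simp add: coord_ring_def)
      finally show False
        using \<rho>_Bij[OF h] that unfolding Bij_def bij_betw_def by (auto dest: inj_onD)
    qed
    then show ?thesis using \<rho>_closed[OF h] that by blast
  qed
  have hom: "\<rho> h (x \<otimes>\<^bsub>R\<^esub> y) = \<rho> h x \<otimes>\<^bsub>R\<^esub> \<rho> h y" if "x \<in> carrier R" "y \<in> carrier R" for x y
    using ring_hom_mult[of "\<rho> h" R R x y] \<rho>_ring_iso[OF h] that by (simp add: ring_iso_def)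
  have eq: "fraction R SR (\<rho> h a') (\<rho> h b') = fraction R SR (\<rho> h a) (\<rho> h b)" if "(a', b') \<in> fraction R SR a b" for a' b'
  proof -
    have as': "a' \<in> carrier R" "b' \<in> SR" and "\<exists>u\<in>SR. u \<otimes>\<^bsub>R\<^esub> (b' \<otimes>\<^bsub>R\<^esub> a) = u \<otimes>\<^bsub>R\<^esub> (b \<otimes>\<^bsub>R\<^esub> a')"
      using that unfolding fraction_def by auto
    then have "fraction R SR a b = fraction R SR a' b'"
      using a b by (subst fraction_eq_iff[OF R.is_cring R.submonoid_nonzero]) auto
    then have "b' \<otimes>\<^bsub>R\<^esub> a = b \<otimes>\<^bsub>R\<^esub> a'" using a b as' by (simp add: R.quotient_eq_iff)
    then have "\<rho> h b' \<otimes>\<^bsub>R\<^esub> \<rho> h a = \<rho> h b \<otimes>\<^bsub>R\<^esub> \<rho> h a'"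
      using a b as' by (simp flip: hom)
    then have "fraction R SR (\<rho> h a) (\<rho> h b) = fraction R SR (\<rho> h a') (\<rho> h b')"
      using a b as' nz[OF b] nz[OF as'(2)] \<rho>_closed[OF h] by (subst R.quotient_eq_iff) auto
    then show ?thesis ..
  qed
  have ne: "(a, b) \<in> fraction R SR a b"
    using a b by (rule mem_fraction[OF R.is_cring R.submonoid_nonzero])
  show ?thesis
    unfolding extend_to_quotients_def R.non_zero_divisors_eq
  proof (intro Set.equalityI subsetI)
    fix p assume "p \<in> (\<Union>(a', b')\<in>fraction R SR a b. fraction R SR (\<rho> h a') (\<rho> h b'))"
    then show "p \<in> fraction R SR (\<rho> h a) (\<rho> h b)" using eq by auto
  next
    fix p assume "p \<in> fraction R SR (\<rho> h a) (\<rho> h b)"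
    then show "p \<in> (\<Union>(a', b')\<in>fraction R SR a b. fraction R SR (\<rho> h a') (\<rho> h b'))" using ne by auto
  qed
qed

lemma fraction_image_T:
  assumes a: "a \<in> CT" and b: "b \<in> ST"
  shows "(\<Union>(a', b')\<in>fraction (Inv T) ST a b. fraction R SR a' b') = fraction R SR a b"
proof -
  interpret I: domain "Inv T" by (rule Inv_domain[OF T_subset_H])
  have SM: "submonoid ST (Inv T)" using I.submonoid_nonzero by (simp add: Inv_ops)
  have eq: "fraction R SR a' b' = fraction R SR a b" if "(a', b') \<in> fraction (Inv T) ST a b" for a' b'
  proof -
    have "a' \<in> CT \<and> b' \<in> ST \<and> (\<exists>u\<in>ST. u \<otimes>\<^bsub>R\<^esub> (b' \<otimes>\<^bsub>R\<^esub> a) = u \<otimes>\<^bsub>R\<^esub> (b \<otimes>\<^bsub>R\<^esub> a'))"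
      using that unfolding fraction_def mem_Collect_eq prod.case Inv_ops .
    then obtain u where as': "a' \<in> CT" "b' \<in> ST" "u \<in> ST" "u \<otimes>\<^bsub>R\<^esub> (b' \<otimes>\<^bsub>R\<^esub> a) = u \<otimes>\<^bsub>R\<^esub> (b \<otimes>\<^bsub>R\<^esub> a')"
      by (elim conjE bexE) (rule that; assumption)
    then have "b' \<otimes>\<^bsub>R\<^esub> a = b \<otimes>\<^bsub>R\<^esub> a'"
      using a b R.m_lcancel[of u "b' \<otimes>\<^bsub>R\<^esub> a" "b \<otimes>\<^bsub>R\<^esub> a'"] CT_R by auto
    then have "fraction R SR a b = fraction R SR a' b'"
      using a b as' CT_R by (subst R.quotient_eq_iff) auto
    then show ?thesis ..
  qed
  have ne: "(a, b) \<in> fraction (Inv T) ST a b"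
    using a b by (rule mem_fraction[OF I.is_cring SM])
  show ?thesis
  proof (intro Set.equalityI subsetI)
    fix p assume "p \<in> (\<Union>(a', b')\<in>fraction (Inv T) ST a b. fraction R SR a' b')"
    then show "p \<in> fraction R SR a b" using eq by auto
  next
    fix p assume "p \<in> fraction R SR a b"
    then show "p \<in> (\<Union>(a', b')\<in>fraction (Inv T) ST a b. fraction R SR a' b')" using ne by auto
  qed
qed

lemma total_quotient_image_T:
  "total_quotient_image R (Inv T) = {fraction R SR a b | a b. a \<in> CT \<and> b \<in> ST}"
proof -
  interpret I: domain "Inv T" by (rule Inv_domain[OF T_subset_H])
  have nz: "non_zero_divisors (Inv T) = ST" using I.non_zero_divisors_eq by (simp add: Inv_ops)
  have car: "carrier (total_quotient_ring (Inv T)) = {fraction (Inv T) ST a b | a b. a \<in> CT \<and> b \<in> ST}"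
    unfolding total_quotient_ring_def nz localization_def by simp
  show ?thesis
    unfolding total_quotient_image_def car R.non_zero_divisors_eq
  proof (intro Set.equalityI subsetI)
    fix z assume "z \<in> (\<lambda>z. \<Union>(a, b)\<in>z. fraction R SR a b) ` {fraction (Inv T) ST a b | a b. a \<in> CT \<and> b \<in> ST}"
    then obtain a b where "a \<in> CT" "b \<in> ST" "z = (\<Union>(a, b)\<in>fraction (Inv T) ST a b. fraction R SR a b)"
      by auto
    then show "z \<in> {fraction R SR a b | a b. a \<in> CT \<and> b \<in> ST}" using fraction_image_T by auto
  next
    fix z assume "z \<in> {fraction R SR a b | a b. a \<in> CT \<and> b \<in> ST}"
    then obtain a b where as: "a \<in> CT" "b \<in> ST" "z = fraction R SR a b" by auto
    show "z \<in> (\<lambda>z. \<Union>(a, b)\<in>z. fraction R SR a b) ` {fraction (Inv T) ST a b | a b. a \<in> CT \<and> b \<in> ST}"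
      by (rule image_eqI[of _ _ "fraction (Inv T) ST a b"]) (use as fraction_image_T in auto)
  qed
qed

text \<open>
  The restriction of a function to \<open>{x} \<times> curve\<close>, extended constantly along the torus.
\<close>

lemma slice_CT:
  assumes x: "x \<in> S" and f: "f \<in> carrier R"
  shows "restrict (\<lambda>y. f (mk x (y r))) V \<in> CT"
proof -
  have "(\<lambda>y. mk x (y r) i) \<in> regfun m V" for i
  proof -
    have "(\<lambda>y. (\<Prod>j<r. x (r + j)) * (1 / g (y r))) \<in> regfun m V"
      by (intro regfun.mult regfun.const inv_g_regular)
    then have "(\<lambda>y. (\<Prod>j<r. x (r + j)) / g (y r)) \<in> regfun m V" by simp
    then show ?thesis
      unfolding mk_def using v_regular regfun.const by (cases "i < r"; cases "i = r"; cases "i = Suc r") auto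
  qed
  then have "(\<lambda>y. f (mk x (y r))) \<in> regfun m V"
    by (rule polyfun.regfun_subst[OF carrier_R_regfun[OF f]]) (use mk_V(1)[OF x V_nonzero(1)] in auto)
  then show ?thesis unfolding CT_iff by (auto intro: coord_in_R)
qed

text \<open>
  Let \<open>a / b\<close> be invariant and \<open>x0\<close> a point of the torus such that \<open>b\<close> does not vanish identically on the slice \<open>{x0} \<times> curve\<close>.
  Moving a point \<open>y\<close> into this slice by an element of \<open>T\<close> shows that \<open>a / b\<close> equals the quotient of the restrictions of \<open>a\<close> and \<open>b\<close>
  to the slice.
\<close>

lemma invariant_fractions:
  "total_quotient_image R (Inv T) =
    {z \<in> carrier (total_quotient_ring R). \<forall>t\<in>T. extend_to_quotients R (\<rho> t) z = z}"
proof (intro Set.equalityI subsetI)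
  fix z assume "z \<in> total_quotient_image R (Inv T)"
  then obtain a b where as: "a \<in> CT" "b \<in> ST" "z = fraction R SR a b"
    unfolding total_quotient_image_T by auto
  have sR: "b \<in> SR" using as(2) CT_R by blast
  have "extend_to_quotients R (\<rho> t) z = z" if "t \<in> T" for t
    unfolding as(3) fraction_image_R[OF CT_R[OF as(1)] sR T_H[OF that]]
    using as(1,2) that by (simp add: Inv_carrier)
  then show "z \<in> {z \<in> carrier (total_quotient_ring R). \<forall>t\<in>T. extend_to_quotients R (\<rho> t) z = z}"
    using R.quotient_carrierI[OF CT_R[OF as(1)] sR] as(3) by simp
next
  fix z assume "z \<in> {z \<in> carrier (total_quotient_ring R). \<forall>t\<in>T. extend_to_quotients R (\<rho> t) z = z}"
  then have z: "z \<in> carrier (total_quotient_ring R)" and inv: "\<And>t. t \<in> T \<Longrightarrow> extend_to_quotients R (\<rho> t) z = z"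
    by auto
  obtain a b where a: "a \<in> carrier R" and b: "b \<in> SR" and z_eq: "z = fraction R SR a b"
    using z by (rule R.quotient_carrierE)
  have sR: "b \<in> carrier R" using b by blast
  obtain y1 where y1: "y1 \<in> V" "b y1 \<noteq> 0"
    using b coord_ring_eqI[OF sR R.zero_closed] by auto
  define x0 where "x0 = tor y1"
  have x0: "x0 \<in> S" unfolding x0_def using y1(1) by (rule tor_S)
  define a0 where "a0 = restrict (\<lambda>y. a (mk x0 (y r))) V"
  define s0 where "s0 = restrict (\<lambda>y. b (mk x0 (y r))) V"
  have a0: "a0 \<in> CT" and s0: "s0 \<in> CT"
    unfolding a0_def s0_def by (intro slice_CT x0 a sR)+
  have "s0 y1 = b y1" using y1(1) mk_tor[OF y1(1)] by (simp add: s0_def x0_def)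
  then have s0_nz: "s0 \<noteq> \<zero>\<^bsub>R\<^esub>" using y1 by auto
  have "s0 \<otimes>\<^bsub>R\<^esub> a = b \<otimes>\<^bsub>R\<^esub> a0"
  proof (rule coord_ring_eqI)
    fix y assume y: "y \<in> V"
    obtain t where t: "t \<in> T" "A t (tor y) = x0" using A_transitive[OF tor_S[OF y] x0] by auto
    have act_t: "act t y = mk x0 (y r)"
      unfolding act_def t(2) using s_Z[of t] T_Z t(1) by auto
    have it: "inv t \<in> T" using t(1) by (rule subgroup.m_inv_closed[OF T_sub])
    have itH: "inv t \<in> H" using it by (rule T_H)
    have \<rho>_it: "\<rho> (inv t) f y = f (mk x0 (y r))" if "f \<in> carrier R" for f
      using that y t(1) act_t H_carrier[OF T_H[OF t(1)]] by (simp add: \<rho>_apply)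
    have nz: "\<rho> (inv t) b \<in> SR"
    proof -
      have "\<rho> (inv t) b \<noteq> \<zero>\<^bsub>R\<^esub>"
      proof
        assume 0: "\<rho> (inv t) b = \<zero>\<^bsub>R\<^esub>"
        have "b = \<rho> t (\<rho> (inv t) b)"
          using sR t(1) by (simp add: T_H itH H_carrier \<rho>_one flip: \<rho>_mult)
        also have "\<dots> = \<zero>\<^bsub>R\<^esub>"
          unfolding 0 using \<rho>_const[OF T_H[OF t(1)], of 0] by (simp add: coord_ring_def)
        finally show False using b by blast
      qed
      then show ?thesis using \<rho>_closed[OF itH sR] by blast
    qed
    have "fraction R SR (\<rho> (inv t) a) (\<rho> (inv t) b) = fraction R SR a b"
      using inv[OF it] unfolding z_eq fraction_image_R[OF a b itH] .
    then have "b \<otimes>\<^bsub>R\<^esub> \<rho> (inv t) a = \<rho> (inv t) b \<otimes>\<^bsub>R\<^esub> a"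
      using R.quotient_eq_iff[OF \<rho>_closed[OF itH a] a nz b] by simp
    from fun_cong[OF this, of y] have "b y * a (mk x0 (y r)) = b (mk x0 (y r)) * a y"
      using y \<rho>_it[OF a] \<rho>_it[OF sR] by simp
    then show "(s0 \<otimes>\<^bsub>R\<^esub> a) y = (b \<otimes>\<^bsub>R\<^esub> a0) y"
      using y by (simp add: s0_def a0_def)
  qed (use a sR CT_R[OF a0] CT_R[OF s0] in auto)
  then have "z = fraction R SR a0 s0"
    unfolding z_eq using R.quotient_eq_iff[OF a CT_R[OF a0] b] CT_R[OF s0] s0_nz by simp
  then show "z \<in> total_quotient_image R (Inv T)"
    unfolding total_quotient_image_T using a0 s0 s0_nz by blast
qed

section \<open>The reflection groups\<close>

text \<open>
  The left-hand group is trivial on the \<open>T\<close>-invariants, as it is contained in \<open>Z\<close>. The right-hand one contains the elements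
  outside \<open>Z\<close>, which move \<open>v\<close>.
\<close>

lemma reflection_groups_differ:
  "restrictions \<rho> (reflection_group HG R \<rho> (Inv H)) CT \<noteq> restrictions \<rho> (reflection_group HG (Inv T) \<rho> (Inv H)) CT"
proof -
  obtain \<tau> where \<tau>: "\<tau> \<in> H" "\<tau> \<notin> Z" using Z_proper Z_H by blast
  have "reflection_group HG R \<rho> (Inv H) \<subseteq> Z"
    unfolding reflection_group_def
  proof (rule group.generate_subgroup_incl[OF group_HG])
    show "(\<Union>Q\<in>Ht1 R (Inv H). inertia_group R \<rho> (carrier HG) Q) \<subseteq> Z"
      using inertia_subset_Z by auto
    show "subgroup Z HG" by (rule subgroup_incl[OF Z_sub H_sub Z_H])
  qed
  moreover have "restrict (\<rho> z) CT = (\<lambda>f\<in>CT. f)" if z: "z \<in> Z" for z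
  proof -
    have "\<rho> z f = f" if f: "f \<in> CT" for f
    proof -
      have "f \<in> carrier (Inv Z)" using Inv_between[OF T_Z subset_refl] f by simp
      then show ?thesis using z by (simp add: Inv_carrier)
    qed
    then show ?thesis by (intro restrict_ext)
  qed
  ultimately have left: "restrictions \<rho> (reflection_group HG R \<rho> (Inv H)) CT \<subseteq> {\<lambda>f\<in>CT. f}"
    unfolding restrictions_def by blast
  have "\<tau> \<in> reflection_group HG (Inv T) \<rho> (Inv H)"
    unfolding reflection_group_def
    by (rule generate.incl) (use P_T_Ht1 inertia_T \<tau>(1) in auto)
  then have right: "restrict (\<rho> \<tau>) CT \<in> restrictions \<rho> (reflection_group HG (Inv T) \<rho> (Inv H)) CT"
    unfolding restrictions_def by blast
  have "restrict (\<rho> \<tau>) CT \<noteq> (\<lambda>f\<in>CT. f)"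
  proof
    assume eq: "restrict (\<rho> \<tau>) CT = (\<lambda>f\<in>CT. f)"
    have "\<rho> \<tau> vf = vf" using fun_cong[OF eq, of vf] vf_CT by simp
    obtain v where v: "v \<noteq> 0" "g v \<noteq> 0" using exists_nonzero_v by auto
    define j where "j = J (inv \<tau>)"
    have j: "\<not> q dvd j" unfolding j_def by (rule J_not_dvd[OF \<tau>])
    have "\<rho> \<tau> vf (mk x1 v) = s j v"
      using point_over[OF v(2)] vf_R H_inv[OF \<tau>(1)] by (simp add: \<rho>_apply vf_apply act_V act_r j_def)
    then have "s j v = v"
      using \<open>\<rho> \<tau> vf = vf\<close> point_over[OF v(2)] by (simp add: vf_apply)
    then have "\<zeta> ^ j = den j v"
      using v(1) den_nonzero[OF v(2), of j] by (simp add: s_def field_simps)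
    then show False
      using \<zeta>_c_cases nontrivial[OF j] v(1) by (auto simp: den_def)
  qed
  then show ?thesis using left right by blast
qed

end

section \<open>Twisting the translation action of a torus\<close>

lemma (in group) centralizer_normal:
  assumes "T \<lhd> G"
  shows "centralizer G T \<lhd> G"
proof -
  have T: "T \<subseteq> carrier G" using subgroup.subset[OF normal_imp_subgroup[OF assms]] .
  have inv_commutes: "inv g \<otimes> t = t \<otimes> inv g" if "g \<in> carrier G" "t \<in> carrier G" "g \<otimes> t = t \<otimes> g" for g t
  proof -
    have "inv g \<otimes> t = inv g \<otimes> (t \<otimes> g) \<otimes> inv g" using that(1,2) by (simp add: m_assoc)
    also have "\<dots> = t \<otimes> inv g" using that(1,2) unfolding that(3)[symmetric] by (simp flip: m_assoc)
    finally show ?thesis .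
  qed
  have sub: "subgroup (centralizer G T) G"
  proof (rule subgroupI)
    show "centralizer G T \<subseteq> carrier G" by (auto simp: centralizer_def)
    have "\<one> \<in> centralizer G T" using T by (auto simp: centralizer_def)
    then show "centralizer G T \<noteq> {}" by blast
    show "inv g \<in> centralizer G T" if "g \<in> centralizer G T" for g
      using that T inv_commutes unfolding centralizer_def by auto
    show "g \<otimes> h \<in> centralizer G T" if g: "g \<in> centralizer G T" and h: "h \<in> centralizer G T" for g h
    proof -
      have gh: "g \<in> carrier G" "h \<in> carrier G" using g h by (auto simp: centralizer_def)
      have "(g \<otimes> h) \<otimes> t = t \<otimes> (g \<otimes> h)" if t: "t \<in> T" for t
      proof -
        have tG: "t \<in> carrier G" using t T by blast
        have c: "g \<otimes> t = t \<otimes> g" "h \<otimes> t = t \<otimes> h" using g h t by (auto simp: centralizer_def)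
        have "(g \<otimes> h) \<otimes> t = g \<otimes> (t \<otimes> h)" using gh tG c(2) by (simp add: m_assoc)
        also have "\<dots> = t \<otimes> (g \<otimes> h)" using gh tG c(1) by (simp flip: m_assoc)
        finally show ?thesis .
      qed
      then show ?thesis using gh by (simp add: centralizer_def)
    qed
  qed
  show ?thesis
    unfolding normal_inv_iff
  proof (intro conjI ballI sub)
    fix x g assume x: "x \<in> carrier G" and g: "g \<in> centralizer G T"
    have gG: "g \<in> carrier G" using g by (simp add: centralizer_def)
    have "(x \<otimes> g \<otimes> inv x) \<otimes> t = t \<otimes> (x \<otimes> g \<otimes> inv x)" if t: "t \<in> T" for t
    proof -
      define u where "u = inv x \<otimes> t \<otimes> x"
      have u: "u \<in> T" unfolding u_def by (rule normal.inv_op_closed1[OF assms x t])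
      have tG: "t \<in> carrier G" and uG: "u \<in> carrier G" using t u T by auto
      have t_eq: "t = x \<otimes> u \<otimes> inv x"
        unfolding u_def using x tG by (simp add: m_assoc inv_mult_cancel)
      have gu: "g \<otimes> u = u \<otimes> g" using g u by (simp add: centralizer_def)
      have "(x \<otimes> g \<otimes> inv x) \<otimes> (x \<otimes> u \<otimes> inv x) = x \<otimes> (g \<otimes> u) \<otimes> inv x"
        using x gG uG by (simp add: m_assoc inv_mult_cancel)
      also have "\<dots> = (x \<otimes> u \<otimes> inv x) \<otimes> (x \<otimes> g \<otimes> inv x)"
        unfolding gu using x gG uG by (simp add: m_assoc inv_mult_cancel)
      finally show ?thesis unfolding t_eq[symmetric] .
    qed
    then show "x \<otimes> g \<otimes> inv x \<in> centralizer G T" using x gG by (simp add: centralizer_def)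
  qed
qed

lemma finite_power_eq:
  fixes u :: "'k::field"
  assumes "N > 0"
  shows "finite {x. x ^ N = u}"
proof -
  have "Polynomial.coeff (Polynomial.monom (1::'k) N - [:u:]) N = 1" using assms by (simp add: coeff_pCons split: nat.splits)
  then have "Polynomial.monom (1::'k) N - [:u:] \<noteq> 0" by (metis Polynomial.coeff_0 zero_neq_one)
  then have "finite {x. poly (Polynomial.monom (1::'k) N - [:u:]) x = 0}" by (rule poly_roots_finite)
  then show ?thesis by (simp add: Polynomial.poly_monom)
qed

lemma root_exists:
  fixes u :: "'k::alg_closed_field"
  assumes "N > 0"
  shows "\<exists>w. w ^ N = u"
proof -
  have "Polynomial.coeff (Polynomial.monom (1::'k) N - [:u:]) N = 1" using assms by (simp add: coeff_pCons split: nat.splits)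
  then have "N \<le> Polynomial.degree (Polynomial.monom (1::'k) N - [:u:])" by (intro le_degree) simp
  then have "Polynomial.degree (Polynomial.monom (1::'k) N - [:u:]) > 0" using assms by simp
  then obtain w where "poly (Polynomial.monom (1::'k) N - [:u:]) w = 0"
    using alg_closed_imp_poly_has_root by blast
  then show ?thesis by (auto simp: Polynomial.poly_monom)
qed

lemma split_torus_iff:
  "x \<in> carrier (split_torus r) \<longleftrightarrow> x \<in> affine_space (2 * r) \<and> (\<forall>i<r. x i * x (r + i) = 1)"
  by (simp add: split_torus_def)

lemma split_torus_nonzero:
  assumes "x \<in> carrier (split_torus r)" "i < 2 * r"
  shows "x i \<noteq> 0"
proof (cases "i < r")
  case True
  then show ?thesis using assms(1) unfolding split_torus_iff by fastforce
next
  case False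
  have "i - r < r" "r + (i - r) = i" using False assms(2) by auto
  then have "x (i - r) * x i = 1" using assms(1) unfolding split_torus_iff by metis
  then show ?thesis by auto
qed

lemma split_torus_root:
  fixes u :: "'k::alg_closed_field point"
  assumes u: "u \<in> carrier (split_torus r)" and N: "N > 0"
  shows "\<exists>x\<in>carrier (split_torus r). \<forall>i<2*r. x i ^ N = u i"
proof -
  have "\<forall>i. \<exists>w. w ^ N = u i" using root_exists[OF N] by blast
  then obtain w where w: "\<And>i. w i ^ N = u i" by metis
  define x where "x i = (if i < r then w i else if i < 2 * r then inverse (w (i - r)) else 0)" for i
  have w0: "w i \<noteq> 0" if "i < r" for i
  proof
    assume "w i = 0"
    then have "u i = 0" using w[of i] N by (simp add: power_0_left)
    then show False using split_torus_nonzero[OF u, of i] that by simp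
  qed
  have "x \<in> carrier (split_torus r)"
    unfolding split_torus_iff by (auto simp: x_def affine_space_def w0)
  moreover have "x i ^ N = u i" if i: "i < 2 * r" for i
  proof (cases "i < r")
    case False
    have "i - r < r" "r + (i - r) = i" using False i by auto
    then have "u (i - r) * u i = 1" using u unfolding split_torus_iff by metis
    then have "u i = inverse (u (i - r))" by (metis inverse_unique)
    then show ?thesis using False i by (simp add: x_def power_inverse w)
  qed (simp add: x_def w)
  ultimately show ?thesis by blast
qed

text \<open>
  An affine algebraic group with a normal torus \<open>T\<close> of finite index, given by an isomorphism \<open>\<phi>\<close> from the split torus and its inverse \<open>\<psi>\<close>.
  A map into the split torus is multiplicative if and only if its coordinates are.
\<close>

locale torus_by_finite = affine_algebraic_group n G
  for n :: nat and G :: "'k::alg_closed_field point monoid" (structure) +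
  fixes T r \<phi> \<psi>
  assumes T_normal: "T \<lhd> G" and T_closed: "closedin (zariski n) T" and T_finite_index: "finite (rcosets T)"
    and \<phi>_T: "x \<in> carrier (split_torus r) \<Longrightarrow> \<phi> x \<in> T"
    and \<psi>_S: "t \<in> T \<Longrightarrow> \<psi> t \<in> carrier (split_torus r)"
    and \<phi>_\<psi>: "t \<in> T \<Longrightarrow> \<phi> (\<psi> t) = t"
    and \<psi>_\<phi>: "x \<in> carrier (split_torus r) \<Longrightarrow> \<psi> (\<phi> x) = x"
    and \<psi>_mult: "s \<in> T \<Longrightarrow> t \<in> T \<Longrightarrow> \<psi> (s \<otimes> t) i = \<psi> s i * \<psi> t i"
    and \<phi>_regular: "i < n \<Longrightarrow> (\<lambda>x. \<phi> x i) \<in> regfun (2 * r) (carrier (split_torus r))"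
    and \<psi>_regular: "i < 2 * r \<Longrightarrow> (\<lambda>t. \<psi> t i) \<in> regfun n T"
begin

abbreviation S where "S \<equiv> carrier (split_torus r) :: 'k point set"

lemma T_sub: "subgroup T G"
  using T_normal by (rule normal_imp_subgroup)

lemma T_carrier: "t \<in> T \<Longrightarrow> t \<in> carrier G"
  using subgroup.mem_carrier[OF T_sub] .

lemma T_mult: "s \<in> T \<Longrightarrow> t \<in> T \<Longrightarrow> s \<otimes> t \<in> T"
  using subgroup.m_closed[OF T_sub] .

lemma T_one: "\<one> \<in> T"
  using subgroup.one_closed[OF T_sub] .

lemma T_conj: "g \<in> carrier G \<Longrightarrow> t \<in> T \<Longrightarrow> g \<otimes> t \<otimes> inv g \<in> T"
  using normal.inv_op_closed2[OF T_normal] .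

lemma \<psi>_inj: "s \<in> T \<Longrightarrow> t \<in> T \<Longrightarrow> \<psi> s = \<psi> t \<Longrightarrow> s = t"
  using \<phi>_\<psi> by metis

text \<open>Points of the split torus vanish outside the first \<open>2 r\<close> coordinates.\<close>

lemma \<psi>_eqI: "s \<in> T \<Longrightarrow> t \<in> T \<Longrightarrow> (\<And>i. i < 2 * r \<Longrightarrow> \<psi> s i = \<psi> t i) \<Longrightarrow> s = t"
proof (rule \<psi>_inj)
  assume st: "s \<in> T" "t \<in> T" "\<And>i. i < 2 * r \<Longrightarrow> \<psi> s i = \<psi> t i"
  show "\<psi> s = \<psi> t"
  proof
    fix i
    show "\<psi> s i = \<psi> t i"
      using st(3)[of i] \<psi>_S[OF st(1)] \<psi>_S[OF st(2)]
      by (cases "i < 2 * r") (auto simp: split_torus_iff affine_space_def)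
  qed
qed

lemma T_comm: "s \<in> T \<Longrightarrow> t \<in> T \<Longrightarrow> s \<otimes> t = t \<otimes> s"
  by (rule \<psi>_eqI) (simp_all add: T_mult \<psi>_mult mult.commute)

lemma \<psi>_one: "i < 2 * r \<Longrightarrow> \<psi> \<one> i = 1"
  using \<psi>_mult[OF T_one T_one, of i] split_torus_nonzero[OF \<psi>_S[OF T_one], of i] by simp

lemma T_pow: "t \<in> T \<Longrightarrow> t [^] (k::nat) \<in> T"
  by (induction k) (auto simp: T_mult T_one)

lemma \<psi>_pow: "t \<in> T \<Longrightarrow> i < 2 * r \<Longrightarrow> \<psi> (t [^] (k::nat)) i = \<psi> t i ^ k"
proof (induction k)
  case (Suc k)
  then show ?case by (simp add: \<psi>_mult T_pow mult.commute)
qed (simp add: \<psi>_one)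

lemma T_root: "u \<in> T \<Longrightarrow> k > 0 \<Longrightarrow> \<exists>t\<in>T. t [^] (k::nat) = u"
proof -
  assume u: "u \<in> T" and k: "k > 0"
  obtain x where x: "x \<in> S" "\<And>i. i < 2 * r \<Longrightarrow> x i ^ k = \<psi> u i"
    using split_torus_root[OF \<psi>_S[OF u] k] by auto
  have "\<phi> x [^] k = u"
    by (rule \<psi>_eqI) (simp_all add: T_pow \<phi>_T x u \<psi>_pow \<psi>_\<phi>)
  then show ?thesis using \<phi>_T[OF x(1)] by blast
qed

lemma finite_roots: "k > 0 \<Longrightarrow> finite {t \<in> T. t [^] (k::nat) = u}"
proof (rule finite_imageD[of \<psi>])
  assume k: "k > 0"
  let ?B = "\<Union>i<2*r. {w. w ^ k = \<psi> u i}"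
  have fin: "finite {f. \<forall>i. (i \<in> {..<2*r} \<longrightarrow> f i \<in> ?B) \<and> (i \<notin> {..<2*r} \<longrightarrow> f i = 0)}"
    by (rule finite_set_of_finite_funs) (auto simp: finite_power_eq k)
  have "\<psi> ` {t \<in> T. t [^] k = u} \<subseteq> {f. \<forall>i. (i \<in> {..<2*r} \<longrightarrow> f i \<in> ?B) \<and> (i \<notin> {..<2*r} \<longrightarrow> f i = 0)}"
  proof
    fix f assume "f \<in> \<psi> ` {t \<in> T. t [^] k = u}"
    then obtain t where t: "t \<in> T" "t [^] k = u" "f = \<psi> t" by blast
    have "f i ^ k = \<psi> u i" if "i < 2 * r" for i using \<psi>_pow[OF t(1) that, of k] t(2,3) by simp
    moreover have "f i = 0" if "\<not> i < 2 * r" for i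
      using \<psi>_S[OF t(1)] that unfolding t(3) split_torus_iff affine_space_def by simp
    ultimately show "f \<in> {f. \<forall>i. (i \<in> {..<2*r} \<longrightarrow> f i \<in> ?B) \<and> (i \<notin> {..<2*r} \<longrightarrow> f i = 0)}" by blast
  qed
  then show "finite (\<psi> ` {t \<in> T. t [^] k = u})" by (rule finite_subset[OF _ fin])
  show "inj_on \<psi> {t \<in> T. t [^] k = u}" by (rule inj_onI) (use \<psi>_inj in auto)
qed

lemma \<psi>_character: "i < 2 * r \<Longrightarrow> (\<lambda>t. \<psi> t i) \<in> regular_characters T"
  using \<psi>_regular[of i] by (simp add: characters_def \<psi>_mult \<psi>_one)

sublocale diag: diagonalizable_subgroup n G T
proof (rule diagonalizable_subgroup.intro[OF affine_algebraic_group_axioms diagonalizable_subgroup_axioms.intro])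
  interpret E: function_algebra "bisum (regular_characters T) (regfun n (carrier G))"
    by (intro function_algebra_bisum function_algebra_agree_on function_algebra_polyfun)
      (auto simp: characters_def algebra_simps intro: regfun.const regfun.mult)
  show "T \<lhd> G" "closedin (zariski n) T" by (rule T_normal, rule T_closed)
  fix i assume i: "i < n"
  have "(\<lambda>p. \<phi> (\<psi> (fst p)) i) \<in> agree_on (T \<times> carrier G) (bisum (regular_characters T) (regfun n (carrier G)))"
  proof (rule E.regfun_subst[OF \<phi>_regular[OF i]])
    show "(\<lambda>p. \<psi> (fst p) k) \<in> agree_on (T \<times> carrier G) (bisum (regular_characters T) (regfun n (carrier G)))"
      if "k < 2 * r" for k
      by (intro agree_on_incl bisum_fst[OF \<psi>_character[OF that]] regfun.const)
  qed (auto intro: \<psi>_S)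
  then show "(\<lambda>p. fst p i) \<in> agree_on (T \<times> carrier G) (bisum (regular_characters T) (regfun n (carrier G)))"
    by (rule agree_on_cong) (auto simp: \<phi>_\<psi>)
qed

sublocale transfer: abelian_normal_subgroup G T
  by (rule abelian_normal_subgroup.intro[OF is_group abelian_normal_subgroup_axioms.intro])
    (rule T_normal T_comm T_finite_index; assumption?)+

abbreviation \<delta> where "\<delta> \<equiv> transfer.transfer_cocycle"
abbreviation N where "N \<equiv> card (rcosets T)"

text \<open>
  The cocycle identity for \<open>\<delta>\<close> makes this an action of the group on the split torus by affine maps: an automorphism followed
  by a translation.
\<close>

definition twist where "twist h x = \<psi> (\<delta> h \<otimes> (h \<otimes> \<phi> x \<otimes> inv h))"

lemma twist_T: "h \<in> carrier G \<Longrightarrow> x \<in> S \<Longrightarrow> \<delta> h \<otimes> (h \<otimes> \<phi> x \<otimes> inv h) \<in> T"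
  by (intro T_mult T_conj transfer.cocycle_closed \<phi>_T)

lemma twist_closed: "h \<in> carrier G \<Longrightarrow> x \<in> S \<Longrightarrow> twist h x \<in> S"
  unfolding twist_def by (intro \<psi>_S twist_T)

lemma \<phi>_twist: "h \<in> carrier G \<Longrightarrow> x \<in> S \<Longrightarrow> \<phi> (twist h x) = \<delta> h \<otimes> (h \<otimes> \<phi> x \<otimes> inv h)"
  unfolding twist_def by (intro \<phi>_\<psi> twist_T)

lemma twist_one: "x \<in> S \<Longrightarrow> twist \<one> x = x"
  using transfer.cocycle_T[OF T_one] T_carrier[OF \<phi>_T] by (simp add: twist_def \<psi>_\<phi>)

lemma twist_mult:
  assumes h: "h \<in> carrier G" and k: "k \<in> carrier G" and x: "x \<in> S"
  shows "twist (h \<otimes> k) x = twist h (twist k x)"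
proof -
  have c: "\<delta> h \<in> T" "\<delta> k \<in> T" "\<phi> x \<in> T" using h k x by (simp_all add: transfer.cocycle_closed \<phi>_T)
  note cG = c[THEN T_carrier]
  have "\<delta> (h \<otimes> k) \<otimes> ((h \<otimes> k) \<otimes> \<phi> x \<otimes> inv (h \<otimes> k)) =
      (\<delta> h \<otimes> (h \<otimes> \<delta> k \<otimes> inv h)) \<otimes> ((h \<otimes> k) \<otimes> \<phi> x \<otimes> inv (h \<otimes> k))"
    unfolding transfer.cocycle_mult[OF h k] using T_comm[OF c(1) T_conj[OF h c(2)]] by simp
  also have "\<dots> = \<delta> h \<otimes> (h \<otimes> (\<delta> k \<otimes> (k \<otimes> \<phi> x \<otimes> inv k)) \<otimes> inv h)"
    using h k cG by (simp add: m_assoc inv_mult_group inv_mult_cancel)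
  finally show ?thesis
    unfolding twist_def[of h] \<phi>_twist[OF k x] by (simp add: twist_def)
qed

lemma twist_T_eq: "t \<in> T \<Longrightarrow> x \<in> S \<Longrightarrow> twist t x = \<psi> (t [^] N \<otimes> \<phi> x)"
proof -
  assume t: "t \<in> T" and x: "x \<in> S"
  have "t \<otimes> \<phi> x \<otimes> inv t = \<phi> x"
    unfolding T_comm[OF t \<phi>_T[OF x]] using T_carrier t \<phi>_T[OF x] by (simp add: m_assoc)
  then show ?thesis by (simp add: twist_def transfer.cocycle_T[OF t])
qed

lemma twist_transitive: "x \<in> S \<Longrightarrow> y \<in> S \<Longrightarrow> \<exists>t\<in>T. twist t x = y"
proof -
  assume x: "x \<in> S" and y: "y \<in> S"
  have "\<phi> y \<otimes> inv (\<phi> x) \<in> T" by (intro T_mult subgroup.m_inv_closed[OF T_sub] \<phi>_T x y)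
  then obtain t where t: "t \<in> T" "t [^] N = \<phi> y \<otimes> inv (\<phi> x)"
    using T_root transfer.card_rcosets_pos by blast
  have "twist t x = y"
    unfolding twist_T_eq[OF t(1) x] t(2) using T_carrier[OF \<phi>_T] x y by (simp add: m_assoc \<psi>_\<phi>)
  then show ?thesis using t(1) by blast
qed

lemma twist_identity:
  assumes h: "h \<in> carrier G" and id: "\<And>x. x \<in> S \<Longrightarrow> twist h x = x"
  shows "\<delta> h = \<one>" "h \<in> centralizer G T"
proof -
  have dG: "\<delta> h \<in> carrier G" by (rule T_carrier[OF transfer.cocycle_closed[OF h]])
  have id': "\<delta> h \<otimes> (h \<otimes> t \<otimes> inv h) = t" if t: "t \<in> T" for t
    using \<phi>_twist[OF h \<psi>_S[OF t]] unfolding id[OF \<psi>_S[OF t]] \<phi>_\<psi>[OF t] by simp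
  show d: "\<delta> h = \<one>" using id'[OF T_one] h dG by simp
  have "h \<otimes> t = t \<otimes> h" if t: "t \<in> T" for t
  proof -
    have tG: "t \<in> carrier G" by (rule T_carrier[OF t])
    have "h \<otimes> t \<otimes> inv h = t" using id'[OF t] h tG unfolding d by simp
    then have "h \<otimes> t \<otimes> inv h \<otimes> h = t \<otimes> h" by simp
    then show ?thesis using h tG by (simp add: m_assoc)
  qed
  then show "h \<in> centralizer G T" using h by (simp add: centralizer_def)
qed

lemma cocycle_translate:
  assumes "t \<in> T" "a \<in> carrier G"
  shows "\<delta> (t \<otimes> a) = \<delta> a \<otimes> t [^] N"
proof -
  have tG: "t \<in> carrier G" and d: "\<delta> a \<in> T" "\<delta> a \<in> carrier G"
    using assms T_carrier transfer.cocycle_closed by auto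
  have "t \<otimes> \<delta> a \<otimes> inv t = \<delta> a"
    unfolding T_comm[OF assms(1) d(1)] using tG d(2) by (simp add: m_assoc)
  then show ?thesis
    unfolding transfer.cocycle_mult[OF tG assms(2)] transfer.cocycle_T[OF assms(1)] by simp
qed

text \<open>
  On a coset \<open>T a\<close> the equation \<open>\<delta> (t a) = \<one>\<close> prescribes \<open>t [^] N\<close>, and only finitely many elements of a torus have a given
  power.
\<close>

lemma finite_twist_kernel: "finite {h \<in> carrier G. \<delta> h = \<one>}"
proof -
  have "\<forall>C\<in>rcosets T. \<exists>a. a \<in> carrier G \<and> C = T #> a" unfolding RCOSETS_def by blast
  from bchoice[OF this] obtain a where a: "\<And>C. C \<in> rcosets T \<Longrightarrow> a C \<in> carrier G" "\<And>C. C \<in> rcosets T \<Longrightarrow> C = T #> a C"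
    by auto
  let ?F = "\<lambda>C. (\<lambda>t. t \<otimes> a C) ` {t \<in> T. t [^] N = inv (\<delta> (a C))}"
  have "{h \<in> carrier G. \<delta> h = \<one>} \<subseteq> (\<Union>C\<in>rcosets T. ?F C)"
  proof
    fix h assume "h \<in> {h \<in> carrier G. \<delta> h = \<one>}"
    then have h: "h \<in> carrier G" "\<delta> h = \<one>" by auto
    define C where "C = T #> h"
    have C: "C \<in> rcosets T" "h \<in> C"
      using h rcos_self[OF h(1) T_sub] unfolding C_def RCOSETS_def by auto
    have "h \<in> T #> a C" using C(2) a(2)[OF C(1)] by simp
    then obtain t where t: "t \<in> T" "h = t \<otimes> a C" unfolding r_coset_def by auto
    have dG: "\<delta> (a C) \<in> carrier G" by (rule T_carrier[OF transfer.cocycle_closed[OF a(1)[OF C(1)]]])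
    have tN: "t [^] N \<in> carrier G" by (rule T_carrier[OF T_pow[OF t(1)]])
    have "\<delta> (a C) \<otimes> t [^] N = \<one>"
      using h(2) unfolding t(2) cocycle_translate[OF t(1) a(1)[OF C(1)]] .
    then have "t [^] N \<otimes> \<delta> (a C) = \<one>" using T_comm[OF transfer.cocycle_closed[OF a(1)[OF C(1)]] T_pow[OF t(1)]] by metis
    then have "t [^] N = inv (\<delta> (a C))" using dG tN by (metis inv_equality)
    then have "h \<in> ?F C" using t by blast
    then show "h \<in> (\<Union>C\<in>rcosets T. ?F C)" using C(1) by blast
  qed
  moreover have "finite (\<Union>C\<in>rcosets T. ?F C)"
    by (intro finite_UN_I T_finite_index finite_imageI finite_roots transfer.card_rcosets_pos)
  ultimately show ?thesis by (rule finite_subset)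
qed

lemma twist_translate:
  assumes t: "t \<in> T" and a: "a \<in> carrier G" and x: "x \<in> S" and i: "i < 2 * r"
  shows "twist (t \<otimes> a) x i = \<psi> (\<delta> a) i * \<psi> t i ^ N * \<psi> (a \<otimes> \<phi> x \<otimes> inv a) i"
proof -
  have tG: "t \<in> carrier G" and xT: "\<phi> x \<in> T" and xG: "\<phi> x \<in> carrier G"
    using t x T_carrier \<phi>_T by auto
  have conj: "a \<otimes> \<phi> x \<otimes> inv a \<in> T" by (rule T_conj[OF a xT])
  have "(t \<otimes> a) \<otimes> \<phi> x \<otimes> inv (t \<otimes> a) = t \<otimes> (a \<otimes> \<phi> x \<otimes> inv a) \<otimes> inv t"
    using tG a xG by (simp add: m_assoc inv_mult_group)
  also have "\<dots> = a \<otimes> \<phi> x \<otimes> inv a"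
    unfolding T_comm[OF t conj] using tG T_carrier[OF conj] by (simp add: m_assoc)
  finally show ?thesis
    unfolding twist_def cocycle_translate[OF t a]
    using transfer.cocycle_closed[OF a] T_pow[OF t] conj t i by (simp add: \<psi>_mult T_mult \<psi>_pow)
qed

text \<open>
  On the coset \<open>T a\<close> the action is given by \<open>twist_translate\<close> with \<open>t = h a\<inverse>\<close>. The coordinates of \<open>\<psi>\<close> are regular on \<open>T\<close> only, so the
  one applied to \<open>h a\<inverse>\<close> is replaced by a polynomial \<open>Q\<close> that represents it, which is defined for all \<open>h\<close>.
\<close>

lemma twist_regular:
  assumes H: "H \<subseteq> carrier G" and E: "\<And>y. y \<in> V \<Longrightarrow> E y \<in> S"
    and E_reg: "\<And>i. i < 2 * r \<Longrightarrow> (\<lambda>y. E y i) \<in> regfun m V" and i: "i < 2 * r"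
  shows "(\<lambda>p. twist (fst p) (E (snd p)) i) \<in> agree_on (H \<times> V) (bisum (regfun n H) (regfun m V))"
proof -
  have FA: "function_algebra (bisum (regfun n H) (regfun m V))"
    by (intro function_algebra_bisum function_algebra_agree_on function_algebra_polyfun regfun.const regfun.mult)
  interpret B: function_algebra "bisum (regfun n H) (regfun m V)" by (rule FA)
  interpret BD: function_algebra "agree_on (H \<times> V) (bisum (regfun n H) (regfun m V))"
    by (rule function_algebra_agree_on[OF FA])
  have fst_reg: "(\<lambda>p. fst p j) \<in> agree_on (H \<times> V) (bisum (regfun n H) (regfun m V))" if "j < n" for j
    by (intro agree_on_incl bisum_fst[OF regfun_coord[OF that]] regfun.const)
  have \<phi>_reg: "(\<lambda>p. \<phi> (E (snd p)) j) \<in> agree_on (H \<times> V) (bisum (regfun n H) (regfun m V))" if j: "j < n" for j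
  proof (rule B.regfun_subst[OF \<phi>_regular[OF j]])
    show "(\<lambda>p. E (snd p) k) \<in> agree_on (H \<times> V) (bisum (regfun n H) (regfun m V))" if "k < 2 * r" for k
      by (intro agree_on_incl bisum_snd[OF _ E_reg[OF that]] regfun.const)
  qed (auto intro: E)
  obtain Q where Q: "Q \<in> polyfun n" "\<And>t. t \<in> T \<Longrightarrow> \<psi> t i = Q t"
    using \<psi>_regular[OF i] by (rule agree_onE) (rule that)
  show ?thesis
  proof (rule diag.regular_if_regular_on_cosets[where \<pi> = fst, OF FA T_finite_index])
    fix a assume a: "a \<in> carrier G"
    have const: "(\<lambda>p. b j) \<in> agree_on (H \<times> V) (bisum (regfun n H) (regfun m V))" for b :: "'k point" and j
      by (rule BD.const)
    have "(\<lambda>p. Q (fst p \<otimes> inv a)) \<in> agree_on (H \<times> V) (bisum (regfun n H) (regfun m V))"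
    proof (rule BD.polyfun_subst[OF Q(1)])
      show "(\<lambda>p. (fst p \<otimes> inv a) j) \<in> agree_on (H \<times> V) (bisum (regfun n H) (regfun m V))" if "j < n" for j
        by (rule mult_subst[OF FA that]) (use H a fst_reg const in auto)
    qed
    moreover have "(\<lambda>p. \<psi> (a \<otimes> \<phi> (E (snd p)) \<otimes> inv a) i) \<in> agree_on (H \<times> V) (bisum (regfun n H) (regfun m V))"
    proof (rule B.regfun_subst[OF \<psi>_regular[OF i]])
      have a\<phi>: "(\<lambda>p. (a \<otimes> \<phi> (E (snd p))) j) \<in> agree_on (H \<times> V) (bisum (regfun n H) (regfun m V))" if "j < n" for j
        by (rule mult_subst[OF FA that]) (use a \<phi>_reg const T_carrier[OF \<phi>_T[OF E]] in auto)
      show "(\<lambda>p. (a \<otimes> \<phi> (E (snd p)) \<otimes> inv a) j) \<in> agree_on (H \<times> V) (bisum (regfun n H) (regfun m V))" if "j < n" for j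
        by (rule mult_subst[OF FA that]) (use a a\<phi> const T_carrier[OF \<phi>_T[OF E]] in auto)
      show "a \<otimes> \<phi> (E (snd p)) \<otimes> inv a \<in> T" if "p \<in> H \<times> V" for p
        using that by (intro T_conj[OF a] \<phi>_T E) (auto simp: mem_Times_iff)
    qed
    ultimately have "(\<lambda>p. \<psi> (\<delta> a) i * Q (fst p \<otimes> inv a) ^ N * \<psi> (a \<otimes> \<phi> (E (snd p)) \<otimes> inv a) i)
        \<in> agree_on (H \<times> V) (bisum (regfun n H) (regfun m V))"
      by (intro BD.mult BD.power BD.const)
    moreover have "twist (fst p) (E (snd p)) i = \<psi> (\<delta> a) i * Q (fst p \<otimes> inv a) ^ N * \<psi> (a \<otimes> \<phi> (E (snd p)) \<otimes> inv a) i"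
      if p: "p \<in> H \<times> V" "fst p \<in> T #> a" for p
    proof -
      obtain t where t: "t \<in> T" "fst p = t \<otimes> a" using p(2) unfolding r_coset_def by auto
      have ta: "t \<otimes> a \<otimes> inv a = t" using T_carrier[OF t(1)] a by (simp add: m_assoc)
      have "E (snd p) \<in> S" using p(1) by (auto intro: E)
      from twist_translate[OF t(1) a this i] show ?thesis unfolding t(2) ta Q(2)[OF t(1)] .
    qed
    ultimately show "\<exists>F\<in>agree_on (H \<times> V) (bisum (regfun n H) (regfun m V)).
        \<forall>p\<in>H \<times> V. fst p \<in> T #> a \<longrightarrow> twist (fst p) (E (snd p)) i = F p"
      by (intro bexI[of _ "\<lambda>p. \<psi> (\<delta> a) i * Q (fst p \<otimes> inv a) ^ N * \<psi> (a \<otimes> \<phi> (E (snd p)) \<otimes> inv a) i"]) auto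
  qed (use H fst_reg in auto)
qed

lemma torus_subset_centralizer: "T \<subseteq> centralizer G T"
  using T_carrier T_comm by (auto simp: centralizer_def)

lemma closed_if_contains_centralizer:
  assumes "subgroup H G" "centralizer G T \<subseteq> H"
  shows "closedin (zariski n) H"
proof (rule diag.closed_if_coset_stable[OF T_finite_index subgroup.subset[OF assms(1)]])
  show "T #> h \<subseteq> H" if "h \<in> H" for h
  proof
    fix g assume "g \<in> T #> h"
    then obtain t where "t \<in> T" "g = t \<otimes> h" unfolding r_coset_def by auto
    then show "g \<in> H" using subgroup.m_closed[OF assms(1), of t h] that torus_subset_centralizer assms(2) by blast
  qed
qed

text \<open>
  The exponent modulo \<open>q\<close> is constant on the cosets of \<open>T\<close>, which is contained in \<open>Z\<close>.
\<close>

lemma expo_regular: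
  assumes "cyclic_extension G (centralizer G T) \<tau> q"
  shows "(\<lambda>h. if cyclic_extension.expo G (centralizer G T) \<tau> h mod q = j then 1 else 0)
    \<in> regfun n (cyclic_extension.H G (centralizer G T) \<tau>)"
proof -
  interpret C: cyclic_extension G "centralizer G T" \<tau> q by (rule assms)
  have const: "C.expo h mod q = C.expo k mod q" if h: "h \<in> C.H" "h \<in> T #> a" and k: "k \<in> C.H" "k \<in> T #> a" and a: "a \<in> carrier G" for h k a
  proof -
    have "T #> k = T #> a" using repr_independence[OF k(2) a T_sub] by simp
    then obtain t where t: "t \<in> T" "h = t \<otimes> k" using h(2) unfolding r_coset_def by auto
    have tZ: "t \<in> centralizer G T" using t(1) torus_subset_centralizer by blast
    then have tH: "t \<in> C.H" using C.Z_subset_H by blast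
    have "q dvd C.expo t" using C.expo_Z[OF tH] tZ by simp
    then show ?thesis unfolding t(2) C.expo_mult[OF tH k(1)] by (auto elim: dvdE)
  qed
  show ?thesis
  proof (rule diag.regular_if_regular_on_cosets[where \<pi> = "\<lambda>h. h", OF function_algebra_polyfun T_finite_index])
    fix a assume a: "a \<in> carrier G"
    define b :: 'k where "b = (if \<exists>k\<in>C.H. k \<in> T #> a \<and> C.expo k mod q = j then 1 else 0)"
    have b: "(if C.expo h mod q = j then 1 else 0) = b" if h: "h \<in> C.H" "h \<in> T #> a" for h
    proof -
      have "C.expo k mod q = C.expo h mod q" if "k \<in> C.H" "k \<in> T #> a" for k
        by (rule const[OF that h a])
      then have "(\<exists>k\<in>C.H. k \<in> T #> a \<and> C.expo k mod q = j) \<longleftrightarrow> C.expo h mod q = j"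
        using h by metis
      then show ?thesis by (simp add: b_def)
    qed
    show "\<exists>F\<in>regfun n C.H. \<forall>h\<in>C.H. h \<in> T #> a \<longrightarrow> (if C.expo h mod q = j then 1 else 0) = F h"
      by (intro bexI[OF _ regfun.const[of b]] ballI impI) (rule b)
  qed (auto intro: regfun_coord C.H_carrier)
qed

lemma twist_torus_curve_action:
  assumes cyc: "cyclic_extension G (centralizer G T) \<tau> q" and curve: "twisted_curve q \<zeta> (c :: 'k)"
  shows "torus_curve_action q \<zeta> c r G n (cyclic_extension.H G (centralizer G T) \<tau>) T (centralizer G T) twist
    (cyclic_extension.expo G (centralizer G T) \<tau>)"
proof -
  interpret C: cyclic_extension G "centralizer G T" \<tau> q by (rule cyc)
  interpret K: torus_curve q \<zeta> c r by (rule torus_curve.intro[OF curve])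
  show ?thesis
  proof (rule torus_curve_action.intro[OF K.torus_curve_axioms is_group torus_curve_action_axioms.intro])
    show "subgroup C.H G" "subgroup (centralizer G T) G" "subgroup T G"
      by (rule C.H_subgroup C.Z_sub T_sub)+
    show "T \<subseteq> centralizer G T" "centralizer G T \<subseteq> C.H"
      by (rule torus_subset_centralizer C.Z_subset_H)+
    show "centralizer G T \<noteq> C.H" using C.\<tau>_H by blast
    show "twist h x \<in> S" if "h \<in> C.H" "x \<in> S" for h x
      using that by (intro twist_closed C.H_carrier)
    show "twist \<one> x = x" if "x \<in> S" for x using that by (rule twist_one)
    show "twist (h \<otimes> k) x = twist h (twist k x)" if "h \<in> C.H" "k \<in> C.H" "x \<in> S" for h k x
      using that by (intro twist_mult C.H_carrier)
    show "C.expo (h \<otimes> k) mod q = (C.expo h + C.expo k) mod q" if "h \<in> C.H" "k \<in> C.H" for h k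
      using that by (rule C.expo_mult)
    show "q dvd C.expo h \<longleftrightarrow> h \<in> centralizer G T" if "h \<in> C.H" for h
      using that by (rule C.expo_Z)
    show "\<exists>h\<in>C.H. C.expo h mod q = j mod q" for j
    proof
      have one: "\<one> \<in> centralizer G T" by (rule subgroup.one_closed[OF C.Z_sub])
      show H: "\<tau> [^] j \<otimes> \<one> \<in> C.H" by (rule C.H_I[OF one])
      obtain z where z: "z \<in> centralizer G T" "\<tau> [^] j \<otimes> \<one> = \<tau> [^] C.expo (\<tau> [^] j \<otimes> \<one>) \<otimes> z"
        using C.expo[OF H] by (elim bexE) (rule that; assumption)
      show "C.expo (\<tau> [^] j \<otimes> \<one>) mod q = j mod q"
        using C.expo_unique[OF z(2) one z(1)] by (rule sym)
    qed
    show "\<exists>t\<in>T. twist t x = y" if "x \<in> S" "y \<in> S" for x y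
      using that by (rule twist_transitive)
    show "h \<in> centralizer G T" if "h \<in> C.H" "\<And>x. x \<in> S \<Longrightarrow> twist h x = x" for h
      using that by (intro twist_identity(2) C.H_carrier)
    have "{h \<in> C.H. \<forall>x\<in>S. twist h x = x} \<subseteq> {h \<in> carrier G. \<delta> h = \<one>}"
      using twist_identity(1) C.H_carrier by blast
    then show "finite {h \<in> C.H. \<forall>x\<in>S. twist h x = x}"
      by (rule finite_subset[OF _ finite_twist_kernel])
    show "(\<lambda>p. twist (fst p) (K.tor (snd p)) i) \<in> agree_on (C.H \<times> K.V) (bisum (regfun n C.H) (regfun K.m K.V))"
      if "i < 2 * r" for i
      by (rule twist_regular[OF _ K.tor_S K.tor_regular that]) (use C.H_carrier in auto)
    show "(\<lambda>h. if C.expo h mod q = j then 1 else 0) \<in> regfun n C.H" for j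
      by (rule expo_regular[OF cyc])
    show "(\<lambda>h. (inv h) i) \<in> regfun n C.H" if "i < n" for i
      by (rule inv_subst[OF function_algebra_polyfun that]) (auto intro: regfun_coord C.H_carrier)
  qed
qed

end

section \<open>The construction for a group whose identity component is a torus\<close>

text \<open>
  A root \<open>\<zeta>\<close> of \<open>1 + X + \<dots> + X\<^sup>q\<^sup>-\<^sup>1\<close> satisfies \<open>\<zeta>\<^sup>q = 1\<close>. If \<open>\<zeta> = 1\<close>, then \<open>q = 0\<close> in the field.
\<close>

lemma twisted_curve_exists:
  assumes q: "Factorial_Ring.prime (q :: nat)"
  shows "\<exists>\<zeta> c :: 'k::alg_closed_field. twisted_curve q \<zeta> c"
proof -
  have q2: "q \<ge> 2" using q by (rule prime_ge_2_nat)
  define p :: "'k poly" where "p = (\<Sum>i<q. Polynomial.monom 1 i)"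
  have "Polynomial.coeff p (q - 1) = 1" using q2 by (simp add: p_def Polynomial.coeff_sum)
  then have "q - 1 \<le> Polynomial.degree p" by (intro le_degree) simp
  then have "Polynomial.degree p > 0" using q2 by simp
  then obtain \<zeta> where "poly p \<zeta> = 0" using alg_closed_imp_poly_has_root by blast
  then have sum: "(\<Sum>i<q. \<zeta> ^ i) = 0" by (simp add: p_def poly_sum Polynomial.poly_monom)
  have "\<zeta> ^ q - 1 = (\<zeta> - 1) * (\<Sum>i<q. \<zeta> ^ i)" by (rule power_diff_1_eq)
  then have pow: "\<zeta> ^ q = 1" unfolding sum by simp
  have "of_nat q = (0::'k)" if "\<zeta> = 1" using sum that by simp
  then have "twisted_curve q \<zeta> (if \<zeta> = 1 then 1 else 0)"
    by unfold_locales (auto simp: q pow)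
  then show ?thesis by blast
qed

lemma torus_by_finite_identity_component:
  fixes G :: "'k::alg_closed_field point monoid" (structure)
  assumes "affine_algebraic_group n G" and torus: "algebraic_torus n (G\<lparr>carrier := identity_component n G\<rparr>)"
  shows "\<exists>r \<phi> \<psi>. torus_by_finite n G (identity_component n G) r \<phi> \<psi>"
proof -
  interpret affine_algebraic_group n G by (rule assms(1))
  define T where "T = identity_component n G"
  obtain r \<phi> where T: "affine_algebraic_group n (G\<lparr>carrier := T\<rparr>)"
    and iso: "\<phi> \<in> iso (split_torus r) (G\<lparr>carrier := T\<rparr>)"
    and reg: "regular_map (2 * r) (carrier (split_torus r)) n T \<phi>"
      "regular_map n T (2 * r) (carrier (split_torus r)) (inv_into (carrier (split_torus r)) \<phi>)"
    using torus unfolding algebraic_torus_def T_def[symmetric] by auto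
  let ?S = "carrier (split_torus r) :: 'k point set"
  define \<psi> where "\<psi> = inv_into ?S \<phi>"
  interpret A: affine_algebraic_group n "G\<lparr>carrier := T\<rparr>" by (rule T)
  have sub: "subgroup (identity_component n G) G"
    using group_incl_imp_subgroup[OF identity_component_subset] A.is_group unfolding T_def .
  have bij: "bij_betw \<phi> ?S T" using iso by (simp add: iso_def)
  have \<phi>_\<psi>: "\<phi> (\<psi> t) = t" and \<psi>_S: "\<psi> t \<in> ?S" if "t \<in> T" for t
    using that bij unfolding \<psi>_def bij_betw_def by (auto intro: f_inv_into_f inv_into_into)
  have \<psi>_\<phi>: "\<psi> (\<phi> x) = x" if "x \<in> ?S" for x
    using that bij unfolding \<psi>_def bij_betw_def by simp
  have \<psi>_mult: "\<psi> (s \<otimes> t) i = \<psi> s i * \<psi> t i" if s: "s \<in> T" and t: "t \<in> T" for s t i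
  proof -
    have "(\<psi> s i * \<psi> s (r + i)) * (\<psi> t i * \<psi> t (r + i)) = 1" if "i < r" for i
      using \<psi>_S[OF s] \<psi>_S[OF t] that by (simp add: split_torus_iff)
    then have S: "\<psi> s \<otimes>\<^bsub>split_torus r\<^esub> \<psi> t \<in> ?S"
      using \<psi>_S[OF s] \<psi>_S[OF t] by (auto simp: split_torus_def affine_space_def mult_ac)
    have "\<phi> (\<psi> s \<otimes>\<^bsub>split_torus r\<^esub> \<psi> t) = s \<otimes> t"
      using iso \<psi>_S[OF s] \<psi>_S[OF t] by (auto simp: iso_def hom_def \<phi>_\<psi> s t)
    then have "\<psi> (s \<otimes> t) = \<psi> s \<otimes>\<^bsub>split_torus r\<^esub> \<psi> t" using \<psi>_\<phi>[OF S] by simp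
    then show ?thesis by (simp add: split_torus_def)
  qed
  have "torus_by_finite n G T r \<phi> \<psi>"
  proof (rule torus_by_finite.intro[OF assms(1) torus_by_finite_axioms.intro])
    show "T \<lhd> G" "finite (rcosets T)"
      unfolding T_def by (rule identity_component_normal[OF sub], rule identity_component_finite_index[OF sub])
    show "closedin (zariski n) T" using A.closed by simp
    show "\<phi> x \<in> T" if "x \<in> ?S" for x using that bij by (auto simp: bij_betw_def)
    show "(\<lambda>x. \<phi> x i) \<in> regfun (2 * r) ?S" if "i < n" for i
      using that reg(1) unfolding regular_map_iff by blast
    show "(\<lambda>t. \<psi> t i) \<in> regfun n T" if "i < 2 * r" for i
      using that reg(2) unfolding regular_map_iff \<psi>_def by blast
  qed (fact \<psi>_S \<phi>_\<psi> \<psi>_\<phi> \<psi>_mult)+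
  then show ?thesis unfolding T_def by blast
qed

theorem proposition4p1:
  fixes n :: nat and G :: "'k::alg_closed_field point monoid"
  assumes "affine_algebraic_group n G"
    and "algebraic_torus n (G\<lparr>carrier := identity_component n G\<rparr>)"
    and "carrier G \<noteq> centralizer G (identity_component n G)"
  shows "\<exists>H m V \<rho>.
    let G0 = identity_component n G;
        HG = G\<lparr>carrier := H\<rparr>;
        R = coord_ring m V;
        Inv = invariant_ring R \<rho>
    in closed_subgroup n G H \<and> centralizer G G0 \<subset> H \<and>
       affine_normal_variety m V \<and> regular_action n HG m V \<rho> \<and> effective_action HG R \<rho> \<and>
       total_quotient_image R (Inv G0) =
         {z \<in> carrier (total_quotient_ring R). \<forall>\<sigma>\<in>G0. extend_to_quotients R (\<rho> \<sigma>) z = z} \<and>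
       (\<exists>P \<in> Ht1 R (Inv H).
         let B = Inv (inertia_group R \<rho> H P <#>\<^bsub>G\<^esub> G0);
             A = Inv (inertia_group (Inv G0) \<rho> H (P \<inter> carrier (Inv G0)))
         in ramification_index B (P \<inter> carrier B) (P \<inter> carrier A) > 1) \<and>
       restrictions \<rho> (reflection_group HG R \<rho> (Inv H)) (carrier (Inv G0)) \<noteq>
       restrictions \<rho> (reflection_group HG (Inv G0) \<rho> (Inv H)) (carrier (Inv G0))"
proof -
  let ?T = "identity_component n G"
  obtain r \<phi> \<psi> where "torus_by_finite n G ?T r \<phi> \<psi>"
    using torus_by_finite_identity_component[OF assms(1,2)] by (elim exE) (rule that; assumption)
  then interpret torus_by_finite n G ?T r \<phi> \<psi> .
  obtain \<tau> q where "\<tau> \<in> carrier G" "Factorial_Ring.prime (q::nat)" "\<And>k :: nat. \<tau> [^]\<^bsub>G\<^esub> k \<in> centralizer G ?T \<longleftrightarrow> q dvd k"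
    using prime_power_in_normal[OF centralizer_normal[OF T_normal] T_sub torus_subset_centralizer T_finite_index assms(3)]
    by this (rule that; assumption)
  then have cyc: "cyclic_extension G (centralizer G ?T) \<tau> q" and q: "Factorial_Ring.prime q"
    by (auto intro!: cyclic_extension.intro is_group cyclic_extension_axioms.intro centralizer_normal T_normal)
  interpret C: cyclic_extension G "centralizer G ?T" \<tau> q by (rule cyc)
  obtain \<zeta> c :: 'k where curve: "twisted_curve q \<zeta> c"
    using twisted_curve_exists[OF q] by (elim exE) (rule that; assumption)
  interpret K: torus_curve_action q \<zeta> c r G n C.H ?T "centralizer G ?T" twist C.expo
    by (rule twist_torus_curve_action[OF cyc curve])
  have "closed_subgroup n G C.H"
    unfolding closed_subgroup_def
    using closed_if_contains_centralizer[OF C.H_subgroup C.Z_subset_H] C.H_subgroup by simp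
  moreover have "centralizer G ?T \<subset> C.H" using K.Z_proper K.Z_H by blast
  moreover have "affine_normal_variety K.m K.V"
    unfolding affine_normal_variety_def using closedin_principal_open[OF K.G] K.normal_domain_coord_ring by simp
  moreover have "ramification_index (K.Inv (inertia_group K.R K.\<rho> C.H K.P <#>\<^bsub>G\<^esub> ?T))
      (K.P \<inter> carrier (K.Inv (inertia_group K.R K.\<rho> C.H K.P <#>\<^bsub>G\<^esub> ?T)))
      (K.P \<inter> carrier (K.Inv (inertia_group (K.Inv ?T) K.\<rho> C.H (K.P \<inter> carrier (K.Inv ?T))))) > 1"
    unfolding K.Inv_inertia_T K.inertia_T by (rule K.ramification)
  ultimately show ?thesis
    unfolding Let_def
    using K.P_Ht1 K.\<rho>_regular_action K.\<rho>_effective K.invariant_fractions K.reflection_groups_differ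
    by (intro exI[of _ C.H] exI[of _ K.m] exI[of _ K.V] exI[of _ K.\<rho>] conjI bexI[of _ K.P]) assumption+
qed

end
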